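(* Let $M,N$ be smooth manifolds, let $(\mathcal{A}\to M,\rho,[\cdot,\cdot]_{\mathcal{A}})$ be a Lie algebroid, and let $f:N\to M$ be a smooth map such that the pullback Lie algebroid $f^!\mathcal{A}\to N$ is defined, i.e. $f_*(T_yN)+\rho(\mathcal{A}_{f(y)})=T_{f(y)}M$ for all $y\in N$. Let $\mathcal{B}\subset\mathcal{A}$ be a coorientable Lie subalgebroid over $M$ of corank $q$ such that $f^!\mathcal{B}$ is also defined, i.e. $f_*(T_yN)+\rho(\mathcal{B}_{f(y)})=T_{f(y)}M$ for all $y\in N$. Then $$\mathrm{GV}_{f^!\mathcal{A}}(f^!\mathcal{B})=f^!\,\mathrm{GV}_{\mathcal{A}}(\mathcal{B})\qquad\text{in } H^{2q+1}(f^!\mathcal{A}).$$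
   Context: **Lie algebroids.** A Lie algebroid on $M$ is a vector bundle $\mathcal{A}\to M$ with a bundle map $\rho:\mathcal{A}\to TM$ (the anchor) and a Lie bracket $[\cdot,\cdot]_{\mathcal{A}}$ on $\Gamma(\mathcal{A})$ satisfying $[v,fw]_{\mathcal{A}}=f[v,w]_{\mathcal{A}}+(\mathcal{L}_{\rho(v)}f)w$ for $v,w\in\Gamma(\mathcal{A})$, $f\in C^\infty(M)$. Then $\rho([v,w]_{\mathcal{A}})=[\rho(v),\rho(w)]$. **Cohomology.** Set $\Omega^k(\mathcal{A})=\Gamma(\wedge^k\mathcal{A}^* )$ and define $d_{\mathcal{A}}:\Omega^k(\mathcal{A})\to\Omega^{k+1}(\mathcal{A})$ by $$d_{\mathcal{A}}\eta(v_0,\dots,v_k)=\sum_{i=0}^k(-1)^i\mathcal{L}_{\rho(v_i)}(\eta(v_0,\dots,\hat{v_i},\dots,v_k))+\sum_{0\le i<j\le k}(-1)^{i+j}\eta([v_i,v_j]_{\mathcal{A}},v_0,\dots,\hat{v_i},\dots,\hat{v_j},\dots,v_k).$$ One has $d_{\mathcal{A}}\circ d_{\mathcal{A}}=0$; $H^k(\mathcal{A})$ is the $k$-th cohomology of $(\Omega^\bullet(\mathcal{A}),d_{\mathcal{A}})$. The wedge product is normalized so that $d_{\mathcal{A}}$ is a graded derivation, e.g. $(\beta\wedge\alpha)(v_0,v_1)=\beta(v_0)\alpha(v_1)-\beta(v_1)\alpha(v_0)$ for $1$-forms. **Lie subalgebroids.** A Lie subalgebroid $\mathcal{B}\subset\mathcal{A}$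 over $M$ is a vector subbundle over $M$ with $[\Gamma(\mathcal{B}),\Gamma(\mathcal{B})]_{\mathcal{A}}\subset\Gamma(\mathcal{B})$; it is a Lie algebroid with the restricted anchor and bracket. It is coorientable if the quotient bundle $\mathcal{A}/\mathcal{B}$ is trivial. Its corank is $q=\operatorname{rank}(\mathcal{A}/\mathcal{B})$. **Godbillon–Vey class.** Let $\mathcal{B}\subset\mathcal{A}$ be a coorientable Lie subalgebroid over $M$ of corank $q$. A defining form of $\mathcal{B}$ is a nowhere vanishing $\alpha\in\Omega^q(\mathcal{A})$ which is locally decomposable, $\alpha|_U=\alpha_1\wedge\cdots\wedge\alpha_q$ with $\alpha_i\in\Omega^1(\mathcal{A}|_U)$, and satisfies $\mathcal{B}|_U=\bigcap_{i=1}^q\ker\alpha_i$ for such local decompositions. A defining form exists globally, and there is $\beta\in\Omega^1(\mathcal{A})$ with $d_{\mathcal{A}}\alpha=\beta\wedge\alpha$. The Godbillon–Vey class of $\mathcal{B}$ with respect to $\mathcal{A}$ is $$\mathrm{GV}_{\mathcal{A}}(\mathcal{B}):=[\beta\wedge(d_{\mathcal{A}}\beta)^q]\in H^{2q+1}(\mathcal{A}),$$ which does not depend on the choice of $\alpha$ and $\beta$. **Pullback Lie algebroid.** If $f:N\to M$ is transverse to $\mathcal{A}$, i.e. $f_*(TN)+\rho(\mathcal{A})=TM$ along $f$, then $$f^!\mathcal{A}:=\mathcal{A}\times_{TM}TN=\{(v,X)\in\mathcal{A}\times TN\mid\rho(v)=f_*X\}$$ is a vector bundle over $N$. It is a Lie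 algebroid whose anchor is the projection to $TN$. Its bracket is $[(v_1,X_1),(v_2,X_2)]_{f^!\mathcal{A}}=([v_1,v_2]_{\mathcal{A}},[X_1,X_2])$ on sections given by pairs $v_i\in\Gamma(\mathcal{A})$, $X_i\in\mathfrak{X}(N)$ with $\rho(v_i)\circ f=f_*X_i$, extended by the Leibniz rule. Explicitly, write general sections as $(\sum_i g_i\,(v_i\circ f),X)$ and $(\sum_j h_j\,(w_j\circ f),Y)$ with $g_i,h_j\in C^\infty(N)$, $v_i,w_j\in\Gamma(\mathcal{A})$, $X,Y\in\mathfrak{X}(N)$; their bracket is $$\Big(\sum_{i,j}g_ih_j\,([v_i,w_j]_{\mathcal{A}}\circ f)+\sum_jX(h_j)\,(w_j\circ f)-\sum_iY(g_i)\,(v_i\circ f),\ [X,Y]\Big).$$ If $f$ is transverse to $\mathcal{B}$, i.e. $f_*(TN)+\rho(\mathcal{B})=TM$ along $f$, then $f^!\mathcal{B}=\{(v,X)\in\mathcal{B}\times TN\mid\rho(v)=f_*X\}$ is a Lie subalgebroid of $f^!\mathcal{A}$ over $N$. **Pullback map.** The pullback of forms along the projection $f^!\mathcal{A}\to\mathcal{A}$, $(v,X)\mapsto v$, is denoted $f^!:\Omega^\bullet(\mathcal{A})\to\Omega^\bullet(f^!\mathcal{A})$. It is a cochain map, and the induced map is $f^!:H^\bullet(\mathcal{A})\to H^\bullet(f^!\mathcal{A})$. *)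

theory Defs
  imports "HOL-Analysis.Analysis" "HOL-Library.Function_Algebras"
begin

text \<open>
  Functions into a real vector space form a real vector space under the pointwise operations;
  the additive structure is that of \<^theory>\<open>HOL-Library.Function_Algebras\<close>.
\<close>

instantiation "fun" :: (type, real_vector) real_vector
begin

definition scaleR_fun :: "real \<Rightarrow> ('a \<Rightarrow> 'b) \<Rightarrow> 'a \<Rightarrow> 'b" where
  "scaleR_fun r f = (\<lambda>x. r *\<^sub>R f x)"

instance
  by standard (auto simp: scaleR_fun_def fun_eq_iff scaleR_add_right scaleR_add_left)

end


section \<open>Smooth manifolds\<close>

text \<open>
  Both notions below are meant for open sets of a finite-dimensional space: \<open>C\<^sup>k\<close> means that all
  iterated directional derivatives up to order \<open>k\<close> exist and are continuous.
\<close>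

primrec Ck_on :: "nat \<Rightarrow> 'a::real_normed_vector set \<Rightarrow> ('a \<Rightarrow> 'b::real_normed_vector) \<Rightarrow> bool" where
  "Ck_on 0 S f \<longleftrightarrow> continuous_on S f"
| "Ck_on (Suc k) S f \<longleftrightarrow>
     (\<forall>x\<in>S. f differentiable (at x)) \<and> (\<forall>v. Ck_on k S (\<lambda>x. frechet_derivative f (at x) v))"

definition smooth_on :: "'a::real_normed_vector set \<Rightarrow> ('a \<Rightarrow> 'b::real_normed_vector) \<Rightarrow> bool" where
  "smooth_on S f \<longleftrightarrow> (\<forall>k. Ck_on k S f)"

text \<open>
  A manifold is a Hausdorff second countable type with an atlas of charts \<open>(U, \<phi>)\<close>.  The model
  space is a finite-dimensional inner product space rather than a \<^class>\<open>euclidean_space\<close>, because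
  the latter class excludes dimension 0, and Lie algebroids over a point are Lie algebras.
\<close>

type_synonym ('m, 'e) atlas = "('m set \<times> ('m \<Rightarrow> 'e)) set"

definition smooth_manifold ::
    "('m::{t2_space,second_countable_topology}, 'e::real_inner) atlas \<Rightarrow> bool" where
  "smooth_manifold M \<longleftrightarrow>
     (\<exists>B::'e set. finite B \<and> span B = UNIV) \<and>
     (\<forall>p. \<exists>(U, \<phi>)\<in>M. p \<in> U) \<and>
     (\<forall>(U, \<phi>)\<in>M. open U \<and> open (\<phi> ` U) \<and> inj_on \<phi> U \<and>
        homeomorphism U (\<phi> ` U) \<phi> (inv_into U \<phi>)) \<and>
     (\<forall>(U, \<phi>)\<in>M. \<forall>(V, \<psi>)\<in>M. smooth_on (\<phi> ` (U \<inter> V)) (\<psi> \<circ> inv_into U \<phi>))"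

definition smooth_fun_on ::
    "('m::topological_space, 'e::real_inner) atlas \<Rightarrow> 'm set \<Rightarrow> ('m \<Rightarrow> real) \<Rightarrow> bool" where
  "smooth_fun_on M U g \<longleftrightarrow> (\<forall>(V, \<phi>)\<in>M. smooth_on (\<phi> ` (U \<inter> V)) (g \<circ> inv_into V \<phi>))"

definition smooth_funs :: "('m::topological_space, 'e::real_inner) atlas \<Rightarrow> ('m \<Rightarrow> real) set" where
  "smooth_funs M = {g. smooth_fun_on M UNIV g}"

definition smooth_map ::
    "('n::topological_space, 'e::real_inner) atlas \<Rightarrow> ('m::topological_space, 'd::real_inner) atlas
      \<Rightarrow> ('n \<Rightarrow> 'm) \<Rightarrow> bool" where
  "smooth_map N M f \<longleftrightarrow> continuous_on UNIV f \<and>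
     (\<forall>(U, \<phi>)\<in>N. \<forall>(V, \<psi>)\<in>M. smooth_on (\<phi> ` (U \<inter> f -` V)) (\<psi> \<circ> f \<circ> inv_into U \<phi>))"

text \<open>
  Tangent vectors at \<open>p\<close> are the derivations of the algebra of smooth functions at \<open>p\<close>.  They are
  set to 0 on non-smooth functions, so that equality of tangent vectors is equality in HOL.
\<close>

type_synonym 'm tangent = "('m \<Rightarrow> real) \<Rightarrow> real"

definition tangent_space ::
    "('m::topological_space, 'e::real_inner) atlas \<Rightarrow> 'm \<Rightarrow> 'm tangent set" where
  "tangent_space M p = {D.
     (\<forall>g. g \<notin> smooth_funs M \<longrightarrow> D g = 0) \<and>
     (\<forall>g\<in>smooth_funs M. \<forall>h\<in>smooth_funs M. \<forall>a b.
        D (\<lambda>x. a * g x + b * h x) = a * D g + b * D h) \<and>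
     (\<forall>g\<in>smooth_funs M. \<forall>h\<in>smooth_funs M.
        D (\<lambda>x. g x * h x) = g p * D h + h p * D g)}"

definition vector_fields ::
    "('m::topological_space, 'e::real_inner) atlas \<Rightarrow> 'm set \<Rightarrow> ('m \<Rightarrow> 'm tangent) set" where
  "vector_fields M U = {X. (\<forall>p\<in>U. X p \<in> tangent_space M p) \<and>
     (\<forall>g\<in>smooth_funs M. smooth_fun_on M U (\<lambda>p. X p g))}"

definition vector_field_bracket ::
    "('m::topological_space, 'e::real_inner) atlas \<Rightarrow> ('m \<Rightarrow> 'm tangent) \<Rightarrow> ('m \<Rightarrow> 'm tangent)
      \<Rightarrow> 'm \<Rightarrow> 'm tangent" where
  "vector_field_bracket M X Y = (\<lambda>p g.
     if g \<in> smooth_funs M then X p (\<lambda>x. Y x g) - Y p (\<lambda>x. X x g) else 0)"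

definition pushforward ::
    "('m::topological_space, 'd::real_inner) atlas \<Rightarrow> ('n \<Rightarrow> 'm) \<Rightarrow> 'n tangent \<Rightarrow> 'm tangent" where
  "pushforward M f X = (\<lambda>g. if g \<in> smooth_funs M then X (g \<circ> f) else 0)"


section \<open>Vector bundles\<close>

text \<open>
  The fibres of a bundle are linear subspaces of a common real vector space, which carries no
  topology and may be infinite-dimensional; every vector bundle has this form, since one may take
  the direct sum of all its fibres.  The smooth structure is given by a bundle atlas.  A local
  trivialization over \<open>U\<close> is recorded by the list of local sections over \<open>U\<close> that it maps to the
  standard basis.
\<close>

record ('m, 'v) vbundle =
  fibre :: "'m \<Rightarrow> 'v set"
  frames :: "('m set \<times> ('m \<Rightarrow> 'v) list) set"

definition basis_at :: "('m \<Rightarrow> 'v::real_vector) list \<Rightarrow> 'm \<Rightarrow> 'v set \<Rightarrow> bool" where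
  "basis_at es p F \<longleftrightarrow> distinct (map (\<lambda>e. e p) es) \<and>
     independent (set (map (\<lambda>e. e p) es)) \<and> span (set (map (\<lambda>e. e p) es)) = F"

text \<open>Smooth sections over an open set \<open>U\<close>; values outside \<open>U\<close> are irrelevant.\<close>

definition sections ::
    "('m::topological_space, 'e::real_inner) atlas \<Rightarrow> ('m, 'v::real_vector, 'z) vbundle_scheme
      \<Rightarrow> 'm set \<Rightarrow> ('m \<Rightarrow> 'v) set" where
  "sections M E U = {\<sigma>. (\<forall>p\<in>U. \<sigma> p \<in> fibre E p) \<and>
     (\<forall>(V, es)\<in>frames E. \<exists>c. (\<forall>i<length es. smooth_fun_on M (U \<inter> V) (c i)) \<and>
        (\<forall>p\<in>U \<inter> V. \<sigma> p = (\<Sum>i<length es. c i p *\<^sub>R (es ! i) p)))}"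

abbreviation global_sections ("\<Gamma>") where
  "\<Gamma> M E \<equiv> sections M E UNIV"

definition vector_bundle ::
    "('m::topological_space, 'e::real_inner) atlas \<Rightarrow> ('m, 'v::real_vector, 'z) vbundle_scheme
      \<Rightarrow> bool" where
  "vector_bundle M E \<longleftrightarrow>
     (\<forall>p. \<exists>(U, es)\<in>frames E. p \<in> U) \<and>
     (\<forall>(U, es)\<in>frames E. open U \<and> (\<forall>p\<in>U. basis_at es p (fibre E p)) \<and>
        (\<forall>e\<in>set es. e \<in> sections M E U))"

definition subbundle ::
    "('m::topological_space, 'e::real_inner) atlas \<Rightarrow> ('m, 'v::real_vector, 'z) vbundle_scheme
      \<Rightarrow> ('m \<Rightarrow> 'v set) \<Rightarrow> bool" where
  "subbundle M E B \<longleftrightarrow> (\<forall>p. subspace (B p) \<and> B p \<subseteq> fibre E p) \<and>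
     (\<forall>p. \<exists>U es. open U \<and> p \<in> U \<and> (\<forall>e\<in>set es. e \<in> sections M E U) \<and>
        (\<forall>x\<in>U. basis_at es x (B x)))"

text \<open>
  Triviality of the quotient bundle: a vector bundle isomorphism \<open>T\<close> from \<open>E/B\<close>, whose fibres
  consist of the cosets \<open>v + B\<^sub>p\<close>, to the product bundle with fibre \<open>\<real>\<^sup>q\<close>, here the functions
  \<open>nat \<Rightarrow> real\<close> vanishing from \<open>q\<close> on.  Smooth sections of \<open>E/B\<close> are locally the classes of
  smooth sections of \<open>E\<close>, which gives the smoothness condition on \<open>T\<close>.
\<close>

definition coset :: "'v::real_vector set \<Rightarrow> 'v \<Rightarrow> 'v set" where
  "coset B v = (\<lambda>b. v + b) ` B"

definition trivial_quotient ::
    "('m::topological_space, 'e::real_inner) atlas \<Rightarrow> ('m, 'v::real_vector, 'z) vbundle_scheme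
      \<Rightarrow> ('m \<Rightarrow> 'v set) \<Rightarrow> nat \<Rightarrow> bool" where
  "trivial_quotient M E B q \<longleftrightarrow> (\<exists>T :: 'm \<Rightarrow> 'v set \<Rightarrow> nat \<Rightarrow> real.
     (\<forall>p. bij_betw (T p) (coset (B p) ` fibre E p) {c. \<forall>i\<ge>q. c i = 0}) \<and>
     (\<forall>p. \<forall>v\<in>fibre E p. \<forall>w\<in>fibre E p. \<forall>a b.
        T p (coset (B p) (a *\<^sub>R v + b *\<^sub>R w)) =
          a *\<^sub>R T p (coset (B p) v) + b *\<^sub>R T p (coset (B p) w)) \<and>
     (\<forall>\<sigma>\<in>\<Gamma> M E. \<forall>i<q. smooth_fun_on M UNIV (\<lambda>p. T p (coset (B p) (\<sigma> p)) i)))"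

definition pullback_bundle ::
    "('n \<Rightarrow> 'm) \<Rightarrow> ('m, 'v, 'z) vbundle_scheme \<Rightarrow> ('n, 'v) vbundle" where
  "pullback_bundle f E = \<lparr>fibre = (\<lambda>y. fibre E (f y)),
     frames = (\<lambda>(U, es). (f -` U, map (\<lambda>e. e \<circ> f) es)) ` frames E\<rparr>"


section \<open>Lie algebroids\<close>

record ('m, 'v) lie_algebroid = "('m, 'v) vbundle" +
  anchor :: "'m \<Rightarrow> 'v \<Rightarrow> 'm tangent"
  bracket :: "('m \<Rightarrow> 'v) \<Rightarrow> ('m \<Rightarrow> 'v) \<Rightarrow> 'm \<Rightarrow> 'v"

definition lie_algebroid ::
    "('m::topological_space, 'e::real_inner) atlas \<Rightarrow> ('m, 'v::real_vector) lie_algebroid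
      \<Rightarrow> bool" where
  "lie_algebroid M A \<longleftrightarrow> vector_bundle M A \<and>
     (\<forall>p. \<forall>v\<in>fibre A p. \<forall>w\<in>fibre A p. \<forall>a b.
        anchor A p (a *\<^sub>R v + b *\<^sub>R w) = a *\<^sub>R anchor A p v + b *\<^sub>R anchor A p w) \<and>
     (\<forall>v\<in>\<Gamma> M A. (\<lambda>p. anchor A p (v p)) \<in> vector_fields M UNIV) \<and>
     (\<forall>v\<in>\<Gamma> M A. \<forall>w\<in>\<Gamma> M A. bracket A v w \<in> \<Gamma> M A) \<and>
     (\<forall>u\<in>\<Gamma> M A. \<forall>v\<in>\<Gamma> M A. \<forall>w\<in>\<Gamma> M A. \<forall>a b.
        bracket A (a *\<^sub>R u + b *\<^sub>R v) w = a *\<^sub>R bracket A u w + b *\<^sub>R bracket A v w) \<and>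
     (\<forall>v\<in>\<Gamma> M A. \<forall>w\<in>\<Gamma> M A. bracket A v w = - bracket A w v) \<and>
     (\<forall>u\<in>\<Gamma> M A. \<forall>v\<in>\<Gamma> M A. \<forall>w\<in>\<Gamma> M A.
        bracket A u (bracket A v w) + bracket A v (bracket A w u) + bracket A w (bracket A u v) = 0) \<and>
     (\<forall>v\<in>\<Gamma> M A. \<forall>w\<in>\<Gamma> M A. \<forall>g\<in>smooth_funs M.
        bracket A v (\<lambda>p. g p *\<^sub>R w p) =
          (\<lambda>p. g p *\<^sub>R bracket A v w p + anchor A p (v p) g *\<^sub>R w p))"

definition lie_subalgebroid ::
    "('m::topological_space, 'e::real_inner) atlas \<Rightarrow> ('m, 'v::real_vector) lie_algebroid
      \<Rightarrow> ('m \<Rightarrow> 'v set) \<Rightarrow> bool" where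
  "lie_subalgebroid M A B \<longleftrightarrow> subbundle M A B \<and>
     (\<forall>v\<in>\<Gamma> M A. \<forall>w\<in>\<Gamma> M A. (\<forall>p. v p \<in> B p) \<longrightarrow> (\<forall>p. w p \<in> B p) \<longrightarrow>
        (\<forall>p. bracket A v w p \<in> B p))"


section \<open>Differential forms and cohomology\<close>

text \<open>
  A \<open>k\<close>-form assigns to \<open>p\<close> a function on lists \<open>[v\<^sub>1, \<dots>, v\<^sub>k]\<close> of elements of the fibre at \<open>p\<close>;
  it is set to 0 on all other lists and at all points outside its domain \<open>U\<close>.
\<close>

type_synonym ('m, 'v) form = "'m \<Rightarrow> 'v list \<Rightarrow> real"

definition eval_sections :: "('m \<Rightarrow> 'v) list \<Rightarrow> 'm \<Rightarrow> 'v list" where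
  "eval_sections vs p = map (\<lambda>v. v p) vs"

definition forms_on ::
    "('m::topological_space, 'e::real_inner) atlas \<Rightarrow> ('m, 'v::real_vector, 'z) vbundle_scheme
      \<Rightarrow> 'm set \<Rightarrow> nat \<Rightarrow> ('m, 'v) form set" where
  "forms_on M A U k = {\<omega>.
     (\<forall>p vs. \<omega> p vs \<noteq> 0 \<longrightarrow> p \<in> U \<and> length vs = k \<and> set vs \<subseteq> fibre A p) \<and>
     (\<forall>p\<in>U. \<forall>vs. length vs = k \<longrightarrow> set vs \<subseteq> fibre A p \<longrightarrow>
        (\<forall>i<k. \<forall>v\<in>fibre A p. \<forall>w\<in>fibre A p. \<forall>a b.
           \<omega> p (vs[i := a *\<^sub>R v + b *\<^sub>R w]) = a * \<omega> p (vs[i := v]) + b * \<omega> p (vs[i := w])) \<and>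
        (\<forall>j<k. \<forall>i<j. vs ! i = vs ! j \<longrightarrow> \<omega> p vs = 0)) \<and>
     (\<forall>vs. length vs = k \<longrightarrow> set vs \<subseteq> sections M A U \<longrightarrow>
        smooth_fun_on M U (\<lambda>p. \<omega> p (eval_sections vs p)))}"

abbreviation forms ("\<Omega>") where
  "\<Omega> M A \<equiv> forms_on M A UNIV"

text \<open>
  The wedge product of a \<open>k\<close>-form and an \<open>l\<close>-form, as the sum over all permutations divided by
  \<open>k! l!\<close>, i.e. over the \<open>(k, l)\<close>-shuffles; so \<open>(\<beta> \<and> \<alpha>)(v, w) = \<beta>(v) \<alpha>(w) - \<beta>(w) \<alpha>(v)\<close> for 1-forms.
\<close>

definition wedge ::
    "nat \<Rightarrow> nat \<Rightarrow> ('m, 'v) form \<Rightarrow> ('m, 'v) form \<Rightarrow> ('m, 'v) form" where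
  "wedge k l \<omega> \<eta> = (\<lambda>p vs. 1 / (fact k * fact l) *
     (\<Sum>\<pi> | \<pi> permutes {..<k + l}. of_int (sign \<pi>) *
        \<omega> p (take k (permute_list \<pi> vs)) * \<eta> p (drop k (permute_list \<pi> vs))))"

definition unit_form :: "('m, 'v) form" where
  "unit_form = (\<lambda>p vs. if vs = [] then 1 else 0)"

text \<open>\<open>\<alpha>\<^sub>1 \<and> \<dots> \<and> \<alpha>\<^sub>q\<close> for 1-forms \<open>\<alpha>\<^sub>i\<close>\<close>

primrec wedge_list :: "('m, 'v) form list \<Rightarrow> ('m, 'v) form" where
  "wedge_list [] = unit_form"
| "wedge_list (\<alpha> # \<alpha>s) = wedge 1 (length \<alpha>s) \<alpha> (wedge_list \<alpha>s)"

text \<open>\<open>\<omega>\<^sup>n\<close> for a 2-form \<open>\<omega>\<close>\<close>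

primrec wedge_power2 :: "('m, 'v) form \<Rightarrow> nat \<Rightarrow> ('m, 'v) form" where
  "wedge_power2 \<omega> 0 = unit_form"
| "wedge_power2 \<omega> (Suc n) = wedge 2 (2 * n) \<omega> (wedge_power2 \<omega> n)"

text \<open>
  The value of \<open>d \<eta>\<close> on global sections \<open>v\<^sub>0, \<dots>, v\<^sub>k\<close>; \<open>nths vs (-S)\<close> omits the entries with
  index in \<open>S\<close>.
\<close>

definition d_on_sections ::
    "('m, 'v) lie_algebroid \<Rightarrow> ('m, 'v) form \<Rightarrow> ('m \<Rightarrow> 'v) list \<Rightarrow> 'm \<Rightarrow> real" where
  "d_on_sections A \<eta> vs p =
     (\<Sum>i<length vs. (-1) ^ i *
        anchor A p ((vs ! i) p) (\<lambda>x. \<eta> x (eval_sections (nths vs (-{i})) x))) +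
     (\<Sum>j<length vs. \<Sum>i<j. (-1) ^ (i + j) *
        \<eta> p (eval_sections (bracket A (vs ! i) (vs ! j) # nths vs (-{i, j})) p))"

definition lie_d ::
    "('m::topological_space, 'e::real_inner) atlas \<Rightarrow> ('m, 'v::real_vector) lie_algebroid
      \<Rightarrow> nat \<Rightarrow> ('m, 'v) form \<Rightarrow> ('m, 'v) form" where
  "lie_d M A k \<eta> = (THE \<omega>. \<omega> \<in> \<Omega> M A (Suc k) \<and>
     (\<forall>vs. length vs = Suc k \<longrightarrow> set vs \<subseteq> \<Gamma> M A \<longrightarrow>
        (\<forall>p. \<omega> p (eval_sections vs p) = d_on_sections A \<eta> vs p)))"

definition cocycles ::
    "('m::topological_space, 'e::real_inner) atlas \<Rightarrow> ('m, 'v::real_vector) lie_algebroid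
      \<Rightarrow> nat \<Rightarrow> ('m, 'v) form set" where
  "cocycles M A k = {\<omega> \<in> \<Omega> M A k. lie_d M A k \<omega> = 0}"

definition coboundaries ::
    "('m::topological_space, 'e::real_inner) atlas \<Rightarrow> ('m, 'v::real_vector) lie_algebroid
      \<Rightarrow> nat \<Rightarrow> ('m, 'v) form set" where
  "coboundaries M A k = (case k of 0 \<Rightarrow> {0} | Suc j \<Rightarrow> lie_d M A j ` \<Omega> M A j)"

definition cohomology_class ::
    "('m::topological_space, 'e::real_inner) atlas \<Rightarrow> ('m, 'v::real_vector) lie_algebroid
      \<Rightarrow> nat \<Rightarrow> ('m, 'v) form \<Rightarrow> ('m, 'v) form set" where
  "cohomology_class M A k \<omega> = (\<lambda>\<eta>. \<omega> + \<eta>) ` coboundaries M A k"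

definition cohomology ::
    "('m::topological_space, 'e::real_inner) atlas \<Rightarrow> ('m, 'v::real_vector) lie_algebroid
      \<Rightarrow> nat \<Rightarrow> ('m, 'v) form set set" where
  "cohomology M A k = cohomology_class M A k ` cocycles M A k"


section \<open>The Godbillon--Vey class\<close>

definition decomposes_on ::
    "('m::topological_space, 'e::real_inner) atlas \<Rightarrow> ('m, 'v::real_vector, 'z) vbundle_scheme
      \<Rightarrow> 'm set \<Rightarrow> nat \<Rightarrow> ('m, 'v) form \<Rightarrow> ('m, 'v) form list \<Rightarrow> bool" where
  "decomposes_on M A U q \<alpha> \<alpha>s \<longleftrightarrow> length \<alpha>s = q \<and> set \<alpha>s \<subseteq> forms_on M A U 1 \<and>
     (\<forall>p\<in>U. \<alpha> p = wedge_list \<alpha>s p)"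

definition defining_form ::
    "('m::topological_space, 'e::real_inner) atlas \<Rightarrow> ('m, 'v::real_vector, 'z) vbundle_scheme
      \<Rightarrow> ('m \<Rightarrow> 'v set) \<Rightarrow> nat \<Rightarrow> ('m, 'v) form \<Rightarrow> bool" where
  "defining_form M A B q \<alpha> \<longleftrightarrow> \<alpha> \<in> \<Omega> M A q \<and> (\<forall>p. \<exists>vs. \<alpha> p vs \<noteq> 0) \<and>
     (\<forall>p. \<exists>U \<alpha>s. open U \<and> p \<in> U \<and> decomposes_on M A U q \<alpha> \<alpha>s) \<and>
     (\<forall>U \<alpha>s. open U \<longrightarrow> decomposes_on M A U q \<alpha> \<alpha>s \<longrightarrow>
        (\<forall>p\<in>U. B p = {v \<in> fibre A p. \<forall>a\<in>set \<alpha>s. a p [v] = 0}))"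

definition godbillon_vey ::
    "('m::topological_space, 'e::real_inner) atlas \<Rightarrow> ('m, 'v::real_vector) lie_algebroid
      \<Rightarrow> ('m \<Rightarrow> 'v set) \<Rightarrow> nat \<Rightarrow> ('m, 'v) form set" where
  "godbillon_vey M A B q = (THE c. \<exists>\<alpha> \<beta>. defining_form M A B q \<alpha> \<and> \<beta> \<in> \<Omega> M A 1 \<and>
     lie_d M A q \<alpha> = wedge 1 q \<beta> \<alpha> \<and>
     c = cohomology_class M A (2 * q + 1)
           (wedge 1 (2 * q) \<beta> (wedge_power2 (lie_d M A 1 \<beta>) q)))"


section \<open>Pullback Lie algebroids\<close>

definition transverse ::
    "('n::topological_space, 'e::real_inner) atlas \<Rightarrow> ('m::topological_space, 'd::real_inner) atlas
      \<Rightarrow> ('n \<Rightarrow> 'm) \<Rightarrow> ('m, 'v) lie_algebroid \<Rightarrow> ('m \<Rightarrow> 'v set) \<Rightarrow> bool" where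
  "transverse N M f A B \<longleftrightarrow>
     (\<forall>y. {pushforward M f X + anchor A (f y) v | X v. X \<in> tangent_space N y \<and> v \<in> B (f y)}
        = tangent_space M (f y))"

definition pullback_fibre ::
    "('n::topological_space, 'e::real_inner) atlas \<Rightarrow> ('m::topological_space, 'd::real_inner) atlas
      \<Rightarrow> ('n \<Rightarrow> 'm) \<Rightarrow> ('m, 'v) lie_algebroid \<Rightarrow> ('m \<Rightarrow> 'v set)
      \<Rightarrow> 'n \<Rightarrow> ('v \<times> 'n tangent) set" where
  "pullback_fibre N M f A B y =
     {(v, X). v \<in> B (f y) \<and> X \<in> tangent_space N y \<and> anchor A (f y) v = pushforward M f X}"

text \<open>
  The list \<open>[(g\<^sub>1, v\<^sub>1), \<dots>]\<close> represents the section \<open>s\<close> of \<open>f\<^sup>*A\<close> as \<open>\<Sum>\<^sub>i g\<^sub>i (v\<^sub>i \<circ> f)\<close> near \<open>y\<close>.  The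
  bracket at \<open>y\<close> is computed from such representations near \<open>y\<close>, which may be global ones; since
  the bracket formula is local, it does not depend on the representations.
\<close>

definition represents_near ::
    "('n::topological_space, 'e::real_inner) atlas \<Rightarrow> ('m::topological_space, 'd::real_inner) atlas
      \<Rightarrow> ('n \<Rightarrow> 'm) \<Rightarrow> ('m, 'v::real_vector) lie_algebroid \<Rightarrow> 'n \<Rightarrow> ('n \<Rightarrow> 'v)
      \<Rightarrow> (('n \<Rightarrow> real) \<times> ('m \<Rightarrow> 'v)) list \<Rightarrow> bool" where
  "represents_near N M f A y s gvs \<longleftrightarrow>
     (\<forall>(g, v)\<in>set gvs. g \<in> smooth_funs N \<and> v \<in> \<Gamma> M A) \<and>
     (\<exists>U. open U \<and> y \<in> U \<and> (\<forall>x\<in>U. s x = (\<Sum>(g, v)\<leftarrow>gvs. g x *\<^sub>R v (f x))))"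

definition pullback_bracket ::
    "('n::topological_space, 'e::real_inner) atlas \<Rightarrow> ('m::topological_space, 'd::real_inner) atlas
      \<Rightarrow> ('n \<Rightarrow> 'm) \<Rightarrow> ('m, 'v::real_vector) lie_algebroid
      \<Rightarrow> ('n \<Rightarrow> 'v \<times> 'n tangent) \<Rightarrow> ('n \<Rightarrow> 'v \<times> 'n tangent) \<Rightarrow> 'n \<Rightarrow> 'v \<times> 'n tangent" where
  "pullback_bracket N M f A s t = (\<lambda>y.
     (THE z. \<exists>gvs hws. represents_near N M f A y (fst \<circ> s) gvs \<and>
        represents_near N M f A y (fst \<circ> t) hws \<and>
        z = (\<Sum>(g, v)\<leftarrow>gvs. \<Sum>(h, w)\<leftarrow>hws. (g y * h y) *\<^sub>R bracket A v w (f y))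
            + (\<Sum>(h, w)\<leftarrow>hws. snd (s y) h *\<^sub>R w (f y))
            - (\<Sum>(g, v)\<leftarrow>gvs. snd (t y) g *\<^sub>R v (f y)),
      vector_field_bracket N (snd \<circ> s) (snd \<circ> t) y))"

text \<open>
  The smooth structure is that of a subbundle of \<open>f\<^sup>*A \<oplus> TN\<close>: the frames are all local frames
  whose members have smooth components in \<open>f\<^sup>*A\<close> and \<open>TN\<close>.
\<close>

definition pullback_algebroid ::
    "('n::topological_space, 'e::real_inner) atlas \<Rightarrow> ('m::topological_space, 'd::real_inner) atlas
      \<Rightarrow> ('n \<Rightarrow> 'm) \<Rightarrow> ('m, 'v::real_vector) lie_algebroid
      \<Rightarrow> ('n, 'v \<times> 'n tangent) lie_algebroid" where
  "pullback_algebroid N M f A = \<lparr>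
     fibre = pullback_fibre N M f A (fibre A),
     frames = {(U, es). open U \<and>
       (\<forall>e\<in>set es. fst \<circ> e \<in> sections N (pullback_bundle f A) U \<and> snd \<circ> e \<in> vector_fields N U) \<and>
       (\<forall>y\<in>U. basis_at es y (pullback_fibre N M f A (fibre A) y))},
     anchor = (\<lambda>y. snd),
     bracket = pullback_bracket N M f A\<rparr>"

definition pullback_form ::
    "('n::topological_space, 'e::real_inner) atlas \<Rightarrow> ('m::topological_space, 'd::real_inner) atlas
      \<Rightarrow> ('n \<Rightarrow> 'm) \<Rightarrow> ('m, 'v::real_vector) lie_algebroid
      \<Rightarrow> ('m, 'v) form \<Rightarrow> ('n, 'v \<times> 'n tangent) form" where
  "pullback_form N M f A \<omega> = (\<lambda>y ws.
     if set ws \<subseteq> fibre (pullback_algebroid N M f A) y then \<omega> (f y) (map fst ws) else 0)"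

definition pullback_class ::
    "('n::topological_space, 'e::real_inner) atlas \<Rightarrow> ('m::topological_space, 'd::real_inner) atlas
      \<Rightarrow> ('n \<Rightarrow> 'm) \<Rightarrow> ('m, 'v::real_vector) lie_algebroid \<Rightarrow> nat
      \<Rightarrow> ('m, 'v) form set \<Rightarrow> ('n, 'v \<times> 'n tangent) form set" where
  "pullback_class N M f A k c = (THE c'. \<exists>\<omega>\<in>c.
     c' = cohomology_class N (pullback_algebroid N M f A) k (pullback_form N M f A \<omega>))"

end

theory Submission
 imports Defs "HOL-Real_Asymp.Real_Asymp"
begin

text \<open>
  Forms are treated as functions on lists of vectors. On the module of sections the differential is
  given recursively by Cartan's formula, so that every identity between forms is an induction on the
  list. For fixed \<open>\<alpha>\<close> the class of \<open>\<beta> \<and> (d\<beta>)\<^sup>q\<close> is unique because \<open>d\<beta>\<close> lies in the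
  ideal of the forms vanishing on \<open>B\<close>, whose \<open>(q + 1)\<close>-st power is zero. Locally \<open>\<beta>\<close> is
  \<open>v \<mapsto> d\<alpha>(v, w) / \<alpha>(w)\<close> for a list \<open>w\<close> of \<open>q\<close> sections, and a partition of unity glues.
  Near a point, sections of the pullback algebroid have the form \<open>(\<Sum>\<^sub>i g\<^sub>i (v\<^sub>i \<circ> f), X)\<close> with a
  frame \<open>v\<^sub>i\<close> of \<open>A\<close>, which determines the bracket and shows that pullback commutes with \<open>d\<close>.
  Transversality to \<open>B\<close> makes \<open>f\<^sup>!\<alpha>\<close> nowhere zero, hence a defining form of \<open>f\<^sup>!B\<close>.
\<close>

text \<open>\<open>d\<beta>\<close> lies in the ideal because
  \<open>0 = d d \<alpha> = d\<beta> \<and> \<alpha>\<close>. Replacing \<open>\<alpha>\<close> by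
  \<open>g \<alpha>\<close> changes \<open>\<beta>\<close> by the exact form
  \<open>1/2 d ln g^2\<close>, up to a 1-form \<open>u\<close> that vanishes on \<open>B\<close>;
  the difference of the two representatives telescopes, and every term that is not exact has more
  than \<open>q\<close> factors from the ideal. The quotient
  \<open>d\<alpha>(v, w) / \<alpha>(w)\<close> is a valid choice because
  \<open>\<beta> \<and> \<alpha>\<close> depends only on the restriction of \<open>\<beta>\<close>
  to \<open>B\<close>, where involutivity makes the contraction of \<open>d\<alpha>\<close>
  proportional to \<open>\<alpha>\<close>; hence the choice of \<open>w\<close> does not matter
  there and local choices may be averaged. For the pullback, neither a frame nor the bracket is
  given explicitly: the fibre is the solution set of linear equations, one for each coordinate of
  \<open>M\<close>, and transversality makes Gaussian elimination with smooth pivots possible; the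
  bracket is a definite description, so its independence of the representation has to be settled
  before any axiom can be checked.\<close>

notation scaleR (infixr "*R" 75)

section \<open>Calculus in finite-dimensional spaces\<close>

lemma Ck_on_cong:
 assumes "Ck_on k S g" "!!x. x : S ==> g x = h x" "open S"
 shows "Ck_on k S h" using assms(1,2)
proof (induction k arbitrary: g h)
 case 0
 thus ?case using continuous_on_cong[of S S g h] by simp
next
 case (Suc k)
 have g: "(g has_derivative frechet_derivative g (at x)) (at x)" if "x : S" for x
  using Suc.prems that by (simp add: frechet_derivative_works)
 have h: "(h has_derivative frechet_derivative g (at x)) (at x)" if "x : S" for x
  using has_derivative_transform_within_open[OF g[OF that] `open S` that] Suc.prems(2) by simp
 have eq: "frechet_derivative g (at x) = frechet_derivative h (at x)" if "x : S" for x
  using frechet_derivative_at[OF h[OF that]] .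
 have "Ck_on k S (%x. frechet_derivative h (at x) v)" for v
  by (rule Suc.IH[of "%x. frechet_derivative g (at x) v"]) (use Suc.prems eq in auto)
 thus ?case using h by (auto simp: differentiable_def)
qed

text \<open>\<open>Ck_on\<close> is phrased through \<open>frechet_derivative\<close>; uniqueness of
  derivatives lets any explicitly known derivative take its place, so that the closure lemmas below
  follow from the usual differentiation rules.\<close>

lemma Ck_on_SucI:
 assumes "!!x. x : S ==> (f has_derivative F x) (at x)"
  and "!!v. Ck_on k S (%x. F x v)" and "open S"
 shows "Ck_on (Suc k) S f"
proof -
 have "frechet_derivative f (at x) = F x" if "x : S" for x using frechet_derivative_at[OF assms(1)[OF that]] by simp
 hence "Ck_on k S (%x. frechet_derivative f (at x) v)" for v
  using Ck_on_cong[OF assms(2) _ assms(3), of v "%x. frechet_derivative f (at x) v"] by simp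
 thus ?thesis using assms(1) by (auto simp: differentiable_def)
qed

lemma Ck_on_continuous:
 assumes "Ck_on k S f" shows "continuous_on S f"
proof (cases k)
 case (Suc j)
 hence "isCont f x" if "x : S" for x using assms that by (auto intro: differentiable_imp_continuous_within)
 thus ?thesis by (simp add: continuous_at_imp_continuous_on)
qed (use assms in simp)

lemma Ck_on_deriv: "Ck_on (Suc k) S f ==> x : S ==> (f has_derivative frechet_derivative f (at x)) (at x)"
 by (simp add: frechet_derivative_works)

lemma Ck_on_SucD: "Ck_on (Suc k) S f ==> Ck_on k S f"
proof (induction k arbitrary: f)
 case 0
 thus ?case using Ck_on_continuous[of "Suc 0" S f] by simp
qed simp

lemma Ck_on_const: "open S ==> Ck_on k S (%x. c)"
proof (induction k arbitrary: c)
 case (Suc k)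
 thus ?case by (intro Ck_on_SucI[where F="%x v. 0"]) auto
qed simp

lemma Ck_on_bounded_linear:
 assumes "bounded_linear L" "open S" "Ck_on k S f"
 shows "Ck_on k S (%x. L (f x))" using assms(3)
proof (induction k arbitrary: f)
 case 0
 thus ?case using bounded_linear.continuous_on[OF assms(1)] by simp
next
 case (Suc k)
 show ?case by (rule Ck_on_SucI[where F="%x v. L (frechet_derivative f (at x) v)"])
   (use Suc assms Ck_on_deriv[OF Suc.prems] in \<open>auto intro: bounded_linear.has_derivative\<close>)
qed

lemma Ck_on_linear:
 assumes "bounded_linear L" "open S" shows "Ck_on k S L"
proof (cases k)
 case 0
 thus ?thesis using linear_continuous_on[OF assms(1)] by simp
next
 case (Suc j)
 thus ?thesis using Ck_on_SucI[where F="%x v. L v" and S=S and f=L and k=j] assms Ck_on_const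
   bounded_linear_imp_has_derivative[OF assms(1)] by blast
qed

lemma Ck_on_add:
 assumes "open S" "Ck_on k S f" "Ck_on k S g"
 shows "Ck_on k S (%x. f x + g x)" using assms(2,3)
proof (induction k arbitrary: f g)
 case 0
 thus ?case by (auto intro!: continuous_intros)
next
 case (Suc k)
 show ?case by (rule Ck_on_SucI[where F="%x v. frechet_derivative f (at x) v + frechet_derivative g (at x) v"])
   (use Suc assms Ck_on_deriv[OF Suc.prems(1)] Ck_on_deriv[OF Suc.prems(2)]
    in \<open>auto intro!: has_derivative_add\<close>)
qed

lemma Ck_on_mult:
 fixes f g :: "'a::real_normed_vector => real"
 assumes "open S" "Ck_on k S f" "Ck_on k S g"
 shows "Ck_on k S (%x. f x * g x)" using assms(2,3)
proof (induction k arbitrary: f g)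
 case 0
 thus ?case by (auto intro!: continuous_intros)
next
 case (Suc k)
 show ?case
 proof (rule Ck_on_SucI[where F="%x v. f x * frechet_derivative g (at x) v + frechet_derivative f (at x) v * g x"])
  show "Ck_on k S (%x. f x * frechet_derivative g (at x) v + frechet_derivative f (at x) v * g x)" for v
   using Suc.prems Suc.prems[THEN Ck_on_SucD] by (auto intro!: Ck_on_add[OF `open S`] Suc.IH)
 qed (use assms Ck_on_deriv[OF Suc.prems(1)] Ck_on_deriv[OF Suc.prems(2)]
    in \<open>auto intro!: has_derivative_mult\<close>)
qed

lemma Ck_on_sum:
 assumes "open S" "!!i. i : I ==> Ck_on k S (f i)"
 shows "Ck_on k S (%x. SUM i:I. f i x)" using assms(2)
proof (induction I rule: infinite_finite_induct)
 case (insert i I)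
 hence "Ck_on k S (%x. f i x + (SUM i:I. f i x))" using Ck_on_add[OF `open S`] by blast
 thus ?case using insert by simp
qed (auto intro: Ck_on_const[OF `open S`])

lemma Ck_on_inverse:
 fixes f :: "'a::real_normed_vector => real"
 assumes "open S" "Ck_on k S f" "!!x. x : S ==> f x ~= 0"
 shows "Ck_on k S (%x. inverse (f x))" using assms(2)
proof (induction k)
 case 0
 thus ?case using assms(3) by (auto intro!: continuous_intros)
next
 case (Suc k)
 let ?F = "%x v. - (inverse (f x) * frechet_derivative f (at x) v * inverse (f x))"
 show ?case
 proof (rule Ck_on_SucI[where F="?F"])
  have "Ck_on k S (%x. inverse (f x))" using Suc Ck_on_SucD by blast
  hence "Ck_on k S (%x. (-1) * (inverse (f x) * frechet_derivative f (at x) v * inverse (f x)))" for v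
   using Suc by (intro Ck_on_mult[OF `open S`] Ck_on_const[OF `open S`]) auto
  thus "Ck_on k S (%x. ?F x v)" for v by simp
 qed (use assms Ck_on_deriv[OF Suc.prems] in \<open>auto intro!: has_derivative_inverse\<close>)
qed

lemma Ck_on_ln:
 fixes f :: "'a::real_normed_vector => real"
 assumes "open S" "Ck_on k S f" and pos: "!!x. x : S ==> f x > 0"
 shows "Ck_on k S (%x. ln (f x))"
proof (cases k)
 case 0
 thus ?thesis using assms by (auto intro!: continuous_on_ln less_imp_neq[THEN not_sym])
next
 case (Suc j)
 have f: "Ck_on (Suc j) S f" using assms(2) Suc by simp
 show ?thesis unfolding Suc
 proof (rule Ck_on_SucI[where F="%x v. frechet_derivative f (at x) v * inverse (f x)"])
  have "f x ~= 0" if "x : S" for x using pos[OF that] by simp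
  thus "Ck_on j S (%x. frechet_derivative f (at x) v * inverse (f x))" for v using f Ck_on_SucD[OF f]
   by (intro Ck_on_mult[OF `open S`] Ck_on_inverse[OF `open S`]) auto
  fix x assume "x : S"
  have "(ln has_derivative (*) (inverse (f x))) (at (f x))"
   using pos[OF `x : S`] DERIV_ln unfolding has_field_derivative_def by blast
  hence "((%x. ln (f x)) has_derivative (%v. inverse (f x) * frechet_derivative f (at x) v)) (at x)"
   using has_derivative_compose[OF Ck_on_deriv[OF f `x : S`]] by blast
  thus "((%x. ln (f x)) has_derivative (%v. frechet_derivative f (at x) v * inverse (f x))) (at x)"
   by (simp add: mult.commute)
 qed fact
qed

lemma Ck_on_subset: "Ck_on k S f ==> T <= S ==> Ck_on k T f" by (induction k arbitrary: f) (auto intro: continuous_on_subset)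

lemma Ck_on_localI:
 assumes "!!x. x : S ==> EX U. open U & x : U & Ck_on k U f"
 shows "Ck_on k S f" using assms
proof (induction k arbitrary: f)
 case 0
 show ?case by (simp add: continuous_on_eq_continuous_within)
   (metis 0 Ck_on.simps(1) continuous_at_imp_continuous_within continuous_on_eq_continuous_at)
next
 case (Suc k)
 thus ?case by auto (meson Suc.IH)
qed

subsection \<open>Orthonormal bases\<close>

definition onb :: "'e::real_inner set => bool" where
 "onb B \<longleftrightarrow> finite B & span B = UNIV & (ALL b:B. ALL c:B. b \<bullet> c = (if b = c then 1 else 0))"

text \<open>Gram-Schmidt, one spanning vector at a time: the residual \<open>r\<close> after
  subtracting the projections is normalised, or dropped when it vanishes.\<close>

lemma onb_exists:
 fixes B :: "'e::real_inner set"
 assumes "finite B" "span B = UNIV"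
 shows "EX C::'e set. onb C"
proof -
 have "EX C. finite C & span C = span B & (ALL b:C. ALL c:C. b \<bullet> c = (if b = c then 1 else 0))" using assms(1)
 proof (induction B)
  case (insert a B)
  then obtain C where C: "finite C" "span C = span B"
   "!!b c. b : C ==> c : C ==> b \<bullet> c = (if b = c then 1 else 0)" by blast
  define r where "r = a - (SUM c:C. (a \<bullet> c) *R c)"
  have orth: "r \<bullet> c = 0" if "c : C" for c
  proof -
   have "(SUM d:C. (a \<bullet> d) * (d \<bullet> c)) = (SUM d:C. if d = c then a \<bullet> c else 0)" using C(3) that by (intro sum.cong) auto
   thus ?thesis using that C(1) by (simp add: r_def inner_diff_left inner_sum_left)
  qed
  have sp: "(SUM c:C. (a \<bullet> c) *R c) : span B" unfolding C(2)[symmetric] by (intro span_sum span_mul span_base)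
  show ?case
  proof (cases "r = 0")
   case True
   hence "a : span B" using sp by (simp add: r_def)
   thus ?thesis using C by (intro exI[of _ C]) (auto simp: span_redundant)
  next
   case False
   define u where "u = (1 / norm r) *R r"
   have "span (insert u C) = span (insert a B)"
   proof (rule span_eq[THEN iffD2], safe)
    have "a : span (insert a B)" "(SUM c:C. (a \<bullet> c) *R c) : span (insert a B)"
     using sp span_mono[of B "insert a B"] by (auto intro: span_base)
    thus "u : span (insert a B)" unfolding u_def r_def by (intro span_mul span_diff)
    show "x : span (insert a B)" if "x : C" for x using that C(2) span_base[of x C] span_mono[of B "insert a B"] by auto
    have "a = norm r *R u + (SUM c:C. (a \<bullet> c) *R c)" using False by (simp add: u_def r_def)
    also have "... : span (insert u C)" by (intro span_add span_mul span_sum span_base) auto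
    finally show "a : span (insert u C)" .
    show "x : span (insert u C)" if "x : B" for x using that C(2) span_base[of x B] span_mono[of C "insert u C"] by auto
   qed
   moreover have "u \<bullet> u = 1" using False by (simp add: u_def power2_norm_eq_inner[symmetric] power2_eq_square)
   moreover have "u \<bullet> c = 0" "c \<bullet> u = 0" if "c : C" for c using orth[OF that] by (auto simp: u_def inner_commute)
   moreover have "u ~: C" using calculation(2,3) by auto
   ultimately show ?thesis using C by (intro exI[of _ "insert u C"]) auto
  qed
 qed auto
 thus ?thesis using assms(2) by (auto simp: onb_def)
qed

lemma onb_expand:
 assumes "onb B" shows "(SUM b:B. (x \<bullet> b) *R b) = x"
proof -
 have "x : span B" using assms by (auto simp: onb_def)
 then obtain r where r: "x = (SUM b:B. r b *R b)"
  using assms span_finite[of B] unfolding onb_def by (metis (no_types, lifting) imageE)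
 have "x \<bullet> c = r c" if "c : B" for c
 proof -
  have "x \<bullet> c = (SUM b:B. if b = c then r c else 0)"
   unfolding r inner_sum_left using assms that by (intro sum.cong) (auto simp: onb_def)
  thus ?thesis using assms that by (simp add: onb_def)
 qed
 thus ?thesis using r by simp
qed

lemma onb_linear:
 assumes "onb B" "linear L"
 shows "L x = (SUM b:B. (x \<bullet> b) *R L b)" using linear_sum[OF assms(2), of "%b. (x \<bullet> b) *R b" B] linear_cmul[OF assms(2)]
  onb_expand[OF assms(1), of x] by simp

lemma onb_derivative:
 fixes f :: "'e::real_inner => real"
 assumes "onb B" "(f has_derivative L) F"
 shows "L x = (SUM b:B. (x \<bullet> b) * L b)"
 using onb_linear[OF assms(1) has_derivative_linear[OF assms(2)], of x] by (simp only: real_scaleR_def)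

lemma onb_abs_le: "onb B ==> b : B ==> \<bar>x \<bullet> b\<bar> <= norm x"
 using Cauchy_Schwarz_ineq2[of x b] by (simp add: onb_def norm_eq_sqrt_inner)

text \<open>The ball around 0 is a closed subset of the box of vectors whose coordinates are bounded
  by \<open>r\<close>, and this box is a finite sum of compact segments.\<close>

lemma compact_cball_onb:
 fixes a :: "'e::real_inner"
 assumes "onb (B::'e set)"
 shows "compact (cball a r)"
proof -
 have "compact {(SUM b:C. c b *R b) |c. ALL b:C. \<bar>c b\<bar> <= r}" if "finite C" for C :: "'e set" using that
 proof (induction C)
  case (insert b C)
  have "compact ((%t. t *R b) ` {-r..r})" by (intro compact_continuous_image continuous_intros) simp
  moreover have "{(SUM b:insert b C. c b *R b) |c. ALL b:insert b C. \<bar>c b\<bar> <= r} =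
    {x + y |x y. x : (%t. t *R b) ` {-r..r} & y : {(SUM b:C. c b *R b) |c. ALL b:C. \<bar>c b\<bar> <= r}}" (is "?L = ?R")
  proof (intro equalityI subsetI)
   fix x assume "x : ?L"
   then obtain c where "x = c b *R b + (SUM b:C. c b *R b)" "ALL b:insert b C. \<bar>c b\<bar> <= r" using insert by auto
   thus "x : ?R" by (fastforce intro!: image_eqI[where x="c b"])
  next
   fix x assume "x : ?R"
   then obtain t c where x: "x = t *R b + (SUM b:C. c b *R b)" "\<bar>t\<bar> <= r" "ALL b:C. \<bar>c b\<bar> <= r" by auto
   have "(SUM d:C. c d *R d) = (SUM d:C. (c(b := t)) d *R d)" using insert by (intro sum.cong) auto
   hence "x = (SUM d:insert b C. (c(b := t)) d *R d)" using x insert by simp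
   thus "x : ?L" using x by (intro CollectI exI[of _ "c(b := t)"]) auto
  qed
  ultimately show ?case using compact_sums insert.IH by fastforce
 qed auto
 from this[of B] have K: "compact {(SUM b:B. c b *R b) |c. ALL b:B. \<bar>c b\<bar> <= r}" (is "compact ?K")
  using assms by (auto simp: onb_def)
 have "cball 0 r <= ?K"
 proof
  fix x :: 'e assume "x : cball 0 r"
  hence "ALL b:B. \<bar>x \<bullet> b\<bar> <= r" using onb_abs_le[OF assms, of _ x] by fastforce
  thus "x : ?K" using onb_expand[OF assms, of x] by (intro CollectI exI[of _ "%b. x \<bullet> b"]) auto
 qed
 hence "compact (cball (0::'e) r)" using compact_Int_closed[OF K, of "cball 0 r"] by (simp add: Int_absorb1)
 thus ?thesis using compact_translation[of "cball 0 r" a] by (simp add: cball_translation)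
qed

text \<open>The chain rule is expanded along the basis because the induction hypothesis concerns
  derivatives of \<open>g\<close> in a fixed direction, whereas the direction \<open>f'(x) v\<close>
  moves with \<open>x\<close>.\<close>

lemma Ck_on_compose:
 fixes f :: "'a::real_normed_vector => 'b::real_inner" and g :: "'b => real"
 assumes B: "onb (B::'b set)" and "open S" "open T" "f ` S <= T"
  and "Ck_on k S f" "Ck_on k T g"
 shows "Ck_on k S (%x. g (f x))" using assms(5,6)
proof (induction k arbitrary: g)
 case 0
 thus ?case using assms continuous_on_compose2[of T g S f] by auto
next
 case (Suc k)
 show ?case
 proof (rule Ck_on_SucI[where F="%x v. SUM b:B. (frechet_derivative f (at x) v \<bullet> b) * frechet_derivative g (at (f x)) b"])
  show "Ck_on k S (%x. SUM b:B. (frechet_derivative f (at x) v \<bullet> b) * frechet_derivative g (at (f x)) b)" for v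
   using Suc.prems Ck_on_SucD[OF Suc.prems(1)] by (intro Ck_on_sum[OF `open S`] Ck_on_mult[OF `open S`] Suc.IH
     Ck_on_bounded_linear[OF bounded_linear_inner_left `open S`]) auto
  fix x assume "x : S"
  have g: "(g has_derivative frechet_derivative g (at (f x))) (at (f x))"
   using Ck_on_deriv[OF Suc.prems(2)] `x : S` assms(4) by blast
  have "((%x. g (f x)) has_derivative (%v. frechet_derivative g (at (f x)) (frechet_derivative f (at x) v))) (at x)"
   using has_derivative_compose[of f "frechet_derivative f (at x)" x UNIV g, OF _ g]
    Ck_on_deriv[OF Suc.prems(1) `x : S`] by simp
  thus "((%x. g (f x)) has_derivative
    (%v. SUM b:B. (frechet_derivative f (at x) v \<bullet> b) * frechet_derivative g (at (f x)) b)) (at x)"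
   by (subst (asm) onb_derivative[OF B g])
 qed fact
qed

subsection \<open>Bump functions and Hadamard's lemma\<close>

text \<open>The power of \<open>1/t\<close> is carried along so that the family is closed under
  differentiation up to linear combinations; smoothness is then one induction on the order.\<close>

definition flat_exp :: "nat => real => real" where
 "flat_exp n t = (if t <= 0 then 0 else exp (- inverse t) * inverse t ^ n)"

lemma flat_exp_deriv:
 "(flat_exp n has_real_derivative (flat_exp (n + 2) t - n * flat_exp (n + 1) t)) (at t)"
proof -
 consider "t < 0" | "t = 0" | "t > 0" by linarith
 thus ?thesis
 proof cases
  case 1
  hence "((%_. 0) has_real_derivative 0) (at t)" by simp
  hence "(flat_exp n has_real_derivative 0) (at t)"
   using has_field_derivative_transform_within_open[of "%_. 0" 0 t "{..<0}" "flat_exp n"] 1 by (auto simp: flat_exp_def)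
  thus ?thesis using 1 by (simp add: flat_exp_def)
 next
  case 3
  have "((%t. inverse t) has_real_derivative - (inverse t ^ 2)) (at t)"
   using DERIV_inverse[of t] 3 by (simp add: power_inverse numeral_2_eq_2)
  from DERIV_mult[OF DERIV_fun_exp[OF DERIV_minus[OF this]] DERIV_power[OF this, of n]]
  have "((%t. exp (- inverse t) * inverse t ^ n) has_real_derivative
   exp (- inverse t) * (- (- (inverse t ^ 2))) * inverse t ^ n +
   real n * (- (inverse t ^ 2) * inverse t ^ (n - Suc 0)) * exp (- inverse t)) (at t)" by simp
  also have "exp (- inverse t) * (- (- (inverse t ^ 2))) * inverse t ^ n +
   real n * (- (inverse t ^ 2) * inverse t ^ (n - Suc 0)) * exp (- inverse t) =
   flat_exp (n + 2) t - n * flat_exp (n + 1) t" using 3 by (cases n) (auto simp: flat_exp_def power_add power2_eq_square)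
  finally have "((%t. exp (- inverse t) * inverse t ^ n) has_real_derivative
   (flat_exp (n + 2) t - n * flat_exp (n + 1) t)) (at t)" . thus ?thesis
   using has_field_derivative_transform_within_open[of "%t. exp (- inverse t) * inverse t ^ n" _ t "{0<..}" "flat_exp n"] 3
   by (auto simp: flat_exp_def)
 next
  case 2
  \<comment> \<open>From the right the difference quotient at 0 is \<open>exp (-1/h)\<close> times a
    power of \<open>1/h\<close>, and the exponential wins.\<close>
  have r: "((%h. flat_exp n h / h) \<longlongrightarrow> 0) (at_right 0)"
  proof (rule Lim_transform_eventually)
   show "((%h::real. exp (- inverse h) * inverse h ^ n / h) \<longlongrightarrow> 0) (at_right 0)" by real_asymp
   show "\<forall>\<^sub>F h in at_right 0. exp (- inverse h) * inverse h ^ n / h = flat_exp n h / h"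
    by (auto simp: eventually_at_filter flat_exp_def)
  qed
  have l: "((%h. flat_exp n h / h) \<longlongrightarrow> 0) (at_left 0)"
   by (rule Lim_transform_eventually[of "%_. 0"]) (auto simp: eventually_at_filter flat_exp_def)
  have "((%h. flat_exp n h / h) \<longlongrightarrow> 0) (at 0)" using filterlim_split_at[OF l r] .
  thus ?thesis using 2 by (simp add: DERIV_def flat_exp_def)
 qed
qed

lemma Ck_on_flat_exp: "Ck_on k UNIV (flat_exp n)"
proof (induction k arbitrary: n)
 case 0
 have "isCont (flat_exp n) t" for t by (rule DERIV_isCont[OF flat_exp_deriv])
 thus ?case by (simp add: continuous_at_imp_continuous_on)
next
 case (Suc k)
 show ?case
 proof (rule Ck_on_SucI[where F="%t v. (flat_exp (n + 2) t + (- real n) * flat_exp (n + 1) t) * v"])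
  show "Ck_on k UNIV (%t. (flat_exp (n + 2) t + (- real n) * flat_exp (n + 1) t) * v)" for v
   by (intro Ck_on_mult Ck_on_add Ck_on_const Suc) auto
 qed (use flat_exp_deriv in \<open>auto simp: has_field_derivative_def\<close>)
qed

text \<open>For every \<open>t\<close> at least one of \<open>2 - t\<close> and \<open>t - 1\<close>
  is positive, so the denominator has no zero.\<close>

definition cutoff :: "real => real" where
 "cutoff t = flat_exp 0 (2 - t) * inverse (flat_exp 0 (2 - t) + flat_exp 0 (t - 1))"

lemma cutoff_1: "t <= 1 ==> cutoff t = 1" and cutoff_0: "t >= 2 ==> cutoff t = 0" by (auto simp: cutoff_def flat_exp_def)

lemma Ck_on_cutoff: "Ck_on k UNIV cutoff"
proof -
 have onb: "onb {1::real}" by (auto simp: onb_def) (metis mult.right_neutral real_scaleR_def span_base span_mul singletonI)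
 have a: "Ck_on k UNIV (%t::real. 2 + (-1) * t)" "Ck_on k UNIV (%t::real. t + (-1))"
  by (intro Ck_on_add Ck_on_const Ck_on_mult Ck_on_linear bounded_linear_ident open_UNIV)+
 have "Ck_on k UNIV (%t::real. flat_exp 0 (2 - t))" "Ck_on k UNIV (%t::real. flat_exp 0 (t - 1))"
  using Ck_on_compose[OF onb open_UNIV open_UNIV _ a(1) Ck_on_flat_exp[of k 0]]
   Ck_on_compose[OF onb open_UNIV open_UNIV _ a(2) Ck_on_flat_exp[of k 0]] by auto
 moreover have "flat_exp 0 (2 - t) + flat_exp 0 (t - 1) ~= 0" for t
  by (auto simp: flat_exp_def add_pos_pos less_imp_neq[symmetric] dest!: not_le_imp_less)
 ultimately have "Ck_on k UNIV (%t. flat_exp 0 (2 - t) * inverse (flat_exp 0 (2 - t) + flat_exp 0 (t - 1)))"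
  by (intro Ck_on_mult Ck_on_inverse Ck_on_add) auto
 thus ?thesis by (rule Ck_on_cong) (auto simp: cutoff_def)
qed

lemma bump_exists:
 fixes a :: "'e::real_inner"
 assumes "onb (B::'e set)" "r > 0"
 obtains h :: "'e => real" and d where "smooth_on UNIV h" "d > 0" "d < r"
  "!!x. dist a x <= d ==> h x = 1" "!!x. dist a x >= r ==> h x = 0"
proof -
 \<comment> \<open>Scaled so that the argument of \<open>cutoff\<close> reaches 2, where it starts
   to vanish, at distance \<open>r\<close>; at distance \<open>r / 2\<close> the argument is 1/2,
   where \<open>cutoff\<close> is still 1.\<close>
 define s where "s = 2 / r\<^sup>2"
 define h where "h x = cutoff (s * ((x - a) \<bullet> (x - a)))" for x
 have onb1: "onb {1::real}" by (auto simp: onb_def) (metis mult.right_neutral real_scaleR_def span_base span_mul singletonI)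
 \<comment> \<open>The squared distance is a polynomial in the coordinates, to which the closure
   rules for \<open>Ck_on\<close> apply.\<close>
 have nsq: "(x - a) \<bullet> (x - a) = (SUM b:B. (x \<bullet> b + - (a \<bullet> b)) * (x \<bullet> b + - (a \<bullet> b)))" for x
 proof -
  have "(x - a) \<bullet> (x - a) = (SUM b:B. ((x - a) \<bullet> b) *R b) \<bullet> (x - a)" unfolding onb_expand[OF assms(1)] ..
  also have "... = (SUM b:B. ((x - a) \<bullet> b) * ((x - a) \<bullet> b))"
   by (simp only: inner_sum_left inner_scaleR_left inner_commute[of "x - a"])
  finally show ?thesis by (simp add: inner_diff_left)
 qed
 have "Ck_on k UNIV h" for k
 proof -
  have "Ck_on k UNIV (%x. s * ((x - a) \<bullet> (x - a)))" unfolding nsq by (intro Ck_on_mult Ck_on_const Ck_on_sum Ck_on_add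
     Ck_on_linear[OF bounded_linear_inner_left] open_UNIV)
  from Ck_on_compose[OF onb1 open_UNIV open_UNIV _ this Ck_on_cutoff] show ?thesis by (auto simp: h_def[abs_def])
 qed
 moreover have "h x = 1" if "dist a x <= r / 2" for x
 proof -
  have "(norm (x - a))\<^sup>2 <= (r / 2)\<^sup>2" using that by (intro power_mono) (auto simp: dist_norm norm_minus_commute)
  also have "... <= r\<^sup>2 / 2" by (simp add: power_divide)
  finally have "s * (norm (x - a))\<^sup>2 <= 1" using assms(2) by (simp add: s_def field_simps)
  thus ?thesis by (simp add: h_def power2_norm_eq_inner cutoff_1)
 qed
 moreover have "h x = 0" if "dist a x >= r" for x
 proof -
  have "(dist a x)\<^sup>2 >= r\<^sup>2" using that assms(2) by (intro power_mono) auto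
  hence "s * (norm (x - a))\<^sup>2 >= 2" using assms(2) by (simp add: s_def field_simps dist_norm norm_minus_commute)
  thus ?thesis by (simp add: h_def power2_norm_eq_inner cutoff_0)
 qed
 ultimately show ?thesis using assms(2) by (intro that[of h "r / 2"]) (auto simp: smooth_on_def)
qed

text \<open>For \<open>n = 0\<close> and \<open>g\<close> a partial derivative these are the factors
  in Hadamard's lemma. Each differentiation in \<open>x\<close> pulls out a factor \<open>t\<close>;
  the exponent \<open>n\<close> counts them.\<close>

definition radial_mean :: "nat => 'e::real_inner => ('e => real) => 'e => real" where
 "radial_mean n a g x = integral {0..1} (%t. t ^ n * g (a + t *R (x - a)))"

lemma smooth_on_deriv:
 "smooth_on S g ==> x : S ==> (g has_derivative frechet_derivative g (at x)) (at x)"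
 "smooth_on S g ==> smooth_on S (%x. frechet_derivative g (at x) v)"
 unfolding smooth_on_def by (metis Ck_on_deriv) (metis Ck_on.simps(2))

lemma segment_in_ball:
 fixes a :: "'e::real_normed_vector"
 assumes "x : ball a r" "0 <= t" "t <= 1"
 shows "a + t *R (x - a) : ball a r"
proof -
 have "t * norm (x - a) <= 1 * norm (x - a)" using assms by (intro mult_right_mono) auto
 thus ?thesis using assms by (simp add: dist_norm norm_minus_commute)
qed

lemma radial_continuous:
 fixes g :: "'e::real_inner => real"
 assumes "continuous_on (ball a r) g" "x : ball a r"
 shows "continuous_on {0..1} (%t. t ^ n * g (a + t *R (x - a)))" using assms segment_in_ball[OF assms(2)]
 by (intro continuous_intros continuous_on_compose2[OF assms(1)]) auto

text \<open>Differentiation under the integral sign by a direct epsilon argument: the partial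
  derivatives are uniformly continuous on a compact ball, so the linearisation error of
  \<open>g\<close> along the moving segment is uniform in \<open>t\<close>.\<close>

lemma radial_mean_deriv:
 fixes g :: "'e::real_inner => real"
 assumes B: "onb (B::'e set)" and g: "smooth_on (ball a r) g" and x: "x : ball a r"
 shows "(radial_mean n a g has_derivative (%v. radial_mean (Suc n) a (%x. frechet_derivative g (at x) v) x)) (at x)"
proof -
 let ?D = "%v x. frechet_derivative g (at x) v"
 have gD: "(g has_derivative (%v. ?D v y)) (at y)" if "y : ball a r" for y using smooth_on_deriv(1)[OF g that] .
 have cD: "continuous_on (ball a r) (?D v)" for v
  using smooth_on_deriv(2)[OF g, of v] Ck_on_continuous unfolding smooth_on_def by blast
 have cg: "continuous_on (ball a r) g" using g Ck_on_continuous unfolding smooth_on_def by blast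
 have lin: "?D v y = (SUM b:B. (v \<bullet> b) * ?D b y)" if "y : ball a r" for v y by (rule onb_derivative[OF B gD[OF that]])
 have inD: "(%t. t ^ n * ?D v (a + t *R (y - a))) integrable_on {0..1}"
  and ing: "(%t. t ^ n * g (a + t *R (y - a))) integrable_on {0..1}"
  if "y : ball a r" for v y n by (rule integrable_continuous_real[OF radial_continuous[OF cD that]],
    rule integrable_continuous_real[OF radial_continuous[OF cg that]])
 have RL: "radial_mean m a (?D v) x = (SUM b:B. (v \<bullet> b) * radial_mean m a (?D b) x)" for m v
 proof -
  have "radial_mean m a (?D v) x = integral {0..1} (%t. SUM b:B. (v \<bullet> b) * (t ^ m * ?D b (a + t *R (x - a))))"
   unfolding radial_mean_def using lin[OF segment_in_ball[OF x]]
   by (intro integral_cong) (auto simp: sum_distrib_left algebra_simps)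
  also have "... = (SUM b:B. integral {0..1} (%t. (v \<bullet> b) * (t ^ m * ?D b (a + t *R (x - a)))))"
   using B by (intro integral_sum integrable_on_mult_right inD[OF x]) (simp add: onb_def)
  finally show ?thesis by (simp add: radial_mean_def)
 qed
 have "bounded_linear (%v. SUM b:B. (v \<bullet> b) * radial_mean (Suc n) a (?D b) x)"
  by (intro bounded_linear_sum bounded_linear_mult_const bounded_linear_inner_left)
 hence "bounded_linear (%v. radial_mean (Suc n) a (?D v) x)" using RL[of "Suc n"] by (metis (no_types, lifting) ext)
 moreover have "EX d>0. ALL y. norm (y - x) < d -->
   norm (radial_mean n a g y - radial_mean n a g x - radial_mean (Suc n) a (?D (y - x)) x)
    <= e * norm (y - x)" if "e > 0" for e proof - define e' where "e' = e / (card B + 1)"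
  \<comment> \<open>The errors in the \<open>card B\<close> basis directions add up to at most
    \<open>e\<close>; the summand 1 in the denominator takes care of dimension 0.\<close>
  have "e' > 0" using that by (simp add: e'_def add_nonneg_pos)
  \<comment> \<open>The closed ball of an intermediate radius is compact and still lies in the
    domain of \<open>g\<close>.\<close>
  obtain r' where r': "dist a x < r'" "r' < r" using x dense[of "dist a x" r] by auto
  have sub: "cball a r' <= ball a r" using r' by auto
  have "EX d>0. ALL y:cball a r'. ALL z:cball a r'. dist z y < d --> dist (?D b z) (?D b y) < e'" for b
   using compact_uniformly_continuous[OF continuous_on_subset[OF cD sub] compact_cball_onb[OF B], of b]
    `e' > 0` unfolding uniformly_continuous_on_def by blast
  then obtain d where d: "!!b. d b > 0" "!!b y z. y : cball a r' ==> z : cball a r' ==>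
    dist z y < d b ==> dist (?D b z) (?D b y) < e'" by metis define c where "c = Min (insert (r' - dist a x) (d ` B))"
  have fB: "finite B" using B by (simp add: onb_def)
  \<comment> \<open>Below \<open>c\<close> all points stay in the compact ball and all moduli of
    continuity \<open>d b\<close> apply; the entry \<open>r' - dist a x\<close> also keeps the set
    under \<open>Min\<close> nonempty when \<open>B\<close> is empty.\<close>
  have c: "c > 0" "c <= r' - dist a x" "!!b. b : B ==> c <= d b" using fB d(1) r'(1) by (auto simp: c_def)
  show ?thesis
  proof (intro exI[of _ c] conjI allI impI)
   fix y assume y: "norm (y - x) < c"
   define v where "v = y - x"
   have inb: "z : cball a r'" if "dist x z < c" for z using that c(2) dist_triangle[of a z x] by auto
   have yb: "y : ball a r" using inb[of y] y sub by (auto simp: dist_norm norm_minus_commute)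
   \<comment> \<open>Mean value estimate on the segment from \<open>z\<close> to
     \<open>z + s v\<close> for \<open>g\<close> minus its linear part at \<open>z\<close>: by the
     choice of \<open>c\<close> the derivative of this difference is at most \<open>e\<close>
     there.\<close>
   have err: "\<bar>g (z + s *R v) - g z - s * ?D v z\<bar> <= s * (e * norm v)"
    if z: "z = a + s *R (x - a)" and s: "0 <= s" "s <= 1" for z s
   proof -
    have seg: "z + u *R v : cball a r'" if "0 <= u" "u <= s" for u
    proof -
     have "z + u *R v - a = s *R (x - a) + u *R v" by (simp add: z)
     hence "norm (z + u *R v - a) <= norm (s *R (x - a)) + norm (u *R v)" by (simp only: norm_triangle_ineq)
     also have "... = s * norm (x - a) + u * norm v" using s that by simp
     also have "... <= 1 * norm (x - a) + 1 * norm v" using s that by (intro add_mono mult_right_mono) auto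
     also have "... <= r'" using y c(2) by (simp add: v_def dist_norm norm_minus_commute)
     finally show ?thesis by (simp add: dist_norm norm_minus_commute)
    qed
    have z0: "z : cball a r'" using seg[of 0] s by simp
    have "norm (g (z + s *R v) - g z - ?D (z + s *R v - z) z) <= norm (z + s *R v - z) * e"
    proof (rule differentiable_bound_linearization[where S = "{u : cball a r'. dist u z < c}" and f' = "%u w. ?D w u"])
     show "z + t *R (z + s *R v - z) : {u : cball a r'. dist u z < c}" if "t : {0..1}" for t
     proof -
      have ts: "t * s <= 1 * s" using that s by (intro mult_right_mono) auto
      hence "t * s * norm v <= 1 * norm v" using s by (intro mult_right_mono) auto
      thus ?thesis using seg[of "t * s"] ts that s y by (simp add: v_def dist_norm)
     qed
     show "(g has_derivative (%w. ?D w u)) (at u within {u : cball a r'. dist u z < c})"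
      if "u : {u : cball a r'. dist u z < c}" for u by (rule has_derivative_at_withinI[OF gD]) (use sub that in auto)
     show "onorm ((%w. ?D w u) - (%w. ?D w z)) <= e" if u: "u : {u : cball a r'. dist u z < c}" for u
     proof (rule onorm_bound)
      fix w
      have "?D w u - ?D w z = (SUM b:B. (w \<bullet> b) * (?D b u - ?D b z))"
       using lin[of z w] lin[of u w] z0 u sub by (simp add: sum_subtractf right_diff_distrib subset_iff)
      also have "\<bar>...\<bar> <= (SUM b:B. norm w * e')"
      proof (rule order_trans[OF sum_abs sum_mono], unfold abs_mult, rule mult_mono)
       fix b assume "b : B"
       show "\<bar>w \<bullet> b\<bar> <= norm w" using onb_abs_le[OF B `b : B`] .
       show "\<bar>?D b u - ?D b z\<bar> <= e'" using d(2)[OF z0, of u b] u c(3)[OF `b : B`] by (simp add: dist_real_def)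
      qed auto
      also have "... <= e * norm w" using `e > 0` by (simp add: e'_def field_simps)
      finally show "norm (((%w. ?D w u) - (%w. ?D w z)) w) <= e * norm w" by simp
     qed (use `e > 0` in simp)
    qed (use z0 c(1) in simp)
    thus ?thesis using s linear_cmul[OF has_derivative_linear[OF gD[of z]], of s v] z0 sub by (auto simp: algebra_simps)
   qed
   have "radial_mean n a g y - radial_mean n a g x - radial_mean (Suc n) a (?D v) x =
    integral {0..1} (%t. t ^ n * g (a + t *R (y - a)) - t ^ n * g (a + t *R (x - a))
      - t ^ Suc n * ?D v (a + t *R (x - a)))" unfolding radial_mean_def
    unfolding integral_diff[OF integrable_diff[OF ing[OF yb, of n] ing[OF x, of n]] inD[OF x, of "Suc n" v]]
     integral_diff[OF ing[OF yb, of n] ing[OF x, of n]] ..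
   also have "norm ... <= integral {0..1} (%t::real. e * norm v)"
   proof (rule integral_norm_bound_integral)
    fix t :: real assume t: "t : {0..1}"
    have "a + t *R (y - a) = (a + t *R (x - a)) + t *R v" by (simp add: v_def algebra_simps)
    hence "t ^ n * g (a + t *R (y - a)) - t ^ n * g (a + t *R (x - a))
      - t ^ Suc n * ?D v (a + t *R (x - a)) = t ^ n * (g ((a + t *R (x - a)) + t *R v)
       - g (a + t *R (x - a)) - t * ?D v (a + t *R (x - a)))" by (simp add: algebra_simps)
    also have "norm ... <= 1 * (1 * (e * norm v))" unfolding real_norm_def abs_mult
    proof (rule mult_mono)
     show "\<bar>g ((a + t *R (x - a)) + t *R v)
       - g (a + t *R (x - a)) - t * ?D v (a + t *R (x - a))\<bar> <= 1 * (e * norm v)"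
      using t `e > 0` by (intro order_trans[OF err[OF refl]] mult_right_mono) auto
    qed (use t in \<open>auto intro: power_le_one\<close>)
    finally show "norm (t ^ n * g (a + t *R (y - a)) - t ^ n * g (a + t *R (x - a))
      - t ^ Suc n * ?D v (a + t *R (x - a))) <= e * norm v" by simp
   qed (use integrable_diff[OF integrable_diff[OF ing[OF yb, of n] ing[OF x, of n]] inD[OF x, of "Suc n" v]]
    in auto)
   finally show "norm (radial_mean n a g y - radial_mean n a g x - radial_mean (Suc n) a (?D (y - x)) x)
    <= e * norm (y - x)" by (simp add: v_def) qed (rule c) qed
 ultimately show ?thesis unfolding has_derivative_at_alt by blast
qed

lemma smooth_on_radial_mean:
 fixes g :: "'e::real_inner => real"
 assumes B: "onb (B::'e set)" and g: "smooth_on (ball a r) g"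
 shows "smooth_on (ball a r) (radial_mean n a g)"
proof -
 have "Ck_on k (ball a r) (radial_mean n a g)" for k using g
 proof (induction k arbitrary: n g)
  case 0
  thus ?case using radial_mean_deriv[OF B] by (auto intro!: continuous_at_imp_continuous_on has_derivative_continuous)
 next
  case (Suc k)
  show ?case by (rule Ck_on_SucI[OF radial_mean_deriv[OF B]])
    (auto intro!: Suc smooth_on_deriv(2) simp del: frechet_derivative_const)
 qed
 thus ?thesis by (simp add: smooth_on_def)
qed

text \<open>The fundamental theorem of calculus along the segment from \<open>a\<close> to
  \<open>x\<close>, with the derivative in direction \<open>x - a\<close> expanded along the
  basis.\<close>

lemma hadamard:
 fixes g :: "'e::real_inner => real"
 assumes B: "onb (B::'e set)" and g: "smooth_on (ball a r) g" and x: "x : ball a r"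
 shows "g x = g a + (SUM b:B. ((x - a) \<bullet> b) * radial_mean 0 a (%y. frechet_derivative g (at y) b) x)"
proof -
 let ?D = "%v x. frechet_derivative g (at x) v"
 have gD: "(g has_derivative (%v. ?D v y)) (at y)" if "y : ball a r" for y using smooth_on_deriv(1)[OF g that] .
 have "((%t. g (a + t *R (x - a))) has_vector_derivative ?D (x - a) (a + t *R (x - a))) (at t within {0..1})"
  if "t : {0..1}" for t
 proof -
  have "((%u. a + u *R (x - a)) has_derivative (%w. w *R (x - a))) (at t within {0..1})"
   by (auto intro!: derivative_eq_intros)
  from has_derivative_compose[OF this gD] show ?thesis
   using segment_in_ball[OF x, of t] that linear_cmul[OF has_derivative_linear[OF gD[of "a + t *R (x - a)"]]]
   by (simp add: has_vector_derivative_def)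
 qed
 hence "((%t. ?D (x - a) (a + t *R (x - a))) has_integral (g (a + 1 *R (x - a)) - g (a + 0 *R (x - a)))) {0..1}"
  by (intro fundamental_theorem_of_calculus) auto
 hence "g x - g a = integral {0..1} (%t. ?D (x - a) (a + t *R (x - a)))" by (simp add: integral_unique)
 also have "... = integral {0..1} (%t. SUM b:B. ((x - a) \<bullet> b) * ?D b (a + t *R (x - a)))"
  by (intro integral_cong onb_derivative[OF B gD] segment_in_ball[OF x]) auto
 also have "... = (SUM b:B. integral {0..1} (%t. ((x - a) \<bullet> b) * ?D b (a + t *R (x - a))))"
 proof (rule integral_sum)
  fix b
  have "(%t. ?D b (a + t *R (x - a))) integrable_on {0..1}"
   using radial_continuous[of a r "?D b" x 0] smooth_on_deriv(2)[OF g, of b] Ck_on_continuous x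
   unfolding smooth_on_def by (auto intro!: integrable_continuous_real)
  thus "(%t. ((x - a) \<bullet> b) * ?D b (a + t *R (x - a))) integrable_on {0..1}" by (rule integrable_on_mult_right)
 qed (use B in \<open>simp add: onb_def\<close>)
 finally show ?thesis by (simp add: radial_mean_def)
qed

section \<open>Smooth functions and tangent vectors\<close>

text \<open>Smoothness of a germ. On an open set it is equivalent to \<open>smooth_fun_on\<close>
  pointwise, and closure rules are easier to apply at one point, without keeping track of
  domains.\<close>

definition smooth_at ::
  "('m::topological_space, 'e::real_inner) atlas => ('m => real) => 'm => bool" where
 "smooth_at M g p \<longleftrightarrow> (EX U. open U & p : U & smooth_fun_on M U g)"

lemma smooth_on_subset: "smooth_on S f ==> T <= S ==> smooth_on T f" unfolding smooth_on_def by (blast intro: Ck_on_subset)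

locale manifold =
 fixes M :: "('m::{t2_space,second_countable_topology}, 'e::real_inner) atlas"
 assumes manifold: "smooth_manifold M"
begin

definition basis :: "'e set" where "basis = (SOME B. onb B)"

lemma onb_basis: "onb basis" using manifold onb_exists unfolding basis_def smooth_manifold_def by (metis someI_ex)

lemma finite_basis [simp]: "finite basis" using onb_basis by (simp add: onb_def)

lemma chart_at: obtains V c where "(V, c) : M" "p : V"
proof -
 have "EX (U, c):M. p : U" using manifold unfolding smooth_manifold_def by blast
 thus ?thesis using that by blast
qed

lemma chartD:
 assumes "(V, c) : M"
 shows "open V" "open (c ` V)" "inj_on c V" "continuous_on V c"
  "continuous_on (c ` V) (inv_into V c)"
proof -
 have "ALL (V, c):M. open V & open (c ` V) & inj_on c V & homeomorphism V (c ` V) c (inv_into V c)"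
  using manifold unfolding smooth_manifold_def by blast
 from bspec[OF this assms]
 show "open V" "open (c ` V)" "inj_on c V" "continuous_on V c"
  "continuous_on (c ` V) (inv_into V c)" by (auto simp: homeomorphism_def)
qed

lemma transition:
 "(V, c) : M ==> (V', h) : M ==> smooth_on (c ` (V Int V')) (h o inv_into V c)"
proof -
 assume "(V, c) : M" "(V', h) : M"
 moreover have "ALL (U, c):M. ALL (V, h):M. smooth_on (c ` (U Int V)) (h o inv_into U c)"
  using manifold unfolding smooth_manifold_def by blast
 ultimately show ?thesis by blast
qed

lemma open_chart_image:
 assumes "(V, c) : M" "open U"
 shows "open (c ` (U Int V))"
proof -
 have "c ` (U Int V) = c ` V Int inv_into V c -` U"
  using chartD(3)[OF assms(1)] by (auto simp: inv_into_f_f inv_into_into image_iff)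
 thus ?thesis using continuous_open_preimage[OF chartD(5,2)[OF assms(1)] assms(2)] by simp
qed

lemma open_chart_preimage:
 assumes "(V, c) : M" "open T"
 shows "open {x : V. c x : T}"
proof -
 have "{x : V. c x : T} = V Int c -` T" by auto
 thus ?thesis using continuous_open_preimage[OF chartD(4,1)[OF assms(1)] assms(2)] by simp
qed

lemma smooth_fun_on_mono:
 assumes "smooth_fun_on M U g" "U' <= U" shows "smooth_fun_on M U' g" unfolding smooth_fun_on_def
proof safe
 fix V c assume "(V, c) : M"
 hence "smooth_on (c ` (U Int V)) (g o inv_into V c)" using assms(1) unfolding smooth_fun_on_def by blast
 thus "smooth_on (c ` (U' Int V)) (g o inv_into V c)" by (rule smooth_on_subset) (use assms(2) in blast)
qed

lemma smooth_fun_on_iff: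
 assumes "open U"
 shows "smooth_fun_on M U g \<longleftrightarrow> (ALL p:U. smooth_at M g p)"
proof
 assume "ALL p:U. smooth_at M g p"
 hence loc: "EX U'. open U' & p : U' & smooth_fun_on M U' g" if "p : U" for p using that by (auto simp: smooth_at_def)
 show "smooth_fun_on M U g" unfolding smooth_fun_on_def smooth_on_def
 proof (safe, rule Ck_on_localI, safe)
  fix V c k p assume V: "(V, c) : M" and p: "p : U" "p : V"
  obtain U' where U': "open U'" "p : U'" "smooth_fun_on M U' g" using loc[OF p(1)] by blast
  show "EX T. open T & c p : T & Ck_on k T (g o inv_into V c)"
   using open_chart_image[OF V U'(1)] U' V p unfolding smooth_fun_on_def smooth_on_def
   by (intro exI[of _ "c ` (U' Int V)"]) auto
 qed
qed (use assms in \<open>auto simp: smooth_at_def\<close>)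

text \<open>One chart is enough: in any other chart the expression of \<open>g\<close> is
  precomposed with a transition map, which is smooth.\<close>

lemma smooth_at_chartI:
 assumes V: "(V, c) : M" and W: "open W" "W <= V" "p : W"
  and g: "smooth_on (c ` W) (g o inv_into V c)"
 shows "smooth_at M g p"
proof -
 have "smooth_fun_on M W g" unfolding smooth_fun_on_def smooth_on_def
 proof (safe)
  fix V' h k assume V': "(V', h) : M"
  let ?S = "h ` (W Int V')"
  have oS: "open ?S" using open_chart_image[OF V' W(1)] .
  have oW: "open (c ` W)" using open_chart_image[OF V W(1)] W(2) by (simp add: Int_absorb2)
  have tr: "Ck_on k ?S (c o inv_into V' h)"
  proof -
   have "smooth_on ?S (c o inv_into V' h)" by (rule smooth_on_subset[OF transition[OF V' V]]) (use W(2) in blast)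
   thus ?thesis by (simp add: smooth_on_def)
  qed
  have im: "(c o inv_into V' h) ` ?S <= c ` W" using chartD(3)[OF V'] by (auto simp: inv_into_f_f)
  have "Ck_on k ?S (%x. (g o inv_into V c) ((c o inv_into V' h) x))"
   using Ck_on_compose[OF onb_basis oS oW im tr] g unfolding smooth_on_def by blast
  thus "Ck_on k ?S (g o inv_into V' h)"
  proof (rule Ck_on_cong[OF _ _ oS])
   fix x assume "x : ?S"
   then obtain p where "x = h p" "p : W" "p : V'" by auto
   thus "(g o inv_into V c) ((c o inv_into V' h) x) = (g o inv_into V' h) x"
    using chartD(3)[OF V'] chartD(3)[OF V] W(2) by (auto simp: inv_into_f_f)
  qed
 qed
 thus ?thesis using W by (auto simp: smooth_at_def)
qed

lemma smooth_at_chartD: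
 assumes V: "(V, c) : M" and U: "open U" "U <= V" and g: "!!p. p : U ==> smooth_at M g p"
 shows "smooth_on (c ` U) (g o inv_into V c)" using g smooth_fun_on_iff[OF U(1), of g] V U(2)
 unfolding smooth_fun_on_def by (auto simp: Int_absorb2)

lemma smooth_funs_iff: "g : smooth_funs M \<longleftrightarrow> (ALL p. smooth_at M g p)" by (simp add: smooth_funs_def smooth_fun_on_iff)

lemma smooth_funsD: "g : smooth_funs M ==> smooth_at M g p" by (simp add: smooth_funs_iff)

lemma smooth_at_open:
 assumes "smooth_at M g p"
 obtains U where "open U" "p : U" "!!x. x : U ==> smooth_at M g x"
 using assms smooth_fun_on_iff unfolding smooth_at_def by blast

lemma smooth_at_cong:
 assumes "smooth_at M g p" "open U" "p : U" "!!x. x : U ==> g x = h x"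
 shows "smooth_at M h p"
proof -
 obtain U' where U': "open U'" "p : U'" "smooth_fun_on M U' g" using assms(1) by (auto simp: smooth_at_def)
 have "smooth_fun_on M (U' Int U) h" unfolding smooth_fun_on_def smooth_on_def
 proof safe
  fix V c k assume V: "(V, c) : M"
  have "Ck_on k (c ` (U' Int U Int V)) (g o inv_into V c)" using smooth_fun_on_mono[OF U'(3), of "U' Int U"] V
   unfolding smooth_fun_on_def smooth_on_def by auto
  thus "Ck_on k (c ` (U' Int U Int V)) (h o inv_into V c)" by (rule Ck_on_cong)
    (use assms(4) chartD(3)[OF V] open_chart_image[OF V open_Int[OF U'(1) assms(2)]]
     in \<open>auto simp: inv_into_f_f\<close>)
 qed
 thus ?thesis using U' assms by (auto simp: smooth_at_def)
qed

lemma smooth_at_Ck: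
 assumes "!!x. x : U ==> smooth_at M g x" "(V, c) : M" "open U"
 shows "Ck_on k (c ` (U Int V)) (g o inv_into V c)"
 using assms smooth_fun_on_iff[OF assms(3), of g] unfolding smooth_fun_on_def smooth_on_def by auto

lemma smooth_at_CkI:
 assumes "open U" "p : U" "!!V c k. (V, c) : M ==> Ck_on k (c ` (U Int V)) (g o inv_into V c)"
 shows "smooth_at M g p" using assms unfolding smooth_at_def smooth_fun_on_def smooth_on_def by blast

lemma smooth_at_const [simp]: "smooth_at M (%x. c) p" by (rule smooth_at_CkI[of UNIV])
  (auto simp: comp_def intro!: Ck_on_const open_chart_image[of _ _ UNIV, simplified])

lemma smooth_at_common:
 assumes "smooth_at M g p" "smooth_at M h p"
 obtains U where "open U" "p : U" "!!x. x : U ==> smooth_at M g x" "!!x. x : U ==> smooth_at M h x"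
proof -
 obtain U1 U2 where "open U1" "p : U1" "!!x. x : U1 ==> smooth_at M g x"
  "open U2" "p : U2" "!!x. x : U2 ==> smooth_at M h x" using smooth_at_open[OF assms(1)] smooth_at_open[OF assms(2)] by metis
 thus ?thesis by (intro that[of "U1 Int U2"]) auto
qed

lemma smooth_at_add:
 assumes "smooth_at M g p" "smooth_at M h p" shows "smooth_at M (%x. g x + h x) p"
proof -
 obtain U where U: "open U" "p : U" "!!x. x : U ==> smooth_at M g x" "!!x. x : U ==> smooth_at M h x"
  using smooth_at_common[OF assms] by metis
 have "Ck_on k (c ` (U Int V)) ((%x. g x + h x) o inv_into V c)" if V: "(V, c) : M" for V c k
  using Ck_on_add[OF open_chart_image[OF V U(1)] smooth_at_Ck[OF U(3) V U(1)] smooth_at_Ck[OF U(4) V U(1)]]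
  by (simp add: comp_def)
 thus ?thesis using smooth_at_CkI U by blast
qed

lemma smooth_at_mult:
 assumes "smooth_at M g p" "smooth_at M h p" shows "smooth_at M (%x. g x * h x) p"
proof -
 obtain U where U: "open U" "p : U" "!!x. x : U ==> smooth_at M g x" "!!x. x : U ==> smooth_at M h x"
  using smooth_at_common[OF assms] by metis
 have "Ck_on k (c ` (U Int V)) ((%x. g x * h x) o inv_into V c)" if V: "(V, c) : M" for V c k
  using Ck_on_mult[OF open_chart_image[OF V U(1)] smooth_at_Ck[OF U(3) V U(1)] smooth_at_Ck[OF U(4) V U(1)]]
  by (simp add: comp_def)
 thus ?thesis using smooth_at_CkI U by blast
qed

lemma smooth_at_minus: "smooth_at M g p ==> smooth_at M (%x. - g x) p" using smooth_at_mult[of "%x. -1" p g] by simp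

lemma smooth_at_diff: "smooth_at M g p ==> smooth_at M h p ==> smooth_at M (%x. g x - h x) p"
 using smooth_at_add[of g p "%x. - h x"] smooth_at_minus by simp

lemma smooth_at_sum: "(!!i. i : I ==> smooth_at M (f i) p) ==> smooth_at M (%x. SUM i:I. f i x) p"
 by (induction I rule: infinite_finite_induct) (auto intro: smooth_at_add)

lemma smooth_at_prod: "(!!i. i : I ==> smooth_at M (f i) p) ==> smooth_at M (%x. PROD i:I. f i x) p"
 by (induction I rule: infinite_finite_induct) (auto intro: smooth_at_mult)

lemma smooth_at_continuous:
 assumes "smooth_at M g p" shows "isCont g p"
proof -
 obtain V c where V: "(V, c) : M" "p : V" by (rule chart_at)
 obtain U where U: "open U" "p : U" "!!x. x : U ==> smooth_at M g x" using smooth_at_open[OF assms] by metis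
 have "continuous_on (c ` (U Int V)) (g o inv_into V c)" using smooth_at_Ck[OF U(3) V(1) U(1), of 0] by simp
 hence "continuous_on (U Int V) (%x. (g o inv_into V c) (c x))"
  by (rule continuous_on_compose2) (auto intro: continuous_on_subset[OF chartD(4)[OF V(1)]])
 hence "continuous_on (U Int V) g" by (rule continuous_on_eq) (use chartD(3)[OF V(1)] in \<open>auto simp: inv_into_f_f\<close>)
 thus ?thesis using continuous_on_eq_continuous_at[OF open_Int[OF U(1) chartD(1)[OF V(1)]]] U(2) V(2) by blast
qed

lemma smooth_at_nonzero_open:
 assumes "smooth_at M g p" "g p ~= 0"
 obtains U where "open U" "p : U" "!!x. x : U ==> smooth_at M g x & g x ~= 0"
proof -
 obtain U where U: "open U" "p : U" "!!x. x : U ==> smooth_at M g x" using smooth_at_open[OF assms(1)] by metis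
 hence "continuous_on U g" using smooth_at_continuous by (simp add: continuous_at_imp_continuous_on)
 hence "open (U Int g -` (- {0}))" using U(1) by (intro continuous_open_preimage) auto
 thus ?thesis using U assms(2) by (intro that[of "U Int g -` (- {0})"]) auto
qed

lemma smooth_at_inverse:
 assumes "smooth_at M g p" "g p ~= 0" shows "smooth_at M (%x. inverse (g x)) p"
proof -
 obtain U where U: "open U" "p : U" "!!x. x : U ==> smooth_at M g x & g x ~= 0" using smooth_at_nonzero_open[OF assms] by metis
 have "Ck_on k (c ` (U Int V)) ((%x. inverse (g x)) o inv_into V c)" if V: "(V, c) : M" for V c k unfolding comp_def
  by (rule Ck_on_inverse[OF open_chart_image[OF V U(1)]])
   (use smooth_at_Ck[OF _ V U(1), of g] U(3) chartD(3)[OF V] in \<open>auto simp: comp_def inv_into_f_f\<close>)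
 thus ?thesis using smooth_at_CkI U by blast
qed

lemma smooth_at_divide:
 "smooth_at M g p ==> smooth_at M h p ==> h p ~= 0 ==> smooth_at M (%x. g x / h x) p"
 using smooth_at_mult[of g p "%x. inverse (h x)"] smooth_at_inverse by (simp add: divide_inverse)

lemma smooth_funs_ln:
 assumes "g : smooth_funs M" "!!x. g x > 0" shows "(%x. ln (g x)) : smooth_funs M"
proof -
 have "Ck_on k (c ` (UNIV Int V)) ((%x. ln (g x)) o inv_into V c)" if V: "(V, c) : M" for V c k unfolding comp_def
  by (rule Ck_on_ln[OF open_chart_image[OF V open_UNIV]])
   (use smooth_at_Ck[OF _ V open_UNIV, of g] assms in \<open>auto simp: comp_def smooth_funs_iff\<close>)
 thus ?thesis using smooth_at_CkI[of UNIV] by (auto simp: smooth_funs_iff)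
qed

lemma smooth_funs_closed:
 "(%x. c) : smooth_funs M"
 "g : smooth_funs M ==> h : smooth_funs M ==> (%x. g x + h x) : smooth_funs M"
 "g : smooth_funs M ==> h : smooth_funs M ==> (%x. g x * h x) : smooth_funs M"
 "g : smooth_funs M ==> (%x. - g x) : smooth_funs M"
 "g : smooth_funs M ==> h : smooth_funs M ==> (%x. g x - h x) : smooth_funs M"
 "(!!i. i : I ==> f i : smooth_funs M) ==> (%x. SUM i:I. f i x) : smooth_funs M"
 "(!!i. i : I ==> f i : smooth_funs M) ==> (%x. PROD i:I. f i x) : smooth_funs M"
 by (auto simp: smooth_funs_iff intro: smooth_at_add smooth_at_mult smooth_at_minus
   smooth_at_diff smooth_at_sum smooth_at_prod)

lemma smooth_at_coord:
 assumes "(V, c) : M" "p : V"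
 shows "smooth_at M (%x. c x \<bullet> b) p"
proof (rule smooth_at_chartI[OF assms(1) chartD(1)[OF assms(1)] order_refl assms(2)])
 have "Ck_on k (c ` V) ((%x. c x \<bullet> b) o inv_into V c)" for k
  by (rule Ck_on_cong[OF Ck_on_linear[OF bounded_linear_inner_left[of b]]])
   (auto simp: chartD[OF assms(1)] inv_into_f_f)
 thus "smooth_on (c ` V) ((%x. c x \<bullet> b) o inv_into V c)" by (simp add: smooth_on_def)
qed

text \<open>\<open>C\<close> is the image of a compact ball in a chart, hence closed because the
  manifold is Hausdorff; this makes the extension by zero smooth. Having \<open>C\<close> at hand
  lets \<open>smooth_cutoff\<close> and \<open>section_cutoff\<close> repeat the argument for
  products.\<close>

lemma bump:
 assumes "open U" "p : U"
 obtains h W C where "h : smooth_funs M" "open W" "p : W" "W <= C" "closed C" "C <= U"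
  "!!x. x : W ==> h x = 1" "!!x. x ~: C ==> h x = 0"
proof -
 obtain V c where V: "(V, c) : M" "p : V" by (rule chart_at)
 note V' = chartD[OF V(1)]
 obtain r where r: "r > 0" "ball (c p) r <= c ` (U Int V)"
  using open_chart_image[OF V(1) assms(1)] assms(2) V(2) by (meson IntI imageI openE)
 obtain h0 :: "'e => real" and d where h0: "smooth_on UNIV h0" "d > 0" "d < r / 2"
  "!!x. dist (c p) x <= d ==> h0 x = 1" "!!x. dist (c p) x >= r / 2 ==> h0 x = 0"
  using bump_exists[OF onb_basis, of "r / 2" "c p"] r(1) by auto
 define C where "C = inv_into V c ` cball (c p) (r / 2)"
 have sub: "cball (c p) (r / 2) <= c ` (U Int V)" using r by (intro order_trans[OF _ r(2)]) (auto simp: subset_iff)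
 have "compact C" unfolding C_def
  by (intro compact_continuous_image compact_cball_onb[OF onb_basis] continuous_on_subset[OF V'(5)])
   (use sub in auto)
 hence "closed C" by (rule compact_imp_closed)
 have CU: "C <= U Int V"
 proof
  fix x assume "x : C"
  then obtain z where "z : c ` (U Int V)" "x = inv_into V c z" using sub by (force simp: C_def)
  thus "x : U Int V" using V'(3) by (auto simp: inv_into_f_f)
 qed
 define h where "h x = (if x : V then h0 (c x) else 0)" for x
 have inC: "x : C \<longleftrightarrow> c x : cball (c p) (r / 2)" if "x : V" for x
 proof
  assume "c x : cball (c p) (r / 2)"
  thus "x : C" unfolding C_def using that V'(3) by (metis image_eqI inv_into_f_f)
 next
  assume "x : C"
  then obtain z where "z : cball (c p) (r / 2)" "x = inv_into V c z" by (auto simp: C_def)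
  moreover from this sub have "z : c ` V" by auto
  ultimately show "c x : cball (c p) (r / 2)" by (simp add: f_inv_into_f)
 qed
 have 0: "h x = 0" if "x ~: C" for x using that inC[of x] h0(5)[of "c x"] by (auto simp: h_def)
 have "smooth_at M h x" for x
 proof (cases "x : V")
  case True
  have "Ck_on k (c ` V) (h o inv_into V c)" for k by (rule Ck_on_cong[of _ _ h0]) (use h0(1) V' in
    \<open>auto simp: smooth_on_def h_def inv_into_f_f intro: Ck_on_subset\<close>)
  thus ?thesis using smooth_at_chartI[OF V(1) V'(1) order_refl True] by (simp add: smooth_on_def)
 next
  case False
  hence "x ~: C" using CU by auto
  show ?thesis by (rule smooth_at_cong[OF smooth_at_const[of 0], of "- C"]) (use `closed C` `x ~: C` 0 in auto)
 qed
 hence "h : smooth_funs M" by (simp add: smooth_funs_iff)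
 moreover have "open {x : V. c x : ball (c p) d}" using open_chart_preimage[OF V(1) open_ball] .
 moreover have "{x : V. c x : ball (c p) d} <= C" using inC h0(3) by auto
 ultimately show ?thesis
  using `closed C` CU 0 h0(2,4) V(2) by (intro that[of h "{x : V. c x : ball (c p) d}" C]) (auto simp: h_def)
qed

lemma smooth_cutoff:
 assumes "h : smooth_funs M" "closed C" "C <= U" "!!x. x ~: C ==> h x = 0"
  and "!!x. x : U ==> smooth_at M g x"
 shows "(%x. h x * g x) : smooth_funs M" unfolding smooth_funs_iff
proof
 fix x
 show "smooth_at M (%x. h x * g x) x"
 proof (cases "x : C")
  case True
  thus ?thesis using assms by (auto intro!: smooth_at_mult simp: smooth_funs_iff)
 next
  case False
  show ?thesis by (rule smooth_at_cong[OF smooth_at_const[of 0], of "- C"]) (use assms False in auto)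
 qed
qed

text \<open>Tangent vectors act on global functions only, so a local function has to be replaced by
  a global one with the same germ.\<close>

lemma smooth_extend:
 assumes "smooth_at M g p"
 obtains h W where "h : smooth_funs M" "open W" "p : W" "!!x. x : W ==> h x = g x"
proof -
 obtain U where U: "open U" "p : U" "!!x. x : U ==> smooth_at M g x" using smooth_at_open[OF assms] by metis
 obtain u W C where "u : smooth_funs M" "open W" "p : W" "W <= C" "closed C" "C <= U"
  "!!x. x : W ==> u x = 1" "!!x. x ~: C ==> u x = 0" using bump[OF U(1,2)] by metis
 thus ?thesis using smooth_cutoff[of u C U g] U(3) by (intro that[of "%x. u x * g x" W]) auto
qed

text \<open>The family telescopes: \<open>h n = u (c n) * (PROD m<n. 1 - u (c m))\<close> has the
  partial sums \<open>1 - (PROD m<=k. 1 - u (c m))\<close>. Where \<open>u (c k) = 1\<close> these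
  sums equal 1 from \<open>k\<close> on and all later terms vanish, which takes the place of local
  finiteness. Second countability enters through Lindelof.\<close>

lemma smooth_partition:
 assumes "!!p. open (U p)" "!!p. p : U p"
 obtains c :: "nat => 'm" and h W where "!!n. h n : smooth_funs M" "!!n. open (W n)" "(\<Union>n. W n) = UNIV"
  "!!n x. x ~: U (c n) ==> h n x = 0"
  "!!k n x. x : W k ==> k < n ==> h n x = 0"
  "!!k x. x : W k ==> (SUM n<=k. h n x) = 1"
proof -
 have "EX u W. u : smooth_funs M & open W & p : W & (ALL x:W. u x = 1) & (ALL x. x ~: U p --> u x = 0)" for p
  using bump[OF assms(1,2)[of p]] by (metis subsetD)
 then obtain u W where u: "!!p. u p : smooth_funs M" "!!p. open (W p)" "!!p. p : W p"
  "!!p x. x : W p ==> u p x = 1" "!!p x. x ~: U p ==> u p x = 0" by metis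
 obtain F where F: "F <= range W" "countable F" "\<Union>F = \<Union>(range W)" using Lindelof[of "range W"] u(2) by blast
 have UW: "\<Union>F = UNIV" using F(3) u(3) by auto
 hence "F ~= {}" by auto
 have "ALL n. EX p. W p = from_nat_into F n" using from_nat_into[OF `F ~= {}`] F(1) by (metis imageE subsetD)
 then obtain c where c: "!!n. W (c n) = from_nat_into F n" by metis
 define h where "h n x = u (c n) x * (PROD m<n. 1 - u (c m) x)" for n x
 have part: "(SUM n<=k. h n x) = 1 - (PROD m<=k. 1 - u (c m) x)" for k x
  by (induction k) (auto simp: h_def lessThan_Suc_atMost algebra_simps)
 have "(PROD m<=k. 1 - u (c m) x) = 0" if "x : W (c k)" for k x using u(4)[OF that] by (intro prod_zero) auto
 hence sum1: "(SUM n<=k. h n x) = 1" if "x : W (c k)" for k x using that by (simp add: part)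
 have "h n x = 0" if "x : W (c k)" "k < n" for k n x
 proof -
  have "(PROD m<n. 1 - u (c m) x) = 0" using u(4)[OF that(1)] that(2) by (intro prod_zero) auto
  thus ?thesis by (simp add: h_def)
 qed
 moreover have "h n : smooth_funs M" for n unfolding h_def by (intro smooth_funs_closed u)
 moreover have "(\<Union>n. W (c n)) = UNIV" unfolding c using range_from_nat_into[OF `F ~= {}` F(2)] UW by simp
 moreover have "h n x = 0" if "x ~: U (c n)" for n x using u(5)[OF that] by (simp add: h_def)
 ultimately show ?thesis using sum1 u(2) by (intro that[of h "%n. W (c n)" c]) auto
qed

subsection \<open>Tangent vectors\<close>

lemma tangentD:
 assumes "X : tangent_space M p"
 shows tangent_nonsmooth: "g ~: smooth_funs M ==> X g = 0"
  and tangent_lin: "g : smooth_funs M ==> h : smooth_funs M ==> X (%x. a * g x + b * h x) = a * X g + b * X h"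
  and tangent_mult: "g : smooth_funs M ==> h : smooth_funs M ==> X (%x. g x * h x) = g p * X h + h p * X g"
 using assms unfolding tangent_space_def by auto

lemma tangentI:
 assumes "!!g. g ~: smooth_funs M ==> X g = 0"
  "!!g h a b. g : smooth_funs M ==> h : smooth_funs M ==> X (%x. a * g x + b * h x) = a * X g + b * X h"
  "!!g h. g : smooth_funs M ==> h : smooth_funs M ==> X (%x. g x * h x) = g p * X h + h p * X g"
 shows "X : tangent_space M p" using assms unfolding tangent_space_def by auto

lemma tangent_lin_comb:
 "X : tangent_space M p ==> Y : tangent_space M p ==> a *R X + b *R Y : tangent_space M p"
 by (rule tangentI) (auto simp: tangentD scaleR_fun_def algebra_simps)

lemma tangent_zero: "0 : tangent_space M p" by (rule tangentI) auto

lemma tangent_sum: "(!!i. i : I ==> X i : tangent_space M p) ==> (SUM i:I. a i *R X i) : tangent_space M p"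
proof (induction I rule: infinite_finite_induct)
 case (insert i I)
 hence "X i : tangent_space M p" "(SUM i:I. a i *R X i) : tangent_space M p" by auto
 from tangent_lin_comb[OF this, of "a i" 1] show ?case unfolding sum.insert[OF insert(1,2)] scaleR_one .
qed (auto simp: tangent_zero)

lemma tangent_add:
 "X : tangent_space M p ==> g : smooth_funs M ==> h : smooth_funs M ==> X (%x. g x + h x) = X g + X h"
 using tangent_lin[of X p g h 1 1] by simp

lemma tangent_cmult: "X : tangent_space M p ==> g : smooth_funs M ==> X (%x. a * g x) = a * X g"
 using tangent_lin[of X p g g a 0] by simp

lemma tangent_diff:
 "X : tangent_space M p ==> g : smooth_funs M ==> h : smooth_funs M ==> X (%x. g x - h x) = X g - X h"
 using tangent_lin[of X p g h 1 "-1"] by simp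

lemma tangent_const: assumes "X : tangent_space M p" shows "X (%x. c) = 0"
proof -
 have "X (%x. 1) = 0" using tangent_mult[OF assms smooth_funs_closed(1) smooth_funs_closed(1), of 1 1] by simp
 thus ?thesis using tangent_cmult[OF assms smooth_funs_closed(1)[of 1], of c] by simp
qed

lemma tangent_sum_fun:
 assumes "X : tangent_space M p" "!!i. i : I ==> f i : smooth_funs M"
 shows "X (%x. SUM i:I. f i x) = (SUM i:I. X (f i))" using assms(2)
proof (induction I rule: infinite_finite_induct)
 case (insert i I)
 thus ?case using tangent_add[OF assms(1), of "f i" "%x. SUM i:I. f i x"] smooth_funs_closed(6)[of I f] by simp
qed (auto simp: tangent_const[OF assms(1)])

text \<open>With a bump function \<open>u\<close> supported in \<open>U\<close>, the product
  \<open>(g - h) u\<close> is 0 everywhere, and the product rule at \<open>p\<close> turns this into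
  \<open>X (g - h) = 0\<close> because \<open>u p = 1\<close> and \<open>g p = h p\<close>.\<close>

lemma tangent_local:
 assumes X: "X : tangent_space M p" and g: "g : smooth_funs M" and h: "h : smooth_funs M"
  and U: "open U" "p : U" "!!x. x : U ==> g x = h x"
 shows "X g = X h"
proof -
 obtain u W C where u: "u : smooth_funs M" "open W" "p : W" "W <= C" "closed C" "C <= U"
  "!!x. x : W ==> u x = 1" "!!x. x ~: C ==> u x = 0" using bump[OF U(1,2)] by metis
 have d: "(%x. g x - h x) : smooth_funs M" using g h by (rule smooth_funs_closed)
 have "(%x. (g x - h x) * u x) = (%x. 0)" using u(6,8) U(3) by fastforce
 hence "0 = X (%x. (g x - h x) * u x)" using tangent_const[OF X] by simp
 also have "... = X (%x. g x - h x)" using tangent_mult[OF X d u(1)] u(3,7) U(2,3) by simp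
 finally show ?thesis using tangent_diff[OF X g h] by simp
qed

text \<open>The coordinate vector field of the chart in direction \<open>b\<close>, set to 0 off the
  smooth functions as \<open>tangent_space\<close> demands.\<close>

definition chart_deriv :: "'m set => ('m => 'e) => 'm => 'e => 'm tangent" where
 "chart_deriv V c p b = (%g. if g : smooth_funs M then frechet_derivative (g o inv_into V c) (at (c p)) b else 0)"

lemma chart_has_derivative:
 assumes "(V, c) : M" "p : V" "g : smooth_funs M"
 shows "(g o inv_into V c has_derivative (%b. chart_deriv V c p b g)) (at (c p))"
 using smooth_on_deriv(1)[OF smooth_at_chartD[OF assms(1) chartD(1)[OF assms(1)] order_refl smooth_funsD]]
  assms by (simp add: chart_deriv_def)

lemma chart_deriv_eqI:
 assumes "(V, c) : M" "p : V" "g : smooth_funs M" "(g o inv_into V c has_derivative D) (at (c p))"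
 shows "chart_deriv V c p b g = D b" using has_derivative_unique[OF chart_has_derivative[OF assms(1-3)] assms(4)] by meson

lemma chart_deriv_tangent:
 assumes V: "(V, u) : M" "p : V"
 shows "chart_deriv V u p b : tangent_space M p"
proof (rule tangentI)
 fix g h assume gh: "g : smooth_funs M" "h : smooth_funs M"
 note d = chart_has_derivative[OF V gh(1)] chart_has_derivative[OF V gh(2)]
 have inv: "inv_into V u (u p) = p" using V chartD(3) by (simp add: inv_into_f_f)
 show "chart_deriv V u p b (%x. a * g x + c * h x) = a * chart_deriv V u p b g + c * chart_deriv V u p b h" for a c
  using d by (intro chart_deriv_eqI[OF V]) (auto intro!: derivative_eq_intros smooth_funs_closed gh simp: comp_def)
 have "((%x. g x * h x) o inv_into V u has_derivative
   (%b. (g o inv_into V u) (u p) * chart_deriv V u p b h + chart_deriv V u p b g * (h o inv_into V u) (u p))) (at (u p))"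
  using has_derivative_mult[OF d] by (simp add: comp_def)
 from chart_deriv_eqI[OF V _ this, of b]
 show "chart_deriv V u p b (%x. g x * h x) = g p * chart_deriv V u p b h + h p * chart_deriv V u p b g"
  using smooth_funs_closed(3)[OF gh] inv by (simp add: mult.commute)
qed (simp add: chart_deriv_def)

lemma chart_deriv_smooth:
 assumes V: "(V, c) : M" "p : V" and g: "g : smooth_funs M"
 shows "smooth_at M (%x. chart_deriv V c x b g) p"
proof (rule smooth_at_chartI[OF V(1) chartD(1)[OF V(1)] order_refl V(2)])
 have s: "smooth_on (c ` V) (%z. frechet_derivative (g o inv_into V c) (at z) b)"
  using smooth_at_chartD[OF V(1) chartD(1)[OF V(1)] order_refl] g by (intro smooth_on_deriv(2)) (simp add: smooth_funs_iff)
 show "smooth_on (c ` V) ((%x. chart_deriv V c x b g) o inv_into V c)" unfolding smooth_on_def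
 proof
  fix k
  show "Ck_on k (c ` V) ((%x. chart_deriv V c x b g) o inv_into V c)" by (rule Ck_on_cong[OF _ _ chartD(2)[OF V(1)]])
    (use s g in \<open>auto simp: smooth_on_def chart_deriv_def f_inv_into_f\<close>)
 qed
qed

text \<open>Hadamard's lemma writes \<open>g\<close> near \<open>p\<close> as a constant plus
  products of the functions \<open>u b x - c p \<bullet> b\<close>, which vanish at
  \<open>p\<close>, with smooth factors. A derivation kills the constant and keeps of each product
  only the derivative of the first factor times the value of the second.\<close>

lemma tangent_coord:
 assumes V: "(V, c) : M" "p : V" and X: "X : tangent_space M p" and g: "g : smooth_funs M"
  and u: "!!b. b : basis ==> u b : smooth_funs M" "open U" "p : U"
   "!!b x. b : basis ==> x : U ==> u b x = c x \<bullet> b"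
 shows "X g = (SUM b:basis. X (u b) * chart_deriv V c p b g)"
proof -
 let ?G = "g o inv_into V c" and ?a = "c p"
 obtain r where r: "r > 0" "ball ?a r <= c ` V" using chartD(2)[OF V(1)] V(2) by (meson imageI openE)
 have G: "smooth_on (ball ?a r) ?G" using smooth_at_chartD[OF V(1) chartD(1)[OF V(1)] order_refl smooth_funsD[OF g]] r(2)
  unfolding smooth_on_def by (blast intro: Ck_on_subset)
 define H where "H b = radial_mean 0 ?a (%y. frechet_derivative ?G (at y) b)" for b
 have H: "smooth_on (ball ?a r) (H b)" for b
  unfolding H_def by (intro smooth_on_radial_mean[OF onb_basis] smooth_on_deriv(2) G)
 define W where "W = {x : V. c x : ball ?a r}"
 have W: "open W" "p : W" "W <= V" using open_chart_preimage[OF V(1) open_ball] V(2) r(1) by (auto simp: W_def)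
 have "smooth_at M (%x. H b (c x)) p" for b
 proof (rule smooth_at_chartI[OF V(1) W(1,3,2)])
  show "smooth_on (c ` W) ((%x. H b (c x)) o inv_into V c)" unfolding smooth_on_def
  proof
   fix k
   have "open (c ` W)" using open_chart_image[OF V(1) W(1)] W(3) by (simp add: Int_absorb2)
   moreover have "Ck_on k (c ` W) (H b)"
    using smooth_on_subset[OF H[of b], of "c ` W"] unfolding smooth_on_def W_def by blast
   ultimately show "Ck_on k (c ` W) ((%x. H b (c x)) o inv_into V c)"
    by (rule Ck_on_cong[rotated 2]) (use W(3) chartD(3)[OF V(1)] in \<open>auto simp: inv_into_f_f subset_iff\<close>)
  qed
 qed
 hence "EX h W'. h : smooth_funs M & open W' & p : W' & (ALL x:W'. h x = H b (c x))" for b using smooth_extend by metis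
 then obtain h W' where h: "!!b. h b : smooth_funs M" "!!b. open (W' b)" "!!b. p : W' b"
  "!!b x. x : W' b ==> h b x = H b (c x)" by metis
 define g' where "g' x = g p + (SUM b:basis. (u b x - ?a \<bullet> b) * h b x)" for x
 have s: "(%x. (u b x - ?a \<bullet> b) * h b x) : smooth_funs M" if "b : basis" for b using that by (intro smooth_funs_closed h u)
 have g': "g' : smooth_funs M" unfolding g'_def by (intro smooth_funs_closed h u)
 have "X g = X g'"
 proof (rule tangent_local[OF X g g'])
  show "open (U Int W Int (INT b:basis. W' b))" using u(2) W(1) h(2) by (intro open_Int open_INT) auto
  show "p : U Int W Int (INT b:basis. W' b)" using u(3) W(2) h(3) by auto
  fix x assume x: "x : U Int W Int (INT b:basis. W' b)"
  hence "g x = ?G (c x)" "g p = ?G ?a" using W(3) V chartD(3)[OF V(1)] by (auto simp: inv_into_f_f)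
  thus "g x = g' x" using hadamard[OF onb_basis G, of "c x"] x h(4) u(4)
   by (auto simp: g'_def H_def W_def inner_diff_left)
 qed
 also have "... = (SUM b:basis. X (%x. (u b x - ?a \<bullet> b) * h b x))" unfolding g'_def using s
  by (simp add: tangent_add[OF X smooth_funs_closed(1) smooth_funs_closed(6)] tangent_const[OF X] tangent_sum_fun[OF X])
 also have "... = (SUM b:basis. X (u b) * chart_deriv V c p b g)"
 proof (rule sum.cong[OF refl])
  fix b assume b: "b : basis"
  have "X (%x. (u b x - ?a \<bullet> b) * h b x) = (u b p - ?a \<bullet> b) * X (h b) + h b p * X (%x. u b x - ?a \<bullet> b)"
   using b by (intro tangent_mult[OF X] smooth_funs_closed h u)
  also have "... = h b p * X (u b)"
   using tangent_diff[OF X u(1)[OF b] smooth_funs_closed(1)] tangent_const[OF X] u(3,4) b by simp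
  \<comment> \<open>At the centre the radial mean is the integral of a constant over the unit
    interval, that is, the partial derivative itself.\<close>
  also have "h b p = chart_deriv V c p b g" using h(3,4) g by (simp add: H_def radial_mean_def chart_deriv_def)
  finally show "X (%x. (u b x - ?a \<bullet> b) * h b x) = X (u b) * chart_deriv V c p b g" by simp
 qed
 finally show ?thesis .
qed

lemma coord_exist:
 assumes "(V, c) : M" "p : V"
 obtains u U where "!!b. b : basis ==> u b : smooth_funs M" "open U" "p : U" "U <= V"
   "!!b x. b : basis ==> x : U ==> u b x = c x \<bullet> b"
proof -
 have "EX h W. h : smooth_funs M & open W & p : W & (ALL x:W. h x = c x \<bullet> b)" for b
  using smooth_extend[OF smooth_at_coord[OF assms]] by metis
 then obtain u W where "!!b. u b : smooth_funs M" "!!b. open (W b)" "!!b. p : W b"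
  "!!b x. x : W b ==> u b x = c x \<bullet> b" by metis
 thus ?thesis using chartD(1)[OF assms(1)] assms(2) by (intro that[of u "V Int (INT b:basis. W b)"] open_Int open_INT) auto
qed

lemma chart_deriv_coord:
 assumes V: "(V, u) : M" "p : V" and y: "y : smooth_funs M" "open U" "p : U"
   "!!x. x : U ==> y x = u x \<bullet> c" and "b : basis" "c : basis"
 shows "chart_deriv V u p b y = (if b = c then 1 else 0)"
proof -
 have "open (u ` (U Int V))" "u p : u ` (U Int V)" using open_chart_image[OF V(1) y(2)] V y(3) by auto
 moreover have "((%z. z \<bullet> c) has_derivative (%b. b \<bullet> c)) (at (u p))" by (auto intro!: derivative_eq_intros)
 ultimately have "(y o inv_into V u has_derivative (%b. b \<bullet> c)) (at (u p))" using y(4) chartD(3)[OF V(1)]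
  by (elim has_derivative_transform_within_open) (auto simp: inv_into_f_f)
 from chart_deriv_eqI[OF V y(1) this] show ?thesis using onb_basis assms(7,8) by (simp add: onb_def)
qed

text \<open>The derivation axioms are purely algebraic, so the chain rule is obtained by expanding
  in coordinates. It serves to compute the anchor action on \<open>1/2 ln g^2\<close> when a
  defining form is rescaled by \<open>g\<close>.\<close>

lemma tangent_ln:
 assumes X: "X : tangent_space M p" and g: "g : smooth_funs M" "!!x. g x > 0"
 shows "X (%x. ln (g x)) = X g / g p"
proof -
 obtain V c where V: "(V, c) : M" "p : V" by (rule chart_at)
 obtain u U where u: "!!b. b : basis ==> u b : smooth_funs M" "open U" "p : U" "U <= V"
   "!!b x. b : basis ==> x : U ==> u b x = c x \<bullet> b" using coord_exist[OF V] by metis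
 have inv: "inv_into V c (c p) = p" using V chartD(3) by (simp add: inv_into_f_f)
 have "(ln has_derivative (%h. inverse (g p) * h)) (at ((g o inv_into V c) (c p)))"
  using DERIV_ln[OF g(2)[of p]] inv unfolding has_field_derivative_def by simp
 from has_derivative_compose[OF chart_has_derivative[OF V g(1)] this]
 have "((%x. ln (g x)) o inv_into V c has_derivative (%b. inverse (g p) * chart_deriv V c p b g)) (at (c p))"
  by (simp add: comp_def)
 from chart_deriv_eqI[OF V smooth_funs_ln[OF g] this]
 have "chart_deriv V c p b (%x. ln (g x)) = chart_deriv V c p b g / g p" for b by (simp add: field_simps)
 thus ?thesis using tangent_coord[OF V X smooth_funs_ln[OF g] u(1,2,3,5)] tangent_coord[OF V X g(1) u(1,2,3,5)]
  by (simp add: sum_divide_distrib)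
qed

end

lemma smooth_at_compose:
 assumes "manifold N" "manifold M" and f: "smooth_map N M f" and g: "smooth_at M g (f y)"
 shows "smooth_at N (%x. g (f x)) y"
proof -
 interpret N: manifold N by fact
 interpret M: manifold M by fact
 have cf: "continuous_on UNIV f" using f by (simp add: smooth_map_def)
 obtain V c where V: "(V, c) : N" "y : V" by (rule N.chart_at)
 obtain V' h where V': "(V', h) : M" "f y : V'" by (rule M.chart_at)
 obtain U where U: "open U" "f y : U" "!!x. x : U ==> smooth_at M g x" using M.smooth_at_open[OF g] by metis
 define W where "W = V Int f -` (U Int V')"
 have oW: "open W" unfolding W_def using cf U(1) M.chartD(1)[OF V'(1)] N.chartD(1)[OF V(1)]
  by (intro open_Int open_vimage) auto
 have oI: "open (c ` W)" using N.open_chart_image[OF V(1) oW] by (simp add: W_def Int_absorb2 inf_commute inf_left_commute)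
 show ?thesis
 proof (rule N.smooth_at_chartI[OF V(1) oW])
  show "smooth_on (c ` W) ((%x. g (f x)) o inv_into V c)" unfolding smooth_on_def
  proof
   fix k
   have 1: "Ck_on k (c ` W) (h o f o inv_into V c)"
   proof -
    have "smooth_on (c ` (V Int f -` V')) (h o f o inv_into V c)" using f V(1) V'(1) unfolding smooth_map_def by blast
    hence "smooth_on (c ` W) (h o f o inv_into V c)" by (rule smooth_on_subset) (auto simp: W_def)
    thus ?thesis by (simp add: smooth_on_def)
   qed
   have 2: "Ck_on k (h ` (U Int V')) (g o inv_into V' h)" using M.smooth_at_Ck[OF U(3) V'(1) U(1)] by blast
   have 3: "(h o f o inv_into V c) ` c ` W <= h ` (U Int V')" using N.chartD(3)[OF V(1)] by (auto simp: W_def inv_into_f_f)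
   show "Ck_on k (c ` W) ((%x. g (f x)) o inv_into V c)"
    by (rule Ck_on_cong[OF Ck_on_compose[OF M.onb_basis oI M.open_chart_image[OF V'(1) U(1)] 3 1 2] _ oI])
     (use N.chartD(3)[OF V(1)] M.chartD(3)[OF V'(1)] in \<open>auto simp: W_def inv_into_f_f\<close>)
  qed
 qed (use V U V' in \<open>auto simp: W_def\<close>)
qed

section \<open>Alternating forms on lists\<close>

definition contract :: "'l => ('l list => 'r) => 'l list => 'r" where
 "contract v F = (%vs. F (v # vs))"

text \<open>The grading involution. The sign is read off the length of the argument list, so that
  the wedge product needs no degrees.\<close>

definition invol :: "('l list => 'r::comm_ring_1) => 'l list => 'r" where
 "invol F = (%vs. (-1) ^ length vs * F vs)"

text \<open>The recursion says that contraction with a vector is an antiderivation. Values lie in an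
  arbitrary commutative ring, since the same product serves for real-valued forms on one fibre and
  for function-valued forms on sections.\<close>

fun lwedge :: "('l list => 'r::comm_ring_1) => ('l list => 'r) => 'l list => 'r" where
 "lwedge F G [] = F [] * G []"
| "lwedge F G (v # vs) = lwedge (contract v F) G vs + lwedge (invol F) (contract v G) vs"

definition homog :: "nat => ('l list => 'r::zero) => bool" where
 "homog k F \<longleftrightarrow> (ALL vs. length vs ~= k --> F vs = 0)"

lemma contract_apply: "contract v F vs = F (v # vs)" by (simp add: contract_def)

lemma contract_simps [simp]:
 "contract v F [] = F [v]" "contract v F (w # ws) = F (v # w # ws)"
 "contract v F (xs @ ys) = F (v # xs @ ys)" by (simp_all add: contract_def)

lemma contract_add: "contract v (F + G) = contract v F + contract v G"
 and contract_diff: "contract v (%us. F us - G us) = (%us. contract v F us - contract v G us)"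
 and contract_minus: "contract v (%us. - F us) = (%us. - contract v F us)"
 and contract_uminus: "contract v (- F) = - contract v F"
 and contract_scale: "contract v (%us. c * F us) = (%us. c * contract v F us)" by (auto simp: fun_eq_iff contract_def)

lemma invol_add: "invol (F + G) = invol F + invol G" by (auto simp: fun_eq_iff invol_def algebra_simps)

lemma contract_invol: "contract v (invol F) = - invol (contract v F)" by (auto simp: fun_eq_iff invol_def contract_def)

lemma invol_invol [simp]: "invol (invol F) = F"
 by (auto simp: fun_eq_iff invol_def mult.assoc[symmetric] power_add[symmetric] mult_2[symmetric])

lemma lwedge_cong:
 "(!!us. set us <= set vs ==> F us = F' us) ==> (!!us. set us <= set vs ==> G us = G' us) ==> lwedge F G vs = lwedge F' G' vs"
proof (induction vs arbitrary: F F' G G')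
 case (Cons v vs)
 have "lwedge (contract v F) G vs = lwedge (contract v F') G' vs"
  by (rule Cons.IH) (use Cons.prems in \<open>auto simp: subset_iff contract_def\<close>)
 moreover have "lwedge (invol F) (contract v G) vs = lwedge (invol F') (contract v G') vs"
  by (rule Cons.IH) (use Cons.prems in \<open>auto simp: invol_def subset_iff contract_def\<close>)
 ultimately show ?case by simp
qed auto

lemma lwedge_add_left: "lwedge (F + F') G = lwedge F G + lwedge F' G"
proof
 show "lwedge (F + F') G vs = (lwedge F G + lwedge F' G) vs" for vs
  by (induction vs arbitrary: F F' G) (auto simp: contract_add invol_add algebra_simps)
qed

lemma lwedge_add_right: "lwedge F (G + G') = lwedge F G + lwedge F G'"
proof
 show "lwedge F (G + G') vs = (lwedge F G + lwedge F G') vs" for vs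
  by (induction vs arbitrary: F G G') (auto simp: contract_add algebra_simps)
qed

lemma lwedge_scale_left: "lwedge (%vs. c * F vs) G = (%vs. c * lwedge F G vs)"
proof
 show "lwedge (%vs. c * F vs) G vs = c * lwedge F G vs" for vs
 proof (induction vs arbitrary: F G)
  case (Cons v vs)
  have "invol (%vs. c * F vs) = (%vs. c * invol F vs)" by (auto simp: fun_eq_iff invol_def)
  thus ?case by (simp add: Cons distrib_left contract_scale)
 qed auto
qed

lemma lwedge_scale_right: "lwedge F (%vs. c * G vs) = (%vs. c * lwedge F G vs)"
proof
 show "lwedge F (%vs. c * G vs) vs = c * lwedge F G vs" for vs
 proof (induction vs arbitrary: F G)
  case (Cons v vs)
  show ?case by (simp add: Cons distrib_left contract_scale)
 qed auto
qed

lemma lwedge_minus_left: "lwedge (- F) G = - lwedge F G"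
 using lwedge_scale_left[of "- 1" F G] by (simp add: fun_eq_iff fun_Compl_def)

lemma lwedge_minus_right: "lwedge F (- G) = - lwedge F G"
 using lwedge_scale_right[of F "- 1" G] by (simp add: fun_eq_iff fun_Compl_def)

lemma lwedge_diff_left: "lwedge (F - F') G = lwedge F G - lwedge F' G"
 using lwedge_add_left[of F "- F'" G] by (simp add: lwedge_minus_left)

lemma lwedge_diff_right: "lwedge F (G - G') = lwedge F G - lwedge F G'"
 using lwedge_add_right[of F G "- G'"] by (simp add: lwedge_minus_right)

lemma lwedge_zero_left [simp]: "lwedge 0 G = 0" using lwedge_scale_left[of 0 0 G] by (simp add: fun_eq_iff zero_fun_def)

lemma lwedge_zero_right [simp]: "lwedge F 0 = 0" using lwedge_scale_right[of F 0 0] by (simp add: fun_eq_iff zero_fun_def)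

lemma invol_lwedge: "invol (lwedge F G) = lwedge (invol F) (invol G)"
proof
 show "invol (lwedge F G) vs = lwedge (invol F) (invol G) vs" for vs
 proof (induction vs arbitrary: F G)
  case (Cons v vs)
  have "invol (lwedge F G) (v # vs) = - (invol (lwedge (contract v F) G) vs + invol (lwedge (invol F) (contract v G)) vs)"
   by (simp add: invol_def algebra_simps)
  thus ?case by (simp add: Cons contract_invol lwedge_minus_left lwedge_minus_right)
 qed (simp add: invol_def)
qed

lemma contract_lwedge:
 "contract v (lwedge F G) = lwedge (contract v F) G + lwedge (invol F) (contract v G)"
 by (auto simp: fun_eq_iff contract_apply)

lemma lwedge_assoc: "lwedge (lwedge F G) H = lwedge F (lwedge G H)"
proof
 show "lwedge (lwedge F G) H vs = lwedge F (lwedge G H) vs" for vs by (induction vs arbitrary: F G H)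
   (auto simp: contract_lwedge invol_lwedge lwedge_add_left lwedge_add_right mult.assoc add.assoc)
qed

lemma homog_contract_Suc: "homog (Suc k) F ==> homog k (contract v F)" by (auto simp: homog_def contract_def)

lemma homog_0_contract: "homog 0 F ==> contract v F = 0" by (auto simp: homog_def fun_eq_iff contract_def)

lemma homog_invol:
 assumes "homog k F" shows "invol F = (%vs. (-1) ^ k * F vs)"
proof
 show "invol F vs = (-1) ^ k * F vs" for vs using assms by (cases "length vs = k") (auto simp: homog_def invol_def)
qed

lemma homog_lwedge: "homog k F ==> homog l G ==> homog (k + l) (lwedge F G)"
proof -
 have "lwedge F G vs = 0" if "length vs ~= k + l" "homog k F" "homog l G" for vs using that
 proof (induction vs arbitrary: k l F G)
  case (Cons v vs)
  have "lwedge (contract v F) G vs = 0"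
  proof (cases k)
   case 0
   thus ?thesis using Cons.prems by (simp add: homog_0_contract)
  next
   case (Suc j)
   thus ?thesis using Cons.prems by (intro Cons.IH[of j l]) (auto simp: homog_contract_Suc)
  qed
  moreover have "lwedge (invol F) (contract v G) vs = 0"
  proof (cases l)
   case 0
   thus ?thesis using Cons.prems by (simp add: homog_0_contract)
  next
   case (Suc j)
   have "homog k (invol F)" using Cons.prems by (auto simp: homog_def invol_def)
   with Suc show ?thesis using Cons.prems by (intro Cons.IH[of k j]) (auto simp: homog_contract_Suc)
  qed
  ultimately show ?case by simp
 qed (auto simp: homog_def)
 thus "homog k F ==> homog l G ==> homog (k + l) (lwedge F G)" by (auto simp: homog_def)
qed

text \<open>Even and odd \<open>F\<close> are treated in one induction because contraction changes
  the parity; for odd \<open>F\<close> the sign is carried by \<open>invol G\<close>, so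
  \<open>G\<close> may have mixed degree.\<close>

lemma lwedge_commute:
 fixes F G :: "'l list => 'r::comm_ring_1"
 shows "invol F = F ==> lwedge F G = lwedge G F"
  and "invol F = - F ==> lwedge F G = lwedge (invol G) F"
proof -
 have "(invol F = F --> lwedge F G vs = lwedge G F vs) & (invol F = - F --> lwedge F G vs = lwedge (invol G) F vs)" for vs
 proof (induction vs arbitrary: F G)
  case (Cons v vs)
  have ci: "contract v (invol F) = - invol (contract v F)" by (rule contract_invol)
  show ?case
  proof (intro conjI impI)
   assume F: "invol F = F"
   have "invol (contract v F) = - contract v F" using ci F by (metis minus_minus)
   hence 1: "lwedge (contract v F) G vs = lwedge (invol G) (contract v F) vs"
    using Cons.IH[of "contract v F" G] by blast
   have 2: "lwedge F (contract v G) vs = lwedge (contract v G) F vs" using Cons.IH[of F "contract v G"] F by blast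
   show "lwedge F G (v # vs) = lwedge G F (v # vs)" unfolding lwedge.simps F 1 2 by (rule add.commute)
  next
   assume F: "invol F = - F"
   have "invol (contract v F) = contract v F" using ci F contract_uminus[of v F] by (metis neg_equal_iff_equal)
   hence 1: "lwedge (contract v F) G vs = lwedge G (contract v F) vs" using Cons.IH[of "contract v F" G] by blast
   have 2: "lwedge F (contract v G) vs = lwedge (invol (contract v G)) F vs" using Cons.IH[of F "contract v G"] F by blast
   show "lwedge F G (v # vs) = lwedge (invol G) F (v # vs)"
    unfolding lwedge.simps F contract_invol lwedge_minus_left invol_invol 1 by (simp add: 2)
  qed
 qed (simp add: mult.commute invol_def)
 thus "invol F = F ==> lwedge F G = lwedge G F"
  and "invol F = - F ==> lwedge F G = lwedge (invol G) F" by auto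
qed

text \<open>Carriers are explicit because smooth functions and sections are only subsets of their
  function types. There are two kinds of instances, global sections over smooth functions and a
  single fibre over the reals, which share the algebra of alternating maps.\<close>

locale lmodule =
 fixes R :: "'r::comm_ring_1 set" and L :: "'l::ab_group_add set" and sm :: "'r => 'l => 'l"
 assumes R_const: "0 : R" "1 : R"
  and R_add: "!!g h. g : R ==> h : R ==> g + h : R"
  and R_mult: "!!g h. g : R ==> h : R ==> g * h : R"
  and R_minus: "!!g. g : R ==> - g : R"
  and L_zero: "0 : L"
  and L_add: "!!v w. v : L ==> w : L ==> v + w : L"
  and L_minus: "!!v. v : L ==> - v : L"
  and L_sm: "!!g v. g : R ==> v : L ==> sm g v : L"
begin

lemma R_diff: "g : R ==> h : R ==> g - h : R" using R_add[of g "- h"] R_minus by simp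

lemma R_sign: "g : R ==> (-1) ^ n * g : R" by (induction n) (auto simp: R_minus)

definition valued :: "('l list => 'r) => bool" where
 "valued F \<longleftrightarrow> (ALL vs:lists L. F vs : R)"

text \<open>Kept apart from linearity over \<open>R\<close>: for the differential, this linearity is
  first known in the leading argument and is carried to the others by \<open>alt0_move\<close>,
  which therefore must not presuppose it.\<close>

definition alt0 :: "('l list => 'r) => bool" where
 "alt0 F \<longleftrightarrow> valued F & (ALL xs:lists L. ALL ys:lists L. ALL v:L. ALL w:L. F (xs @ (v + w) # ys) = F (xs @ v # ys) + F (xs @ w # ys)) &
   (ALL xs:lists L. ALL ys:lists L. ALL v:L. F (xs @ v # v # ys) = 0)" definition altf :: "('l list => 'r) => bool" where
 "altf F \<longleftrightarrow> alt0 F & (ALL xs:lists L. ALL ys:lists L. ALL v:L. ALL g:R. F (xs @ sm g v # ys) = g * F (xs @ v # ys))"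

lemma alt0D:
 assumes "alt0 F" "xs : lists L" "ys : lists L" "v : L"
 shows alt0_valued: "valued F"
  and alt0_add: "w : L ==> F (xs @ (v + w) # ys) = F (xs @ v # ys) + F (xs @ w # ys)"
  and alt0_same: "F (xs @ v # v # ys) = 0" using assms by (auto simp: alt0_def)

lemma altfD:
 assumes "altf F"
 shows altf_alt0: "alt0 F" and altf_valued: "valued F"
  and altf_sm: "xs : lists L ==> ys : lists L ==> v : L ==> g : R ==> F (xs @ sm g v # ys) = g * F (xs @ v # ys)"
 using assms by (auto simp: altf_def alt0_def)

lemma altfI:
 assumes "!!vs. vs : lists L ==> F vs : R"
  and "!!xs ys v w. xs : lists L ==> ys : lists L ==> v : L ==> w : L ==> F (xs @ (v + w) # ys) = F (xs @ v # ys) + F (xs @ w # ys)"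
  and "!!xs ys v. xs : lists L ==> ys : lists L ==> v : L ==> F (xs @ v # v # ys) = 0"
  and "!!xs ys v g. xs : lists L ==> ys : lists L ==> v : L ==> g : R ==> F (xs @ sm g v # ys) = g * F (xs @ v # ys)"
 shows "altf F" unfolding altf_def alt0_def valued_def by (intro conjI ballI assms)

lemma valued_contract: "valued F ==> v : L ==> valued (contract v F)" by (auto simp: valued_def contract_def)

lemma valued_invol: "valued F ==> valued (invol F)" by (auto simp: valued_def invol_def R_sign)

lemma valued_add: "valued F ==> valued G ==> valued (F + G)" by (auto simp: valued_def R_add)

lemma valued_lwedge: "valued F ==> valued G ==> valued (lwedge F G)"
proof -
 have "lwedge F G vs : R" if "vs : lists L" "valued F" "valued G" for vs using that
 proof (induction vs arbitrary: F G)
  case (Cons v vs)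
  thus ?case by (auto simp: valued_contract valued_invol intro: R_add)
 qed (auto simp: valued_def intro: R_mult)
 thus "valued F ==> valued G ==> valued (lwedge F G)" by (simp add: valued_def)
qed

lemma alt0_contract:
 assumes "alt0 F" "v : L" shows "alt0 (contract v F)" unfolding alt0_def
proof (intro conjI ballI)
 show "valued (contract v F)" using assms by (auto simp: alt0_def valued_contract)
 fix xs ys u assume l: "xs : lists L" "ys : lists L" "u : L"
 have vx: "v # xs : lists L" using l assms by simp
 show "contract v F (xs @ (u + w) # ys) = contract v F (xs @ u # ys) + contract v F (xs @ w # ys)" if "w : L" for w
  using alt0_add[OF assms(1) vx l(2,3) that] by simp
 show "contract v F (xs @ u # u # ys) = 0" using alt0_same[OF assms(1) vx l(2,3)] by simp
qed

lemma altf_contract: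
 assumes "altf F" "v : L" shows "altf (contract v F)" unfolding altf_def
proof (intro conjI ballI)
 show "alt0 (contract v F)" using assms by (simp add: altf_alt0 alt0_contract)
 fix xs ys u g assume l: "xs : lists L" "ys : lists L" "u : L" "g : R"
 have vx: "v # xs : lists L" using l assms by simp
 show "contract v F (xs @ sm g u # ys) = g * contract v F (xs @ u # ys)" using altf_sm[OF assms(1) vx l(2,3,4)] by simp
qed

lemma alt0_swap:
 assumes F: "alt0 F" and l: "xs : lists L" "ys : lists L" "v : L" "w : L"
 shows "F (xs @ v # w # ys) = - F (xs @ w # v # ys)"
proof -
 have "0 = F (xs @ (v + w) # (v + w) # ys)" using alt0_same[OF F l(1,2) L_add[OF l(3,4)]] by simp
 also have "... = F (xs @ v # (v + w) # ys) + F (xs @ w # (v + w) # ys)"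
  using alt0_add[OF F l(1) _ l(3,4), of "(v + w) # ys"] l L_add by simp
 also have "F (xs @ v # (v + w) # ys) = F (xs @ v # v # ys) + F (xs @ v # w # ys)"
  using alt0_add[OF F _ l(2,3,4), of "xs @ [v]"] l by simp
 also have "F (xs @ w # (v + w) # ys) = F (xs @ w # v # ys) + F (xs @ w # w # ys)"
  using alt0_add[OF F _ l(2,3,4), of "xs @ [w]"] l by simp
 finally show ?thesis using alt0_same[OF F l(1,2,3)] alt0_same[OF F l(1,2,4)] by (simp add: eq_neg_iff_add_eq_0)
qed

lemma alt0_move:
 assumes "alt0 F" "xs : lists L" "ys : lists L" "v : L"
 shows "F (xs @ v # ys) = (-1) ^ length xs * F (v # xs @ ys)" using assms(1,2)
proof (induction xs arbitrary: F)
 case (Cons x xs)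
 hence "F (x # xs @ v # ys) = (-1) ^ length xs * F (x # v # xs @ ys)"
  using Cons.IH[OF alt0_contract[OF Cons.prems(1), of x]] by simp
 thus ?case using alt0_swap[OF Cons.prems(1), of "[]" "xs @ ys" x v] Cons.prems assms(3,4) by simp
qed simp

lemma alt0_repeat:
 assumes "alt0 F" "vs : lists L" "~ distinct vs"
 shows "F vs = 0"
proof -
 obtain xs ys zs v where vs: "vs = xs @ [v] @ ys @ [v] @ zs" using not_distinct_decomp[OF assms(3)] by blast
 have l: "xs : lists L" "ys : lists L" "zs : lists L" "v : L" using assms(2) vs by auto
 have "F vs = F ((xs @ [v] @ ys) @ v # zs)" using vs by simp
 also have "... = (-1) ^ length (xs @ [v] @ ys) * F ([v] @ xs @ v # ys @ zs)" using l by (subst alt0_move[OF assms(1)]) auto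
 also have "F ([v] @ xs @ v # ys @ zs) = (-1) ^ length xs * F (v # v # xs @ ys @ zs)"
  using alt0_move[OF alt0_contract[OF assms(1) l(4)] l(1) _ l(4), of "ys @ zs"] l by simp
 also have "F (v # v # xs @ ys @ zs) = 0" using alt0_same[OF assms(1), of "[]" "xs @ ys @ zs" v] l by simp
 finally show ?thesis by simp
qed

text \<open>The sign is left open, since the lemma only has to transport vanishing along
  rearrangements.\<close>

lemma alt0_perm:
 assumes "alt0 F" "vs : lists L" "mset us = mset vs"
 shows "F us = F vs | F us = - F vs" using assms
proof (induction vs arbitrary: us F)
 case (Cons v vs)
 have "v : set us" using Cons.prems(3) by (metis list.set_intros(1) set_mset_mset)
 then obtain xs ys where us: "us = xs @ v # ys" by (meson split_list)
 have m: "mset (xs @ ys) = mset vs" using Cons.prems(3) us by simp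
 hence l: "xs @ ys : lists L" using Cons.prems(2) by (metis in_lists_conv_set list.set_intros(2) mset_eq_setD)
 have "F us = (-1) ^ length xs * F (v # xs @ ys)" unfolding us using l Cons.prems by (intro alt0_move) auto
 hence "F us = F (v # xs @ ys) | F us = - F (v # xs @ ys)" by (cases "even (length xs)") auto
 moreover have "F (v # xs @ ys) = F (v # vs) | F (v # xs @ ys) = - F (v # vs)"
  using Cons.IH[OF alt0_contract[OF Cons.prems(1), of v] _ m] Cons.prems(2) by (simp add: contract_apply[of v F vs])
 ultimately show ?case by auto
qed simp

lemma altf_minus_arg:
 assumes "altf F" "xs : lists L" "ys : lists L" "v : L"
 shows "F (xs @ - v # ys) = - F (xs @ v # ys)"
proof -
 have "F (xs @ (0 + 0) # ys) = F (xs @ 0 # ys) + F (xs @ 0 # ys)"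
  using alt0_add[OF altf_alt0 _ _ L_zero L_zero] assms by blast
 hence "F (xs @ 0 # ys) = 0" by simp
 thus ?thesis using alt0_add[OF altf_alt0[OF assms(1)] assms(2,3,4) L_minus[OF assms(4)]]
  by (simp add: eq_neg_iff_add_eq_0 add.commute)
qed

lemma altf_add: "altf F ==> altf G ==> altf (F + G)" by (auto simp: altf_def alt0_def valued_add algebra_simps)

lemma altf_scale: "altf F ==> g : R ==> altf (%vs. g * F vs)" by (auto simp: altf_def alt0_def valued_def algebra_simps R_mult)

lemma altf_minus: "altf F ==> altf (- F)" using altf_scale[of F "- 1"] R_minus[OF R_const(2)] by (simp add: fun_Compl_def)

lemma altf_zero: "altf 0" by (auto simp: altf_def alt0_def valued_def R_const)

lemma altf_diff: "altf F ==> altf G ==> altf (F - G)" using altf_add[of F "- G"] altf_minus[of G] by simp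

lemma altf_invol:
 assumes "altf F" shows "altf (invol F)"
proof (rule altfI)
 fix xs ys v w assume "xs : lists L" "ys : lists L" "v : L" "w : L"
 thus "invol F (xs @ (v + w) # ys) = invol F (xs @ v # ys) + invol F (xs @ w # ys)"
  using alt0_add[OF altf_alt0[OF assms], of xs ys v w] by (simp add: invol_def algebra_simps)
next
 fix xs ys v assume "xs : lists L" "ys : lists L" "v : L"
 thus "invol F (xs @ v # v # ys) = 0" using alt0_same[OF altf_alt0[OF assms], of xs ys v] by (simp add: invol_def)
next
 fix xs ys v g assume "xs : lists L" "ys : lists L" "v : L" "g : R"
 thus "invol F (xs @ sm g v # ys) = g * invol F (xs @ v # ys)"
  using altf_sm[OF assms, of xs ys v g] by (simp add: invol_def)
qed (use assms altf_valued[THEN valued_invol] in \<open>auto simp: valued_def\<close>)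

text \<open>Each law is checked with the distinguished argument in front and then passes through the
  prefix \<open>xs\<close>, because contraction and \<open>invol\<close> preserve the
  hypotheses.\<close>

lemma altf_lwedge:
 assumes "altf F" "altf G" shows "altf (lwedge F G)"
proof (rule altfI)
 fix xs ys v w assume l: "xs : lists L" "ys : lists L" "v : L" "w : L"
 show "lwedge F G (xs @ (v + w) # ys) = lwedge F G (xs @ v # ys) + lwedge F G (xs @ w # ys)" using l(1) assms
 proof (induction xs arbitrary: F G)
  case Nil
  have "H ((v + w) # us) = H (v # us) + H (w # us)" if "altf H" "set us <= set ys" for H us
   using alt0_add[OF altf_alt0[OF that(1)], of "[]" us v w] l that by auto
  hence "lwedge (contract (v + w) F) G ys = lwedge (contract v F + contract w F) G ys"
   "lwedge (invol F) (contract (v + w) G) ys = lwedge (invol F) (contract v G + contract w G) ys"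
   using Nil by (auto intro!: lwedge_cong simp: contract_apply)
  thus ?case by (simp add: lwedge_add_left lwedge_add_right)
 next
  case (Cons x xs)
  thus ?case by (simp add: altf_contract altf_invol)
 qed
next
 fix xs ys v g assume l: "xs : lists L" "ys : lists L" "v : L" "g : R"
 show "lwedge F G (xs @ sm g v # ys) = g * lwedge F G (xs @ v # ys)" using l(1) assms
 proof (induction xs arbitrary: F G)
  case Nil
  have "H (sm g v # us) = g * H (v # us)" if "altf H" "set us <= set ys" for H us
   using altf_sm[OF that(1), of "[]" us v g] l that by auto
  hence "lwedge (contract (sm g v) F) G ys = lwedge (%us. g * contract v F us) G ys"
   "lwedge (invol F) (contract (sm g v) G) ys = lwedge (invol F) (%us. g * contract v G us) ys"
   using Nil by (auto intro!: lwedge_cong simp: contract_apply)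
  thus ?case by (simp add: lwedge_scale_left lwedge_scale_right distrib_left)
 next
  case (Cons x xs)
  thus ?case by (simp add: altf_contract altf_invol distrib_left)
 qed
next
 fix xs ys v assume l: "xs : lists L" "ys : lists L" "v : L"
 show "lwedge F G (xs @ v # v # ys) = 0" using l(1) assms
 proof (induction xs arbitrary: F G)
  case Nil
  have z: "H (v # v # us) = 0" if "altf H" "set us <= set ys" for H us
   using alt0_same[OF altf_alt0[OF that(1)], of "[]" us v] l that by auto
  have "lwedge (contract v (contract v F)) G ys = lwedge 0 G ys"
   "lwedge (invol (invol F)) (contract v (contract v G)) ys = lwedge (invol (invol F)) 0 ys"
   by (intro lwedge_cong; use z Nil in \<open>auto simp: contract_apply\<close>)+
  \<comment> \<open>The two mixed terms, in which each factor is contracted once, cancel because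
    \<open>invol\<close> anticommutes with contraction.\<close>
  thus ?case by (simp add: contract_invol lwedge_minus_left)
 next
  case (Cons x xs)
  thus ?case by (simp add: altf_contract altf_invol)
 qed
qed (use assms altf_valued valued_lwedge in \<open>auto simp: valued_def\<close>)

end

section \<open>The differential of a Lie--Rinehart algebra\<close>

text \<open>The structure formed by the global functions and sections of an algebroid.
  \<open>br_self\<close> stands beside antisymmetry because in a general abelian group the latter
  does not force it; the Jacobi identity has the derivation form that matches commutators of Lie
  derivatives.\<close>

locale lie_rinehart = lmodule R L sm
 for R :: "'r::comm_ring_1 set" and L :: "'l::ab_group_add set" and sm +
 fixes rho :: "'l => 'r => 'r" and br :: "'l => 'l => 'l"
 assumes rho_closed: "!!v g. v : L ==> g : R ==> rho v g : R"
  and rho_add: "!!v g h. v : L ==> g : R ==> h : R ==> rho v (g + h) = rho v g + rho v h"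
  and rho_mult: "!!v g h. v : L ==> g : R ==> h : R ==> rho v (g * h) = g * rho v h + h * rho v g"
  and rho_add_left: "!!v w g. v : L ==> w : L ==> g : R ==> rho (v + w) g = rho v g + rho w g"
  and rho_sm: "!!v g h. v : L ==> g : R ==> h : R ==> rho (sm g v) h = g * rho v h"
  and br_closed: "!!v w. v : L ==> w : L ==> br v w : L"
  and br_add: "!!u v w. u : L ==> v : L ==> w : L ==> br u (v + w) = br u v + br u w"
  and br_antisym: "!!v w. v : L ==> w : L ==> br v w = - br w v"
  and br_self: "!!v. v : L ==> br v v = 0"
  and br_sm: "!!v w g. v : L ==> w : L ==> g : R ==> br v (sm g w) = sm g (br v w) + sm (rho v g) w"
  and jacobi: "!!u v w. u : L ==> v : L ==> w : L ==> br u (br v w) = br (br u v) w + br v (br u w)"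
  and rho_br: "!!v w g. v : L ==> w : L ==> g : R ==> rho (br v w) g = rho v (rho w g) - rho w (rho v g)"
begin

text \<open>The recursion is the commutation rule of the Lie derivative along \<open>v\<close> with
  contraction by \<open>w\<close>: their commutator is contraction by the bracket.\<close>

fun llie :: "'l => ('l list => 'r) => 'l list => 'r" where
 "llie v F [] = rho v (F [])"
| "llie v F (w # ws) = llie v (contract w F) ws - F (br v w # ws)"

text \<open>Cartan's formula is used as the definition, so that all identities follow by induction.\<close>

fun ld :: "('l list => 'r) => 'l list => 'r" where
 "ld F [] = 0"
| "ld F (v # vs) = llie v F vs - ld (contract v F) vs"

definition dfun :: "'r => 'l list => 'r" where
 "dfun g us = (case us of [w] => rho w g | _ => 0)"

lemma rho_minus: assumes "v : L" "g : R" shows "rho v (- g) = - rho v g"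
proof -
 have z: "rho v 0 = 0" using rho_add[OF assms(1), of 0 0] R_const by simp
 have "rho v g + rho v (- g) = rho v (g + - g)" using rho_add[OF assms R_minus[OF assms(2)]] by simp
 hence "rho v g + rho v (- g) = 0" using z by simp
 thus ?thesis by (simp add: eq_neg_iff_add_eq_0 add.commute)
qed

lemma rho_diff: "v : L ==> g : R ==> h : R ==> rho v (g - h) = rho v g - rho v h"
 using rho_add[of v g "- h"] rho_minus R_minus by simp

lemma rho_zero: "v : L ==> rho v 0 = 0" using rho_diff[of v 0 0] R_const by simp

section \<open>Cartan calculus: Lie derivative, differential and their commutation rules\<close>

lemma llie_cong:
 "vs : lists L ==> v : L ==> (!!us. us : lists L ==> F us = G us) ==> llie v F vs = llie v G vs"
proof (induction vs arbitrary: F G)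
 case (Cons w ws)
 have "llie v (contract w F) ws = llie v (contract w G) ws" using Cons by (intro Cons.IH) (auto simp: contract_apply)
 thus ?case using Cons.prems br_closed by simp
qed simp

lemma ld_cong:
 "vs : lists L ==> (!!us. us : lists L ==> F us = G us) ==> ld F vs = ld G vs"
proof (induction vs arbitrary: F G)
 case (Cons w ws)
 have "ld (contract w F) ws = ld (contract w G) ws" using Cons by (intro Cons.IH) (auto simp: contract_apply)
 thus ?case using Cons.prems llie_cong[of ws w F G] by simp
qed simp

lemma llie_add: "vs : lists L ==> v : L ==> valued F ==> valued G ==> llie v (F + G) vs = llie v F vs + llie v G vs"
proof (induction vs arbitrary: F G)
 case Nil
 thus ?case by (auto simp: valued_def rho_add)
next
 case (Cons w ws)
 hence "llie v (contract w F + contract w G) ws = llie v (contract w F) ws + llie v (contract w G) ws"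
  by (intro Cons.IH valued_contract) auto
 thus ?case unfolding llie.simps contract_add by simp
qed

lemma llie_scale:
 "vs : lists L ==> v : L ==> valued F ==> g : R ==> llie v (%us. g * F us) vs = rho v g * F vs + g * llie v F vs"
proof (induction vs arbitrary: F)
 case Nil
 thus ?case by (auto simp: valued_def rho_mult mult.commute)
next
 case (Cons w ws)
 hence "llie v (%us. g * contract w F us) ws = rho v g * contract w F ws + g * llie v (contract w F) ws"
  by (intro Cons.IH valued_contract) auto
 thus ?case unfolding llie.simps contract_scale by (simp add: contract_apply[of w F ws] algebra_simps)
qed

lemma llie_minus: "vs : lists L ==> v : L ==> valued F ==> llie v (- F) vs = - llie v F vs"
proof (induction vs arbitrary: F)
 case Nil
 thus ?case by (auto simp: valued_def rho_minus)
next
 case (Cons w ws)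
 hence "llie v (- contract w F) ws = - llie v (contract w F) ws" by (intro Cons.IH valued_contract) auto
 thus ?case unfolding llie.simps contract_uminus by simp
qed

lemma valued_minus: "valued F ==> valued (- F)" by (auto simp: valued_def R_minus)

lemma llie_diff: "vs : lists L ==> v : L ==> valued F ==> valued G ==> llie v (F - G) vs = llie v F vs - llie v G vs"
 using llie_add[of vs v F "- G"] llie_minus valued_minus by simp

lemma llie_zero: "vs : lists L ==> v : L ==> llie v 0 vs = 0" using llie_diff[of vs v 0 0] by (simp add: valued_def R_const)

lemma valued_llie: assumes "v : L" "valued F" shows "valued (llie v F)"
proof -
 have "llie v F vs : R" if "vs : lists L" for vs using that assms(2)
 proof (induction vs arbitrary: F)
  case (Cons w ws)
  have "F (br v w # ws) : R" using Cons.prems Cons.hyps assms(1) br_closed by (auto simp: valued_def)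
  thus ?case using Cons by (auto simp: valued_contract intro: R_diff)
 qed (use assms in \<open>auto simp: valued_def intro: rho_closed\<close>)
 thus ?thesis by (simp add: valued_def)
qed

lemma valued_ld: assumes "valued F" shows "valued (ld F)"
proof -
 have "ld F vs : R" if "vs : lists L" for vs using that assms
 proof (induction vs arbitrary: F)
  case (Cons w ws)
  have "llie w F ws : R" using Cons.prems Cons.hyps valued_llie[of w F] by (auto simp: valued_def)
  thus ?case using Cons by (auto simp: valued_contract intro: R_diff)
 qed (simp add: R_const)
 thus ?thesis by (simp add: valued_def)
qed

lemma ld_add: "vs : lists L ==> valued F ==> valued G ==> ld (F + G) vs = ld F vs + ld G vs"
proof (induction vs arbitrary: F G)
 case (Cons w ws)
 hence "ld (contract w F + contract w G) ws = ld (contract w F) ws + ld (contract w G) ws"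
  by (intro Cons.IH valued_contract) auto
 moreover have "llie w (F + G) ws = llie w F ws + llie w G ws" using Cons.prems by (intro llie_add) auto
 ultimately show ?case unfolding ld.simps contract_add by simp
qed simp

lemma ld_minus: "vs : lists L ==> valued F ==> ld (- F) vs = - ld F vs"
proof (induction vs arbitrary: F)
 case (Cons w ws)
 hence "ld (- contract w F) ws = - ld (contract w F) ws" by (intro Cons.IH valued_contract) auto
 moreover have "llie w (- F) ws = - llie w F ws" using Cons.prems by (intro llie_minus) auto
 ultimately show ?case unfolding ld.simps contract_uminus by simp
qed simp

lemma ld_diff: "vs : lists L ==> valued F ==> valued G ==> ld (F - G) vs = ld F vs - ld G vs"
 using ld_add[of vs F "- G"] ld_minus valued_minus by simp

lemma contract_llie: "contract u (llie w F) = llie w (contract u F) - contract (br w u) F" by (auto simp: contract_apply)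

lemma contract_ld: "contract v (ld F) = llie v F - ld (contract v F)" by (auto simp: contract_apply)

lemma altf_cons_add: "altf F ==> us : lists L ==> v : L ==> w : L ==> F ((v + w) # us) = F (v # us) + F (w # us)"
 using alt0_add[OF altf_alt0, of F "[]" us v w] by simp

text \<open>In the inductive step the mixed terms are symmetric in \<open>v\<close> and
  \<open>w\<close> and cancel; the double brackets combine by the Jacobi identity, for which
  \<open>F\<close> must be additive in its first slot.\<close>

lemma llie_commutator:
 "vs : lists L ==> v : L ==> w : L ==> altf F ==> llie v (llie w F) vs - llie w (llie v F) vs = llie (br v w) F vs"
proof (induction vs arbitrary: F)
 case Nil
 thus ?case using altf_valued[of F] by (auto simp: valued_def rho_br)
next
 case (Cons u us)
 hence u: "u : L" "us : lists L" by auto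
 note vw = Cons.prems(2,3) and F = Cons.prems(4)
 have val: "valued (contract x F)" if "x : L" for x using valued_contract[OF altf_valued[OF F] that] .
 have step: "llie a (llie b F) (u # us) = llie a (llie b (contract u F)) us
   - llie a (contract (br b u) F) us - (llie b (contract (br a u) F) us - F (br b (br a u) # us))"
  if "a : L" "b : L" for a b using u that br_closed by (simp add: contract_llie llie_diff valued_llie val)
 have "F (br v (br w u) # us) = F (br (br v w) u # us) + F (br w (br v u) # us)"
  using jacobi[OF vw u(1)] altf_cons_add[OF F u(2)] br_closed vw u(1) by simp
 thus ?case unfolding step[OF vw] step[OF vw(2,1)]
  using Cons.IH[OF u(2) vw altf_contract[OF F u(1)]] by (simp add: algebra_simps)
qed

text \<open>Linearity over functions survives although \<open>v\<close> differentiates them: the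
  term with \<open>rho v g\<close> from the product rule cancels the one from the bracket
  \<open>br v (sm g a)\<close>.\<close>

lemma altf_llie:
 assumes v: "v : L" and "altf F" shows "altf (llie v F)"
proof (rule altfI)
 fix xs ys a b assume l: "xs : lists L" "ys : lists L" "a : L" "b : L"
 show "llie v F (xs @ (a + b) # ys) = llie v F (xs @ a # ys) + llie v F (xs @ b # ys)" using l(1) assms(2)
 proof (induction xs arbitrary: F)
  case Nil
  have "llie v (contract (a + b) F) ys = llie v (contract a F + contract b F) ys"
   using l v Nil by (intro llie_cong) (auto simp: altf_cons_add contract_apply)
  thus ?case using l v Nil br_closed altf_valued valued_contract by (simp add: llie_add br_add altf_cons_add)
 next
  case (Cons x xs)
  hence "F ((br v x # xs) @ (a + b) # ys) = F ((br v x # xs) @ a # ys) + F ((br v x # xs) @ b # ys)"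
   using l br_closed v by (intro alt0_add altf_alt0) auto
  thus ?case using Cons by (simp add: altf_contract)
 qed
next
 fix xs ys a g assume l: "xs : lists L" "ys : lists L" "a : L" "g : R"
 show "llie v F (xs @ sm g a # ys) = g * llie v F (xs @ a # ys)" using l(1) assms(2)
 proof (induction xs arbitrary: F)
  case Nil
  have s: "F (sm h c # us) = h * F (c # us)" if "us : lists L" "h : R" "c : L" for us h c
   using altf_sm[OF Nil, of "[]" us c h] that by simp
  have "llie v (contract (sm g a) F) ys = llie v (%us. g * contract a F us) ys"
   using l v by (intro llie_cong) (auto simp: s contract_apply)
  moreover have "F (br v (sm g a) # ys) = g * F (br v a # ys) + rho v g * F (a # ys)"
   using l v br_closed rho_closed L_sm by (simp add: br_sm altf_cons_add[OF Nil] s)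
  ultimately show ?case
   using l v Nil altf_valued valued_contract by (simp add: llie_scale algebra_simps contract_apply[of a F ys])
 next
  case (Cons x xs)
  hence "F ((br v x # xs) @ sm g a # ys) = g * F ((br v x # xs) @ a # ys)" using l br_closed v by (intro altf_sm) auto
  thus ?case using Cons by (simp add: altf_contract right_diff_distrib)
 qed
next
 fix xs ys a assume l: "xs : lists L" "ys : lists L" "a : L"
 show "llie v F (xs @ a # a # ys) = 0" using l(1) assms(2)
 proof (induction xs arbitrary: F)
  case Nil
  have "llie v (contract a (contract a F)) ys = llie v 0 ys"
   using l v alt0_same[OF altf_alt0[OF Nil], of "[]" _ a] by (intro llie_cong) (auto simp: contract_apply)
  moreover have "F (a # br v a # ys) = - F (br v a # a # ys)"
   using alt0_swap[OF altf_alt0[OF Nil], of "[]" ys a "br v a"] l v br_closed by simp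
  ultimately show ?case using l v by (simp add: llie_zero)
 next
  case (Cons x xs)
  hence "F ((br v x # xs) @ a # a # ys) = 0" using l br_closed v by (intro alt0_same altf_alt0) auto
  thus ?case using Cons by (simp add: altf_contract)
 qed
qed (use valued_llie[OF v altf_valued[OF assms(2)]] in \<open>auto simp: valued_def\<close>)

lemma ld_llie:
 "vs : lists L ==> v : L ==> altf F ==> llie v (ld F) vs = ld (llie v F) vs"
proof (induction vs arbitrary: F)
 case (Cons w ws)
 hence w: "w : L" "ws : lists L" "v : L" "altf F" by auto
 have val: "valued (contract x F)" "valued (llie x F)" if "x : L" for x
  using valued_contract[OF altf_valued[OF w(4)] that] valued_llie[OF that altf_valued[OF w(4)]] .
 have "llie v (ld F) (w # ws) = llie v (llie w F) ws - llie v (ld (contract w F)) ws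
   - (llie (br v w) F ws - ld (contract (br v w) F) ws)"
  using w br_closed by (simp add: contract_ld llie_diff val valued_ld)
 moreover have "ld (llie v F) (w # ws) = llie w (llie v F) ws
   - (ld (llie v (contract w F)) ws - ld (contract (br v w) F) ws)"
  using w br_closed by (simp add: contract_llie ld_diff val valued_llie)
 ultimately show ?case using llie_commutator[OF w(2,3,1,4)] Cons.IH[OF w(2,3) altf_contract[OF w(4,1)]]
  by (simp add: algebra_simps)
qed (simp add: rho_zero)

text \<open>Cartan's formula applied twice: contracting \<open>d d F\<close> with \<open>v\<close>
  leaves \<open>L_v d F - d L_v F + d d (contract v F)\<close>. The first two terms cancel by
  \<open>ld_llie\<close>, and the last is evaluated on a shorter list.\<close>

lemma ld_ld: "vs : lists L ==> altf F ==> ld (ld F) vs = 0"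
proof (induction vs arbitrary: F)
 case (Cons v vs)
 hence v: "v : L" "vs : lists L" "altf F" by auto
 have "ld (ld F) (v # vs) = llie v (ld F) vs - (ld (llie v F) vs - ld (ld (contract v F)) vs)"
  using v by (simp add: contract_ld ld_diff valued_llie valued_ld valued_contract altf_valued)
 thus ?case using ld_llie[OF v(2,1,3)] Cons.IH[OF v(2) altf_contract[OF v(3,1)]] by simp
qed simp

lemma llie_invol: "vs : lists L ==> v : L ==> valued F ==> llie v (invol F) vs = invol (llie v F) vs"
proof (induction vs arbitrary: F)
 case (Cons w ws)
 hence "llie v (invol F) (w # ws) = - invol (llie v (contract w F)) ws - invol F (br v w # ws)"
  by (simp add: contract_invol llie_minus valued_invol valued_contract)
 thus ?case by (simp add: invol_def algebra_simps)
qed (simp add: invol_def)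

lemma llie_lwedge:
 "vs : lists L ==> v : L ==> valued F ==> valued G ==> llie v (lwedge F G) vs = lwedge (llie v F) G vs + lwedge F (llie v G) vs"
proof (induction vs arbitrary: F G)
 case Nil
 thus ?case by (auto simp: valued_def rho_mult algebra_simps)
next
 case (Cons w ws)
 hence w: "w : L" "ws : lists L" "v : L" by auto
 note FG = Cons.prems(3,4)
 note val = valued_contract[OF FG(1) w(1)] valued_contract[OF FG(2) w(1)] valued_invol[OF FG(1)]
 have inv: "lwedge (llie v (invol F)) (contract w G) ws = lwedge (invol (llie v F)) (contract w G) ws"
  using w FG by (intro lwedge_cong) (auto intro!: llie_invol simp: subset_iff)
 have "llie v (lwedge F G) (w # ws) = llie v (lwedge (contract w F) G) ws + llie v (lwedge (invol F) (contract w G)) ws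
   - (lwedge (contract (br v w) F) G ws + lwedge (invol F) (contract (br v w) G) ws)"
  using w FG val by (simp add: contract_lwedge llie_add valued_lwedge)
 also have "llie v (lwedge (contract w F) G) ws = lwedge (llie v (contract w F)) G ws + lwedge (contract w F) (llie v G) ws"
  using w FG val by (intro Cons.IH)
 also have "llie v (lwedge (invol F) (contract w G)) ws =
   lwedge (llie v (invol F)) (contract w G) ws + lwedge (invol F) (llie v (contract w G)) ws"
  using w FG val by (intro Cons.IH)
 finally show ?case by (simp add: inv contract_llie lwedge_diff_left lwedge_diff_right algebra_simps)
qed

lemma ld_invol: "vs : lists L ==> valued F ==> ld (invol F) vs = - invol (ld F) vs"
proof (induction vs arbitrary: F)
 case (Cons v vs)
 hence "ld (invol F) (v # vs) = invol (llie v F) vs - invol (ld (contract v F)) vs"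
  by (simp add: contract_invol ld_minus valued_invol valued_contract llie_invol)
 thus ?case by (simp add: invol_def algebra_simps)
qed (simp add: invol_def)

text \<open>Contraction is an antiderivation and the Lie derivative a derivation of the wedge
  product; Cartan's formula transfers this to the differential by induction on the list.\<close>

lemma ld_lwedge:
 "vs : lists L ==> valued F ==> valued G ==> ld (lwedge F G) vs = lwedge (ld F) G vs + lwedge (invol F) (ld G) vs"
proof (induction vs arbitrary: F G)
 case (Cons v vs)
 hence v: "v : L" "vs : lists L" by auto
 note FG = Cons.prems(2,3)
 note val = valued_contract[OF FG(1) v(1)] valued_contract[OF FG(2) v(1)] valued_invol[OF FG(1)]
 have inv: "lwedge (ld (invol F)) (contract v G) vs = lwedge (- invol (ld F)) (contract v G) vs"
  using v FG by (intro lwedge_cong) (auto intro!: ld_invol simp: subset_iff)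
 have "ld (lwedge F G) (v # vs) = llie v (lwedge F G) vs
   - (ld (lwedge (contract v F) G) vs + ld (lwedge (invol F) (contract v G)) vs)"
  using v FG val by (simp add: contract_lwedge ld_add valued_lwedge)
 also have "ld (lwedge (contract v F) G) vs = lwedge (ld (contract v F)) G vs + lwedge (invol (contract v F)) (ld G) vs"
  using v FG val by (intro Cons.IH)
 also have "ld (lwedge (invol F) (contract v G)) vs =
   lwedge (ld (invol F)) (contract v G) vs + lwedge (invol (invol F)) (ld (contract v G)) vs"
  using v FG val by (intro Cons.IH)
 also have "llie v (lwedge F G) vs = lwedge (llie v F) G vs + lwedge F (llie v G) vs" using v FG by (intro llie_lwedge)
 finally show ?case
  by (simp add: inv contract_ld contract_invol lwedge_diff_left lwedge_diff_right lwedge_minus_left algebra_simps)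
qed simp

lemma lwedge_dfun: "lwedge (dfun g) F (v # vs) = rho v g * F vs - lwedge (dfun g) (contract v F) vs"
proof -
 have c: "contract v (dfun g) = (%us. rho v g * (if us = [] then 1 else 0))"
  by (auto simp: fun_eq_iff dfun_def contract_def split: list.split)
 have i: "invol (dfun g) = - dfun g" by (auto simp: fun_eq_iff dfun_def invol_def split: list.split)
 have unit: "lwedge (%us. if us = [] then 1 else 0) G us = G us" for G :: "'l list => 'r" and us
 proof (induction us arbitrary: G)
  case (Cons u us)
  have "contract u (%us. if us = [] then 1 else 0) = (0 :: 'l list => 'r)"
   "invol (%us. if us = [] then 1 else 0) = (%us :: 'l list. if us = [] then 1 else 0 :: 'r)"
   by (auto simp: fun_eq_iff invol_def contract_def)
  thus ?case by (simp add: Cons contract_apply)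
 qed simp
 show ?thesis by (simp add: c i lwedge_scale_left unit lwedge_minus_left)
qed

lemma ld_scale:
 "vs : lists L ==> valued F ==> g : R ==> ld (%us. g * F us) vs = g * ld F vs + lwedge (dfun g) F vs"
proof (induction vs arbitrary: F)
 case (Cons v vs)
 thus ?case by (simp add: contract_scale lwedge_dfun llie_scale valued_contract algebra_simps del: lwedge.simps)
qed (simp add: dfun_def)

lemma br_sm_left:
 assumes "v : L" "w : L" "g : R"
 shows "br (sm g v) w = - (sm g (br w v) + sm (rho w g) v)"
 using br_antisym[OF L_sm[OF assms(3,1)] assms(2)] br_sm[OF assms(2,1,3)] by simp

text \<open>The classical rule \<open>L_{gv} = g L_v + dg \<and> i_v\<close>. It measures the
  failure of function linearity in \<open>v\<close>, which is compensated in
  \<open>altf_ld\<close>.\<close>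

lemma llie_sm:
 "vs : lists L ==> v : L ==> altf F ==> g : R ==> llie (sm g v) F vs = g * llie v F vs + lwedge (dfun g) (contract v F) vs"
proof (induction vs arbitrary: F)
 case Nil
 thus ?case using altf_valued[of F] by (auto simp: valued_def dfun_def rho_sm)
next
 case (Cons w ws)
 hence w: "w : L" "ws : lists L" "v : L" "altf F" "g : R" by auto
 have s: "F (sm h c # us) = h * F (c # us)" if "us : lists L" "h : R" "c : L" for us h c
  using altf_sm[OF w(4), of "[]" us c h] that by simp
 have mi: "F (- c # us) = - F (c # us)" if "us : lists L" "c : L" for us c
  using altf_minus_arg[OF w(4), of "[]" us c] that by simp
 have b: "br w v : L" "rho w g : R" using w br_closed rho_closed by auto
 have A: "F (br (sm g v) w # ws) = - (g * F (br w v # ws) + rho w g * F (v # ws))"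
  using w b L_sm L_add by (simp only: br_sm_left mi altf_cons_add s)
 have B: "F (br v w # ws) = - F (br w v # ws)" using w b by (simp only: br_antisym[of v w] mi)
 have C: "lwedge (dfun g) (contract v (contract w F)) ws = lwedge (dfun g) (- contract w (contract v F)) ws"
 proof (rule lwedge_cong)
  fix us assume "set us <= set ws"
  hence "us : lists L" using w(2) by auto
  thus "contract v (contract w F) us = (- contract w (contract v F)) us"
   using alt0_swap[OF altf_alt0[OF w(4)], of "[]" us w v] w by (simp add: contract_apply)
 qed simp
 show ?case unfolding llie.simps lwedge_dfun Cons.IH[OF w(2,3) altf_contract[OF w(4,1)] w(5)] A B C lwedge_minus_right
   contract_apply[of v F ws] by (simp add: algebra_simps)
qed

text \<open>In the leading argument the \<open>dg\<close> terms of \<open>llie_sm\<close> and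
  \<open>ld_scale\<close> cancel. Additivity and alternation are available in every position by
  then, so function linearity can be moved to the other arguments.\<close>

lemma altf_ld:
 assumes "altf F" shows "altf (ld F)"
proof -
 have add: "ld F (xs @ (a + b) # ys) = ld F (xs @ a # ys) + ld F (xs @ b # ys)"
  if l: "xs : lists L" "ys : lists L" "a : L" "b : L" for xs ys a b using l(1) assms
 proof (induction xs arbitrary: F)
  case Nil
  have ladd: "llie (a + b) F ys = llie a F ys + llie b F ys" if "ys : lists L" "altf F" for ys F using that
  proof (induction ys arbitrary: F)
   case Nil
   thus ?case using l altf_valued[of F] by (simp add: rho_add_left valued_def)
  next
   case (Cons y ys)
   have "br (a + b) y = br a y + br b y"
    using br_antisym[of "a + b" y] br_antisym[of a y] br_antisym[of b y] br_add[of y a b] l Cons.hyps L_add by simp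
   thus ?case using Cons l br_closed altf_cons_add[OF Cons.prems] by (simp add: altf_contract)
  qed
  have "ld (contract (a + b) F) ys = ld (contract a F + contract b F) ys"
   using l Nil by (intro ld_cong) (auto simp: altf_cons_add contract_apply)
  thus ?case using l Nil altf_valued valued_contract ladd by (simp add: ld_add)
 next
  case (Cons x xs)
  hence "llie x F (xs @ (a + b) # ys) = llie x F (xs @ a # ys) + llie x F (xs @ b # ys)"
   using l altf_llie[of x F] by (intro alt0_add altf_alt0) auto
  thus ?case using Cons by (simp add: altf_contract)
 qed
 have same: "ld F (xs @ a # a # ys) = 0" if l: "xs : lists L" "ys : lists L" "a : L" for xs ys a using l(1) assms
 proof (induction xs arbitrary: F)
  case Nil
  have "ld (contract a (contract a F)) ys = ld 0 ys"
   using l alt0_same[OF altf_alt0[OF Nil], of "[]" _ a] by (intro ld_cong) (auto simp: contract_apply)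
  also have "... = 0" using ld_diff[OF l(2), of 0 0] by (simp add: valued_def R_const)
  finally have "ld (contract a (contract a F)) ys = 0" .
  moreover have "F (0 # ys) = 0" using altf_cons_add[OF Nil l(2) L_zero L_zero] by simp
  ultimately show ?case using l br_self by simp
 next
  case (Cons x xs)
  hence "llie x F (xs @ a # a # ys) = 0" using l altf_llie[of x F] by (intro alt0_same altf_alt0) auto
  thus ?case using Cons by (simp add: altf_contract)
 qed
 have val: "valued (ld F)" using valued_ld[OF altf_valued[OF assms]] .
 have a0: "alt0 (ld F)" using add same val by (auto simp: alt0_def)
 have front: "ld F (sm g a # ys) = g * ld F (a # ys)" if l: "ys : lists L" "a : L" "g : R" for ys a g
 proof -
  have s: "F (sm g a # us) = g * F (a # us)" if "us : lists L" for us
   using altf_sm[OF assms, of "[]" us a g] that l by simp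
  have "ld (contract (sm g a) F) ys = ld (%us. g * contract a F us) ys"
   using l by (intro ld_cong) (auto simp: s contract_apply)
  thus ?thesis using l assms by (simp add: llie_sm ld_scale valued_contract altf_valued algebra_simps)
 qed
 show ?thesis unfolding altf_def
 proof (intro conjI ballI a0)
  fix xs ys a g assume l: "xs : lists L" "ys : lists L" "a : L" "g : R"
  show "ld F (xs @ sm g a # ys) = g * ld F (xs @ a # ys)"
   unfolding alt0_move[OF a0 l(1,2,3)] alt0_move[OF a0 l(1,2) L_sm[OF l(4,3)]] using front[of "xs @ ys" a g] l by simp
 qed
qed

lemma homog_llie: "vs : lists L ==> v : L ==> homog k F ==> length vs ~= k ==> llie v F vs = 0"
proof (induction vs arbitrary: k F)
 case Nil
 thus ?case by (auto simp: homog_def rho_zero)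
next
 case (Cons w ws)
 have "llie v (contract w F) ws = 0"
 proof (cases k)
  case 0
  have "contract w F = 0" using 0 Cons.prems homog_0_contract by auto
  thus ?thesis using Cons.prems llie_zero[of ws v] by simp
 next
  case (Suc j)
  thus ?thesis using Cons homog_contract_Suc[of j F w] by auto
 qed
 thus ?case using Cons.prems by (auto simp: homog_def)
qed

lemma homog_ld: "homog k F ==> vs : lists L ==> length vs ~= Suc k ==> ld F vs = 0"
proof (induction vs arbitrary: k F)
 case (Cons w ws)
 have "ld (contract w F) ws = 0"
 proof (cases k)
  case 0
  have "contract w F = 0" using 0 Cons.prems homog_0_contract by auto
  thus ?thesis using Cons.prems ld_diff[of ws 0 0] by (simp add: valued_def R_const)
 next
  case (Suc j)
  thus ?thesis using Cons homog_contract_Suc[of j F w] by auto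
 qed
 thus ?case using Cons.prems homog_llie[of ws w k F] by auto
qed simp

end

subsection \<open>Forms on a real vector space with a distinguished subspace\<close>

text \<open>Corresponds to the \<open>j\<close>-th power of the ideal of forms vanishing on
  \<open>B\<close>: at least \<open>j\<close> arguments outside \<open>B\<close> are needed for a
  nonzero value.\<close>

definition filt :: "'v set => 'v set => nat => ('v list => real) => bool" where
 "filt V B j F \<longleftrightarrow> (ALL vs:lists V. length (filter (%v. v ~: B) vs) < j --> F vs = 0)"

lemma filt_0 [simp]: "filt V B 0 F" by (simp add: filt_def)

lemma filt_mono: "filt V B j F ==> i <= j ==> filt V B i F" by (auto simp: filt_def)

lemma filt_add: "filt V B j F ==> filt V B j G ==> filt V B j (F + G)"
 and filt_diff: "filt V B j F ==> filt V B j G ==> filt V B j (F - G)" by (auto simp: filt_def)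

lemma filt_contract: "filt V B j F ==> v : V ==> filt V B (if v : B then j else j - 1) (contract v F)"
 by (auto simp: filt_def contract_def)

lemma filt_invol: "filt V B j F ==> filt V B j (invol F)" by (auto simp: filt_def invol_def)

text \<open>A vector outside \<open>B\<close> lowers the count of such arguments and the index of
  the contracted factor by one; a vector of \<open>B\<close> lowers neither.\<close>

lemma filt_lwedge:
 assumes "filt V B i F" "filt V B j G" shows "filt V B (i + j) (lwedge F G)"
proof -
 have "lwedge F G vs = 0" if "vs : lists V" "length (filter (%v. v ~: B) vs) < i + j" for vs using that assms
 proof (induction vs arbitrary: i j F G)
  case Nil
  thus ?case by (cases "0 < i") (auto simp: filt_def)
 next
  case (Cons v vs)
  let ?n = "%k. if v : B then k else k - 1"
  have v: "v : V" using Cons.hyps by auto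
  have 1: "filt V B (?n i) (contract v F)" "filt V B (?n j) (contract v G)"
   using filt_contract[OF Cons.prems(2) v] filt_contract[OF Cons.prems(3) v] .
  have 2: "length (filter (%v. v ~: B) vs) < ?n i + j" "length (filter (%v. v ~: B) vs) < i + ?n j"
   using Cons.prems(1) by (auto split: if_splits)
  show ?case using Cons.IH[OF 2(1) 1(1) Cons.prems(3)] Cons.IH[OF 2(2) filt_invol[OF Cons.prems(2)] 1(2)] by simp
 qed
 thus ?thesis by (simp add: filt_def)
qed

lemma lmodule_subspace:
 assumes "subspace (V :: 'v::real_vector set)"
 shows "lmodule (UNIV :: real set) V scaleR"
 by standard (use assms in \<open>auto simp: subspace_0 subspace_add subspace_neg subspace_mul\<close>)

abbreviation alt_on :: "'v::real_vector set => ('v list => real) => bool" where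
 "alt_on V \<equiv> lmodule.altf UNIV V scaleR"

text \<open>The arguments are expanded from the right, so the induction carries a suffix that
  already consists of elements of \<open>S\<close>.\<close>

lemma alt_on_span_zero:
 assumes V: "subspace V" and F: "alt_on V F" and S: "S <= V" "V <= span S"
  and z: "!!vs. vs : lists S ==> F vs = 0" and vs: "vs : lists V"
 shows "F vs = 0"
proof -
 interpret lmodule "UNIV :: real set" V scaleR using lmodule_subspace[OF V] .
 have "ALL ys:lists S. F (xs @ ys) = 0" if "xs : lists V" for xs using that
 proof (induction xs rule: rev_induct)
  case (snoc x xs)
  hence x: "x : span S" "x : V" "xs : lists V" using S(2) by auto
  have sp: "span S <= V" using span_minimal[OF S(1) V] .
  show ?case
  proof
   fix ys assume ys: "ys : lists S"
   have ysV: "ys : lists V" using ys S(1) by auto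
   have "x : V & F (xs @ x # ys) = 0" using x(1)
   proof (induction rule: span_induct_alt)
    case base
    thus ?case using altf_sm[OF F x(3) ysV subspace_0[OF V], of 0] subspace_0[OF V] by simp
   next
    case (step c s y)
    have s: "s : V" using step S(1) by auto
    have "F (xs @ s # ys) = 0" using snoc.IH x(3) step(1) ys by simp
    hence "F (xs @ (c *R s) # ys) = 0" using altf_sm[OF F x(3) ysV s, of c] by simp
    thus ?case
     using alt0_add[OF altf_alt0[OF F] x(3) ysV L_sm[OF _ s, of c], of y] step L_add L_sm[OF _ s, of c] by simp
   qed
   thus "F ((xs @ [x]) @ ys) = 0" by simp
  qed
 qed (use z in simp)
 from bspec[OF this[OF vs], of "[]"] show ?thesis by simp
qed

text \<open>On a list from \<open>B\<close> and \<open>ws\<close> the filtration asks for at least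
  \<open>length ws\<close> entries outside \<open>B\<close>, and alternation for distinct ones; so
  these entries are precisely those of \<open>ws\<close>, each once, and only the values on
  \<open>bs @ ws\<close> remain. The vanishing and uniqueness statements about forms modulo
  \<open>B\<close> rest on this.\<close>

lemma alt_on_filt_zero:
 assumes V: "subspace V" and F: "alt_on V F" and B: "B <= V"
  and ws: "ws : lists V" "V <= span (B Un set ws)"
  and fil: "filt V B (length ws) F"
  and z: "!!bs. bs : lists B ==> F (bs @ ws) = 0" and vs: "vs : lists V"
 shows "F vs = 0"
proof (rule alt_on_span_zero[OF V F _ ws(2) _ vs])
 interpret lmodule "UNIV :: real set" V scaleR using lmodule_subspace[OF V] .
 show "B Un set ws <= V" using B ws(1) by auto
 fix us assume us: "us : lists (B Un set ws)"
 hence usV: "us : lists V" using B ws(1) by auto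
 let ?nb = "filter (%v. v ~: B) us"
 show "F us = 0"
 proof (cases "distinct us & length ?nb >= length ws")
  case False
  thus ?thesis using alt0_repeat[OF altf_alt0[OF F] usV] fil usV unfolding filt_def by (meson not_le)
 next
  case True
  have sub: "set ?nb <= set ws" using us by auto
  have d: "distinct ?nb" using True by simp
  have "card (set ?nb) >= length ws" using True distinct_card[OF d] by simp
  hence c: "card (set ws) <= card (set ?nb)" using card_length[of ws] by simp
  have eq: "set ?nb = set ws" using card_seteq[OF _ sub c] by simp
  have "length ?nb = length ws" using True distinct_card[OF d] eq card_length[of ws] by (metis antisym)
  hence "distinct ws" using distinct_card[OF d] eq card_distinct by metis
  hence "mset ?nb = mset ws" using d eq set_eq_iff_mset_eq_distinct by blast
  hence m: "mset (filter (%v. v : B) us @ ws) = mset us" by (metis mset_append mset_filter multiset_partition)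
  have "F (filter (%v. v : B) us @ ws) = 0" by (intro z) auto
  thus ?thesis using alt0_perm[OF altf_alt0[OF F] usV m] by auto
 qed
qed

subsection \<open>Comparison with the permutation and index formulas\<close>

text \<open>The sum in the definition of \<open>wedge\<close> without its factor, for an arbitrary
  function of the permuted list, which is what the induction on the number of arguments
  needs.\<close>

definition alt_sum :: "nat => ('l list => real) => 'l list => real" where
 "alt_sum n T vs = (SUM r | r permutes {..<n}. of_int (sign r) * T (permute_list r vs))"

lemma alt_sum_cong:
 assumes "length vs = n" "!!us. length us = n ==> set us = set vs ==> T us = T' us"
 shows "alt_sum n T vs = alt_sum n T' vs" unfolding alt_sum_def by (intro sum.cong) (use assms in auto)

lemma alt_sum_add: "alt_sum n (%us. T us + T' us) vs = alt_sum n T vs + alt_sum n T' vs"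
 by (simp add: alt_sum_def distrib_left sum.distrib)

lemma alt_sum_scale: "alt_sum n (%us. c * T us) vs = c * alt_sum n T vs"
 by (simp add: alt_sum_def sum_distrib_left mult.left_commute)

lemma permute_list_snoc:
 assumes "r permutes {..<length vs}"
 shows "permute_list r (vs @ [v]) = permute_list r vs @ [v]"
proof -
 have "r (length vs) = length vs" using assms by (simp add: permutes_not_in)
 moreover have "r i < length vs" if "i < length vs" for i using permutes_in_image[OF assms, of i] that by simp
 ultimately show ?thesis by (auto simp: permute_list_def nth_append)
qed

text \<open>The cycle that moves the last of \<open>n + 1\<close> entries to position \<open>b\<close>\<close>

definition ins_cycle :: "nat => nat => nat => nat" where
 "ins_cycle n b i = (if i = b then n else if b < i & i <= n then i - 1 else i)"

text \<open>Starting from the identity at \<open>b = n\<close>, each step down composes with one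
  adjacent transposition; the number \<open>n - b\<close> of steps gives the sign.\<close>

lemma ins_cycle: "b <= n ==> ins_cycle n b permutes {..<Suc n} & sign (ins_cycle n b) = (-1) ^ (n - b)"
proof (induction rule: inc_induct)
 case base
 have "ins_cycle n n = id" by (auto simp: ins_cycle_def)
 thus ?case using permutes_id sign_id by (metis diff_self_eq_0 power_0)
next
 case (step b)
 let ?t = "Transposition.transpose b (Suc b)"
 have t: "?t permutes {..<Suc n}" using step by (intro permutes_swap_id) auto
 have eq: "ins_cycle n b = ins_cycle n (Suc b) o ?t" by (rule HOL.ext) (use step.hyps(2) in \<open>auto simp: ins_cycle_def Transposition.transpose_def\<close>)
 have "permutation (ins_cycle n (Suc b))" "permutation ?t"
  using step.IH t permutes_imp_permutation[OF finite_lessThan] by blast+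
 hence "sign (ins_cycle n b) = - ((-1) ^ (n - Suc b))"
  using step.IH unfolding eq by (simp add: sign_compose sign_swap_id)
 moreover have "n - b = Suc (n - Suc b)" using step by simp
 moreover have "ins_cycle n b permutes {..<Suc n}" unfolding eq using permutes_compose[OF t conjunct1[OF step.IH]] .
 ultimately show ?case by simp
qed

lemma permute_list_ins_cycle:
 assumes "length us = n" "b <= n"
 shows "permute_list (ins_cycle n b) (us @ [v]) = take b us @ v # drop b us"
proof (rule nth_equalityI)
 fix i assume "i < length (permute_list (ins_cycle n b) (us @ [v]))"
 thus "permute_list (ins_cycle n b) (us @ [v]) ! i = (take b us @ v # drop b us) ! i"
  using assms by (auto simp: permute_list_def ins_cycle_def nth_append nth_Cons' min_def less_Suc_eq)
qed (use assms in simp)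

text \<open>A permutation of \<open>n + 1\<close> entries amounts to a permutation of the first
  \<open>n\<close> together with the place \<open>b\<close> at which the last one is
  inserted.\<close>

lemma alt_sum_insert:
 assumes "length vs = n"
 shows "alt_sum (Suc n) T (vs @ [v]) = alt_sum n (%us. SUM b<=n. (-1) ^ (n - b) * T (take b us @ v # drop b us)) vs"
proof -
 let ?f = "%u. of_int (sign u) * T (permute_list u (vs @ [v]))"
 have ins: "{..<Suc n} = insert n {..<n}" "insert n {..<n} = {..n}" by auto
 have "alt_sum (Suc n) T (vs @ [v]) = (SUM u | u permutes insert n {..<n}. ?f (inv u))"
  unfolding alt_sum_def ins(1) by (rule sum_permutations_inverse)
 also have "... = (SUM b:insert n {..<n}. SUM u | u permutes {..<n}. ?f (inv (Transposition.transpose n b o u)))"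
  by (rule sum_over_permutations_insert) auto
 also have "... = (SUM b:insert n {..<n}. SUM u | u permutes {..<n}. ?f (inv u o Transposition.transpose n b))"
  by (intro sum.cong[OF refl]) (auto dest!: permutes_bij simp: o_inv_distrib)
 also have "... = (SUM b:insert n {..<n}. SUM u | u permutes {..<n}. ?f (u o Transposition.transpose n b))"
  by (intro sum.cong[OF refl] sum_permutations_inverse[symmetric])
 also have "... = (SUM b:insert n {..<n}. SUM u | u permutes {..<n}.
   of_int (sign u) * ((-1) ^ (n - b) * T (take b (permute_list u vs) @ v # drop b (permute_list u vs))))"
 proof (rule sum.cong[OF refl])
  fix b assume "b : insert n {..<n}"
  hence b: "b <= n" by auto
  let ?t = "Transposition.transpose n b"
  note c = ins_cycle[OF b]
  \<comment> \<open>So far the last entry is moved by a transposition. This differs from the cycle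
    by a permutation that fixes \<open>n\<close>, which the sum over \<open>u\<close>
    absorbs.\<close>
  have "ins_cycle n b o ?t permutes {..<Suc n}" using c b by (intro permutes_compose permutes_swap_id) auto
  hence r: "ins_cycle n b o ?t permutes {..<n}" by (rule permutes_superset) (auto simp: ins_cycle_def)
  have "(SUM u | u permutes {..<n}. ?f (u o ?t)) = (SUM u | u permutes {..<n}. ?f (u o ins_cycle n b))"
   by (subst sum_permutations_compose_right[OF r]) (simp add: comp_assoc)
  also have "... = (SUM u | u permutes {..<n}.
    of_int (sign u) * ((-1) ^ (n - b) * T (take b (permute_list u vs) @ v # drop b (permute_list u vs))))"
  proof (rule sum.cong[OF refl])
   fix u assume "u : {u. u permutes {..<n}}"
   hence u: "u permutes {..<n}" by simp
   have "permutation u" "permutation (ins_cycle n b)" using u c permutes_imp_permutation[OF finite_lessThan] by blast+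
   thus "?f (u o ins_cycle n b) =
     of_int (sign u) * ((-1) ^ (n - b) * T (take b (permute_list u vs) @ v # drop b (permute_list u vs)))"
    using c assms b permute_list_compose[of "ins_cycle n b" "vs @ [v]" u] u
    by (simp add: sign_compose permute_list_snoc permute_list_ins_cycle)
  qed
  finally show "(SUM u | u permutes {..<n}. ?f (u o ?t)) = (SUM u | u permutes {..<n}.
    of_int (sign u) * ((-1) ^ (n - b) * T (take b (permute_list u vs) @ v # drop b (permute_list u vs))))" . qed
 also have "... = alt_sum n (%us. SUM b<=n. (-1) ^ (n - b) * T (take b us @ v # drop b us)) vs"
  unfolding alt_sum_def sum_distrib_left ins(2) by (rule sum.swap)
 finally show ?thesis .
qed

text \<open>Of the \<open>k + l\<close> places for the last vector, \<open>k\<close> fall into the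
  argument of \<open>F\<close> and \<open>l\<close> into that of \<open>G\<close>. Moved to the
  front of its part, the vector yields a contraction with a sign that is the same for all places in
  that part, and the factors \<open>k\<close> and \<open>l\<close> build up
  \<open>k! l!\<close>.\<close>

lemma alt_sum_lwedge:
 fixes V :: "'v::real_vector set"
 assumes V: "subspace V"
 shows "vs : lists V ==> length vs = k + l ==> alt_on V F ==> alt_on V G ==> homog k F ==> homog l G ==>
  alt_sum (k + l) (%us. F (take k us) * G (drop k us)) vs = fact k * fact l * lwedge F G vs"
proof (induction vs arbitrary: k l F G rule: rev_induct)
 case Nil
 thus ?case by (simp add: alt_sum_def sign_id permutes_empty)
next
 case (snoc v vs)
 interpret lmodule "UNIV :: real set" V scaleR using lmodule_subspace[OF V] .
 let ?T = "%us. F (take k us) * G (drop k us)"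
 obtain n where n: "k + l = Suc n" "length vs = n" using snoc.prems(2) by auto
 have v: "v : V" "vs : lists V" using snoc.prems(1) by auto
 note F = altf_alt0[OF snoc.prems(3)] and G = altf_alt0[OF snoc.prems(4)]
 let ?A = "%us. contract v F (take (k - 1) us) * G (drop (k - 1) us)"
  and ?B = "%us. F (take k us) * contract v G (drop k us)"
 have ins: "(SUM b<=n. (-1) ^ (n - b) * ?T (take b us @ v # drop b us)) = (-1) ^ n * k * ?A us + ((-1) ^ (n - k) * l) * ?B us"
  if us: "length us = n" "set us = set vs" for us
 proof -
  have l: "take i us : lists V" "drop i us : lists V" "take i (drop j us) : lists V" for i j
   using v(2) us(2) by (auto dest!: in_set_takeD in_set_dropD)
  have lo: "(-1) ^ (n - b) * ?T (take b us @ v # drop b us) = (-1) ^ n * ?A us" if b: "b < k" for b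
  proof -
   have "take k (take b us @ v # drop b us) = take b us @ v # take (k - 1 - b) (drop b us)"
    using b n us by (simp add: take_Cons' min_def)
   hence "F (take k (take b us @ v # drop b us)) = (-1) ^ length (take b us) * F (v # take b us @ take (k - 1 - b) (drop b us))"
    using alt0_move[OF F l(1) l(3) v(1), of b "k - 1 - b" b] by simp
   moreover have "take b us @ take (k - 1 - b) (drop b us) = take (k - 1) us"
    using b take_add[of b "k - 1 - b" us] by simp
   moreover have "drop k (take b us @ v # drop b us) = drop (k - 1) us" using b n us by (simp add: drop_Cons')
   moreover have "(-1 :: real) ^ (n - b) * (-1) ^ b = (-1) ^ n" using b n by (simp flip: power_add)
   ultimately show ?thesis using b n us by (simp add: contract_apply min_def flip: mult.assoc)
  qed
  have hi: "(-1) ^ (n - b) * ?T (take b us @ v # drop b us) = (-1) ^ (n - k) * ?B us" if b: "k <= b" "b <= n" for b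
  proof -
   have "drop k (take b us @ v # drop b us) = take (b - k) (drop k us) @ v # drop (b - k) (drop k us)"
    using b us by (simp add: drop_take)
   hence "G (drop k (take b us @ v # drop b us)) = (-1) ^ length (take (b - k) (drop k us)) * G (v # drop k us)"
    using alt0_move[OF G l(3) l(2) v(1), of "b - k" k b] append_take_drop_id[of "b - k" "drop k us"] b by simp
   moreover have "(-1 :: real) ^ (n - b) * (-1) ^ (b - k) = (-1) ^ (n - k)" using b by (simp flip: power_add)
   ultimately show ?thesis using b us by (simp add: contract_apply min_def flip: mult.assoc)
  qed
  have "{..n} = {..<k} Un {k..n}" using n by auto
  hence "(SUM b<=n. h b) = (SUM b<k. h b) + (SUM b:{k..n}. h b)" for h :: "nat => real"
   by (simp add: sum.union_disjoint Int_absorb2 disjoint_iff)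
  moreover have "Suc n - k = l" using n by simp
  ultimately show ?thesis using lo hi by simp
 qed
 \<comment> \<open>For \<open>k = 0\<close>, where \<open>k - 1\<close> is truncated, the left side
   vanishes by its factor and the right side because the contraction of a 0-form is 0.\<close>
 have A: "real k * alt_sum n ?A vs = fact k * fact l * lwedge (contract v F) G vs"
 proof (cases k)
  case (Suc j)
  thus ?thesis
   using snoc.IH[of j l "contract v F" G] n v snoc.prems altf_contract[OF _ v(1)] homog_contract_Suc[of j F v] by simp
 qed (use snoc.prems(5) homog_0_contract[of F v] in simp)
 have B: "real l * alt_sum n ?B vs = fact k * fact l * lwedge F (contract v G) vs"
 proof (cases l)
  case (Suc j)
  thus ?thesis
   using snoc.IH[of k j F "contract v G"] n v snoc.prems altf_contract[OF _ v(1)] homog_contract_Suc[of j G v] by simp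
 qed (use snoc.prems(6) homog_0_contract[of G v] in simp)
 have sgn: "(-1 :: real) ^ (n - k) * l = (-1) ^ n * ((-1) ^ k * l)"
  using n by (cases l) (auto simp: power_add simp flip: power_mult_distrib mult.assoc)
 have "alt_sum (k + l) ?T (vs @ [v]) = alt_sum n (%us. (-1) ^ n * k * ?A us + ((-1) ^ (n - k) * l) * ?B us) vs"
  unfolding n(1) alt_sum_insert[OF n(2)] by (rule alt_sum_cong[OF n(2)]) (rule ins)
 also have "... = (-1) ^ n * (real k * alt_sum n ?A vs + (-1) ^ k * (real l * alt_sum n ?B vs))"
  unfolding alt_sum_add alt_sum_scale using sgn by (auto simp: algebra_simps)
 also have "... = fact k * fact l * ((-1) ^ n * lwedge F G (v # vs))"
  unfolding A B lwedge.simps homog_invol[OF snoc.prems(5)] lwedge_scale_left by (simp add: algebra_simps)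
 \<comment> \<open>The recursion of \<open>lwedge\<close> takes vectors from the front, the
   permutation sum from the end; moving \<open>v\<close> across the other \<open>n\<close> vectors
   accounts for the sign.\<close>
 also have "(-1) ^ n * lwedge F G (v # vs) = lwedge F G (vs @ [v])"
  using alt0_move[OF altf_alt0[OF altf_lwedge[OF snoc.prems(3,4)]] v(2) lists.Nil v(1)] n(2) by simp
 finally show ?case .
qed

context lie_rinehart
begin

lemma llie_formula:
 "vs : lists L ==> v : L ==> alt0 F ==>
  llie v F vs = rho v (F vs) - (SUM j<length vs. (-1) ^ j * F (br v (vs ! j) # nths vs (- {j})))"
proof (induction vs arbitrary: F)
 case (Cons w ws)
 hence w: "w : L" "ws : lists L" "v : L" by auto
 have n: "nths ws (- {j}) : lists L" for j using w(2) set_nths_subset[of ws] by auto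
 have sw: "F (w # br v (ws ! j) # nths ws (- {j})) = - F (br v (ws ! j) # w # nths ws (- {j}))" if "j < length ws" for j
  using alt0_swap[OF Cons.prems(3), of "[]" "nths ws (- {j})" w "br v (ws ! j)"] n w br_closed that
  by (auto simp: in_lists_conv_set)
 have nz: "nths (w # ws) (- {0}) = ws" "nths (w # ws) (- {Suc j}) = w # nths ws (- {j})" for j
  by (auto simp: nths_Cons nths_all intro!: arg_cong[of _ _ "nths ws"])
 have "(SUM j<length (w # ws). (-1) ^ j * F (br v ((w # ws) ! j) # nths (w # ws) (- {j}))) =
   F (br v w # ws) + (SUM j<length ws. (-1) ^ Suc j * F (br v (ws ! j) # w # nths ws (- {j})))"
  by (simp add: sum.lessThan_Suc_shift nz del: sum.lessThan_Suc)
 also have "(SUM j<length ws. (-1) ^ Suc j * F (br v (ws ! j) # w # nths ws (- {j}))) =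
   (SUM j<length ws. (-1) ^ j * contract w F (br v (ws ! j) # nths ws (- {j})))" using sw by (intro sum.cong) auto
 finally show ?case using Cons.IH[OF w(2,3) alt0_contract[OF Cons.prems(3) w(1)]] by (simp add: contract_apply[of w F ws])
qed simp

text \<open>The bridge from Cartan's recursion to the index formula in \<open>d_on_sections\<close>:
  terms with the first vector come from \<open>llie_formula\<close>, the others from the
  differential of the contraction, after exchanging that vector with the bracket.\<close>

lemma ld_formula:
 "vs : lists L ==> alt0 F ==> ld F vs = (SUM i<length vs. (-1) ^ i * rho (vs ! i) (F (nths vs (- {i})))) +
   (SUM j<length vs. SUM i<j. (-1) ^ (i + j) * F (br (vs ! i) (vs ! j) # nths vs (- {i, j})))" proof (induction vs arbitrary: F)
 case (Cons w ws)
 hence w: "w : L" "ws : lists L" by auto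
 have n: "nths ws X : lists L" for X using w(2) set_nths_subset[of ws] by auto
 have sw: "F (w # br (ws ! i) (ws ! j) # nths ws X) = - F (br (ws ! i) (ws ! j) # w # nths ws X)"
  if "i < j" "j < length ws" for i j X
  using alt0_swap[OF Cons.prems(2), of "[]" "nths ws X" w "br (ws ! i) (ws ! j)"] n w br_closed that
  by (auto simp: in_lists_conv_set)
 have nz: "nths (w # ws) (- {0}) = ws" "nths (w # ws) (- {Suc j}) = w # nths ws (- {j})"
  "nths (w # ws) (- {0, Suc j}) = nths ws (- {j})"
  "nths (w # ws) (- {Suc i, Suc j}) = w # nths ws (- {i, j})" for i j
  by (auto simp: nths_Cons nths_all intro!: arg_cong[of _ _ "nths ws"])
 have "(SUM i<length (w # ws). (-1) ^ i * rho ((w # ws) ! i) (F (nths (w # ws) (- {i})))) =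
   rho w (F ws) - (SUM i<length ws. (-1) ^ i * rho (ws ! i) (contract w F (nths ws (- {i}))))"
  by (simp add: sum.lessThan_Suc_shift nz sum_negf contract_apply del: sum.lessThan_Suc)
 moreover have "(SUM j<length (w # ws). SUM i<j. (-1) ^ (i + j) * F (br ((w # ws) ! i) ((w # ws) ! j) # nths (w # ws) (- {i, j})))
   = - (SUM j<length ws. (-1) ^ j * F (br w (ws ! j) # nths ws (- {j})))
    - (SUM j<length ws. SUM i<j. (-1) ^ (i + j) * contract w F (br (ws ! i) (ws ! j) # nths ws (- {i, j})))" proof -
  have "(SUM j<length (w # ws). SUM i<j. (-1) ^ (i + j) * F (br ((w # ws) ! i) ((w # ws) ! j) # nths (w # ws) (- {i, j})))
   = (SUM j<length ws. (-1) ^ Suc j * F (br w (ws ! j) # nths ws (- {j})) +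
     (SUM i<j. (-1) ^ (i + j) * F (br (ws ! i) (ws ! j) # w # nths ws (- {i, j}))))"
   by (simp add: sum.lessThan_Suc_shift nz del: sum.lessThan_Suc)
  also have "... = (SUM j<length ws. - ((-1) ^ j * F (br w (ws ! j) # nths ws (- {j}))) -
     (SUM i<j. (-1) ^ (i + j) * contract w F (br (ws ! i) (ws ! j) # nths ws (- {i, j}))))"
   using sw by (intro sum.cong refl) (auto simp: sum_negf)
  finally show ?thesis by (simp add: sum_subtractf sum_negf)
 qed
 ultimately show ?case using Cons.IH[OF w(2) alt0_contract[OF Cons.prems(2) w(1)]] llie_formula[OF w(2,1) Cons.prems(2)]
  by simp
qed simp

end

section \<open>Sections and forms of vector bundles\<close>

lemma sum_apply: "(SUM i:I. f i) x = (SUM i:I. f i x)" by (induction I rule: infinite_finite_induct) auto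

text \<open>\<open>basis_at\<close> speaks of the set of vectors, frames need coefficients by
  position; the distinctness of the list is what makes the two descriptions equivalent.\<close>

lemma basis_at_iff:
 "basis_at es p F \<longleftrightarrow> (ALL c. (SUM i<length es. c i *R (es ! i) p) = 0 --> (ALL i<length es. c i = (0::real))) &
  F = {(SUM i<length es. c i *R (es ! i) p) | c. True}" proof - define vs where "vs = map (%e. e p) es"
 define n where "n = length es"
 have nth: "vs ! i = (es ! i) p" if "i < n" for i using that by (simp add: vs_def n_def)
 have len: "length vs = n" by (simp add: vs_def n_def)
 have set: "set vs = (%i. vs ! i) ` {..<n}" by (auto simp: len set_conv_nth)
 have in_span: "(SUM i<n. c i *R vs ! i) : span (set vs)" for c :: "nat => real"
  by (intro span_sum span_mul span_base) (simp add: set)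
 have sum_eq: "(SUM i<n. c i *R (es ! i) p) = (SUM i<n. c i *R vs ! i)" for c :: "nat => real"
  by (intro sum.cong) (auto simp: nth)
 show ?thesis
 proof
  assume "basis_at es p F"
  hence d: "distinct vs" and ind: "independent (set vs)" and sp: "span (set vs) = F"
   by (auto simp: basis_at_def vs_def)
  have inj: "inj_on ((!) vs) {..<n}" using d by (auto simp: inj_on_def nth_eq_iff_index_eq len)
  have re: "(SUM i<n. u (vs ! i) *R vs ! i) = (SUM v:set vs. u v *R v)" for u :: "'b => real"
   unfolding set by (simp add: sum.reindex[OF inj])
  have lift: "EX u. ALL i<n. c i = u (vs ! i)" for c :: "nat => real"
   by (rule exI[of _ "%v. c (the_inv_into {..<n} ((!) vs) v)"]) (use the_inv_into_f_f[OF inj] in auto)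
  show "(ALL c. (SUM i<length es. c i *R (es ! i) p) = 0 --> (ALL i<length es. c i = (0::real))) &
   F = {(SUM i<length es. c i *R (es ! i) p) | c. True}" unfolding n_def[symmetric] sum_eq
  proof (intro conjI allI impI equalityI subsetI)
   fix c :: "nat => real" and i assume z: "(SUM i<n. c i *R vs ! i) = 0" and i: "i < n"
   obtain u where u: "ALL i<n. c i = u (vs ! i)" using lift by blast
   hence "(SUM v:set vs. u v *R v) = 0" using z re[of u] by simp
   hence "u (vs ! i) = 0" using ind i set dependent_finite[of "set vs"] by blast
   thus "c i = 0" using u i by simp
  next
   fix x assume "x : F"
   then obtain u where "x = (SUM v:set vs. u v *R v)" using sp span_finite[of "set vs"] by auto
   thus "x : {(SUM i<n. c i *R vs ! i) | c. True}" using re[of u] by (intro CollectI exI[of _ "%i. u (vs ! i)"]) simp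
  next
   fix x assume "x : {(SUM i<n. c i *R vs ! i) | c. True}"
   thus "x : F" unfolding sp[symmetric] using in_span by auto
  qed
 next
  assume r: "(ALL c. (SUM i<length es. c i *R (es ! i) p) = 0 --> (ALL i<length es. c i = (0::real))) &
   F = {(SUM i<length es. c i *R (es ! i) p) | c. True}"
  hence ind: "!!c i. (SUM i<n. c i *R vs ! i) = 0 ==> i < n ==> c i = (0::real)"
   and sp: "F = {(SUM i<n. c i *R vs ! i) | c. True}" unfolding n_def[symmetric] sum_eq by blast+
  have inj: "inj_on ((!) vs) {..<n}"
  proof (rule inj_onI)
   fix i j assume ij: "i : {..<n}" "j : {..<n}" "vs ! i = vs ! j"
   show "i = j"
   proof (rule ccontr)
    assume ne: "i ~= j"
    \<comment> \<open>Two equal entries would satisfy the nontrivial relation with coefficients 1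
      and -1.\<close>
    define c :: "nat => real" where "c k = (if k = i then 1 else 0) - (if k = j then 1 else 0)" for k
    have "(SUM k<n. c k *R vs ! k) = (SUM k<n. (if k = i then vs ! k else 0) - (if k = j then vs ! k else 0))"
     by (intro sum.cong) (auto simp: c_def)
    also have "... = vs ! i - vs ! j" using ij by (simp add: sum_subtractf)
    finally have "c i = 0" using ind[of c i] ij by simp
    thus False using ne by (simp add: c_def)
   qed
  qed
  have re: "(SUM i<n. u (vs ! i) *R vs ! i) = (SUM v:set vs. u v *R v)" for u :: "'b => real"
   unfolding set by (simp add: sum.reindex[OF inj])
  have "distinct vs" using inj unfolding distinct_conv_nth inj_on_def by (auto simp: len)
  moreover have "independent (set vs)"
  proof
   assume "dependent (set vs)"
   then obtain u v where u: "v : set vs" "u v ~= 0" "(SUM v:set vs. u v *R v) = 0"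
    using dependent_finite[of "set vs"] by auto
   obtain i where "i < n" "v = vs ! i" using u(1) set by auto
   thus False using ind[of "%i. u (vs ! i)" i] re[of u] u by simp
  qed
  moreover have "span (set vs) = F"
  proof (intro equalityI subsetI)
   fix x assume "x : span (set vs)"
   then obtain u where "x = (SUM v:set vs. u v *R v)" using span_finite[of "set vs"] by auto
   thus "x : F" unfolding sp using re[of u] by (intro CollectI exI[of _ "%i. u (vs ! i)"]) simp
  next
   fix x assume "x : F"
   thus "x : span (set vs)" unfolding sp using in_span by auto
  qed
  ultimately show "basis_at es p F" by (simp add: basis_at_def vs_def)
 qed
qed

lemma basis_at_unique:
 fixes c d :: "nat => real"
 assumes "basis_at es p F" "(SUM i<length es. c i *R (es ! i) p) = (SUM i<length es. d i *R (es ! i) p)"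
  "i < length es"
 shows "c i = d i"
proof -
 have "(SUM i<length es. (c i - d i) *R (es ! i) p) = 0" using assms(2) by (simp add: scaleR_diff_left sum_subtractf)
 hence "c i - d i = 0"
  using assms(1)[unfolded basis_at_iff, THEN conjunct1, rule_format, of "%i. c i - d i" i] assms(3) by simp
 thus ?thesis by simp
qed

lemma basis_at_subspace: "basis_at es p F ==> subspace F" unfolding basis_at_def by (metis subspace_span)

text \<open>Meaningful for a basis list and a vector in its span; the values at indices from
  \<open>length es\<close> on stay arbitrary.\<close>

definition fcoef :: "('m => 'v::real_vector) list => 'm => 'v => nat => real" where
 "fcoef es p v = (SOME c. v = (SUM i<length es. c i *R (es ! i) p))"

lemma fcoef_sum:
 assumes "basis_at es p F" "v : F"
 shows "v = (SUM i<length es. fcoef es p v i *R (es ! i) p)"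
proof -
 have "EX c. v = (SUM i<length es. c i *R (es ! i) p)" using assms unfolding basis_at_iff by blast
 thus ?thesis unfolding fcoef_def by (rule someI_ex)
qed

lemma fcoef_eq:
 assumes "basis_at es p F" "v = (SUM i<length es. c i *R (es ! i) p)" "i < length es"
 shows "fcoef es p v i = c i"
proof -
 have "v : F" using assms(1,2) unfolding basis_at_iff by blast
 from fcoef_sum[OF assms(1) this] show ?thesis
  using basis_at_unique[OF assms(1) _ assms(3), of "fcoef es p v" c] assms(2) by simp
qed

lemma fcoef_add:
 assumes "basis_at es p F" "v : F" "w : F" "i < length es"
 shows "fcoef es p (v + w) i = fcoef es p v i + fcoef es p w i" by (rule fcoef_eq[OF assms(1) _ assms(4)])
  (simp add: scaleR_add_left sum.distrib fcoef_sum[OF assms(1,2), symmetric] fcoef_sum[OF assms(1,3), symmetric])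

lemma fcoef_scale:
 assumes "basis_at es p F" "v : F" "i < length es"
 shows "fcoef es p (a *R v) i = a * fcoef es p v i" by (rule fcoef_eq[OF assms(1) _ assms(3)])
  (simp add: scaleR_sum_right[symmetric] fcoef_sum[OF assms(1,2), symmetric] scaleR_scaleR[symmetric] del: scaleR_scaleR)

definition smul :: "('m => real) => ('m => 'v::real_vector) => 'm => 'v" where
 "smul g s = (%p. g p *R s p)"

locale vbundle = manifold M for M :: "('m::{t2_space,second_countable_topology}, 'e::real_inner) atlas" +
 fixes E :: "('m, 'v::real_vector, 'z) vbundle_scheme"
 assumes vbundle: "vector_bundle M E"
begin

lemma frame_at: obtains V es where "(V, es) : frames E" "p : V" using vbundle unfolding vector_bundle_def by blast

lemma frameD:
 assumes "(V, es) : frames E"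
 shows "open V" "p : V ==> basis_at es p (fibre E p)" "i < length es ==> es ! i : sections M E V"
proof -
 have "ALL (U, es):frames E. open U & (ALL p:U. basis_at es p (fibre E p)) & (ALL e:set es. e : sections M E U)"
  using vbundle unfolding vector_bundle_def by blast
 from bspec[OF this assms]
 show "open V" "p : V ==> basis_at es p (fibre E p)" "i < length es ==> es ! i : sections M E V" by auto
qed

lemma fibre_subspace: "subspace (fibre E p)"
proof -
 obtain V es where V: "(V, es) : frames E" "p : V" by (rule frame_at)
 show ?thesis by (rule basis_at_subspace[OF frameD(2)[OF V]])
qed

lemma sections_fibre: "s : sections M E U ==> p : U ==> s p : fibre E p" by (simp add: sections_def)

text \<open>The definition of \<open>sections\<close> only provides some smooth coefficients on each
  frame; uniqueness identifies them with \<open>fcoef\<close>.\<close>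

lemma sections_coef:
 assumes "s : sections M E U" "open U" "(V, es) : frames E" "p : U" "p : V" "i < length es"
 shows "smooth_at M (%x. fcoef es x (s x) i) p"
proof -
 obtain c where c: "!!i. i < length es ==> smooth_fun_on M (U Int V) (c i)"
  "!!p. p : U Int V ==> s p = (SUM i<length es. c i p *R (es ! i) p)"
 proof -
  have "ALL (V, es):frames E. EX c. (ALL i<length es. smooth_fun_on M (U Int V) (c i)) &
    (ALL p:U Int V. s p = (SUM i<length es. c i p *R (es ! i) p))" using assms(1) by (simp add: sections_def)
  from bspec[OF this assms(3)] show ?thesis using that by auto
 qed
 have o: "open (U Int V)" by (rule open_Int[OF assms(2) frameD(1)[OF assms(3)]])
 have "smooth_at M (c i) p" using c(1)[OF assms(6)] assms(4,5) smooth_fun_on_iff[OF o] by blast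
 thus ?thesis by (rule smooth_at_cong[OF _ o])
   (use assms(4,5) fcoef_eq[OF frameD(2)[OF assms(3)] c(2) assms(6)] in auto)
qed

lemma sectionsI:
 assumes "open U" "!!p. p : U ==> s p : fibre E p"
  and "!!V es p i. (V, es) : frames E ==> p : U ==> p : V ==> i < length es ==> smooth_at M (%x. fcoef es x (s x) i) p"
 shows "s : sections M E U"
proof -
 have "EX c. (ALL i<length es. smooth_fun_on M (U Int V) (c i)) &
   (ALL p:U Int V. s p = (SUM i<length es. c i p *R (es ! i) p))" if V: "(V, es) : frames E" for V es
 proof (rule exI[of _ "%i x. fcoef es x (s x) i"], intro conjI allI impI ballI)
  have o: "open (U Int V)" by (rule open_Int[OF assms(1) frameD(1)[OF V]])
  show "smooth_fun_on M (U Int V) (%x. fcoef es x (s x) i)" if "i < length es" for i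
   unfolding smooth_fun_on_iff[OF o] using assms(3)[OF V] that by blast
  show "s p = (SUM i<length es. fcoef es p (s p) i *R (es ! i) p)" if "p : U Int V" for p
   using fcoef_sum[OF frameD(2)[OF V]] that assms(2) by auto
 qed
 thus ?thesis using assms(2) unfolding sections_def by blast
qed

lemma sections_mono:
 assumes "s : sections M E U" "open U" "open U'" "U' <= U" shows "s : sections M E U'"
 using assms by (intro sectionsI) (auto intro: sections_fibre sections_coef)

lemma sections_localI:
 assumes "open U" "!!p. p : U ==> EX W. open W & p : W & s : sections M E W"
 shows "s : sections M E U"
proof (rule sectionsI[OF assms(1)])
 fix p assume "p : U"
 then obtain W where W: "open W" "p : W" "s : sections M E W" using assms(2) by blast
 thus "s p : fibre E p" by (simp add: sections_fibre)
 show "smooth_at M (%x. fcoef es x (s x) i) p" if "(V, es) : frames E" "p : V" "i < length es" for V es i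
  using sections_coef[OF W(3,1) that(1) W(2) that(2,3)] .
qed

lemma sections_cong:
 assumes "s : sections M E U" "!!p. p : U ==> s p = t p" shows "t : sections M E U"
 using assms unfolding sections_def by (auto 0 3)

lemma sections_add:
 assumes "open U" "s : sections M E U" "t : sections M E U"
 shows "(%p. s p + t p) : sections M E U"
proof (rule sectionsI[OF assms(1)])
 show "s p + t p : fibre E p" if "p : U" for p using sections_fibre assms that fibre_subspace subspace_add by blast
 fix V es p i assume V: "(V, es) : frames E" "p : U" "p : V" "i < length es"
 have o: "open (U Int V)" by (rule open_Int[OF assms(1) frameD(1)[OF V(1)]])
 show "smooth_at M (%x. fcoef es x (s x + t x) i) p"
  by (rule smooth_at_cong[OF smooth_at_add[OF sections_coef[OF assms(2,1) V] sections_coef[OF assms(3,1) V]] o])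
   (use V fcoef_add[OF frameD(2)[OF V(1)]] sections_fibre assms in auto)
qed

lemma sections_smul:
 assumes "open U" "!!p. p : U ==> smooth_at M g p" "s : sections M E U"
 shows "(%p. g p *R s p) : sections M E U"
proof (rule sectionsI[OF assms(1)])
 show "g p *R s p : fibre E p" if "p : U" for p using sections_fibre assms that fibre_subspace subspace_mul by blast
 fix V es p i assume V: "(V, es) : frames E" "p : U" "p : V" "i < length es"
 have o: "open (U Int V)" by (rule open_Int[OF assms(1) frameD(1)[OF V(1)]])
 show "smooth_at M (%x. fcoef es x (g x *R s x) i) p"
  by (rule smooth_at_cong[OF smooth_at_mult[OF assms(2) sections_coef[OF assms(3,1) V]] o])
   (use V fcoef_scale[OF frameD(2)[OF V(1)]] sections_fibre assms in auto)
qed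

lemma sections_zero: "open U ==> (%p. 0) : sections M E U"
proof (rule sectionsI)
 fix V es p i assume V: "open U" "(V, es) : frames E" "p : U" "p : V" "i < length es"
 show "smooth_at M (%x. fcoef es x 0 i) p" by (rule smooth_at_cong[OF smooth_at_const[of 0] frameD(1)[OF V(2)] V(4)])
   (use fcoef_eq[OF frameD(2)[OF V(2)] _ V(5), of _ 0 "%_. 0"] in auto)
qed (auto simp: subspace_0[OF fibre_subspace])

lemma sections_sum:
 assumes "open U" "!!i. i : I ==> s i : sections M E U"
 shows "(%p. SUM i:I. s i p) : sections M E U" using assms(2)
proof (induction I rule: infinite_finite_induct)
 case (insert i I)
 hence "(%p. s i p + (SUM i:I. s i p)) : sections M E U" by (intro sections_add assms(1)) auto
 thus ?case using insert(1,2) by simp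
qed (auto intro: sections_zero assms(1))

lemma section_cutoff:
 assumes "h : smooth_funs M" "closed C" "C <= U" "!!x. x ~: C ==> h x = 0" "open U" "s : sections M E U"
 shows "(%p. h p *R s p) : \<Gamma> M E"
proof (rule sections_localI[OF open_UNIV])
 fix p
 show "EX W. open W & p : W & (%p. h p *R s p) : sections M E W"
 proof (cases "p : C")
  case True
  thus ?thesis using assms by (intro exI[of _ U]) (auto intro!: sections_smul simp: smooth_funs_iff)
 next
  case False
  have "(%p. h p *R s p) : sections M E (- C)" by (rule sections_cong[OF sections_zero]) (use assms in auto)
  thus ?thesis using False assms by (intro exI[of _ "- C"]) auto
 qed
qed

lemma section_extend:
 assumes "open U" "p : U" "s : sections M E U"
 obtains t W where "t : \<Gamma> M E" "open W" "p : W" "W <= U" "!!x. x : W ==> t x = s x"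
proof -
 obtain h W C where "h : smooth_funs M" "open W" "p : W" "W <= C" "closed C" "C <= U"
  "!!x. x : W ==> h x = 1" "!!x. x ~: C ==> h x = 0" using bump[OF assms(1,2)] by metis
 thus ?thesis using section_cutoff[of h C U s] assms by (intro that[of "%x. h x *R s x" W]) auto
qed

text \<open>The Lie-Rinehart calculus knows only global sections and functions. Therefore the frame
  consists of global sections, and the coefficients over \<open>W\<close> are restrictions of global
  smooth functions.\<close>

definition framed :: "'m set => ('m => 'v) list => bool" where
 "framed W es \<longleftrightarrow> open W & set es <= \<Gamma> M E & (ALL x:W. basis_at es x (fibre E x)) &
  (ALL s:\<Gamma> M E. EX a. (ALL i<length es. a i : smooth_funs M) &
   (ALL x:W. s x = (SUM i<length es. a i x *R (es ! i) x)))" lemma framedD: assumes "framed W es"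
 shows "open W" "set es <= \<Gamma> M E" "x : W ==> basis_at es x (fibre E x)"
  "s : \<Gamma> M E ==> EX a. (ALL i<length es. a i : smooth_funs M) & (ALL x:W. s x = (SUM i<length es. a i x *R (es ! i) x))"
 using assms by (simp_all add: framed_def)

text \<open>Frame members and coefficients are both multiplied by a bump function that is 1 on
  \<open>W\<close>, so the expansions over \<open>W\<close> are unaffected.\<close>

lemma global_frame: obtains W es where "p : W" "framed W es"
proof -
 obtain V es where V: "(V, es) : frames E" "p : V" by (rule frame_at)
 note oV = frameD(1)[OF V(1)]
 obtain h W C where h: "h : smooth_funs M" "open W" "p : W" "W <= C" "closed C" "C <= V"
  "!!x. x : W ==> h x = 1" "!!x. x ~: C ==> h x = 0" using bump[OF oV V(2)] by metis
 define es' where "es' = map (%e x. h x *R e x) es"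
 have eq: "map (%e. e x) es' = map (%e. e x) es" if "x : W" for x using h(7)[OF that] by (simp add: es'_def)
 have nth: "(es' ! i) x = (es ! i) x" if "x : W" "i < length es" for x i using h(7)[OF that(1)] that by (simp add: es'_def)
 show ?thesis
 proof (rule that[of W es'], rule h(3), unfold framed_def, intro conjI ballI)
  show "set es' <= \<Gamma> M E" using section_cutoff[OF h(1,5,6,8) oV] frameD(3)[OF V(1)] by (auto simp: es'_def in_set_conv_nth)
  show "basis_at es' x (fibre E x)" if "x : W" for x
   using frameD(2)[OF V(1), of x] h(4,6) that unfolding basis_at_def eq[OF that] by auto
  show "EX a. (ALL i<length es'. a i : smooth_funs M) & (ALL x:W. s x = (SUM i<length es'. a i x *R (es' ! i) x))"
   if s: "s : \<Gamma> M E" for s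
  proof (rule exI[of _ "%i x. h x * fcoef es x (s x) i"], intro conjI allI impI ballI)
   show "(%x. h x * fcoef es x (s x) i) : smooth_funs M" if "i < length es'" for i
    using that sections_coef[OF s open_UNIV V(1)] by (intro smooth_cutoff[OF h(1,5,6,8)]) (auto simp: es'_def)
   show "s x = (SUM i<length es'. (h x * fcoef es x (s x) i) *R (es' ! i) x)" if x: "x : W" for x
   proof -
    have "s x = (SUM i<length es. fcoef es x (s x) i *R (es ! i) x)"
     using fcoef_sum[OF frameD(2)[OF V(1)]] x h(4,6) sections_fibre[OF s] by blast
    also have "... = (SUM i<length es'. (h x * fcoef es x (s x) i) *R (es' ! i) x)"
     using nth[OF x] h(7)[OF x] by (intro sum.cong) (auto simp: es'_def)
    finally show ?thesis .
   qed
  qed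
 qed (rule h)
qed

lemma section_through:
 assumes "v : fibre E p" obtains s where "s : \<Gamma> M E" "s p = v"
proof -
 obtain W es where p: "p : W" and fr: "framed W es" by (rule global_frame)
 note W = framedD(1)[OF fr] p framedD(2-4)[OF fr]
 have 1: "v = (SUM i<length es. fcoef es p v i *R (es ! i) p)" using fcoef_sum[OF W(4)[OF W(2)] assms] .
 have 2: "(%x. SUM i<length es. fcoef es p v i *R (es ! i) x) : \<Gamma> M E"
 proof (intro sections_sum[OF open_UNIV] sections_smul[OF open_UNIV] smooth_at_const)
  show "es ! i : \<Gamma> M E" if "i : {..<length es}" for i using W(3) nth_mem[of i es] that by blast
 qed
 show ?thesis by (rule that[OF 2 1[symmetric]])
qed

sublocale sec: lmodule "smooth_funs M" "\<Gamma> M E" smul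
proof
 show "(0 :: 'm => real) : smooth_funs M" "(1 :: 'm => real) : smooth_funs M"
  using smooth_funs_closed(1)[of 0] smooth_funs_closed(1)[of 1] by (simp_all add: zero_fun_def one_fun_def)
 show "g + h : smooth_funs M" "g * h : smooth_funs M" "- g : smooth_funs M"
  if "g : smooth_funs M" "h : smooth_funs M" for g h
  using smooth_funs_closed(2,3)[OF that] smooth_funs_closed(4)[OF that(1)]
  by (simp_all add: plus_fun_def times_fun_def fun_Compl_def)
 show "(0 :: 'm => 'v) : \<Gamma> M E" using sections_zero[OF open_UNIV] by (simp add: zero_fun_def)
 show "v + w : \<Gamma> M E" if "v : \<Gamma> M E" "w : \<Gamma> M E" for v w using sections_add[OF open_UNIV that] by (simp add: plus_fun_def)
 show "- v : \<Gamma> M E" if "v : \<Gamma> M E" for v using sections_smul[OF open_UNIV _ that, of "%_. -1"] by (simp add: fun_Compl_def)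
 show "smul g v : \<Gamma> M E" if "g : smooth_funs M" "v : \<Gamma> M E" for g v
  using sections_smul[OF open_UNIV _ that(2), of g] that(1) by (simp add: smul_def smooth_funs_iff)
qed

text \<open>A section vanishing at \<open>p\<close> is a combination of sections with coefficients vanishing at \<open>p\<close>.\<close>

lemma altf_vanish:
 assumes F: "sec.altf F" and u: "u : \<Gamma> M E" "u p = 0" and l: "xs : lists (\<Gamma> M E)" "ys : lists (\<Gamma> M E)"
 shows "F (xs @ u # ys) p = 0"
proof -
 obtain W es where p: "p : W" and fr: "framed W es" by (rule global_frame)
 note W = framedD(1)[OF fr] p framedD(2-4)[OF fr]
 obtain a where a: "!!i. i < length es ==> a i : smooth_funs M"
  "!!x. x : W ==> u x = (SUM i<length es. a i x *R (es ! i) x)" using W(5)[OF u(1)] by blast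
 have a0: "a i p = 0" if "i < length es" for i using W(4)[OF W(2)] a(2)[OF W(2)] u(2) that unfolding basis_at_iff by metis
 obtain h W' C where h: "h : smooth_funs M" "open W'" "p : W'" "W' <= C" "closed C" "C <= W"
  "!!x. x : W' ==> h x = 1" "!!x. x ~: C ==> h x = 0" using bump[OF W(1,2)] by metis
 define s where "s n = (SUM i<n. smul (%x. h x * a i x) (es ! i))" for n
 have es: "es ! i : \<Gamma> M E" if "i < length es" for i using W(3) that by auto
 have g: "(%x. h x * a i x) : smooth_funs M" if "i < length es" for i using smooth_funs_closed(3)[OF h(1) a(1)[OF that]] .
 have s: "s n : \<Gamma> M E & F (xs @ s n # ys) p = 0" if "n <= length es" for n using that
 proof (induction n)
  case 0
  have z: "F (xs @ (0 + 0) # ys) = F (xs @ 0 # ys) + F (xs @ 0 # ys)"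
   using sec.alt0_add[OF sec.altf_alt0[OF F] l sec.L_zero sec.L_zero] .
  have s0: "s 0 = 0" by (simp add: s_def)
  have "F (xs @ 0 # ys) p = 0" using fun_cong[OF z, of p] by simp
  thus ?case unfolding s0 using sec.L_zero by blast
 next
  case (Suc n)
  have t: "smul (%x. h x * a n x) (es ! n) : \<Gamma> M E" using sec.L_sm[OF g es] Suc.prems by simp
  have "F (xs @ smul (%x. h x * a n x) (es ! n) # ys) = (%x. h x * a n x) * F (xs @ (es ! n) # ys)"
   using sec.altf_sm[OF F l es g] Suc.prems by simp
  hence "F (xs @ smul (%x. h x * a n x) (es ! n) # ys) p = 0" using a0 Suc.prems by simp
  moreover have eq: "F (xs @ (s n + smul (%x. h x * a n x) (es ! n)) # ys) =
    F (xs @ s n # ys) + F (xs @ smul (%x. h x * a n x) (es ! n) # ys)"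
   using Suc t by (intro sec.alt0_add[OF sec.altf_alt0[OF F] l]) auto
  have sS: "s (Suc n) = s n + smul (%x. h x * a n x) (es ! n)" by (simp add: s_def)
  have "F (xs @ s (Suc n) # ys) p = F (xs @ s n # ys) p + F (xs @ smul (%x. h x * a n x) (es ! n) # ys) p"
   unfolding sS eq by (rule plus_fun_apply)
  moreover have "s (Suc n) : \<Gamma> M E" unfolding sS using Suc t by (intro sec.L_add) auto
  ultimately show ?case using Suc by simp
 qed
 have r: "(%x. 1 - h x) : smooth_funs M" using h(1) by (intro smooth_funs_closed)
 \<comment> \<open>The frame is available near \<open>p\<close> only; the remainder
   \<open>(1 - h) u\<close> is harmless because its coefficient vanishes at \<open>p\<close> as
   well.\<close>
 have "u = smul (%x. 1 - h x) u + s (length es)"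
 proof
  fix x
  have "s (length es) x = h x *R (SUM i<length es. a i x *R (es ! i) x)"
   unfolding s_def sum_apply by (simp add: smul_def scaleR_sum_right)
  also have "... = h x *R u x" by (cases "x : W") (use a(2) h(6,8) in auto)
  finally show "u x = (smul (%x. 1 - h x) u + s (length es)) x" by (simp add: smul_def scaleR_diff_left)
 qed
 hence "F (xs @ u # ys) = F (xs @ (smul (%x. 1 - h x) u + s (length es)) # ys)" by simp
 also have "... = F (xs @ smul (%x. 1 - h x) u # ys) + F (xs @ s (length es) # ys)"
  using s sec.L_sm[OF r u(1)] by (intro sec.alt0_add[OF sec.altf_alt0[OF F] l]) auto
 also have "F (xs @ smul (%x. 1 - h x) u # ys) = (%x. 1 - h x) * F (xs @ u # ys)" using sec.altf_sm[OF F l u(1) r] .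
 finally have "F (xs @ u # ys) p = (1 - h p) * F (xs @ u # ys) p + F (xs @ s (length es) # ys) p"
  by (metis plus_fun_apply times_fun_apply)
 thus ?thesis using s[of "length es"] h(3,7) by simp
qed

text \<open>Function linearity makes \<open>F\<close> a tensor: arguments are exchanged one at a
  time, and each exchange changes the value at \<open>p\<close> by a term with an argument vanishing
  at \<open>p\<close>.\<close>

lemma altf_pointwise:
 assumes F: "sec.altf F" and l: "vs : lists (\<Gamma> M E)" "ws : lists (\<Gamma> M E)"
  and eq: "eval_sections vs p = eval_sections ws p"
 shows "F vs p = F ws p"
proof -
 have "F (xs @ vs) p = F (xs @ ws) p" if "xs : lists (\<Gamma> M E)" for xs using that l eq
 proof (induction vs arbitrary: ws xs)
  case (Cons v vs)
  then obtain w us where ws: "ws = w # us" "v p = w p" "eval_sections vs p = eval_sections us p"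
   by (cases ws) (auto simp: eval_sections_def)
  have l: "v : \<Gamma> M E" "w : \<Gamma> M E" "vs : lists (\<Gamma> M E)" "us : lists (\<Gamma> M E)" "xs : lists (\<Gamma> M E)"
   using Cons.prems ws by auto
  have "F (xs @ (w + (v + - w)) # vs) = F (xs @ w # vs) + F (xs @ (v + - w) # vs)"
   using l by (intro sec.alt0_add[OF sec.altf_alt0[OF F]] sec.L_add sec.L_minus)
  moreover have "F (xs @ (v + - w) # vs) p = 0"
   using l ws(2) by (intro altf_vanish[OF F]) (auto intro: sec.L_add[OF l(1) sec.L_minus[OF l(2)], simplified])
  ultimately have "F (xs @ v # vs) p = F (xs @ w # vs) p" by simp
  also have "... = F (xs @ w # us) p" using Cons.IH[of "xs @ [w]" us] l ws(3) by simp
  finally show ?case using ws(1) by simp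
 qed (simp add: eval_sections_def)
 from this[of "[]"] show ?thesis by simp
qed

section \<open>Forms on fibres and alternating functions of global sections\<close>

definition extend_vec :: "'m => 'v => 'm => 'v" where
 "extend_vec p v = (SOME s. s : \<Gamma> M E & s p = v)"

lemma extend_vec: "v : fibre E p ==> extend_vec p v : \<Gamma> M E" "v : fibre E p ==> extend_vec p v p = v"
proof -
 assume "v : fibre E p"
 hence "EX s. s : \<Gamma> M E & s p = v" using section_through by metis
 from someI_ex[OF this] show "extend_vec p v : \<Gamma> M E" "extend_vec p v p = v" by (simp_all add: extend_vec_def)
qed

lemma extend_list:
 "set us <= fibre E p ==> map (extend_vec p) us : lists (\<Gamma> M E)"
 "set us <= fibre E p ==> eval_sections (map (extend_vec p) us) p = us"
 by (auto simp: extend_vec eval_sections_def map_idI subset_iff)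

text \<open>The inverse of \<open>on_sections\<close>; by \<open>altf_pointwise\<close> the choice
  of the extensions does not matter. The value 0 off the fibre is the convention of
  \<open>forms_on\<close>.\<close>

definition on_fibre :: "(('m => 'v) list => 'm => real) => ('m, 'v) form" where
 "on_fibre F p us = (if set us <= fibre E p then F (map (extend_vec p) us) p else 0)"

definition on_sections :: "('m, 'v) form => ('m => 'v) list => 'm => real" where
 "on_sections w = (%vs p. w p (eval_sections vs p))"

lemma eval_fibre: "vs : lists (\<Gamma> M E) ==> set (eval_sections vs p) <= fibre E p"
 using sections_fibre by (fastforce simp: eval_sections_def)

lemma on_fibre_eval:
 assumes "sec.altf F" "vs : lists (\<Gamma> M E)"
 shows "on_fibre F p (eval_sections vs p) = F vs p"
 using eval_fibre[OF assms(2), of p] extend_list[OF eval_fibre[OF assms(2), of p]]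
  altf_pointwise[OF assms(1) extend_list(1) assms(2)] by (simp add: on_fibre_def)

lemma on_fibre_alt:
 assumes F: "sec.altf F" shows "alt_on (fibre E p) (on_fibre F p)"
proof -
 interpret pt: lmodule "UNIV :: real set" "fibre E p" scaleR using lmodule_subspace[OF fibre_subspace] .
 have ex: "map (extend_vec p) us : lists (\<Gamma> M E)" "eval_sections (map (extend_vec p) us) p = us" if "us : lists (fibre E p)" for us
  using extend_list[of us p] that by auto
 have ev: "on_fibre F p us = F vs p" if "vs : lists (\<Gamma> M E)" "us = eval_sections vs p" for us vs
  using on_fibre_eval[OF F that(1)] that(2) by simp
 have e1: "eval_sections (xs @ x # ys) p = eval_sections xs p @ x p # eval_sections ys p" for xs ys and x :: "'m => 'v"
  by (simp add: eval_sections_def)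
 show ?thesis
 proof (rule pt.altfI)
  fix xs ys v w assume l: "xs : lists (fibre E p)" "ys : lists (fibre E p)" "v : fibre E p" "w : fibre E p"
  note m = ex[OF l(1)] ex[OF l(2)] extend_vec[OF l(3)] extend_vec[OF l(4)]
  have "on_fibre F p (xs @ (v + w) # ys) = F (map (extend_vec p) xs @ (extend_vec p v + extend_vec p w) # map (extend_vec p) ys) p"
   using m sec.L_add by (intro ev) (auto simp: e1)
  moreover have "on_fibre F p (xs @ v # ys) = F (map (extend_vec p) xs @ extend_vec p v # map (extend_vec p) ys) p"
   "on_fibre F p (xs @ w # ys) = F (map (extend_vec p) xs @ extend_vec p w # map (extend_vec p) ys) p"
   using m by (auto intro!: ev simp: e1)
  ultimately show "on_fibre F p (xs @ (v + w) # ys) = on_fibre F p (xs @ v # ys) + on_fibre F p (xs @ w # ys)"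
   using sec.alt0_add[OF sec.altf_alt0[OF F] m(1,3,5,7)] by simp
 next
  fix xs ys v assume l: "xs : lists (fibre E p)" "ys : lists (fibre E p)" "v : fibre E p"
  note m = ex[OF l(1)] ex[OF l(2)] extend_vec[OF l(3)]
  have "on_fibre F p (xs @ v # v # ys) = F (map (extend_vec p) xs @ extend_vec p v # extend_vec p v # map (extend_vec p) ys) p"
   using m by (intro ev) (auto simp: eval_sections_def)
  thus "on_fibre F p (xs @ v # v # ys) = 0" using sec.alt0_same[OF sec.altf_alt0[OF F] m(1,3,5)] by simp
 next
  fix xs ys v and g :: real assume l: "xs : lists (fibre E p)" "ys : lists (fibre E p)" "v : fibre E p"
  note m = ex[OF l(1)] ex[OF l(2)] extend_vec[OF l(3)]
  have "on_fibre F p (xs @ (g *R v) # ys) = F (map (extend_vec p) xs @ smul (%_. g) (extend_vec p v) # map (extend_vec p) ys) p"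
   using m sec.L_sm[OF smooth_funs_closed(1)] by (intro ev) (auto simp: e1 smul_def)
  moreover have "on_fibre F p (xs @ v # ys) = F (map (extend_vec p) xs @ extend_vec p v # map (extend_vec p) ys) p"
   using m by (auto intro!: ev simp: e1)
  ultimately show "on_fibre F p (xs @ (g *R v) # ys) = g * on_fibre F p (xs @ v # ys)"
   using sec.altf_sm[OF F m(1,3,5) smooth_funs_closed(1), of g] by simp
 qed simp
qed

lemma forms_support:
 assumes "w : forms_on M E U k" "w p vs ~= 0"
 shows "p : U" "length vs = k" "set vs <= fibre E p"
proof -
 have "ALL p vs. w p vs ~= 0 --> p : U & length vs = k & set vs <= fibre E p" using assms(1) by (simp add: forms_on_def)
 thus "p : U" "length vs = k" "set vs <= fibre E p" using assms(2) by blast+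
qed

lemma forms_homog: "w : forms_on M E U k ==> homog k (w p)" using forms_support(2) unfolding homog_def by blast

lemma forms_alt:
 assumes t: "t : forms_on M E U k" "p : U"
 shows "alt_on (fibre E p) (t p)"
proof -
 interpret pt: lmodule "UNIV :: real set" "fibre E p" scaleR using lmodule_subspace[OF fibre_subspace] .
 have z: "t p us = 0" if "length us ~= k" for us using forms_support(2)[OF t(1), of p us] that by blast
 have lin: "t p (vs[i := a *R v + b *R w]) = a * t p (vs[i := v]) + b * t p (vs[i := w])"
  if "length vs = k" "set vs <= fibre E p" "i < k" "v : fibre E p" "w : fibre E p" for vs i v w a b
  using t that unfolding forms_on_def by blast
 have rep: "t p vs = 0" if "length vs = k" "set vs <= fibre E p" "j < k" "i < j" "vs ! i = vs ! j" for vs i j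
  using t that unfolding forms_on_def by blast
 show ?thesis
 proof (rule pt.altfI)
  fix xs ys v w assume l: "xs : lists (fibre E p)" "ys : lists (fibre E p)" "v : fibre E p" "w : fibre E p"
  show "t p (xs @ (v + w) # ys) = t p (xs @ v # ys) + t p (xs @ w # ys)"
   using lin[of "xs @ v # ys" "length xs" v w 1 1] l z by (cases "length (xs @ v # ys) = k") (auto simp: subset_iff)
 next
  fix xs ys v assume l: "xs : lists (fibre E p)" "ys : lists (fibre E p)" "v : fibre E p"
  show "t p (xs @ v # v # ys) = 0" using rep[of "xs @ v # v # ys" "Suc (length xs)" "length xs"] l z
   by (cases "length (xs @ v # v # ys) = k") (auto simp: subset_iff nth_append)
 next
  fix xs ys v and g :: real assume l: "xs : lists (fibre E p)" "ys : lists (fibre E p)" "v : fibre E p"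
  show "t p (xs @ (g *R v) # ys) = g * t p (xs @ v # ys)" using lin[of "xs @ v # ys" "length xs" v v g 0] l z
   by (cases "length (xs @ v # ys) = k") (auto simp: subset_iff)
 qed simp
qed

lemma forms_onI:
 assumes supp: "!!p vs. z p vs ~= 0 ==> p : U & length vs = k & set vs <= fibre E p"
  and alt: "!!p. p : U ==> alt_on (fibre E p) (z p)"
  and smooth: "!!vs. length vs = k ==> set vs <= sections M E U ==> smooth_fun_on M U (%p. z p (eval_sections vs p))"
 shows "z : forms_on M E U k"
proof -
 have lin: "z p (vs[i := a *R v + b *R w]) = a * z p (vs[i := v]) + b * z p (vs[i := w])"
  if p: "p : U" and l: "length vs = k" "set vs <= fibre E p" "i < k" "v : fibre E p" "w : fibre E p" for p vs i v w a b
 proof -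
  interpret pt: lmodule "UNIV :: real set" "fibre E p" scaleR using lmodule_subspace[OF fibre_subspace] .
  have l': "take i vs : lists (fibre E p)" "drop (Suc i) vs : lists (fibre E p)"
   using l by (auto dest: in_set_takeD in_set_dropD)
  have u: "vs[i := x] = take i vs @ x # drop (Suc i) vs" for x using l by (simp add: upd_conv_take_nth_drop)
  show ?thesis unfolding u using pt.alt0_add[OF pt.altf_alt0[OF alt[OF p]] l', of "a *R v" "b *R w"]
    pt.altf_sm[OF alt[OF p] l' l(4), of a] pt.altf_sm[OF alt[OF p] l' l(5), of b]
    l(4,5) pt.L_sm[of a v] pt.L_sm[of b w] by simp
 qed
 have rep: "z p vs = 0" if p: "p : U" and l: "length vs = k" "set vs <= fibre E p" "j < k" "i < j" "vs ! i = vs ! j" for p vs i j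
 proof -
  interpret pt: lmodule "UNIV :: real set" "fibre E p" scaleR using lmodule_subspace[OF fibre_subspace] .
  have "~ distinct vs" using l nth_eq_iff_index_eq[of vs i j] by auto
  thus ?thesis using pt.alt0_repeat[OF pt.altf_alt0[OF alt[OF p]], of vs] l by auto
 qed
 show ?thesis unfolding forms_on_def
  by (intro CollectI conjI allI ballI impI; (rule lin | rule rep | rule smooth | use supp in blast); assumption)
qed

lemma form_altf:
 assumes z: "z : \<Omega> M E k" shows "sec.altf (on_sections z)"
proof (rule sec.altfI)
 have ev: "eval_sections (xs @ x # ys) p = eval_sections xs p @ x p # eval_sections ys p" for xs ys p and x :: "'m => 'v"
  by (simp add: eval_sections_def)
 have mem: "eval_sections xs p : lists (fibre E p)" if "xs : lists (\<Gamma> M E)" for xs p using eval_fibre[OF that] by auto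
 fix vs assume l: "vs : lists (\<Gamma> M E)"
 show "on_sections z vs : smooth_funs M"
 proof (cases "length vs = k")
  case True
  thus ?thesis using z l unfolding forms_on_def smooth_funs_def on_sections_def by auto
 next
  case False
  hence "on_sections z vs = (%_. 0)"
   using forms_homog[OF z] by (auto simp: on_sections_def homog_def eval_sections_def)
  thus ?thesis using smooth_funs_closed(1) by simp
 qed
next
 have ev: "eval_sections (xs @ x # ys) p = eval_sections xs p @ x p # eval_sections ys p" for xs ys p and x :: "'m => 'v"
  by (simp add: eval_sections_def)
 have mem: "eval_sections xs p : lists (fibre E p)" if "xs : lists (\<Gamma> M E)" for xs p using eval_fibre[OF that] by auto
 {
  fix xs ys v w assume l: "xs : lists (\<Gamma> M E)" "ys : lists (\<Gamma> M E)" "v : \<Gamma> M E" "w : \<Gamma> M E"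
  show "on_sections z (xs @ (v + w) # ys) = on_sections z (xs @ v # ys) + on_sections z (xs @ w # ys)"
  proof
   fix p
   interpret pt: lmodule "UNIV :: real set" "fibre E p" scaleR using lmodule_subspace[OF fibre_subspace] .
   show "on_sections z (xs @ (v + w) # ys) p = (on_sections z (xs @ v # ys) + on_sections z (xs @ w # ys)) p"
    using pt.alt0_add[OF pt.altf_alt0[OF forms_alt[OF z UNIV_I]] mem[OF l(1)] mem[OF l(2)]] sections_fibre l
    by (simp add: on_sections_def ev)
  qed
 next
  fix xs ys v assume l: "xs : lists (\<Gamma> M E)" "ys : lists (\<Gamma> M E)" "v : \<Gamma> M E"
  show "on_sections z (xs @ v # v # ys) = 0"
  proof
   fix p
   interpret pt: lmodule "UNIV :: real set" "fibre E p" scaleR using lmodule_subspace[OF fibre_subspace] .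
   show "on_sections z (xs @ v # v # ys) p = 0 p"
    using pt.alt0_same[OF pt.altf_alt0[OF forms_alt[OF z UNIV_I]] mem[OF l(1)] mem[OF l(2)]] sections_fibre l
    by (simp add: on_sections_def eval_sections_def)
  qed
 next
  fix xs ys v g assume l: "xs : lists (\<Gamma> M E)" "ys : lists (\<Gamma> M E)" "v : \<Gamma> M E"
  show "on_sections z (xs @ smul g v # ys) = g * on_sections z (xs @ v # ys)"
  proof
   fix p
   interpret pt: lmodule "UNIV :: real set" "fibre E p" scaleR using lmodule_subspace[OF fibre_subspace] .
   show "on_sections z (xs @ smul g v # ys) p = (g * on_sections z (xs @ v # ys)) p"
    using pt.altf_sm[OF forms_alt[OF z UNIV_I] mem[OF l(1)] mem[OF l(2)]] sections_fibre l
    by (simp add: on_sections_def ev smul_def)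
  qed
 }
qed

lemma on_fibre_form:
 assumes F: "sec.altf F" and h: "!!vs. vs : lists (\<Gamma> M E) ==> length vs ~= k ==> F vs = 0"
 shows "on_fibre F : \<Omega> M E k"
proof (rule forms_onI)
 show "p : UNIV & length vs = k & set vs <= fibre E p" if "on_fibre F p vs ~= 0" for p vs
 proof -
  have "set vs <= fibre E p" using that by (auto simp: on_fibre_def split: if_splits)
  moreover have "length vs = k"
  proof (rule ccontr)
   assume "length vs ~= k"
   hence "F (map (extend_vec p) vs) = 0" using h[OF extend_list(1)] calculation by simp
   thus False using that calculation by (simp add: on_fibre_def)
  qed
  ultimately show ?thesis by simp
 qed
 show "alt_on (fibre E p) (on_fibre F p)" for p using on_fibre_alt[OF F] .
 fix vs assume "length vs = k" "set vs <= \<Gamma> M E"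
 hence vs: "vs : lists (\<Gamma> M E)" by auto
 hence "F vs : smooth_funs M" using sec.altf_valued[OF F] by (auto simp: sec.valued_def)
 moreover have "(%p. on_fibre F p (eval_sections vs p)) = F vs" by (rule ext) (rule on_fibre_eval[OF F vs])
 ultimately show "smooth_fun_on M UNIV (%p. on_fibre F p (eval_sections vs p))" by (simp add: smooth_funs_def)
qed

lemma form_eqI:
 assumes "w : \<Omega> M E k" "h : \<Omega> M E k"
  and "!!vs. vs : lists (\<Gamma> M E) ==> length vs = k ==> on_sections w vs = on_sections h vs"
 shows "w = h"
proof (intro ext)
 fix p us
 show "w p us = h p us"
 proof (cases "set us <= fibre E p & length us = k")
  case True
  thus ?thesis
   using assms(3)[OF extend_list(1), of us p] extend_list(2)[of us p] by (simp add: on_sections_def fun_eq_iff) metis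
 next
  case False
  thus ?thesis using forms_support assms(1,2) by metis
 qed
qed

end

text \<open>Degree-free counterpart of \<open>wedge\<close>, with which it agrees on forms by
  \<open>wedge_eq_fwedge\<close>; associativity and sign rules are inherited from
  \<open>lwedge\<close>.\<close>

definition fwedge :: "('m, 'v) form => ('m, 'v) form => ('m, 'v) form" where
 "fwedge w h = (%p. lwedge (w p) (h p))"

lemma sign_fun_apply: "((-1) ^ n :: 'a => 'b::comm_ring_1) p = (-1) ^ n" by (induction n) auto

lemma lwedge_eval:
 assumes "!!us. F us p = f (eval_sections us p)" "!!us. G us p = g (eval_sections us p)"
 shows "lwedge F G vs p = lwedge f g (eval_sections vs p)" using assms
proof (induction vs arbitrary: F G f g)
 case Nil
 thus ?case by (simp add: eval_sections_def)
next
 case (Cons v vs)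
 have ev: "eval_sections (v # us) p = v p # eval_sections us p" for us by (simp add: eval_sections_def)
 have l: "length (eval_sections us p) = length us" for us :: "('a => 'b) list" by (simp add: eval_sections_def)
 have "lwedge (contract v F) G vs p = lwedge (contract (v p) f) g (eval_sections vs p)"
  by (rule Cons.IH) (auto simp: contract_def Cons.prems ev)
 moreover have "lwedge (invol F) (contract v G) vs p = lwedge (invol f) (contract (v p) g) (eval_sections vs p)"
  by (rule Cons.IH) (auto simp: contract_def Cons.prems ev invol_def sign_fun_apply l)
 ultimately show ?case by (simp add: ev)
qed

lemma lwedge_support:
 assumes "!!us. F us ~= 0 ==> set us <= V" "!!us. G us ~= 0 ==> set us <= V" "lwedge F G vs ~= 0"
 shows "set vs <= V" using assms
proof (induction vs arbitrary: F G)
 case (Cons v vs)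
 have c: "set us <= V & v : V" if "contract v H us ~= 0" "!!us. H us ~= 0 ==> set us <= V" for H us
  using that(2)[of "v # us"] that(1) by (simp add: contract_def)
 have i: "set us <= V" if "invol F us ~= 0" for us
  using Cons.prems(1)[of us] that by (cases "F us = 0") (auto simp: invol_def)
 have z1: "contract v F = 0" "contract v G = 0" if "v ~: V"
  using c[of F] c[of G] Cons.prems(1,2) that by (force simp: fun_eq_iff)+
 have "v : V" by (rule ccontr) (use Cons.prems(3) z1 in simp)
 moreover have "set vs <= V"
 proof (cases "lwedge (contract v F) G vs = 0")
  case False
  thus ?thesis using Cons.IH[of "contract v F" G] c[of F] Cons.prems by blast
 next
  case True
  hence "lwedge (invol F) (contract v G) vs ~= 0" using Cons.prems(3) by simp
  thus ?thesis using Cons.IH[of "invol F" "contract v G"] c[of G] i Cons.prems by blast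
 qed
 ultimately show ?case by simp
qed simp

section \<open>Wedge product and linear structure of smooth forms\<close>

context vbundle
begin

lemma on_sections_fwedge: "on_sections (fwedge w h) vs = lwedge (on_sections w) (on_sections h) vs"
proof
 fix p
 show "on_sections (fwedge w h) vs p = lwedge (on_sections w) (on_sections h) vs p"
  by (subst lwedge_eval[where f="w p" and g="h p"]) (auto simp: on_sections_def fwedge_def)
qed

lemma on_sections_homog: "w : \<Omega> M E k ==> homog k (on_sections w)"
 using forms_homog by (auto simp: homog_def on_sections_def eval_sections_def fun_eq_iff)

lemma fwedge_form:
 assumes w: "w : \<Omega> M E k" and h: "h : \<Omega> M E l"
 shows "fwedge w h : \<Omega> M E (k + l)"
proof (rule forms_onI)
 show "p : UNIV & length vs = k + l & set vs <= fibre E p" if nz: "fwedge w h p vs ~= 0" for p vs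
  using homog_lwedge[OF forms_homog[OF w] forms_homog[OF h], of p p] nz
   lwedge_support[of "w p" "fibre E p" "h p" vs] forms_support(3)[OF w] forms_support(3)[OF h]
  unfolding fwedge_def homog_def by blast
 show "alt_on (fibre E p) (fwedge w h p)" for p unfolding fwedge_def
  by (rule lmodule.altf_lwedge[OF lmodule_subspace[OF fibre_subspace] forms_alt[OF w] forms_alt[OF h]]) auto
 fix vs assume "length vs = k + l" "set vs <= \<Gamma> M E"
 hence "lwedge (on_sections w) (on_sections h) vs : smooth_funs M"
  using sec.valued_lwedge[OF sec.altf_valued[OF form_altf[OF w]] sec.altf_valued[OF form_altf[OF h]]]
  by (auto simp: sec.valued_def)
 thus "smooth_fun_on M UNIV (%p. fwedge w h p (eval_sections vs p))"
  using on_sections_fwedge[of w h vs] by (simp add: on_sections_def smooth_funs_def)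
qed

text \<open>A form at a single point. The factors of a local decomposition are forms on an open set
  only, so \<open>wedge\<close> and \<open>lwedge\<close> have to be compared point by
  point.\<close>

definition ptform :: "'m => nat => ('v list => real) => bool" where
 "ptform p k f \<longleftrightarrow> alt_on (fibre E p) f & homog k f & (ALL us. f us ~= 0 --> set us <= fibre E p)"

lemma forms_ptform: "w : forms_on M E U k ==> p : U ==> ptform p k (w p)"
 using forms_alt forms_homog forms_support(3) unfolding ptform_def by blast

lemma ptform_lwedge: "ptform p k f ==> ptform p l g ==> ptform p (k + l) (lwedge f g)" unfolding ptform_def
 by (blast intro: homog_lwedge lmodule.altf_lwedge[OF lmodule_subspace[OF fibre_subspace]]
   dest: lwedge_support[rotated 2])

lemma wedge_pt:
 assumes w: "ptform p k (w p)" and n: "ptform p l (n p)"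
 shows "wedge k l w n p = lwedge (w p) (n p)"
proof
 fix vs
 have h: "homog k (w p)" "homog l (n p)" and s: "!!us. w p us ~= 0 ==> set us <= fibre E p"
   "!!us. n p us ~= 0 ==> set us <= fibre E p" and a: "alt_on (fibre E p) (w p)" "alt_on (fibre E p) (n p)"
  using w n by (auto simp: ptform_def)
 show "wedge k l w n p vs = lwedge (w p) (n p) vs"
 proof (cases "length vs = k + l & set vs <= fibre E p")
  case True
  have "alt_sum (k + l) (%us. w p (take k us) * n p (drop k us)) vs = fact k * fact l * lwedge (w p) (n p) vs"
   using True a h by (intro alt_sum_lwedge[OF fibre_subspace]) auto
  thus ?thesis by (simp add: wedge_def alt_sum_def mult.assoc)
 next
  case False
  have "lwedge (w p) (n p) vs = 0" using homog_lwedge[OF h] False lwedge_support[of "w p" "fibre E p" "n p" vs] s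
   unfolding homog_def by blast
  moreover have "w p (take k (permute_list r vs)) * n p (drop k (permute_list r vs)) = 0"
   if r: "r permutes {..<k + l}" for r
  proof (rule ccontr)
   assume "w p (take k (permute_list r vs)) * n p (drop k (permute_list r vs)) ~= 0"
   hence 1: "w p (take k (permute_list r vs)) ~= 0" "n p (drop k (permute_list r vs)) ~= 0" by auto
   have "length (take k (permute_list r vs)) = k" "length (drop k (permute_list r vs)) = l"
    using 1 h unfolding homog_def by blast+
   hence len: "length vs = k + l" by auto
   have "set (permute_list r vs) = set (take k (permute_list r vs)) Un set (drop k (permute_list r vs))"
    by (metis append_take_drop_id set_append)
   hence "set vs <= fibre E p" using s(1)[OF 1(1)] s(2)[OF 1(2)] set_permute_list[of r vs] r len by simp
   thus False using False len by simp
  qed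
  ultimately show ?thesis by (auto simp: wedge_def intro!: sum.neutral)
 qed
qed

lemma wedge_eq_fwedge: "w : \<Omega> M E k ==> h : \<Omega> M E l ==> wedge k l w h = fwedge w h"
 by (rule ext) (simp add: fwedge_def wedge_pt forms_ptform)

lemma forms_add: "w : \<Omega> M E k ==> h : \<Omega> M E k ==> w + h : \<Omega> M E k"
proof (rule forms_onI)
 assume w: "w : \<Omega> M E k" and h: "h : \<Omega> M E k"
 show "p : UNIV & length vs = k & set vs <= fibre E p" if nz: "(w + h) p vs ~= 0" for p vs
  using forms_support[OF w, of p vs] forms_support[OF h, of p vs] nz by (cases "w p vs = 0") auto
 interpret pt: lmodule "UNIV :: real set" "fibre E p" scaleR for p using lmodule_subspace[OF fibre_subspace] .
 show "alt_on (fibre E p) ((w + h) p)" for p using pt.altf_add[OF forms_alt[OF w] forms_alt[OF h], of p] by simp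
 fix vs assume "length vs = k" "set vs <= \<Gamma> M E"
 hence "on_sections w vs + on_sections h vs : smooth_funs M"
  using sec.altf_valued[OF form_altf[OF w]] sec.altf_valued[OF form_altf[OF h]]
  by (intro sec.R_add) (auto simp: sec.valued_def)
 thus "smooth_fun_on M UNIV (%p. (w + h) p (eval_sections vs p))"
  by (simp add: on_sections_def smooth_funs_def plus_fun_def)
qed

lemma forms_scale: "w : \<Omega> M E k ==> g : smooth_funs M ==> (%p vs. g p * w p vs) : \<Omega> M E k"
proof (rule forms_onI)
 assume w: "w : \<Omega> M E k" and g: "g : smooth_funs M"
 show "p : UNIV & length vs = k & set vs <= fibre E p" if nz: "g p * w p vs ~= 0" for p vs
  using forms_support[OF w, of p vs] nz by auto
 interpret pt: lmodule "UNIV :: real set" "fibre E p" scaleR for p using lmodule_subspace[OF fibre_subspace] .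
 show "alt_on (fibre E p) (%vs. g p * w p vs)" for p using pt.altf_scale[OF forms_alt[OF w], of p] by simp
 fix vs assume "length vs = k" "set vs <= \<Gamma> M E"
 hence "g * on_sections w vs : smooth_funs M"
  using sec.altf_valued[OF form_altf[OF w]] g by (intro sec.R_mult) (auto simp: sec.valued_def)
 thus "smooth_fun_on M UNIV (%p. g p * w p (eval_sections vs p))"
  by (simp add: on_sections_def smooth_funs_def times_fun_def)
qed

lemma forms_minus: "w : \<Omega> M E k ==> - w : \<Omega> M E k"
 using forms_scale[OF _ smooth_funs_closed(1), of w k "-1"] by (simp add: fun_Compl_def)

lemma forms_diff: "w : \<Omega> M E k ==> h : \<Omega> M E k ==> w - h : \<Omega> M E k" using forms_add[of w k "- h"] forms_minus[of h k] by simp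

lemma forms_zero: "0 : \<Omega> M E k"
proof (rule forms_onI)
 show "alt_on (fibre E p) (0 p)" for p
  using lmodule.altf_zero[OF lmodule_subspace[OF fibre_subspace[of p]]] zero_fun_apply[of p] by metis
qed (auto simp: smooth_fun_on_iff)

lemma fun_form: "g : smooth_funs M ==> (%p vs. if vs = [] then g p else 0) : \<Omega> M E 0"
proof (rule forms_onI)
 interpret pt: lmodule "UNIV :: real set" "fibre E p" scaleR for p using lmodule_subspace[OF fibre_subspace] .
 show "alt_on (fibre E p) (%vs. if vs = [] then g p else 0)" for p by (rule pt.altfI) auto
qed (auto simp: eval_sections_def smooth_funs_def split: if_splits)

lemma unit_form: "unit_form : \<Omega> M E 0" using fun_form[OF smooth_funs_closed(1), of 1] by (simp add: unit_form_def)

end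

subsection \<open>Decomposable forms\<close>

lemma lwedge_cong_lists:
 assumes "vs : lists L" "!!us. us : lists L ==> F us = F' us" "!!us. us : lists L ==> G us = G' us"
 shows "lwedge F G vs = lwedge F' G' vs"
proof (rule lwedge_cong)
 fix us assume "set us <= set vs"
 hence "us : lists L" using assms(1) by auto
 thus "F us = F' us" "G us = G' us" using assms(2,3) by auto
qed

lemma lwedge_scalar_left: "lwedge (%us. if us = [] then c else 0) G = (%us. c * G us)"
proof
 fix us
 show "lwedge (%us. if us = [] then c else 0) G us = c * G us"
 proof (induction us arbitrary: G)
  case (Cons u us)
  have "contract u (%us. if us = [] then c else 0) = 0"
   "invol (%us :: 'a list. if us = [] then c else 0) = (%us. if us = [] then c else 0)"
   by (auto simp: fun_eq_iff invol_def contract_def)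
  thus ?case using Cons[of "contract u G"] by (simp add: contract_apply[of u G us])
 qed simp
qed

lemma homog_0_scalar: "homog 0 F ==> F = (%us. if us = [] then F [] else 0)" by (auto simp: homog_def fun_eq_iff)

fun lwedge_list :: "('l list => 'r::comm_ring_1) list => 'l list => 'r" where
 "lwedge_list [] = (%us. if us = [] then 1 else 0)"
| "lwedge_list (a # as) = lwedge a (lwedge_list as)"

lemma homog_1_invol: "homog 1 a ==> invol a = - a" using homog_invol[of 1 a] by (auto simp: fun_eq_iff)

lemma homog_1_contract: "homog 1 a ==> contract v a = (%us. if us = [] then a [v] else 0)"
 by (auto simp: homog_def fun_eq_iff contract_def)

lemma lwedge_1_Cons:
 assumes "homog 1 a" shows "lwedge a G (v # vs) = a [v] * G vs - lwedge a (contract v G) vs"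
 by (simp add: homog_1_contract[OF assms] homog_1_invol[OF assms] lwedge_scalar_left lwedge_minus_left)

lemma lwedge_1_anticommute:
 assumes "homog 1 a" "homog 1 b" shows "lwedge a b = - lwedge b a"
 using lwedge_commute(2)[OF homog_1_invol[OF assms(1)], of b] by (simp only: homog_1_invol[OF assms(2)] lwedge_minus_left)

lemma lwedge_1_self:
 fixes a :: "'l list => real"
 assumes "homog 1 a" shows "lwedge a a = 0"
proof
 show "lwedge a a vs = 0 vs" for vs using fun_cong[OF lwedge_1_anticommute[OF assms assms], of vs] by simp
qed

text \<open>\<open>a\<close> anticommutes past the other factors until it meets itself.\<close>

lemma lwedge_list_absorb:
 fixes as :: "('l list => real) list"
 shows "a : set as ==> ALL a:set as. homog 1 a ==> lwedge a (lwedge_list as) = 0"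
proof (induction as)
 case (Cons c cs)
 have h: "homog 1 a" "homog 1 c" using Cons.prems by auto
 show ?case
 proof (cases "a = c")
  case True
  thus ?thesis using lwedge_1_self[OF h(1)] by (simp flip: lwedge_assoc)
 next
  case False
  hence 0: "lwedge a (lwedge_list cs) = 0" by (intro Cons.IH) (use Cons.prems in auto)
  have "lwedge a (lwedge_list (c # cs)) = - lwedge c (lwedge a (lwedge_list cs))"
   using lwedge_1_anticommute[OF h] by (simp only: lwedge_list.simps lwedge_assoc[symmetric] lwedge_minus_left)
  thus ?thesis unfolding 0 lwedge_zero_right by (simp only: minus_zero)
 qed
qed simp

lemma lwedge_list_kernel:
 "ALL a:set as. homog 1 a & a [b] = 0 ==> contract b (lwedge_list as) = 0"
proof (induction as)
 case Nil
 thus ?case by (auto simp: fun_eq_iff contract_def)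
next
 case (Cons a as)
 hence 1: "contract b a = 0" by (auto simp: homog_1_contract fun_eq_iff)
 have 2: "contract b (lwedge_list as) = 0" by (rule Cons.IH) (use Cons.prems in auto)
 show ?case unfolding lwedge_list.simps contract_lwedge 1 2 lwedge_zero_left lwedge_zero_right by (rule add_0_left)
qed

text \<open>Applied to \<open>contract v G\<close> when \<open>a \<and> G = 0\<close>, this expresses \<open>a(v) G(ws)\<close> through the \<open>a(w\<^sub>j)\<close> as in Cramer's rule.\<close>

lemma lwedge_1_sum:
 "EX c. ALL a. homog 1 a --> lwedge a G ws = (SUM j<length ws. c j * a [ws ! j])"
proof (induction ws arbitrary: G)
 case Nil
 have "lwedge a G [] = 0" if "homog 1 a" for a using that by (simp add: homog_def)
 thus ?case by simp
next
 case (Cons w ws)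
 obtain c where c: "!!a. homog 1 a ==> lwedge a (contract w G) ws = (SUM j<length ws. c j * a [ws ! j])" using Cons by blast
 define d where "d j = (case j of 0 => G ws | Suc i => - c i)" for j
 have "lwedge a G (w # ws) = (SUM j<length (w # ws). d j * a [(w # ws) ! j])" if "homog 1 a" for a
  using c[OF that] unfolding lwedge_1_Cons[OF that]
  by (simp add: sum.lessThan_Suc_shift d_def sum_negf mult.commute del: sum.lessThan_Suc)
 thus ?case by blast
qed

text \<open>The relation \<open>a \<and> G = 0\<close>, contracted with \<open>v\<close>, expresses
  \<open>a(v)\<close> through the values of \<open>a\<close> on \<open>ws\<close> with coefficients
  that do not depend on \<open>a\<close>. The combination \<open>u\<close> of \<open>ws\<close> with
  these coefficients satisfies \<open>a(u) = a(v)\<close> for all factors at once.\<close>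

lemma decomposable_span:
 fixes V :: "'v::real_vector set"
 assumes V: "subspace V" and as: "ALL a:set as. homog 1 a & alt_on V a"
  and ws: "ws : lists V" "lwedge_list as ws ~= 0"
 shows "V <= span ({v : V. ALL a:set as. a [v] = 0} Un set ws)"
proof
 interpret lmodule "UNIV :: real set" V scaleR using lmodule_subspace[OF V] .
 fix v assume v: "v : V"
 let ?G = "lwedge_list as"
 obtain c where c: "!!a. homog 1 a ==> lwedge a (contract v ?G) ws = (SUM j<length ws. c j * a [ws ! j])"
  using lwedge_1_sum by blast
 define u where "u = (SUM j<length ws. (c j / ?G ws) *R ws ! j)"
 have wsj: "ws ! j : V" if "j < length ws" for j using ws(1) that by (auto simp: in_lists_conv_set)
 have lin: "(SUM j:J. e j *R ws ! j) : V & a [SUM j:J. e j *R ws ! j] = (SUM j:J. e j * a [ws ! j])"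
  if "alt_on V a" "J <= {..<length ws}" for a J and e :: "nat => real"
  using finite_subset[OF that(2) finite_lessThan] that(2)
 proof (induction J)
  case empty
  thus ?case using altf_sm[OF that(1), of "[]" "[]" 0 0] subspace_0[OF V] by simp
 next
  case (insert j J)
  hence j: "ws ! j : V" using wsj by auto
  hence "a [e j *R ws ! j + (SUM j:J. e j *R ws ! j)] = a [e j *R ws ! j] + a [SUM j:J. e j *R ws ! j]"
   using insert alt0_add[OF altf_alt0[OF that(1)], of "[]" "[]"] L_sm by simp
  moreover have "a [e j *R ws ! j] = e j * a [ws ! j]" using altf_sm[OF that(1), of "[]" "[]" "ws ! j" "e j"] j by simp
  ultimately show ?case using insert j L_sm L_add by simp
 qed
 have uV: "u : V"
 proof -
  have "alt_on V (0 :: 'v list => real)" by (rule altf_zero)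
  from lin[OF this order_refl] show ?thesis by (simp add: u_def)
 qed
 have "a [v - u] = 0" if a: "a : set as" for a
 proof -
  have h: "homog 1 a" "alt_on V a" using as a by auto
  have "lwedge a ?G (v # ws) = 0" using lwedge_list_absorb[of a as] a as by simp
  hence "a [v] * ?G ws = (SUM j<length ws. c j * a [ws ! j])" unfolding lwedge_1_Cons[OF h(1)] using c[OF h(1)] by simp
  moreover have "a [u] = (SUM j<length ws. c j * a [ws ! j]) / ?G ws"
   unfolding u_def using lin[OF h(2) order_refl, of "%j. c j / ?G ws"] by (simp add: sum_divide_distrib)
  ultimately have "a [u] = a [v]" using ws(2) by (metis nonzero_mult_div_cancel_right)
  moreover have "a [v + - u] = a [v] + a [- u]"
   using alt0_add[OF altf_alt0[OF h(2)], of "[]" "[]" v "- u"] v L_minus[OF uV] by simp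
  moreover have "a [- u] = - a [u]" using altf_minus_arg[OF h(2), of "[]" "[]" u] uV by simp
  ultimately show ?thesis by simp
 qed
 moreover have "v - u : V" using L_add[OF v L_minus[OF uV]] by simp
 ultimately have 1: "v - u : span ({v : V. ALL a:set as. a [v] = 0} Un set ws)" by (intro span_base) auto
 have 2: "u : span ({v : V. ALL a:set as. a [v] = 0} Un set ws)" unfolding u_def by (intro span_sum span_mul span_base) auto
 show "v : span ({v : V. ALL a:set as. a [v] = 0} Un set ws)" using span_add[OF 1 2] by simp
qed

definition form_kernel :: "'v set => ('v list => real) => 'v set" where
 "form_kernel V F = {v : V. ALL us:lists V. F (v # us) = 0}"

text \<open>Describes the common kernel of the factors by their product alone, hence independently
  of the decomposition; \<open>defining_form\<close> quantifies over all decompositions.\<close>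

lemma decomposable_kernel:
 fixes V :: "'v::real_vector set"
 assumes "ALL a:set as. homog 1 a" "ws : lists V" "lwedge_list as ws ~= 0"
 shows "form_kernel V (lwedge_list as) = {v : V. ALL a:set as. a [v] = 0}"
proof (intro equalityI subsetI)
 fix v assume v: "v : form_kernel V (lwedge_list as)"
 have "a [v] = 0" if a: "a : set as" for a
 proof -
  have h: "homog 1 a" using assms(1) a by auto
  have "lwedge a (lwedge_list as) (v # ws) = 0" using lwedge_list_absorb[of a as] a assms(1) by simp
  moreover have "lwedge a (contract v (lwedge_list as)) ws = lwedge a 0 ws"
   using v by (intro lwedge_cong_lists[OF assms(2)]) (auto simp: form_kernel_def contract_apply)
  ultimately show ?thesis using assms(3) unfolding lwedge_1_Cons[OF h] by simp
 qed
 thus "v : {v : V. ALL a:set as. a [v] = 0}" using v by (simp add: form_kernel_def)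
next
 fix v assume v: "v : {v : V. ALL a:set as. a [v] = 0}"
 hence "contract v (lwedge_list as) = 0" using assms(1) by (intro lwedge_list_kernel) auto
 hence "lwedge_list as (v # us) = 0" for us using contract_apply[of v "lwedge_list as" us] by simp
 thus "v : form_kernel V (lwedge_list as)" using v by (simp add: form_kernel_def)
qed

text \<open>If fewer than \<open>q\<close> of the \<open>q\<close> arguments lie outside
  \<open>B\<close>, one lies in \<open>B\<close> and can be moved to the front.\<close>

lemma filt_kernel:
 assumes V: "subspace V" and F: "alt_on V F" "homog q F" and B: "B <= form_kernel V F"
 shows "filt V B q F" unfolding filt_def
proof (intro ballI impI)
 interpret lmodule "UNIV :: real set" V scaleR using lmodule_subspace[OF V] .
 fix vs assume vs: "vs : lists V" "length (filter (%v. v ~: B) vs) < q"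
 show "F vs = 0"
 proof (cases "length vs = q")
  case True
  hence "EX b:set vs. b : B" using vs(2) filter_True[of vs "%v. v ~: B"] by fastforce
  then obtain b xs ys where b: "b : B" "vs = xs @ b # ys" by (metis split_list)
  hence "F vs = (-1) ^ length xs * F (b # xs @ ys)" using alt0_move[OF altf_alt0[OF F(1)], of xs ys b] vs(1) by simp
  moreover have "b : form_kernel V F" "xs @ ys : lists V" using b B vs(1) by auto
  ultimately show ?thesis by (simp add: form_kernel_def)
 next
  case False
  thus ?thesis using F(2) by (simp add: homog_def)
 qed
qed

text \<open>Every contraction of \<open>G\<close> with an element of \<open>B\<close> vanishes, so
  in the recursion all of \<open>bs\<close> is used up by \<open>F\<close>.\<close>

lemma lwedge_kernel_split:
 assumes "!!b us. b : B ==> us : lists V ==> G (b # us) = 0" "B <= V"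
 shows "bs : lists B ==> ws : lists V ==> homog (length bs) F ==> lwedge F G (bs @ ws) = F bs * G ws"
proof (induction bs arbitrary: F)
 case Nil
 thus ?case using homog_0_scalar[of F] lwedge_scalar_left[of "F []" G] by simp
next
 case (Cons b bs)
 have "lwedge (invol F) (contract b G) (bs @ ws) = lwedge (invol F) 0 (bs @ ws)"
  using Cons.prems assms by (intro lwedge_cong_lists[of _ V]) (auto simp: contract_apply)
 moreover have "lwedge (contract b F) G (bs @ ws) = contract b F bs * G ws"
  using Cons homog_contract_Suc[of "length bs" F b] by auto
 ultimately show ?case by (simp add: contract_apply[of b F bs])
qed

section \<open>Lie algebroids\<close>

lemma add_3_zero: "x = - z + - y" if "x + y + z = (0 :: 'a::ab_group_add)"
proof -
 have "x + (y + z) = 0" using that by (simp only: add.assoc)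
 hence "x = - (y + z)" by (simp only: eq_neg_iff_add_eq_0)
 thus ?thesis by (simp only: minus_add)
qed

locale algebroid = manifold M for M :: "('m::{t2_space,second_countable_topology}, 'e::real_inner) atlas" +
 fixes A :: "('m, 'v::real_vector) lie_algebroid"
 assumes algebroid: "lie_algebroid M A"

sublocale algebroid \<subseteq> vbundle M A by standard (use algebroid in \<open>simp add: lie_algebroid_def\<close>)

definition arho :: "('m, 'v) lie_algebroid => ('m => 'v) => ('m => real) => 'm => real" where
 "arho A v g = (%p. anchor A p (v p) g)"

context algebroid
begin

lemma anchor_lin: "v : fibre A p ==> w : fibre A p ==> anchor A p (a *R v + b *R w) = a *R anchor A p v + b *R anchor A p w"
proof -
 have "ALL p. ALL v:fibre A p. ALL w:fibre A p. ALL a b. anchor A p (a *R v + b *R w) = a *R anchor A p v + b *R anchor A p w"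
  using algebroid unfolding lie_algebroid_def by (elim conjE)
 thus "v : fibre A p ==> w : fibre A p ==> ?thesis" by (metis (no_types))
qed

lemma anchor_field: "v : \<Gamma> M A ==> (%p. anchor A p (v p)) : vector_fields M UNIV"
 using algebroid unfolding lie_algebroid_def by blast

lemma bracket_closed: "v : \<Gamma> M A ==> w : \<Gamma> M A ==> bracket A v w : \<Gamma> M A" using algebroid unfolding lie_algebroid_def by blast

lemma bracket_lin: "u : \<Gamma> M A ==> v : \<Gamma> M A ==> w : \<Gamma> M A ==>
  bracket A (a *R u + b *R v) w = a *R bracket A u w + b *R bracket A v w"
 using algebroid unfolding lie_algebroid_def by blast

lemma bracket_antisym: "v : \<Gamma> M A ==> w : \<Gamma> M A ==> bracket A v w = - bracket A w v"
 using algebroid unfolding lie_algebroid_def by blast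

lemma bracket_jacobi: "u : \<Gamma> M A ==> v : \<Gamma> M A ==> w : \<Gamma> M A ==>
  bracket A u (bracket A v w) + bracket A v (bracket A w u) + bracket A w (bracket A u v) = 0"
 using algebroid unfolding lie_algebroid_def by blast

lemma bracket_leibniz: "v : \<Gamma> M A ==> w : \<Gamma> M A ==> g : smooth_funs M ==>
  bracket A v (%p. g p *R w p) = (%p. g p *R bracket A v w p + anchor A p (v p) g *R w p)"
 using algebroid unfolding lie_algebroid_def by blast

lemma section_tangent: "v : \<Gamma> M A ==> anchor A p (v p) : tangent_space M p"
 using anchor_field[of v] by (simp add: vector_fields_def)

lemma anchor_tangent: assumes "v : fibre A p" shows "anchor A p v : tangent_space M p"
proof -
 obtain s where "s : \<Gamma> M A" "s p = v" using section_through[OF assms] by metis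
 thus ?thesis using section_tangent[of s p] by simp
qed

lemma anchor_add: "v : fibre A p ==> w : fibre A p ==> anchor A p (v + w) g = anchor A p v g + anchor A p w g"
proof -
 assume "v : fibre A p" "w : fibre A p"
 from anchor_lin[OF this, of 1 1] have "anchor A p (v + w) = anchor A p v + anchor A p w" by (simp only: scaleR_one)
 thus ?thesis by simp
qed

lemma anchor_scale: "v : fibre A p ==> anchor A p (a *R v) g = a * anchor A p v g"
 using anchor_lin[of v p v a 0] by (simp add: scaleR_fun_def fun_eq_iff)

lemma arho_smooth: "v : \<Gamma> M A ==> g : smooth_funs M ==> arho A v g : smooth_funs M"
 using anchor_field[of v] unfolding vector_fields_def arho_def smooth_funs_def by blast

lemma bracket_add_left: "u : \<Gamma> M A ==> v : \<Gamma> M A ==> w : \<Gamma> M A ==> bracket A (u + v) w = bracket A u w + bracket A v w"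
 using bracket_lin[of u v w 1 1] by (simp only: scaleR_one)

lemma bracket_add_right: "u : \<Gamma> M A ==> v : \<Gamma> M A ==> w : \<Gamma> M A ==> bracket A u (v + w) = bracket A u v + bracket A u w"
 using bracket_antisym[of u "v + w"] bracket_antisym[of u v] bracket_antisym[of u w] bracket_add_left[of v w u]
  sec.L_add[of v w] by (simp only: minus_add_distrib)

lemma bracket_minus_right: "u : \<Gamma> M A ==> v : \<Gamma> M A ==> bracket A u (- v) = - bracket A u v"
proof -
 assume uv: "u : \<Gamma> M A" "v : \<Gamma> M A"
 have "bracket A u (0 + 0) = bracket A u 0 + bracket A u 0" using uv sec.L_zero by (intro bracket_add_right)
 hence "bracket A u 0 + 0 = bracket A u 0 + bracket A u 0" by (simp only: add_0_left add_0_right)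
 hence z: "bracket A u 0 = 0" by (metis add_left_imp_eq)
 have "bracket A u (v + - v) = bracket A u v + bracket A u (- v)" using uv sec.L_minus by (intro bracket_add_right)
 thus ?thesis using z by (simp only: right_minus) (metis add_eq_0_iff)
qed

lemma bracket_smul: "v : \<Gamma> M A ==> w : \<Gamma> M A ==> g : smooth_funs M ==>
  bracket A v (smul g w) = smul g (bracket A v w) + smul (arho A v g) w"
 using bracket_leibniz[of v w g] by (simp add: smul_def arho_def fun_eq_iff)

lemma bracket_jacobi': "u : \<Gamma> M A ==> v : \<Gamma> M A ==> w : \<Gamma> M A ==>
  bracket A u (bracket A v w) = bracket A (bracket A u v) w + bracket A v (bracket A u w)" proof -
 assume uvw: "u : \<Gamma> M A" "v : \<Gamma> M A" "w : \<Gamma> M A"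
 have "bracket A (bracket A u v) w = - bracket A w (bracket A u v)" using uvw bracket_closed by (intro bracket_antisym)
 moreover have "bracket A v (bracket A u w) = - bracket A v (bracket A w u)"
  using uvw bracket_closed bracket_minus_right[of v "bracket A w u"] bracket_antisym[of u w] by simp
 ultimately show ?thesis using add_3_zero[OF bracket_jacobi[OF uvw]] by (simp only:)
qed

lemma arho_add: "v : \<Gamma> M A ==> g : smooth_funs M ==> h : smooth_funs M ==> arho A v (g + h) = arho A v g + arho A v h"
 using tangent_add[OF section_tangent] by (auto simp: arho_def fun_eq_iff plus_fun_def)

lemma arho_mult: "v : \<Gamma> M A ==> g : smooth_funs M ==> h : smooth_funs M ==> arho A v (g * h) = g * arho A v h + h * arho A v g"
 using tangent_mult[OF section_tangent] by (auto simp: arho_def fun_eq_iff times_fun_def)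

text \<open>
 The anchor of \<open>[u,v]\<close> acts on \<open>g\<close> as the commutator, by the Jacobi identity for \<open>u\<close>, \<open>v\<close> and
 \<open>g w\<close>; where the fibre is zero both sides vanish.
\<close>

lemma arho_bracket:
 assumes u: "u : \<Gamma> M A" and v: "v : \<Gamma> M A" and g: "g : smooth_funs M"
 shows "arho A (bracket A u v) g = arho A u (arho A v g) - arho A v (arho A u g)"
proof
 fix p
 show "arho A (bracket A u v) g p = (arho A u (arho A v g) - arho A v (arho A u g)) p"
 proof (cases "fibre A p <= {0}")
  case True
  hence "u p = 0" "v p = 0" "bracket A u v p = 0" using u v bracket_closed sections_fibre by blast+
  moreover have "anchor A p 0 h = 0" for h using anchor_scale[OF subspace_0[OF fibre_subspace], of p 0 h] by simp
  ultimately show ?thesis by (simp add: arho_def)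
 next
  case False
  then obtain w0 where "w0 : fibre A p" "w0 ~= 0" by auto
  then obtain w where w: "w : \<Gamma> M A" "w p ~= 0" using section_through by metis
  have E: "bracket A a (bracket A b (smul g w)) p = g p *R bracket A a (bracket A b w) p +
    arho A a g p *R bracket A b w p + (arho A b g p *R bracket A a w p + arho A a (arho A b g) p *R w p)"
   if "a : \<Gamma> M A" "b : \<Gamma> M A" for a b
  proof -
   have 1: "bracket A b w : \<Gamma> M A" "arho A b g : smooth_funs M" using that w g bracket_closed arho_smooth by auto
   have "bracket A a (bracket A b (smul g w)) = bracket A a (smul g (bracket A b w)) + bracket A a (smul (arho A b g) w)"
    unfolding bracket_smul[OF that(2) w(1) g] using that w 1 g sec.L_sm by (intro bracket_add_right)
   thus ?thesis unfolding bracket_smul[OF that(1) 1(1) g] bracket_smul[OF that(1) w(1) 1(2)] by (simp add: smul_def)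
  qed
  have "bracket A u (bracket A v (smul g w)) = bracket A (bracket A u v) (smul g w) + bracket A v (bracket A u (smul g w))"
   using u v w g sec.L_sm by (intro bracket_jacobi')
  hence "bracket A u (bracket A v (smul g w)) p =
    bracket A (bracket A u v) (smul g w) p + bracket A v (bracket A u (smul g w)) p" by simp
  moreover have "bracket A (bracket A u v) (smul g w) p =
    g p *R bracket A (bracket A u v) w p + arho A (bracket A u v) g p *R w p"
   unfolding bracket_smul[OF bracket_closed[OF u v] w(1) g] by (simp add: smul_def)
  moreover have "bracket A u (bracket A v w) p = bracket A (bracket A u v) w p + bracket A v (bracket A u w) p"
   using bracket_jacobi'[OF u v w(1)] by simp
  ultimately have "(arho A u (arho A v g) p - arho A v (arho A u g) p - arho A (bracket A u v) g p) *R w p = 0"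
   unfolding E[OF u v] E[OF v u] by (simp add: algebra_simps)
  thus ?thesis using w(2) by simp
 qed
qed

end

sublocale algebroid \<subseteq> lr: lie_rinehart "smooth_funs M" "\<Gamma> M A" smul "arho A" "bracket A"
proof
 fix v w u g h
 assume v: "v : \<Gamma> M A"
 {
  assume g: "g : smooth_funs M"
  show "arho A v g : smooth_funs M" using arho_smooth[OF v g] .
  assume h: "h : smooth_funs M"
  show "arho A v (g + h) = arho A v g + arho A v h" "arho A v (g * h) = g * arho A v h + h * arho A v g"
   using arho_add[OF v g h] arho_mult[OF v g h] .
  show "arho A (smul g v) h = g * arho A v h"
   using anchor_scale sections_fibre[OF v] by (auto simp: arho_def smul_def fun_eq_iff)
 }
 show "bracket A v v = 0" using bracket_antisym[OF v v] by (simp add: fun_eq_iff eq_neg_iff_add_eq_0 flip: mult_2 scaleR_2)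
 assume w: "w : \<Gamma> M A"
 show "bracket A v w : \<Gamma> M A" "bracket A v w = - bracket A w v" using bracket_closed[OF v w] bracket_antisym[OF v w] .
 {
  assume g: "g : smooth_funs M"
  show "arho A (v + w) g = arho A v g + arho A w g"
   using anchor_add sections_fibre[OF v] sections_fibre[OF w] by (auto simp: arho_def fun_eq_iff)
  show "bracket A v (smul g w) = smul g (bracket A v w) + smul (arho A v g) w" using bracket_smul[OF v w g] .
  show "arho A (bracket A v w) g = arho A v (arho A w g) - arho A w (arho A v g)" using arho_bracket[OF v w g] .
 }
 assume u: "u : \<Gamma> M A"
 show "bracket A v (w + u) = bracket A v w + bracket A v u" using bracket_add_right[OF v w u] .
 show "bracket A v (bracket A w u) = bracket A (bracket A v w) u + bracket A w (bracket A v u)"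
  using bracket_jacobi'[OF v w u] .
qed

section \<open>The differential of a Lie algebroid\<close>

context algebroid
begin

lemma d_on_sections_ld:
 assumes h: "h : \<Omega> M A k" and vs: "vs : lists (\<Gamma> M A)"
 shows "d_on_sections A h vs p = lr.ld (on_sections h) vs p"
 unfolding lr.ld_formula[OF vs sec.altf_alt0[OF form_altf[OF h]]]
 by (simp add: d_on_sections_def sum_apply sign_fun_apply arho_def on_sections_def)

text \<open>Justifies the definite description in \<open>lie_d\<close>: existence by carrying
  \<open>ld\<close> over to the fibres, uniqueness because a global section passes through every
  vector.\<close>

lemma lie_d_ex1:
 assumes h: "h : \<Omega> M A k"
 shows "EX! w. w : \<Omega> M A (Suc k) & (ALL vs. length vs = Suc k --> set vs <= \<Gamma> M A -->
    (ALL p. w p (eval_sections vs p) = d_on_sections A h vs p))" proof (rule ex1I) let ?F = "lr.ld (on_sections h)"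
 have F: "sec.altf ?F" using lr.altf_ld[OF form_altf[OF h]] .
 show "on_fibre ?F : \<Omega> M A (Suc k) & (ALL vs. length vs = Suc k --> set vs <= \<Gamma> M A -->
    (ALL p. on_fibre ?F p (eval_sections vs p) = d_on_sections A h vs p))" proof (intro conjI allI impI)
  show "on_fibre ?F : \<Omega> M A (Suc k)" using on_fibre_form[OF F] lr.homog_ld[OF on_sections_homog[OF h]] by blast
  fix vs p assume "set vs <= \<Gamma> M A"
  hence vs: "vs : lists (\<Gamma> M A)" by auto
  show "on_fibre ?F p (eval_sections vs p) = d_on_sections A h vs p"
   using on_fibre_eval[OF F vs] d_on_sections_ld[OF h vs] by simp
 qed
next
 fix w assume w: "w : \<Omega> M A (Suc k) & (ALL vs. length vs = Suc k --> set vs <= \<Gamma> M A -->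
    (ALL p. w p (eval_sections vs p) = d_on_sections A h vs p))" let ?F = "lr.ld (on_sections h)"
 have F: "sec.altf ?F" using lr.altf_ld[OF form_altf[OF h]] .
 show "w = on_fibre ?F"
 proof (rule form_eqI)
  show "on_fibre ?F : \<Omega> M A (Suc k)" using on_fibre_form[OF F] lr.homog_ld[OF on_sections_homog[OF h]] by blast
  fix vs assume vs: "vs : lists (\<Gamma> M A)" "length vs = Suc k"
  hence "set vs <= \<Gamma> M A" by auto
  hence "w p (eval_sections vs p) = on_fibre ?F p (eval_sections vs p)" for p
   using w vs on_fibre_eval[OF F vs(1)] d_on_sections_ld[OF h vs(1)] by simp
  thus "on_sections w vs = on_sections (on_fibre ?F) vs" by (simp add: on_sections_def)
 qed (use w in blast)
qed

lemma lie_d: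
 assumes h: "h : \<Omega> M A k"
 shows lie_d_form: "lie_d M A k h : \<Omega> M A (Suc k)"
  and lie_d_eval: "vs : lists (\<Gamma> M A) ==> on_sections (lie_d M A k h) vs = lr.ld (on_sections h) vs"
proof -
 note d = theI'[OF lie_d_ex1[OF h], folded lie_d_def]
 show *: "lie_d M A k h : \<Omega> M A (Suc k)" using d by blast
 assume vs: "vs : lists (\<Gamma> M A)"
 show "on_sections (lie_d M A k h) vs = lr.ld (on_sections h) vs"
 proof (cases "length vs = Suc k")
  case True
  have "set vs <= \<Gamma> M A" using vs by auto
  thus ?thesis using d True d_on_sections_ld[OF h vs] by (simp add: on_sections_def fun_eq_iff)
 next
  case False
  thus ?thesis using on_sections_homog[OF *] lr.homog_ld[OF on_sections_homog[OF h] vs] by (simp add: homog_def)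
 qed
qed

lemma lie_d_eqI:
 assumes "h : \<Omega> M A k" "w : \<Omega> M A (Suc k)"
  and "!!vs. vs : lists (\<Gamma> M A) ==> length vs = Suc k ==> lr.ld (on_sections h) vs = on_sections w vs"
 shows "lie_d M A k h = w"
 by (rule form_eqI[OF lie_d_form[OF assms(1)] assms(2)]) (simp add: lie_d_eval[OF assms(1)] assms(3))

lemma on_sections_add: "on_sections (w + h) = on_sections w + on_sections h"
 and on_sections_minus: "on_sections (- w) = - on_sections w" by (auto simp: on_sections_def fun_eq_iff)

lemma form_valued: "w : \<Omega> M A k ==> sec.valued (on_sections w)" using sec.altf_valued form_altf by blast

lemma lie_d_add:
 assumes "w : \<Omega> M A k" "h : \<Omega> M A k"
 shows "lie_d M A k (w + h) = lie_d M A k w + lie_d M A k h" using assms by (intro lie_d_eqI forms_add lie_d_form)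
  (simp_all only: on_sections_add lr.ld_add form_valued lie_d_eval plus_fun_apply)

lemma lie_d_minus:
 assumes "w : \<Omega> M A k"
 shows "lie_d M A k (- w) = - lie_d M A k w" using assms by (intro lie_d_eqI forms_minus lie_d_form)
  (simp_all only: on_sections_minus lr.ld_minus form_valued lie_d_eval uminus_apply)

lemma lie_d_diff:
 assumes "w : \<Omega> M A k" "h : \<Omega> M A k"
 shows "lie_d M A k (w - h) = lie_d M A k w - lie_d M A k h"
 using lie_d_add[OF assms(1) forms_minus[OF assms(2)]] lie_d_minus[OF assms(2)] by simp

lemma lie_d_zero: "lie_d M A k 0 = 0" using lie_d_diff[OF forms_zero forms_zero, of k] by simp

lemma lie_d_lie_d:
 assumes "w : \<Omega> M A k" shows "lie_d M A (Suc k) (lie_d M A k w) = 0"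
proof (rule lie_d_eqI[OF lie_d_form[OF assms] forms_zero])
 fix vs assume vs: "vs : lists (\<Gamma> M A)"
 have "lr.ld (on_sections (lie_d M A k w)) vs = lr.ld (lr.ld (on_sections w)) vs"
  using vs lie_d_eval[OF assms] by (intro lr.ld_cong)
 thus "lr.ld (on_sections (lie_d M A k w)) vs = on_sections 0 vs"
  using lr.ld_ld[OF vs form_altf[OF assms]] by (auto simp: on_sections_def fun_eq_iff)
qed

lemma lie_d_fwedge:
 assumes w: "w : \<Omega> M A k" and h: "h : \<Omega> M A l"
 shows "even k ==> lie_d M A (k + l) (fwedge w h) = fwedge (lie_d M A k w) h + fwedge w (lie_d M A l h)"
  and "odd k ==> lie_d M A (k + l) (fwedge w h) = fwedge (lie_d M A k w) h - fwedge w (lie_d M A l h)"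
proof -
 have f: "fwedge (lie_d M A k w) h : \<Omega> M A (Suc (k + l))" "fwedge w (lie_d M A l h) : \<Omega> M A (Suc (k + l))"
  using fwedge_form[OF lie_d_form[OF w] h] fwedge_form[OF w lie_d_form[OF h]] by simp_all
 have e: "lr.ld (on_sections (fwedge w h)) vs =
   on_sections (fwedge (lie_d M A k w) h) vs + lwedge (invol (on_sections w)) (on_sections (lie_d M A l h)) vs"
  if vs: "vs : lists (\<Gamma> M A)" for vs
 proof -
  have sub: "us : lists (\<Gamma> M A)" if "set us <= set vs" for us using that vs by auto
  have "lr.ld (on_sections (fwedge w h)) vs = lr.ld (lwedge (on_sections w) (on_sections h)) vs"
   using vs on_sections_fwedge by (intro lr.ld_cong)
  also have "... = lwedge (lr.ld (on_sections w)) (on_sections h) vs +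
    lwedge (invol (on_sections w)) (lr.ld (on_sections h)) vs" using vs w h form_valued by (intro lr.ld_lwedge)
  also have "lwedge (lr.ld (on_sections w)) (on_sections h) vs = lwedge (on_sections (lie_d M A k w)) (on_sections h) vs"
   using lie_d_eval[OF w] sub by (intro lwedge_cong) auto
  also have "lwedge (invol (on_sections w)) (lr.ld (on_sections h)) vs =
    lwedge (invol (on_sections w)) (on_sections (lie_d M A l h)) vs"
   using lie_d_eval[OF h] sub by (intro lwedge_cong) auto
  finally show ?thesis by (simp only: on_sections_fwedge[of "lie_d M A k w" h vs])
 qed
 have inv: "invol (on_sections w) = (%vs. (-1) ^ k * on_sections w vs)" using homog_invol[OF on_sections_homog[OF w]] .
 {
  assume "even k"
  hence i: "invol (on_sections w) = on_sections w" by (simp add: inv)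
  show "lie_d M A (k + l) (fwedge w h) = fwedge (lie_d M A k w) h + fwedge w (lie_d M A l h)"
   by (rule lie_d_eqI[OF fwedge_form[OF w h] forms_add[OF f]])
    (simp only: e i on_sections_add on_sections_fwedge[symmetric] plus_fun_apply)
 next
  assume "odd k"
  hence i: "invol (on_sections w) = - on_sections w" by (auto simp: inv fun_eq_iff)
  have m: "on_sections (a - b) vs = on_sections a vs + - on_sections b vs" for a b vs
   by (auto simp: on_sections_def fun_eq_iff)
  show "lie_d M A (k + l) (fwedge w h) = fwedge (lie_d M A k w) h - fwedge w (lie_d M A l h)"
   by (rule lie_d_eqI[OF fwedge_form[OF w h] forms_diff[OF f]])
    (simp only: e i m lwedge_minus_left on_sections_fwedge[symmetric] uminus_apply)
 }
qed

end

lemma fwedge_algebra: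
 "fwedge (w + w') h = fwedge w h + fwedge w' h" "fwedge (w - w') h = fwedge w h - fwedge w' h"
 "fwedge w (h + h') = fwedge w h + fwedge w h'" "fwedge w (h - h') = fwedge w h - fwedge w h'"
 "fwedge (fwedge w h) t = fwedge w (fwedge h t)"
 "fwedge 0 h = 0" "fwedge w 0 = 0"
proof -
 have ap: "(f + g) p = f p + g p" "(f - g) p = f p - g p" "(0 :: ('a, 'b) form) p = 0" for f g :: "('a, 'b) form" and p
  by auto
 show "fwedge (w + w') h = fwedge w h + fwedge w' h" "fwedge (w - w') h = fwedge w h - fwedge w' h"
  "fwedge w (h + h') = fwedge w h + fwedge w h'" "fwedge w (h - h') = fwedge w h - fwedge w h'"
  by (rule ext, simp only: fwedge_def ap lwedge_add_left lwedge_diff_left lwedge_add_right lwedge_diff_right)+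
 show "fwedge (fwedge w h) t = fwedge w (fwedge h t)" by (simp only: fwedge_def lwedge_assoc)
 show "fwedge 0 h = 0" "fwedge w 0 = 0" by (rule ext, simp only: fwedge_def ap lwedge_zero_left lwedge_zero_right)+
qed

definition fform :: "('m => real) => ('m, 'v) form" where
 "fform g = (%p vs. if vs = [] then g p else 0)"

lemma fwedge_fform: "fwedge (fform g) w = (%p vs. g p * w p vs)" by (simp add: fwedge_def fform_def lwedge_scalar_left)

context algebroid
begin

lemma fform_form: "g : smooth_funs M ==> fform g : \<Omega> M A 0" using fun_form by (simp add: fform_def)

lemma fwedge_commute_even:
 assumes "w : \<Omega> M A k" "even k" shows "fwedge w h = fwedge h w"
proof -
 have "invol (w p) = w p" for p using homog_invol[OF forms_homog[OF assms(1)], of p] assms(2) by simp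
 thus ?thesis unfolding fwedge_def using lwedge_commute(1) by blast
qed

lemma fwedge_1_self:
 assumes "w : \<Omega> M A 1" shows "fwedge w w = 0"
 using lwedge_1_self[OF forms_homog[OF assms]] by (auto simp: fwedge_def fun_eq_iff)

text \<open>Applied with \<open>h = 1/2 ln g^2\<close>, it turns \<open>dg\<close> into
  \<open>g\<close> times an exact form.\<close>

lemma lie_d_fform_mult:
 assumes g: "g : smooth_funs M" and h: "h : smooth_funs M"
  and gh: "!!v p. v : \<Gamma> M A ==> arho A v g p = g p * arho A v h p"
 shows "lie_d M A 0 (fform g) = fwedge (fform g) (lie_d M A 0 (fform h))"
proof (rule lie_d_eqI[OF fform_form[OF g]])
 show "fwedge (fform g) (lie_d M A 0 (fform h)) : \<Omega> M A (Suc 0)"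
  using fwedge_form[OF fform_form[OF g] lie_d_form[OF fform_form[OF h]]] by simp
 fix vs assume vs: "vs : lists (\<Gamma> M A)" "length vs = Suc 0"
 then obtain v where v: "vs = [v]" "v : \<Gamma> M A" by (auto simp: length_Suc_conv)
 have d: "lr.ld (on_sections (fform g)) vs = arho A v g" for g by (simp add: v on_sections_def fform_def eval_sections_def)
 have "on_sections (fwedge (fform g) (lie_d M A 0 (fform h))) vs p = arho A v g p" for p
  using fun_cong[OF lie_d_eval[OF fform_form[OF h] vs(1)], of p] gh[OF v(2)]
  unfolding d by (simp add: fwedge_fform on_sections_def)
 thus "lr.ld (on_sections (fform g)) vs = on_sections (fwedge (fform g) (lie_d M A 0 (fform h))) vs"
  unfolding d by auto
qed

lemma wedge_power2_form: "x : \<Omega> M A 2 ==> wedge_power2 x n : \<Omega> M A (2 * n)"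
proof (induction n)
 case (Suc n)
 thus ?case
  using wedge_eq_fwedge[of x 2 "wedge_power2 x n" "2 * n"] fwedge_form[of x 2 "wedge_power2 x n" "2 * n"] by simp
qed (simp add: unit_form)

lemma wedge_power2_Suc: "x : \<Omega> M A 2 ==> wedge_power2 x (Suc n) = fwedge x (wedge_power2 x n)"
 using wedge_eq_fwedge[of x 2 "wedge_power2 x n" "2 * n"] wedge_power2_form by simp

lemma wedge_power2_closed:
 assumes x: "x : \<Omega> M A 2" "lie_d M A 2 x = 0"
 shows "lie_d M A (2 * n) (wedge_power2 x n) = 0"
proof (induction n)
 case 0
 have "lie_d M A 0 unit_form = 0"
 proof (rule lie_d_eqI[OF unit_form forms_zero])
  fix vs assume vs: "vs : lists (\<Gamma> M A)" "length vs = Suc 0"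
  then obtain v where v: "vs = [v]" "v : \<Gamma> M A" by (auto simp: length_Suc_conv)
  show "lr.ld (on_sections unit_form) vs = on_sections 0 vs" using tangent_const[OF section_tangent[OF v(2)]]
   by (auto simp: v on_sections_def unit_form_def eval_sections_def arho_def fun_eq_iff)
 qed
 thus ?case by simp
next
 case (Suc n)
 have "lie_d M A (2 + 2 * n) (fwedge x (wedge_power2 x n)) = 0"
  using lie_d_fwedge(1)[OF x(1) wedge_power2_form[OF x(1), of n] even_numeral]
  unfolding Suc x(2) fwedge_algebra(6,7) add_0_left .
 thus ?case unfolding wedge_power2_Suc[OF x(1)] by simp
qed

lemma wedge_power2_filt:
 assumes x: "x : \<Omega> M A 2" "filt (fibre A p) (B p) 1 (x p)"
 shows "filt (fibre A p) (B p) n (wedge_power2 x n p)"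
proof (induction n)
 case (Suc n)
 thus ?case using filt_lwedge[OF x(2) Suc] unfolding wedge_power2_Suc[OF x(1)] fwedge_def by simp
qed simp

subsection \<open>Defining forms\<close>

lemma wedge_list_pt:
 assumes "ALL a:set rs. ptform p 1 (a p)"
 shows "wedge_list rs p = lwedge_list (map (%a. a p) rs) & ptform p (length rs) (wedge_list rs p)" using assms
proof (induction rs)
 case Nil
 thus ?case using forms_ptform[OF unit_form UNIV_I] by (simp add: unit_form_def)
next
 case (Cons a rs)
 hence 1: "ptform p 1 (a p)" "wedge_list rs p = lwedge_list (map (%a. a p) rs)"
  "ptform p (length rs) (wedge_list rs p)" by auto
 show ?case using wedge_pt[where p=p and w=a and n="wedge_list rs", OF 1(1,3)] ptform_lwedge[OF 1(1,3)] 1(2) by simp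
qed

lemma decomposes_pt:
 assumes "decomposes_on M A U q r rs" "p : U"
 shows "r p = lwedge_list (map (%a. a p) rs)" "ALL a:set rs. ptform p 1 (a p)"
proof -
 show *: "ALL a:set rs. ptform p 1 (a p)" using assms forms_ptform unfolding decomposes_on_def by blast
 show "r p = lwedge_list (map (%a. a p) rs)" using wedge_list_pt[OF *] assms unfolding decomposes_on_def by simp
qed

lemma decomposes_kernel:
 assumes "decomposes_on M A U q r rs" "p : U" and ws: "ws : lists (fibre A p)" "r p ws ~= 0"
 shows "{v : fibre A p. ALL a:set rs. a p [v] = 0} = form_kernel (fibre A p) (r p)"
  and "fibre A p <= span (form_kernel (fibre A p) (r p) Un set ws)"
proof -
 note d = decomposes_pt[OF assms(1,2)]
 have h: "ALL a:set (map (%a. a p) rs). homog 1 a & alt_on (fibre A p) a" using d(2) by (auto simp: ptform_def)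
 hence h1: "ALL a:set (map (%a. a p) rs). homog 1 a" by blast
 have nz: "lwedge_list (map (%a. a p) rs) ws ~= 0" using ws(2) unfolding d(1) .
 show 1: "{v : fibre A p. ALL a:set rs. a p [v] = 0} = form_kernel (fibre A p) (r p)"
  using decomposable_kernel[OF h1 ws(1) nz] unfolding d(1) by simp
 show "fibre A p <= span (form_kernel (fibre A p) (r p) Un set ws)"
  using decomposable_span[OF fibre_subspace h ws(1) nz] unfolding 1[symmetric] by simp
qed

lemma defining_formD:
 assumes "defining_form M A B q r"
 shows defining_form_form: "r : \<Omega> M A q"
  and defining_form_nonzero: "EX ws. ws : lists (fibre A p) & length ws = q & r p ws ~= 0"
  and defining_form_kernel: "B p = form_kernel (fibre A p) (r p)"
  and defining_form_span: "ws : lists (fibre A p) ==> r p ws ~= 0 ==> fibre A p <= span (B p Un set ws)"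
proof -
 have a: "r : \<Omega> M A q" "EX vs. r p vs ~= 0"
  "EX U rs. open U & p : U & decomposes_on M A U q r rs"
  "!!U rs. open U ==> decomposes_on M A U q r rs ==> p : U ==> B p = {v : fibre A p. ALL a:set rs. a p [v] = 0}"
  using assms unfolding defining_form_def by blast+
 show "r : \<Omega> M A q" using a(1) .
 obtain vs where vs: "r p vs ~= 0" using a(2) by blast
 have vs': "vs : lists (fibre A p)" "length vs = q" using forms_support(2,3)[OF a(1) vs] by auto
 show "EX ws. ws : lists (fibre A p) & length ws = q & r p ws ~= 0" using vs vs' by blast
 obtain U rs where U: "open U" "p : U" "decomposes_on M A U q r rs" using a(3) by blast
 show *: "B p = form_kernel (fibre A p) (r p)" using a(4)[OF U(1,3,2)] decomposes_kernel(1)[OF U(3,2) vs'(1) vs] by simp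
 show "fibre A p <= span (B p Un set ws)" if "ws : lists (fibre A p)" "r p ws ~= 0"
  unfolding * using decomposes_kernel(2)[OF U(3,2) that] .
qed

lemma defining_form_filt: "defining_form M A B q a ==> filt (fibre A p) (B p) q (a p)"
proof -
 assume a: "defining_form M A B q a"
 show "filt (fibre A p) (B p) q (a p)" unfolding defining_form_kernel[OF a]
  by (rule filt_kernel[OF fibre_subspace forms_alt[OF defining_form_form[OF a] UNIV_I] forms_homog[OF defining_form_form[OF a]] order_refl])
qed

text \<open>\<open>alt_on_filt_zero\<close> for arguments \<open>ws\<close> on which the defining
  form does not vanish; together with \<open>B\<close> they span the fibre.\<close>

lemma form_zeroI:
 assumes a: "defining_form M A B q a" and t: "t : \<Omega> M A k"
  and fil: "!!p. filt (fibre A p) (B p) q (t p)"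
  and z: "!!p bs ws. bs : lists (B p) ==> ws : lists (fibre A p) ==> length ws = q ==> a p ws ~= 0 ==> t p (bs @ ws) = 0"
 shows "t = 0"
proof (intro ext)
 fix p vs
 obtain ws where ws: "ws : lists (fibre A p)" "length ws = q" "a p ws ~= 0" using defining_form_nonzero[OF a] by blast
 have B: "B p <= fibre A p" using defining_form_kernel[OF a, of p] by (auto simp: form_kernel_def)
 have "t p vs = 0" if "vs : lists (fibre A p)"
  by (rule alt_on_filt_zero[OF fibre_subspace forms_alt[OF t UNIV_I] B ws(1) defining_form_span[OF a ws(1,3)]])
   (use fil[of p] z[OF _ ws] ws(2) that in auto)
 thus "t p vs = 0 p vs" using forms_support(3)[OF t, of p vs] by auto
qed

text \<open>On \<open>bs @ ws\<close> at most the \<open>q\<close> entries of \<open>ws\<close> lie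
  outside \<open>B\<close>, one fewer than this step of the filtration asks for.\<close>

lemma form_filt_zero:
 assumes a: "defining_form M A B q a" and t: "t : \<Omega> M A k"
  and fil: "!!p. filt (fibre A p) (B p) (Suc q) (t p)"
 shows "t = 0"
proof (rule form_zeroI[OF a t])
 show "filt (fibre A p) (B p) q (t p)" for p using filt_mono[OF fil] by simp
 fix p bs ws assume l: "bs : lists (B p)" "ws : lists (fibre A p)" "length ws = q"
 have "bs @ ws : lists (fibre A p)" using l defining_form_kernel[OF a, of p] by (auto simp: form_kernel_def)
 moreover have "filter (%v. v ~: B p) bs = []" using l(1) by (auto simp: filter_empty_conv)
 hence "length (filter (%v. v ~: B p) (bs @ ws)) < Suc q" using l(3) length_filter_le[of "%v. v ~: B p" ws] by simp
 ultimately show "t p (bs @ ws) = 0" using fil[of p] by (simp add: filt_def)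
qed

text \<open>Evaluated on \<open>bs @ ws\<close> with \<open>bs\<close> in \<open>B\<close>, the
  product splits into \<open>t(bs) a(ws)\<close>, and \<open>ws\<close> can be chosen with
  \<open>a(ws)\<close> nonzero.\<close>

lemma annihilator_filt:
 assumes a: "defining_form M A B q a" and t: "t : \<Omega> M A k" "fwedge t a = 0"
 shows "filt (fibre A p) (B p) 1 (t p)" unfolding filt_def
proof (intro ballI impI)
 fix bs assume bs: "bs : lists (fibre A p)" "length (filter (%v. v ~: B p) bs) < 1"
 obtain ws where ws: "ws : lists (fibre A p)" "length ws = q" "a p ws ~= 0" using defining_form_nonzero[OF a] by blast
 have K: "B p = form_kernel (fibre A p) (a p)" using defining_form_kernel[OF a] .
 have b: "bs : lists (B p)" using bs by (auto simp: filter_empty_conv)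
 show "t p bs = 0"
 proof (cases "length bs = k")
  case True
  have "lwedge (t p) (a p) (bs @ ws) = t p bs * a p ws" by (rule lwedge_kernel_split[where B="B p" and V="fibre A p"])
    (use b ws True forms_homog[OF t(1)] in \<open>auto simp: K form_kernel_def\<close>)
  moreover have "lwedge (t p) (a p) (bs @ ws) = 0"
   using fun_cong[OF fun_cong[OF t(2)], of p "bs @ ws"] by (simp add: fwedge_def)
  ultimately show ?thesis using ws(3) by simp
 next
  case False
  thus ?thesis using forms_homog[OF t(1)] by (simp add: homog_def)
 qed
qed

text \<open>Both forms lie in the \<open>q\<close>-th step of the filtration, where a
  \<open>q\<close>-form is determined by its value on a single list \<open>ws\<close> with
  \<open>r p ws\<close> nonzero.\<close>

lemma defining_form_unique:
 assumes r: "defining_form M A B q r" and r': "defining_form M A B q r'"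
 obtains g where "g : smooth_funs M" "!!p. g p ~= 0" "r' = fwedge (fform g) r"
proof -
 have "EX ws. ws : lists (fibre A p) & length ws = q & r p ws ~= 0" for p using defining_form_nonzero[OF r] .
 then obtain ws where ws: "!!p. ws p : lists (fibre A p)" "!!p. length (ws p) = q" "!!p. r p (ws p) ~= 0" by metis
 define g where "g p = r' p (ws p) / r p (ws p)" for p
 note f = defining_form_form[OF r] defining_form_form[OF r']
 have eq: "r' p us = g p * r p us" for p us
 proof (cases "us : lists (fibre A p)")
  case True
  interpret pt: lmodule "UNIV :: real set" "fibre A p" scaleR using lmodule_subspace[OF fibre_subspace] .
  let ?F = "r' p - (%us. g p * r p us)"
  have a: "alt_on (fibre A p) ?F"
   using forms_alt[OF f(1) UNIV_I] forms_alt[OF f(2) UNIV_I] by (intro pt.altf_diff pt.altf_scale) auto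
  have BF: "B p <= fibre A p" using defining_form_kernel[OF r, of p] by (auto simp: form_kernel_def)
  have "filt (fibre A p) (B p) q (%us. g p * r p us)" using defining_form_filt[OF r, of p] by (auto simp: filt_def)
  hence fi: "filt (fibre A p) (B p) (length (ws p)) ?F" unfolding ws(2) by (intro filt_diff defining_form_filt[OF r'])
  have "?F (bs @ ws p) = 0" for bs
  proof (cases "bs = []")
   case True
   thus ?thesis using ws(3)[of p] by (simp add: g_def)
  next
   case False
   hence "length (bs @ ws p) ~= q" using ws(2)[of p] by (cases bs) auto
   thus ?thesis using forms_homog[OF f(1), of p] forms_homog[OF f(2), of p] by (simp add: homog_def)
  qed
  hence "?F us = 0"
   by (intro alt_on_filt_zero[OF fibre_subspace a BF ws(1) defining_form_span[OF r ws(1,3)] fi _ True])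
  thus ?thesis by simp
 next
  case False
  hence "~ set us <= fibre A p" by auto
  hence "r p us = 0" "r' p us = 0"
   using forms_support(3)[OF f(1), of p us] forms_support(3)[OF f(2), of p us] by blast+
  thus ?thesis by simp
 qed
 have "g p ~= 0" for p using defining_form_nonzero[OF r', of p] eq[of p] by auto
 \<comment> \<open>The lists \<open>ws p\<close> are chosen without any regularity in
   \<open>p\<close>. As the ratio is the same on every list, it can be computed near
   \<open>p\<close> on fixed sections extending \<open>ws p\<close>.\<close>
 moreover have "smooth_at M g p" for p
 proof -
  let ?vs = "map (extend_vec p) (ws p)"
  have vs: "?vs : lists (\<Gamma> M A)" "eval_sections ?vs p = ws p" using extend_list[of "ws p" p] ws(1)[of p] by auto
  have s: "on_sections r ?vs : smooth_funs M" "on_sections r' ?vs : smooth_funs M"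
   using form_valued[OF f(1)] form_valued[OF f(2)] vs(1) by (auto simp: sec.valued_def)
  have nz: "on_sections r ?vs p ~= 0" using ws(3)[of p] vs(2) by (simp add: on_sections_def)
  obtain U where U: "open U" "p : U" "!!x. x : U ==> smooth_at M (on_sections r ?vs) x & on_sections r ?vs x ~= 0"
   using smooth_at_nonzero_open[OF smooth_funsD[OF s(1)] nz] by metis
  show ?thesis by (rule smooth_at_cong[OF smooth_at_divide[OF smooth_funsD[OF s(2)] smooth_funsD[OF s(1)] nz] U(1,2)])
    (use U(3) eq in \<open>auto simp: on_sections_def\<close>)
 qed
 hence "g : smooth_funs M" by (simp add: smooth_funs_iff)
 moreover have "r' = fwedge (fform g) r" unfolding fwedge_fform using eq by blast
 ultimately show ?thesis using that by blast
qed

subsection \<open>Independence of choices\<close>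

definition gv_pair :: "('m => 'v set) => nat => ('m, 'v) form => ('m, 'v) form => bool" where
 "gv_pair B q a b \<longleftrightarrow> defining_form M A B q a & b : \<Omega> M A 1 & lie_d M A q a = wedge 1 q b a"

definition gv_form :: "nat => ('m, 'v) form => ('m, 'v) form" where
 "gv_form q b = wedge 1 (2 * q) b (wedge_power2 (lie_d M A 1 b) q)"

lemma lie_d_1_form: "b : \<Omega> M A 1 ==> lie_d M A 1 b : \<Omega> M A 2" using lie_d_form[of b 1] by (simp add: numeral_2_eq_2)

lemma lie_d_1_closed: "b : \<Omega> M A 1 ==> lie_d M A 2 (lie_d M A 1 b) = 0" using lie_d_lie_d[of b 1] by (simp add: numeral_2_eq_2)

lemma gv_form_eq: "b : \<Omega> M A 1 ==> gv_form q b = fwedge b (wedge_power2 (lie_d M A 1 b) q)"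
 unfolding gv_form_def by (intro wedge_eq_fwedge wedge_power2_form lie_d_1_form)

lemma gv_form_form: "b : \<Omega> M A 1 ==> gv_form q b : \<Omega> M A (2 * q + 1)"
 using fwedge_form[OF _ wedge_power2_form[OF lie_d_1_form], of b 1 b q] by (simp add: gv_form_eq)

lemma gv_pairD:
 assumes "gv_pair B q a b"
 shows "defining_form M A B q a" "b : \<Omega> M A 1" "lie_d M A q a = fwedge b a"
 using assms wedge_eq_fwedge[OF _ defining_form_form] unfolding gv_pair_def by auto

text \<open>Expand \<open>d d a = 0\<close> with \<open>d a = b \<and> a\<close> and use
  \<open>b \<and> b = 0\<close>.\<close>

lemma gv_pair_annihilate:
 assumes "gv_pair B q a b" shows "fwedge (lie_d M A 1 b) a = 0"
proof -
 note p = gv_pairD[OF assms]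
 have "0 = lie_d M A (Suc q) (fwedge b a)" using lie_d_lie_d[OF defining_form_form[OF p(1)]] p(3) by simp
 also have "... = fwedge (lie_d M A 1 b) a - fwedge b (fwedge b a)"
  using lie_d_fwedge(2)[OF p(2) defining_form_form[OF p(1)]] p(3) by simp
 also have "fwedge b (fwedge b a) = 0"
  using fwedge_1_self[OF p(2)] by (simp only: fwedge_algebra(5)[symmetric] fwedge_algebra(6))
 finally show ?thesis by (metis diff_zero)
qed

text \<open>The differential is the power \<open>q + 1\<close> of \<open>d b\<close>, and each
  factor contributes one step of the filtration.\<close>

lemma gv_form_closed:
 assumes "gv_pair B q a b" shows "lie_d M A (2 * q + 1) (gv_form q b) = 0"
proof -
 note p = gv_pairD[OF assms]
 let ?x = "lie_d M A 1 b"
 note x = lie_d_1_form[OF p(2)] lie_d_1_closed[OF p(2)]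
 have P: "wedge_power2 ?x q : \<Omega> M A (2 * q)" using wedge_power2_form[OF x(1)] .
 have "lie_d M A (1 + 2 * q) (fwedge b (wedge_power2 ?x q)) = fwedge ?x (wedge_power2 ?x q) - fwedge b 0"
  using lie_d_fwedge(2)[OF p(2) P] wedge_power2_closed[OF x] by simp
 also have "... = wedge_power2 ?x (Suc q)" using wedge_power2_Suc[OF x(1)] by (simp only: fwedge_algebra diff_zero)
 also have "... = 0"
 proof (rule form_filt_zero[OF p(1) wedge_power2_form[OF x(1)]])
  have "filt (fibre A y) (B y) 1 (?x y)" for y using annihilator_filt[OF p(1) x(1) gv_pair_annihilate[OF assms]] .
  thus "filt (fibre A y) (B y) (Suc q) (wedge_power2 ?x (Suc q) y)" for y
   using wedge_power2_filt[where B=B, OF x(1)] by blast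
 qed
 finally show ?thesis using gv_form_eq[OF p(2)] by simp
qed

text \<open>With \<open>a' = g a\<close>, the form \<open>b1 = b + dh\<close> for
  \<open>h = 1/2 ln g^2\<close> belongs to \<open>a'\<close> and has the same differential as
  \<open>b\<close>, so \<open>b' = b1 + u\<close> with \<open>u \<and> a' = 0\<close>. Put
  \<open>x = db\<close>, \<open>x' = db'\<close> and \<open>x'^q - x^q = du \<and> Q\<close>. The
  difference of the representatives is then the differential of
  \<open>h x^q - b1 \<and> u \<and> Q\<close>, up to terms of filtration \<open>q + 1\<close>, which
  vanish.\<close>

lemma gv_form_unique:
 assumes 1: "gv_pair B q a b" and 2: "gv_pair B q a' b'"
 shows "gv_form q b' - gv_form q b : lie_d M A (2 * q) ` \<Omega> M A (2 * q)"
proof -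
 note p = gv_pairD[OF 1] and p' = gv_pairD[OF 2]
 obtain g where g: "g : smooth_funs M" "!!p. g p ~= 0" "a' = fwedge (fform g) a"
  using defining_form_unique[OF p(1) p'(1)] by metis
 \<comment> \<open>The square keeps the logarithm legitimate where \<open>g\<close> is
   negative.\<close>
 define h where "h x = 1 / 2 * ln (g x * g x)" for x
 have gg: "(%x. g x * g x) : smooth_funs M" "!!x. g x * g x > 0"
  using smooth_funs_closed(3)[OF g(1,1)] g(2) by (auto simp: zero_less_mult_iff linorder_neq_iff)
 have lg: "(%x. ln (g x * g x)) : smooth_funs M" using smooth_funs_ln[OF gg] .
 have h: "h : smooth_funs M" unfolding h_def by (intro smooth_funs_closed lg)
 have gh: "arho A v g x = g x * arho A v h x" if v: "v : \<Gamma> M A" for v x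
 proof -
  note X = section_tangent[OF v, of x]
  have "arho A v h x = 1 / 2 * ((g x * anchor A x (v x) g + g x * anchor A x (v x) g) / (g x * g x))"
   unfolding arho_def h_def tangent_cmult[OF X lg] tangent_ln[OF X gg] tangent_mult[OF X g(1,1)] ..
  thus ?thesis using g(2)[of x] by (simp add: arho_def field_simps)
 qed
 define k where "k = lie_d M A 0 (fform h)"
 have k: "k : \<Omega> M A 1" "lie_d M A 1 k = 0"
  using lie_d_form[OF fform_form[OF h]] lie_d_lie_d[OF fform_form[OF h]] by (simp_all add: k_def)
 define b1 where "b1 = b + k"
 define u where "u = b' - b1"
 have b1: "b1 : \<Omega> M A 1" "lie_d M A 1 b1 = lie_d M A 1 b"
  using forms_add[OF p(2) k(1)] lie_d_add[OF p(2) k(1)] k(2) by (simp_all add: b1_def)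
 have u: "u : \<Omega> M A 1" using forms_diff[OF p'(2) b1(1)] by (simp add: u_def)
 have "lie_d M A q a' = fwedge b1 a'"
 proof -
  have "lie_d M A (0 + q) (fwedge (fform g) a) = fwedge (lie_d M A 0 (fform g)) a + fwedge (fform g) (lie_d M A q a)"
   using lie_d_fwedge(1)[OF fform_form[OF g(1)] defining_form_form[OF p(1)]] by simp
  also have "lie_d M A 0 (fform g) = fwedge (fform g) k" unfolding k_def by (rule lie_d_fform_mult[OF g(1) h gh])
  also have "fwedge (fform g) k = fwedge k (fform g)" by (rule fwedge_commute_even[OF fform_form[OF g(1)]]) simp
  also have "fwedge (fform g) (lie_d M A q a) = fwedge b (fwedge (fform g) a)"
   unfolding p(3) using fwedge_commute_even[OF fform_form[OF g(1)], of b] by (simp add: fwedge_algebra(5)[symmetric])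
  finally show ?thesis by (simp only: g(3) b1_def fwedge_algebra(1,5) add_0_left add.commute)
 qed
 hence "fwedge u a' = 0" using p'(3) by (simp add: u_def fwedge_algebra(2))
 hence uf: "filt (fibre A y) (B y) 1 (u y)" for y using annihilator_filt[OF p'(1) u] by blast
 define x where "x = lie_d M A 1 b"
 define x' where "x' = lie_d M A 1 b'"
 have x: "x : \<Omega> M A 2" "lie_d M A 2 x = 0" "!!y. filt (fibre A y) (B y) 1 (x y)"
  using lie_d_1_form[OF p(2)] lie_d_1_closed[OF p(2)]
   annihilator_filt[OF p(1) lie_d_1_form[OF p(2)] gv_pair_annihilate[OF 1]] by (auto simp: x_def)
 have x': "x' : \<Omega> M A 2" "lie_d M A 2 x' = 0" "!!y. filt (fibre A y) (B y) 1 (x' y)"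
  using lie_d_1_form[OF p'(2)] lie_d_1_closed[OF p'(2)]
   annihilator_filt[OF p'(1) lie_d_1_form[OF p'(2)] gv_pair_annihilate[OF 2]] by (auto simp: x'_def)
 have du: "lie_d M A 1 u = x' - x" using lie_d_diff[OF p'(2) b1(1)] b1(2) by (simp add: u_def x_def x'_def)
 let ?P = "wedge_power2 x" and ?P' = "wedge_power2 x'"
 \<comment> \<open>\<open>Q n\<close> is the sum of \<open>x^i x'^j\<close> over
   \<open>i + j = n - 1\<close>, the formal quotient of \<open>x'^n - x^n\<close> by
   \<open>x' - x\<close>; hence the shifted index in the claims on degree and filtration.\<close>
 define Q where "Q = rec_nat 0 (%n r. ?P' n + fwedge x r)"
 have Q0: "Q 0 = 0" and QS: "Q (Suc n) = ?P' n + fwedge x (Q n)" for n by (simp_all add: Q_def)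
 have Q: "Q (Suc n) : \<Omega> M A (2 * n) & lie_d M A (2 * n) (Q (Suc n)) = 0 & filt (fibre A y) (B y) n (Q (Suc n) y)" for n y
 proof (induction n)
  case 0
  have "Q (Suc 0) = unit_form" by (simp add: QS Q0 fwedge_algebra(7))
  thus ?case using unit_form wedge_power2_closed[OF x(1,2), of 0] by simp
 next
  case (Suc n)
  have f: "fwedge x (Q (Suc n)) : \<Omega> M A (2 * Suc n)" using fwedge_form[OF x(1), of "Q (Suc n)" "2 * n"] Suc by simp
  have P: "?P' (Suc n) : \<Omega> M A (2 * Suc n)" using wedge_power2_form[OF x'(1)] .
  have Qn: "Q (Suc n) : \<Omega> M A (2 * n)" "lie_d M A (2 * n) (Q (Suc n)) = 0" using Suc by blast+
  have "lie_d M A (2 + 2 * n) (fwedge x (Q (Suc n))) = 0" using lie_d_fwedge(1)[OF x(1) Qn(1) even_numeral]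
   unfolding x(2) Qn(2) fwedge_algebra(6,7) add_0_left .
  hence c: "lie_d M A (2 * Suc n) (fwedge x (Q (Suc n))) = 0" by simp
  have "filt (fibre A y) (B y) (Suc n) (fwedge x (Q (Suc n)) y)"
   using filt_lwedge[OF x(3)] Suc unfolding fwedge_def by fastforce
  hence "filt (fibre A y) (B y) (Suc n) (?P' (Suc n) y + fwedge x (Q (Suc n)) y)"
   using wedge_power2_filt[where B=B, OF x'(1) x'(3)] by (intro filt_add)
  thus ?case unfolding QS[of "Suc n"]
   using forms_add[OF P f] lie_d_add[OF P f] wedge_power2_closed[OF x'(1,2), of "Suc n"] c by (metis add_0 plus_fun_apply)
 qed
 have diffP: "?P' n - ?P n = fwedge (x' - x) (Q n)" for n
 proof (induction n)
  case 0
  show ?case unfolding Q0 fwedge_algebra(7) by (simp only: wedge_power2.simps diff_self)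
 next
  case (Suc n)
  have dx: "x' - x : \<Omega> M A 2" using forms_diff[OF x'(1) x(1)] .
  have "?P' (Suc n) - ?P (Suc n) = fwedge (x' - x) (?P' n) + fwedge x (?P' n - ?P n)"
   unfolding wedge_power2_Suc[OF x(1)] wedge_power2_Suc[OF x'(1)] by (simp add: fwedge_algebra)
  also have "fwedge x (?P' n - ?P n) = fwedge (fwedge x (x' - x)) (Q n)" unfolding Suc fwedge_algebra(5) ..
  also have "fwedge x (x' - x) = fwedge (x' - x) x" using fwedge_commute_even[OF x(1)] by simp
  finally show ?case by (simp only: QS fwedge_algebra(3,5))
 qed
 \<comment> \<open>\<open>u\<close> contributes one step of the filtration and the power
   \<open>q\<close> more.\<close>
 have uP: "fwedge u (?P' q) = 0"
 proof (rule form_filt_zero[OF p(1)])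
  show "fwedge u (?P' q) : \<Omega> M A (1 + 2 * q)" using fwedge_form[OF u wedge_power2_form[OF x'(1)]] .
  show "filt (fibre A y) (B y) (Suc q) (fwedge u (?P' q) y)" for y
   using filt_lwedge[OF uf wedge_power2_filt[where B=B, OF x'(1) x'(3)], of y q] by (simp add: fwedge_def)
 qed
 have "b' = b + k + u" by (simp add: u_def b1_def)
 hence "gv_form q b' - gv_form q b = fwedge b1 (?P' q) - fwedge b (?P q)"
  unfolding gv_form_eq[OF p(2)] gv_form_eq[OF p'(2)] x_def[symmetric] x'_def[symmetric]
  using uP by (simp add: fwedge_algebra(1) b1_def)
 also have "... = fwedge k (?P q) + fwedge b1 (?P' q - ?P q)" by (simp add: fwedge_algebra b1_def)
 also have "fwedge b1 (?P' q - ?P q) = fwedge b1 (fwedge (lie_d M A 1 u) (Q q))" unfolding diffP du ..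
 finally have D: "gv_form q b' - gv_form q b = fwedge k (?P q) + fwedge b1 (fwedge (lie_d M A 1 u) (Q q))" .
 have hP: "fwedge (fform h) (?P q) : \<Omega> M A (2 * q)"
  using fwedge_form[OF fform_form[OF h] wedge_power2_form[OF x(1)]] by simp
 have dhP: "lie_d M A (2 * q) (fwedge (fform h) (?P q)) = fwedge k (?P q)"
  using lie_d_fwedge(1)[OF fform_form[OF h] wedge_power2_form[OF x(1)], of q] wedge_power2_closed[OF x(1,2), of q]
  by (simp add: k_def fwedge_algebra(7))
 \<comment> \<open>For \<open>q = 0\<close> there is nothing to integrate since
   \<open>Q 0 = 0\<close>. Otherwise \<open>t = b1 \<and> u \<and> Q q\<close> works, because the
   unwanted term \<open>x \<and> u \<and> Q q\<close> of its differential has filtration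
   \<open>1 + 1 + (q - 1)\<close>.\<close>
 have "EX t:\<Omega> M A (2 * q). lie_d M A (2 * q) t = - fwedge b1 (fwedge (lie_d M A 1 u) (Q q))"
 proof (cases q)
  case 0
  thus ?thesis by (intro bexI[of _ 0]) (simp_all add: Q0 fwedge_algebra(7) lie_d_zero forms_zero)
 next
  case (Suc n)
  have Qn: "Q q : \<Omega> M A (2 * n)" "lie_d M A (2 * n) (Q q) = 0" "!!y. filt (fibre A y) (B y) n (Q q y)"
   using Q[of n] Suc by auto
  have uQ: "fwedge u (Q q) : \<Omega> M A (1 + 2 * n)" using fwedge_form[OF u Qn(1)] .
  have duQ: "lie_d M A (1 + 2 * n) (fwedge u (Q q)) = fwedge (lie_d M A 1 u) (Q q)"
   using lie_d_fwedge(2)[OF u Qn(1)] Qn(2) by (simp add: fwedge_algebra(7))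
  have t: "fwedge b1 (fwedge u (Q q)) : \<Omega> M A (2 * q)" using fwedge_form[OF b1(1) uQ] Suc by simp
  have "fwedge x (fwedge u (Q q)) = 0"
  proof (rule form_filt_zero[OF p(1)])
   show "fwedge x (fwedge u (Q q)) : \<Omega> M A (2 + (1 + 2 * n))" using fwedge_form[OF x(1) uQ] .
   show "filt (fibre A y) (B y) (Suc q) (fwedge x (fwedge u (Q q)) y)" for y
    using filt_lwedge[OF x(3) filt_lwedge[OF uf Qn(3)], of y] Suc by (simp add: fwedge_def)
  qed
  hence "lie_d M A (1 + (1 + 2 * n)) (fwedge b1 (fwedge u (Q q))) = - fwedge b1 (fwedge (lie_d M A 1 u) (Q q))"
   using lie_d_fwedge(2)[OF b1(1) uQ] duQ b1(2) by (simp add: x_def)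
  thus ?thesis using t Suc by (intro bexI[of _ "fwedge b1 (fwedge u (Q q))"]) simp_all
 qed
 then obtain t where t: "t : \<Omega> M A (2 * q)" "lie_d M A (2 * q) t = - fwedge b1 (fwedge (lie_d M A 1 u) (Q q))" by blast
 have "gv_form q b' - gv_form q b = lie_d M A (2 * q) (fwedge (fform h) (?P q) - t)"
  unfolding D lie_d_diff[OF hP t(1)] t(2) dhP by simp
 thus ?thesis using forms_diff[OF hP t(1)] by blast
qed

lemma cohomology_class_eqI:
 assumes "w' - w : lie_d M A k ` \<Omega> M A k"
 shows "cohomology_class M A (Suc k) w' = cohomology_class M A (Suc k) w"
proof -
 obtain t where t: "t : \<Omega> M A k" "w' - w = lie_d M A k t" using assms by blast
 have e: "w' = w + lie_d M A k t" using t(2) by (simp add: algebra_simps)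
 have 1: "w' + lie_d M A k s = w + lie_d M A k (t + s)" if "s : \<Omega> M A k" for s
  using lie_d_add[OF t(1) that] e by (simp add: add.assoc)
 have 2: "w + lie_d M A k s = w' + lie_d M A k (s - t)" if "s : \<Omega> M A k" for s
  using lie_d_diff[OF that t(1)] e by (simp add: algebra_simps)
 show ?thesis unfolding cohomology_class_def coboundaries_def nat.case
 proof (intro equalityI subsetI)
  fix z assume "z : (+) w' ` lie_d M A k ` \<Omega> M A k"
  thus "z : (+) w ` lie_d M A k ` \<Omega> M A k" using 1 forms_add[OF t(1)] by auto
 next
  fix z assume "z : (+) w ` lie_d M A k ` \<Omega> M A k"
  thus "z : (+) w' ` lie_d M A k ` \<Omega> M A k" using 2 forms_diff[OF _ t(1)] by auto
 qed
qed

text \<open>By \<open>gv_form_unique\<close> any pair may be used to evaluate the definite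
  description in \<open>godbillon_vey\<close>.\<close>

lemma godbillon_vey_eq:
 assumes "gv_pair B q a b"
 shows "godbillon_vey M A B q = cohomology_class M A (2 * q + 1) (gv_form q b)"
  and "godbillon_vey M A B q : cohomology M A (2 * q + 1)"
proof -
 show *: "godbillon_vey M A B q = cohomology_class M A (2 * q + 1) (gv_form q b)" unfolding godbillon_vey_def
 proof (rule the_equality)
  show "EX a b'. defining_form M A B q a & b' : \<Omega> M A 1 & lie_d M A q a = wedge 1 q b' a &
    cohomology_class M A (2 * q + 1) (gv_form q b) = cohomology_class M A (2 * q + 1)
      (wedge 1 (2 * q) b' (wedge_power2 (lie_d M A 1 b') q))" using assms unfolding gv_pair_def gv_form_def by blast
  fix c assume "EX a b'. defining_form M A B q a & b' : \<Omega> M A 1 & lie_d M A q a = wedge 1 q b' a &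
    c = cohomology_class M A (2 * q + 1) (wedge 1 (2 * q) b' (wedge_power2 (lie_d M A 1 b') q))"
  then obtain a' b' where "gv_pair B q a' b'" "c = cohomology_class M A (2 * q + 1) (gv_form q b')"
   unfolding gv_pair_def gv_form_def by blast
  thus "c = cohomology_class M A (2 * q + 1) (gv_form q b)"
   using cohomology_class_eqI[OF gv_form_unique[OF assms]] by simp
 qed
 show "godbillon_vey M A B q : cohomology M A (2 * q + 1)" unfolding * cohomology_def cocycles_def
  using gv_form_form[OF gv_pairD(2)[OF assms]] gv_form_closed[OF assms] by blast
qed

end

section \<open>Existence of Godbillon--Vey pairs\<close>

definition oform :: "('m => 'v set) => ('m => 'v => real) => ('m, 'v) form" where
 "oform V l = (%p us. case us of [u] => if u : V p then l p u else 0 | _ => 0)"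

lemma oform_simps [simp]:
 "oform V l p [] = 0" "oform V l p (u # v # us) = 0" "u : V p ==> oform V l p [u] = l p u" by (simp_all add: oform_def)

lemma (in vbundle) oform_form:
 assumes l: "!!p v w a b. v : fibre E p ==> w : fibre E p ==> l p (a *R v + b *R w) = a * l p v + b * l p w"
  and s: "!!z. z : \<Gamma> M E ==> (%p. l p (z p)) : smooth_funs M"
 shows "oform (fibre E) l : \<Omega> M E 1"
proof -
 define F where "F vs = (case vs of [z] => (%p. l p (z p)) | _ => (%p. 0 :: real))" for vs :: "('m => 'v) list"
 have F1: "F [z] = (%p. l p (z p))" for z by (simp add: F_def)
 have F0: "F vs = (%p. 0)" if "length vs ~= 1" for vs using that by (auto simp: F_def split: list.split)
 have ladd: "l p (v + w) = l p v + l p w" if "v : fibre E p" "w : fibre E p" for p v w using l[OF that, of 1 1] by simp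
 have lsc: "l p (a *R v) = a * l p v" if "v : fibre E p" for p v a using l[OF that that, of a 0] by simp
 have cases: "(xs = [] & ys = []) | length (xs @ v # ys) ~= 1" for xs ys :: "('m => 'v) list" and v
  by (cases xs; cases ys) auto
 have "sec.altf F"
 proof (rule sec.altfI)
  show "F vs : smooth_funs M" if "vs : lists (\<Gamma> M E)" for vs
  proof (cases "length vs = 1")
   case True
   then obtain z where "vs = [z]" by (metis One_nat_def length_0_conv length_Suc_conv)
   thus ?thesis using s that by (simp add: F1)
  next
   case False
   thus ?thesis by (simp only: F0[OF False] smooth_funs_closed(1))
  qed
  show "F (xs @ (v + w) # ys) = F (xs @ v # ys) + F (xs @ w # ys)" if "v : \<Gamma> M E" "w : \<Gamma> M E" for xs ys v w
   using cases[of xs ys v] that by (elim disjE) (auto simp: F1 F0 fun_eq_iff ladd sections_fibre)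
  show "F (xs @ v # v # ys) = 0" for xs ys v by (simp add: F0 fun_eq_iff)
  show "F (xs @ smul g v # ys) = g * F (xs @ v # ys)" if "v : \<Gamma> M E" for xs ys v g using cases[of xs ys v] that
   by (elim disjE) (auto simp: F1 F0 fun_eq_iff smul_def lsc sections_fibre)
 qed
 moreover have "F vs = 0" if "length vs ~= 1" for vs using F0[OF that] by (simp add: fun_eq_iff)
 ultimately have "on_fibre F : \<Omega> M E 1" by (intro on_fibre_form)
 moreover have "oform (fibre E) l = on_fibre F"
 proof (intro HOL.ext)
  show "oform (fibre E) l p us = on_fibre F p us" for p us by (cases "length us = 1")
    (auto simp: oform_def on_fibre_def F1 F0 extend_vec length_Suc_conv split: list.split)
 qed
 ultimately show ?thesis by simp
qed

text \<open>Triangular duality suffices: all later forms vanish on the first vector, so contraction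
  with it removes exactly the first factor.\<close>

lemma lwedge_list_dual:
 "length ws = length as ==> ALL a:set as. homog 1 a ==>
  (!!i j. i < length as ==> j <= i ==> (as ! i) [ws ! j] = (if i = j then 1 else 0)) ==>
  lwedge_list as ws = 1" proof (induction as arbitrary: ws) case Nil thus ?case by simp next case (Cons a as)
 then obtain w ws' where ws: "ws = w # ws'" by (cases ws) auto
 have a: "a [w] = 1" using Cons.prems(3)[of 0 0] by (simp add: ws)
 have "b [w] = 0" if "b : set as" for b
 proof -
  obtain i where "i < length as" "as ! i = b" using `b : set as` by (auto simp: in_set_conv_nth)
  thus ?thesis using Cons.prems(3)[of "Suc i" 0] by (simp add: ws)
 qed
 hence k: "contract w (lwedge_list as) = 0" using lwedge_list_kernel Cons.prems(2) by (metis list.set_intros(2))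
 have "lwedge_list as ws' = 1"
 proof (rule Cons.IH)
  show "length ws' = length as" "ALL a:set as. homog 1 a" using Cons.prems ws by auto
  show "(as ! i) [ws' ! j] = (if i = j then 1 else 0)" if "i < length as" "j <= i" for i j
   using Cons.prems(3)[of "Suc i" "Suc j"] that by (simp add: ws)
 qed
 moreover have "lwedge a (lwedge_list as) (w # ws') = a [w] * lwedge_list as ws' - lwedge a (contract w (lwedge_list as)) ws'"
  by (rule lwedge_1_Cons) (use Cons.prems in simp)
 hence "lwedge a (lwedge_list as) (w # ws') = a [w] * lwedge_list as ws'"
  unfolding k lwedge_zero_right by (simp only: zero_fun_apply diff_0_right)
 ultimately show ?case unfolding ws lwedge_list.simps a by (simp only: mult_1)
qed

context algebroid
begin

lemma wedge_list_form: "set rs <= \<Omega> M A 1 ==> wedge_list rs : \<Omega> M A (length rs)"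
proof (induction rs)
 case Nil
 thus ?case using unit_form by simp
next
 case (Cons a as)
 hence *: "a : \<Omega> M A 1" "wedge_list as : \<Omega> M A (length as)" by auto
 show ?case using fwedge_form[OF *] wedge_eq_fwedge[OF *] by simp
qed

text \<open>The kernel condition concerns arbitrary local decompositions; \<open>form_kernel\<close>
  reduces it to the given global one.\<close>

lemma defining_formI:
 assumes rs: "set rs <= \<Omega> M A 1" and nz: "!!p. EX ws. ws : lists (fibre A p) & wedge_list rs p ws ~= 0"
  and B: "!!p. B p = {v : fibre A p. ALL a:set rs. a p [v] = 0}"
 shows "defining_form M A B (length rs) (wedge_list rs)" unfolding defining_form_def
proof (intro conjI allI impI ballI)
 have d: "decomposes_on M A UNIV (length rs) (wedge_list rs) rs" unfolding decomposes_on_def using rs by blast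
 show "wedge_list rs : \<Omega> M A (length rs)" using wedge_list_form[OF rs] .
 show "EX vs. wedge_list rs p vs ~= 0" for p using nz by blast
 show "EX U bs. open U & p : U & decomposes_on M A U (length rs) (wedge_list rs) bs" for p using d by blast
 fix U bs p assume U: "open U" "decomposes_on M A U (length rs) (wedge_list rs) bs" "p : U"
 obtain ws where ws: "ws : lists (fibre A p)" "wedge_list rs p ws ~= 0" using nz by blast
 show "B p = {v : fibre A p. ALL a:set bs. a p [v] = 0}"
  unfolding decomposes_kernel(1)[OF U(2,3) ws] B decomposes_kernel(1)[OF d UNIV_I ws] ..
qed

text \<open>The components of the trivialization, composed with the projection to the quotient, are
  global 1-forms with common kernel \<open>B\<close>. Preimages of the standard basis in each fibre
  show that their product vanishes nowhere.\<close>

lemma trivial_quotient_forms: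
 assumes B: "!!p. subspace (B p)" "!!p. B p <= fibre A p" and T: "trivial_quotient M A B q"
 obtains rs where "set rs <= \<Omega> M A 1" "length rs = q" "defining_form M A B q (wedge_list rs)"
proof -
 obtain T :: "'m => 'v set => nat => real" where
  bij: "!!p. bij_betw (T p) (coset (B p) ` fibre A p) {c. ALL i>=q. c i = 0}"
  and lin: "!!p v w a b. v : fibre A p ==> w : fibre A p ==> T p (coset (B p) (a *R v + b *R w)) =
     a *R T p (coset (B p) v) + b *R T p (coset (B p) w)"
  and smooth: "!!s i. s : \<Gamma> M A ==> i < q ==> smooth_fun_on M UNIV (%p. T p (coset (B p) (s p)) i)"
  using T unfolding trivial_quotient_def by blast
 define l where "l i p v = T p (coset (B p) v) i" for i p v
 define rs where "rs = map (%i. oform (fibre A) (l i)) [0..<q]"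
 have len: "length rs = q" by (simp add: rs_def)
 have llin: "l i p (a *R v + b *R w) = a * l i p v + b * l i p w"
  if "v : fibre A p" "w : fibre A p" for i p v w a b using lin[OF that, of a b] by (simp add: l_def scaleR_fun_def)
 have form: "oform (fibre A) (l i) : \<Omega> M A 1" if "i < q" for i
 proof (rule oform_form)
  show "l i p (a *R v + b *R w) = a * l i p v + b * l i p w"
   if "v : fibre A p" "w : fibre A p" for p v w a b using llin[OF that] .
  show "(%p. l i p (s p)) : smooth_funs M" if "s : \<Gamma> M A" for s
   using smooth[OF that `i < q`] by (simp add: l_def smooth_funs_def)
 qed
 have rs: "set rs <= \<Omega> M A 1" using form by (auto simp: rs_def)
 have zero: "0 : fibre A p" for p using fibre_subspace subspace_0 by blast
 have c0: "coset (B p) 0 = B p" for p by (auto simp: coset_def)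
 have T0: "T p (B p) = 0" for p using lin[OF zero zero, of p 0 0] by (simp add: c0)
 have ker: "B p = {v : fibre A p. ALL a:set rs. a p [v] = 0}" for p
 proof (intro set_eqI iffI)
  fix v assume v: "v : B p"
  have "coset (B p) v = B p"
  proof (intro set_eqI iffI)
   show "x : B p" if "x : coset (B p) v" for x using that v subspace_add[OF B(1)] by (auto simp: coset_def)
   show "x : coset (B p) v" if "x : B p" for x
   proof -
    have "x - v : B p" using that v subspace_diff[OF B(1)] by blast
    moreover have "x = v + (x - v)" by simp
    ultimately show ?thesis unfolding coset_def by (rule rev_image_eqI)
   qed
  qed
  hence "l i p v = 0" for i by (simp add: l_def T0)
  thus "v : {v : fibre A p. ALL a:set rs. a p [v] = 0}" using v B(2)[of p] by (auto simp: rs_def oform_def)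
 next
  fix v assume v: "v : {v : fibre A p. ALL a:set rs. a p [v] = 0}"
  hence vf: "v : fibre A p" by simp
  have "l i p v = 0" if "i < q" for i using v that by (auto simp: rs_def)
  moreover have "T p (coset (B p) v) : {c. ALL i>=q. c i = 0}" using bij_betw_apply[OF bij] vf by blast
  ultimately have "T p (coset (B p) v) = 0"
   unfolding l_def fun_eq_iff zero_fun_def by (metis (mono_tags, lifting) mem_Collect_eq not_le)
  hence "T p (coset (B p) v) = T p (coset (B p) 0)" by (simp add: c0 T0)
  hence "coset (B p) v = coset (B p) 0"
   using bij_betw_imp_inj_on[OF bij] vf zero by (metis (no_types, lifting) imageI inj_onD)
  moreover have "v : coset (B p) v" unfolding coset_def using subspace_0[OF B(1)] by (rule rev_image_eqI) simp
  ultimately show "v : B p" by (simp add: c0)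
 qed
 have nz: "EX ws. ws : lists (fibre A p) & wedge_list rs p ws ~= 0" for p
 proof -
  have "EX w. w : fibre A p & (ALL i<q. l i p w = (if i = j then 1 else 0))" if "j < q" for j
  proof -
   let ?c = "%i. if i = j then 1 else 0 :: real"
   have "?c : {c. ALL i>=q. c i = 0}" using that by auto
   hence "?c : T p ` coset (B p) ` fibre A p" using bij_betw_imp_surj_on[OF bij] by blast
   then obtain w where "w : fibre A p" "T p (coset (B p) w) = ?c" by auto
   thus ?thesis unfolding l_def by metis
  qed
  then obtain w where w: "!!j. j < q ==> w j : fibre A p"
   "!!i j. j < q ==> i < q ==> l i p (w j) = (if i = j then 1 else 0)" by metis
  let ?ws = "map w [0..<q]"
  have pt: "ALL a:set rs. ptform p 1 (a p)" using rs forms_ptform by blast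
  have "lwedge_list (map (%a. a p) rs) ?ws = 1"
  proof (rule lwedge_list_dual)
   show "ALL a:set (map (%a. a p) rs). homog 1 a" using pt unfolding ptform_def by auto
   show "(map (%a. a p) rs ! i) [?ws ! j] = (if i = j then 1 else 0)"
    if "i < length (map (%a. a p) rs)" "j <= i" for i j using that w by (simp add: rs_def)
  qed (simp add: len)
  hence "wedge_list rs p ?ws ~= 0" using wedge_list_pt[OF pt] by simp
  moreover have "?ws : lists (fibre A p)" using w by auto
  ultimately show ?thesis by blast
 qed
 show ?thesis using that[OF rs len] defining_formI[OF rs nz ker] len by simp
qed

text \<open>Involutivity is stated for global sections with values in \<open>B\<close>, so elements
  of \<open>B\<close> have to be extended to such sections.\<close>

lemma subbundle_section:
 assumes B: "subbundle M A B" and b: "b : B p"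
 obtains s where "s : \<Gamma> M A" "s p = b" "!!x. s x : B x"
proof -
 have sub: "subspace (B x)" for x using B unfolding subbundle_def by blast
 obtain U es where U: "open U" "p : U" "!!e. e : set es ==> e : sections M A U"
  "!!x. x : U ==> basis_at es x (B x)"
 proof -
  have "EX U es. open U & p : U & (ALL e:set es. e : sections M A U) & (ALL x:U. basis_at es x (B x))"
   using B by (simp add: subbundle_def)
  thus ?thesis using that by blast
 qed
 obtain c where c: "b = (SUM i<length es. c i *R (es ! i) p)" using U(4)[OF U(2)] b unfolding basis_at_iff by blast
 define t where "t x = (SUM i<length es. c i *R (es ! i) x)" for x
 have t: "t : sections M A U"
  unfolding t_def by (rule sections_sum[OF U(1)], rule sections_smul[OF U(1)]) (simp_all add: U(3))
 have tB: "t x : B x" if "x : U" for x using U(4)[OF that] unfolding basis_at_iff t_def by blast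
 obtain h W C where h: "h : smooth_funs M" "open W" "p : W" "W <= C" "closed C" "C <= U"
  "!!x. x : W ==> h x = 1" "!!x. x ~: C ==> h x = 0" using bump[OF U(1,2)] by metis
 show ?thesis
 proof
  show "(%x. h x *R t x) : \<Gamma> M A" by (rule section_cutoff[OF h(1,5,6,8) U(1) t])
  show "h p *R t p = b" using h(3,7) by (simp add: c t_def)
  show "h x *R t x : B x" for x using tB[of x] h(6,8) subspace_scale[OF sub] subspace_0[OF sub] by (cases "x : C") auto
 qed
qed

text \<open>If fewer than \<open>q\<close> of \<open>q + 1\<close> arguments lie outside
  \<open>B\<close>, two lie in \<open>B\<close>. Extend these to sections of \<open>B\<close>: each
  term of Cartan's formula then involves the contraction of \<open>a\<close> with one of them or
  with their bracket, which is again in \<open>B\<close>.\<close>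

lemma lie_d_defining_filt:
 assumes B: "lie_subalgebroid M A B" and a: "defining_form M A B q a"
 shows "filt (fibre A p) (B p) q (lie_d M A q a p)" unfolding filt_def
proof (intro ballI impI)
 interpret l: lmodule "UNIV :: real set" "fibre A p" scaleR using lmodule_subspace[OF fibre_subspace] .
 have sub: "subbundle M A B" using B unfolding lie_subalgebroid_def by blast
 have BA: "B x <= fibre A x" for x using sub unfolding subbundle_def by blast
 note af = defining_form_form[OF a]
 let ?D = "lie_d M A q a"
 note D = lie_d_form[OF af]
 define F where "F = on_sections a"
 have Fb: "F (b # us) = 0" if "!!x. b x : B x" "us : lists (\<Gamma> M A)" for b us
 proof
  fix x
  have "b x : form_kernel (fibre A x) (a x)" using that(1) defining_form_kernel[OF a] by metis
  moreover have "eval_sections us x : lists (fibre A x)" using eval_fibre[OF that(2)] by blast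
  ultimately show "F (b # us) x = 0 x" by (simp add: F_def on_sections_def eval_sections_def form_kernel_def)
 qed
 have two: "?D p (b # b' # us) = 0" if "b : B p" "b' : B p" "us : lists (fibre A p)" for b b' us
 proof -
  obtain s where s: "s : \<Gamma> M A" "s p = b" "!!x. s x : B x" using subbundle_section[OF sub `b : B p`] by metis
  obtain s' where s': "s' : \<Gamma> M A" "s' p = b'" "!!x. s' x : B x" using subbundle_section[OF sub `b' : B p`] by metis
  have us': "set us <= fibre A p" using that by auto
  define vs where "vs = map (extend_vec p) us"
  have vs: "vs : lists (\<Gamma> M A)" "eval_sections vs p = us" using extend_list[OF us'] by (simp_all add: vs_def)
  have z: "lr.ld (contract s F) (s' # vs) = lr.ld 0 (s' # vs)"
   by (rule lr.ld_cong) (use vs s' in \<open>auto simp: contract_apply zero_fun_def[symmetric] intro!: Fb[OF s(3)]\<close>)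
  have z0: "lr.ld 0 us = 0" if "us : lists (\<Gamma> M A)" for us
   using lr.ld_diff[OF that sec.altf_valued[OF sec.altf_zero] sec.altf_valued[OF sec.altf_zero]] by simp
  have z': "lr.llie s (contract s' F) vs = lr.llie s 0 vs"
   by (rule lr.llie_cong) (use vs s in \<open>auto simp: contract_apply zero_fun_def[symmetric] intro!: Fb[OF s'(3)]\<close>)
  have br: "bracket A s s' x : B x" for x using B s(1,3) s'(1,3) unfolding lie_subalgebroid_def by blast
  have "lr.ld F (s # s' # vs) = lr.llie s (contract s' F) vs - F (bracket A s s' # vs) - lr.ld (contract s F) (s' # vs)"
   by (simp only: lr.ld.simps lr.llie.simps)
  also have "... = 0" unfolding z z' Fb[OF br vs(1)] lr.llie_zero[OF vs(1) s(1)]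
   using z0[of "s' # vs"] vs(1) s'(1) by (simp only: lists.Cons diff_self diff_0_right)
  finally have "on_sections ?D (s # s' # vs) = 0"
   using lie_d_eval[OF af, of "s # s' # vs"] s(1) s'(1) vs(1) unfolding F_def by auto
  hence "on_sections ?D (s # s' # vs) p = 0" by (simp only: zero_fun_def)
  thus ?thesis by (simp add: on_sections_def eval_sections_def s(2) s'(2) vs(2)[unfolded eval_sections_def])
 qed
 fix us assume us: "us : lists (fibre A p)" "length (filter (%v. v ~: B p) us) < q"
 show "?D p us = 0"
 proof (cases "length us = Suc q")
  case True
  have "length (filter (%v. v : B p) us) + length (filter (%v. v ~: B p) us) = length us" by (rule sum_length_filter_compl)
  hence "2 <= length (filter (%v. v : B p) us)" using True us(2) by simp
  then obtain b b' bs where bs: "filter (%v. v : B p) us = b # b' # bs"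
   by (cases "filter (%v. v : B p) us"; cases "tl (filter (%v. v : B p) us)") auto
  let ?us = "b # b' # bs @ filter (%v. v ~: B p) us"
  have b: "b : B p" "b' : B p" "set bs <= B p" using arg_cong[OF bs, of set] by auto
  have m: "mset us = mset ?us" using arg_cong[OF bs, of mset] multiset_partition[of "mset us" "%v. v : B p"]
   by (simp flip: mset_filter)
  have l: "bs @ filter (%v. v ~: B p) us : lists (fibre A p)" using us b(3) BA[of p] by auto
  hence "?us : lists (fibre A p)" using b BA[of p] by auto
  from l.alt0_perm[OF l.altf_alt0[OF forms_alt[OF D UNIV_I]] this m] two[OF b(1,2) l]
  show ?thesis by auto
 next
  case False
  thus ?thesis using forms_homog[OF D, of p] by (simp add: homog_def)
 qed
qed

text \<open>In degree \<open>q\<close> the \<open>q\<close>-th step of the filtration is the line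
  spanned by the defining form; the crosswise form of the relation avoids division.\<close>

lemma filt_proportional:
 assumes a: "defining_form M A B q a"
  and G: "alt_on (fibre A p) G" "homog q G" "filt (fibre A p) (B p) q G"
  and ws: "ws : lists (fibre A p)" "a p ws ~= 0" and us: "us : lists (fibre A p)"
 shows "G us * a p ws = G ws * a p us"
proof -
 interpret l: lmodule "UNIV :: real set" "fibre A p" scaleR using lmodule_subspace[OF fibre_subspace] .
 note af = defining_form_form[OF a]
 have len: "length ws = q" using forms_homog[OF af, of p] ws(2) unfolding homog_def by blast
 define H where "H = (%us. a p ws * G us) - (%us. G ws * a p us)"
 have "H us = 0"
 proof (rule alt_on_filt_zero[OF fibre_subspace, where ws = ws and B = "B p"])
  show "alt_on (fibre A p) H" unfolding H_def by (intro l.altf_diff l.altf_scale G forms_alt[OF af] UNIV_I)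
  show "B p <= fibre A p" using defining_form_kernel[OF a, of p] by (auto simp: form_kernel_def)
  show "fibre A p <= span (B p Un set ws)" using defining_form_span[OF a ws] .
  show "filt (fibre A p) (B p) (length ws) H"
   using G(3) defining_form_filt[OF a, of p] unfolding filt_def H_def len by simp
  show "H (bs @ ws) = 0" for bs
  proof (cases "bs = []")
   case True
   thus ?thesis by (simp add: H_def)
  next
   case False
   hence "length (bs @ ws) ~= q" using len by simp
   thus ?thesis using G(2) forms_homog[OF af, of p] unfolding H_def homog_def by simp
  qed
 qed (use ws us in auto)
 thus ?thesis by (simp add: H_def algebra_simps)
qed

text \<open>The product with \<open>r\<close> sees a 1-form only on \<open>B\<close>. There the
  contraction of \<open>d r\<close> with \<open>b\<close> is a multiple of \<open>r\<close>, and the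
  factor can be read off on any list of sections where \<open>r\<close> does not vanish. The local
  choices thus agree on \<open>B\<close> and can be averaged by a partition of unity.\<close>

lemma gv_pair_exists:
 assumes B: "lie_subalgebroid M A B" and r: "defining_form M A B q r"
 obtains u where "gv_pair B q r u"
proof -
 let ?D = "lie_d M A q r"
 note rf = defining_form_form[OF r]
 note D = lie_d_form[OF rf]
 have BA: "B x <= fibre A x" for x using B unfolding lie_subalgebroid_def subbundle_def by blast
 \<comment> \<open>\<open>h\<close> is a global function that near \<open>p\<close> is the
   reciprocal of the value of \<open>r\<close> on the sections \<open>Ws\<close>.\<close>
 have "EX Ws h U. Ws : lists (\<Gamma> M A) & h : smooth_funs M & open U & p : U & (ALL x:U. h x * r x (eval_sections Ws x) = 1)" for p
 proof -
  obtain ws where ws: "ws : lists (fibre A p)" "length ws = q" "r p ws ~= 0" using defining_form_nonzero[OF r] by blast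
  have ws': "set ws <= fibre A p" using ws by auto
  define Ws where "Ws = map (extend_vec p) ws"
  have Ws: "Ws : lists (\<Gamma> M A)" "eval_sections Ws p = ws" using extend_list[OF ws'] by (simp_all add: Ws_def)
  let ?f = "%x. r x (eval_sections Ws x)"
  have f: "?f : smooth_funs M"
   using sec.altf_valued[OF form_altf[OF rf]] Ws(1) unfolding sec.valued_def on_sections_def by blast
  have fp: "?f p ~= 0" using ws(3) Ws(2) by simp
  obtain h W where h: "h : smooth_funs M" "open W" "p : W" "!!x. x : W ==> h x = inverse (?f x)"
   using smooth_extend[OF smooth_at_inverse[OF smooth_funsD[OF f] fp]] by metis
  obtain U where U: "open U" "p : U" "!!x. x : U ==> smooth_at M ?f x & ?f x ~= 0"
   using smooth_at_nonzero_open[OF smooth_funsD[OF f] fp] by metis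
  show ?thesis
  proof (intro exI conjI ballI)
   show "open (U Int W)" "p : U Int W" using U h by auto
   show "h x * ?f x = 1" if "x : U Int W" for x using that U(3) h(4) by simp
  qed (fact Ws(1) h(1))+
 qed
 then obtain Ws h U where Ws: "!!p. Ws p : lists (\<Gamma> M A)" and h: "!!p. h p : smooth_funs M"
  and U: "!!p. open (U p)" "!!p. p : U p"
  and hU: "!!p x. x : U p ==> h p x * r x (eval_sections (Ws p) x) = 1" by metis
 obtain c :: "nat => 'm" and y W where y: "!!n. y n : smooth_funs M" and W: "!!n. open (W n)" "(\<Union>n. W n) = UNIV"
  and y0: "!!n x. x ~: U (c n) ==> y n x = 0"
  and yW: "!!k n x. x : W k ==> k < n ==> y n x = 0" "!!k x. x : W k ==> (SUM n<=k. y n x) = 1"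
 proof (rule smooth_partition[OF U], goal_cases)
  case (1 c y W)
  show ?case by (rule that[of y W c, OF 1(2-7)])
 qed
 define K where "K x = (LEAST k. x : W k)" for x
 have KW: "x : W (K x)" for x unfolding K_def using W(2) by (metis LeastI UNIV_I UN_iff)
 have Kle: "K x <= k" if "x : W k" for x k unfolding K_def using that by (rule Least_le)
 define t where "t n x v = y n x * (h (c n) x * ?D x (v # eval_sections (Ws (c n)) x))" for n x v
 \<comment> \<open>The formally infinite sum stops at the first \<open>k\<close> with
   \<open>x\<close> in \<open>W k\<close>, beyond which all terms vanish. Near a given point it may
   be taken up to a fixed bound, which yields smoothness.\<close>
 define l where "l x v = (SUM n<=K x. t n x v)" for x v
 have lW: "l x v = (SUM n<=k. t n x v)" if "x : W k" for x v k unfolding l_def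
 proof (rule sum.mono_neutral_left)
  show "ALL n:{..k} - {..K x}. t n x v = 0" using yW(1)[OF KW] by (auto simp: t_def)
 qed (use Kle[OF that] in auto)
 have ev: "eval_sections (Ws p) x : lists (fibre A x)" for p x using eval_fibre[OF Ws] by blast
 have "l x (a *R v + b *R w) = a * l x v + b * l x w" if v: "v : fibre A x" "w : fibre A x" for x v w a b
 proof -
  interpret l: lmodule "UNIV :: real set" "fibre A x" scaleR using lmodule_subspace[OF fibre_subspace] .
  have "?D x ((a *R v + b *R w) # us) = a * ?D x (v # us) + b * ?D x (w # us)" if "us : lists (fibre A x)" for us
   using l.alt0_add[OF l.altf_alt0[OF forms_alt[OF D UNIV_I]] lists.Nil that, of "a *R v" "b *R w"]
    l.altf_sm[OF forms_alt[OF D UNIV_I] lists.Nil that v(1), of a]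
    l.altf_sm[OF forms_alt[OF D UNIV_I] lists.Nil that v(2), of b]
    subspace_scale[OF fibre_subspace v(1), of a] subspace_scale[OF fibre_subspace v(2), of b] by simp
  thus ?thesis by (simp add: l_def t_def ev sum_distrib_left algebra_simps flip: sum.distrib)
 qed
 moreover have "(%x. l x (s x)) : smooth_funs M" if s: "s : \<Gamma> M A" for s unfolding smooth_funs_iff
 proof
  fix x
  have "(%x. ?D x (s x # eval_sections (Ws p) x)) : smooth_funs M" for p
  proof -
   have "on_sections ?D (s # Ws p) : smooth_funs M"
    by (rule bspec[OF sec.altf_valued[OF form_altf[OF D], unfolded sec.valued_def]]) (simp add: Ws s)
   thus ?thesis by (simp add: on_sections_def eval_sections_def)
  qed
  hence "(%x. SUM n<=K x0. t n x (s x)) : smooth_funs M" for x0 unfolding t_def by (intro smooth_funs_closed y h)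
  from smooth_at_cong[OF smooth_funsD[OF this] W(1) KW]
  show "smooth_at M (%x. l x (s x)) x" using lW by metis
 qed
 ultimately have u: "oform (fibre A) l : \<Omega> M A 1" by (intro oform_form)
 define u where "u = oform (fibre A) l"
 note uf = u[folded u_def]
 \<comment> \<open>For \<open>b\<close> in \<open>B\<close> every local quotient gives the same
   value, so the weights \<open>y n\<close> only have to add up to 1.\<close>
 have bD: "u x [b] * r x ws = ?D x (b # ws)"
  if b: "b : B x" and ws: "ws : lists (fibre A x)" "r x ws ~= 0" for x b ws
 proof -
  interpret l: lmodule "UNIV :: real set" "fibre A x" scaleR using lmodule_subspace[OF fibre_subspace] .
  have bA: "b : fibre A x" using b BA by blast
  have c: "alt_on (fibre A x) (contract b (?D x))" "homog q (contract b (?D x))"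
   "filt (fibre A x) (B x) q (contract b (?D x))"
   using l.altf_contract[OF forms_alt[OF D UNIV_I] bA] homog_contract_Suc[OF forms_homog[OF D]]
    filt_contract[OF lie_d_defining_filt[OF B r] bA] b by auto
  have "t n x b * r x ws = y n x * ?D x (b # ws)" for n
  proof (cases "x : U (c n)")
   case True
   let ?us = "eval_sections (Ws (c n)) x"
   have "?D x (b # ?us) * r x ws = ?D x (b # ws) * r x ?us"
    using filt_proportional[OF r c ws ev, of "c n"] by (simp only: contract_apply)
   hence "t n x b * r x ws = y n x * ?D x (b # ws) * (h (c n) x * r x ?us)"
    unfolding t_def by (simp only: mult.assoc) (simp only: mult.left_commute mult.commute)
   thus ?thesis using hU[OF True] by simp
  next
   case False
   thus ?thesis using y0 by (simp add: t_def)
  qed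
  hence "l x b * r x ws = (SUM n<=K x. y n x) * ?D x (b # ws)" by (simp add: l_def sum_distrib_right)
  thus ?thesis using yW(2)[OF KW] bA by (simp add: u_def)
 qed
 have z: "?D - fwedge u r : \<Omega> M A (Suc q)" using forms_diff[OF D] fwedge_form[OF uf rf] by simp
 have "?D - fwedge u r = 0"
 proof (rule form_zeroI[OF r z])
  fix p
  have "filt (fibre A p) (B p) (0 + q) (fwedge u r p)"
   unfolding fwedge_def by (rule filt_lwedge[OF filt_0 defining_form_filt[OF r]])
  thus "filt (fibre A p) (B p) q ((?D - fwedge u r) p)"
   using filt_diff[OF lie_d_defining_filt[OF B r, of p]] unfolding fun_diff_def by simp
 next
  fix p bs ws assume *: "bs : lists (B p)" "ws : lists (fibre A p)" "length ws = q" "r p ws ~= 0"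
  show "(?D - fwedge u r) p (bs @ ws) = 0"
  proof (cases "length bs = 1")
   case True
   then obtain b where bs: "bs = [b]" by (metis One_nat_def length_0_conv length_Suc_conv)
   have "fwedge u r p (bs @ ws) = u p bs * r p ws" unfolding fwedge_def
   proof (rule lwedge_kernel_split[where B = "B p" and V = "fibre A p"])
    show "r p (b # us) = 0" if "b : B p" "us : lists (fibre A p)" for b us
     using that defining_form_kernel[OF r, of p] by (auto simp: form_kernel_def)
    show "homog (length bs) (u p)" unfolding True using forms_homog[OF uf] .
   qed (use * BA in auto)
   thus ?thesis using bD[of b p ws] * by (simp add: bs)
  next
   case False
   thus ?thesis using forms_homog[OF z, of p] * unfolding homog_def by simp
  qed
 qed
 hence "?D = wedge 1 q u r" using wedge_eq_fwedge[OF uf rf] by simp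
 thus ?thesis using that r uf unfolding gv_pair_def by blast
qed

end

section \<open>The pullback bundle\<close>

lemma sum_split_lessThan: "(SUM i<m + (n::nat). g i :: 'a::comm_monoid_add) = (SUM i<m. g i) + (SUM i<n. g (m + i))"
 by (induction n) (simp_all add: add.assoc)

lemma sum_append:
 "(SUM i<length (xs @ ys). c i *R ((xs @ ys) ! i) p) =
  (SUM i<length xs. c i *R (xs ! i) p) + (SUM i<length ys. c (length xs + i) *R (ys ! i) p)"
 unfolding length_append sum_split_lessThan by (simp add: nth_append)

lemma basis_at_perm: "basis_at (xs @ e # ys) p F ==> basis_at (e # xs @ ys) p F"
 unfolding basis_at_def by (auto simp: insert_commute)

lemma basis_at_prod:
 fixes es :: "('n => 'v::real_vector) list" and ds :: "('n => 'w::real_vector) list"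
 assumes es: "basis_at es p F" and ds: "basis_at ds p G"
 shows "basis_at (map (%e x. (e x, 0)) es @ map (%d x. (0, d x)) ds) p (F \<times> G)"
proof -
 let ?hs = "map (%e x. (e x, 0)) es @ map (%d x. (0, d x)) ds"
 have sum: "(SUM i<length ?hs. c i *R (?hs ! i) p) =
   ((SUM i<length es. c i *R (es ! i) p), (SUM i<length ds. c (length es + i) *R (ds ! i) p))" for c
  unfolding sum_append by (simp add: prod_eq_iff fst_sum snd_sum)
 show ?thesis unfolding basis_at_iff sum
 proof (intro conjI allI impI)
  fix c i assume z: "((SUM i<length es. c i *R (es ! i) p), (SUM i<length ds. c (length es + i) *R (ds ! i) p)) = 0"
   and i: "i < length ?hs"
  have 1: "c j = 0" if "j < length es" for j using basis_at_unique[OF es, of c "%_. 0" j] z that by (simp add: prod_eq_iff)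
  have 2: "c (length es + j) = 0" if "j < length ds" for j
   using basis_at_unique[OF ds, of "%j. c (length es + j)" "%_. 0" j] z that by (simp add: prod_eq_iff)
  show "c i = 0" using 1[of i] 2[of "i - length es"] i by (cases "i < length es") auto
 next
  have F: "F = {(SUM i<length es. c i *R (es ! i) p) | c. True}"
   and G: "G = {(SUM i<length ds. c i *R (ds ! i) p) | c. True}" using es ds unfolding basis_at_iff by blast+
  show "F \<times> G = {((SUM i<length es. c i *R (es ! i) p), (SUM i<length ds. c (length es + i) *R (ds ! i) p)) | c. True}"
  proof (intro set_eqI iffI)
   fix z assume "z : F \<times> G"
   then obtain c d where z: "z = ((SUM i<length es. c i *R (es ! i) p), (SUM i<length ds. d i *R (ds ! i) p))"
    unfolding F G by blast
   let ?c = "%i. if i < length es then c i else d (i - length es)"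
   have "z = ((SUM i<length es. ?c i *R (es ! i) p), (SUM i<length ds. ?c (length es + i) *R (ds ! i) p))" unfolding z by simp
   thus "z : {((SUM i<length es. c i *R (es ! i) p), (SUM i<length ds. c (length es + i) *R (ds ! i) p)) | c. True}"
    unfolding mem_Collect_eq by (intro exI[of _ ?c] conjI TrueI)
  next
   fix z assume "z : {((SUM i<length es. c i *R (es ! i) p), (SUM i<length ds. c (length es + i) *R (ds ! i) p)) | c. True}"
   then obtain c where z: "z = ((SUM i<length es. c i *R (es ! i) p), (SUM i<length ds. c (length es + i) *R (ds ! i) p))"
    by auto
   have "(SUM i<length es. c i *R (es ! i) p) : F" unfolding F by blast
   moreover have "(SUM i<length ds. c (length es + i) *R (ds ! i) p) : G"
    unfolding G mem_Collect_eq by (intro exI[of _ "%i. c (length es + i)"] conjI TrueI refl)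
   ultimately show "z : F \<times> G" unfolding z by (rule SigmaI)
  qed
 qed
qed

text \<open>One step of Gaussian elimination: the pivot \<open>e\<close> is used to clear \<open>l\<close> on the other members of the frame.\<close>

lemma basis_at_pivot:
 fixes l :: "'v::real_vector => real"
 assumes b: "basis_at (e # es) p F" and e: "l (e p) ~= 0"
  and l: "!!v w a b. v : F ==> w : F ==> l (a *R v + b *R w) = a * l v + b * l w"
  and a: "!!x. a x = (%d. l (d x) / l (e x))"
 shows "basis_at (map (%d x. d x - a x d *R e x) es) p {v : F. l v = 0}"
proof -
 let ?hs = "map (%d x. d x - a x d *R e x) es"
 have F: "F = {(SUM i<length (e # es). c i *R ((e # es) ! i) p) | c. True}" using b unfolding basis_at_iff by blast
 have F': "F = {c 0 *R e p + (SUM i<length es. c (Suc i) *R (es ! i) p) | c. True}"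
  unfolding F by (simp only: length_Cons sum.lessThan_Suc_shift nth_Cons_0 nth_Cons_Suc comp_def)
 have sub: "subspace F" using basis_at_subspace[OF b] .
 have gen: "set (map (%e. e p) (e # es)) <= F" using b span_superset unfolding basis_at_def by blast
 have eF: "e p : F" using gen by simp
 have esF: "d p : F" if "d : set es" for d using gen that by auto
 have hF: "(SUM i:I. c i *R (es ! i) p) : F" if "I <= {..<length es}" for I c
  by (intro subspace_sum[OF sub] subspace_scale[OF sub] esF) (use that in auto)
 have l0: "l 0 = 0" using l[OF eF eF, of 0 0] by simp
 have lsum: "l (SUM i:I. c i *R (es ! i) p) = (SUM i:I. c i * l ((es ! i) p))" if "finite I" "I <= {..<length es}" for I c
  using that
 proof (induction I)
  case (insert i I)
  thus ?case using l[OF esF hF, of "es ! i" I "c i" 1 c] by simp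
 qed (simp add: l0)
 have sum: "(SUM i<length ?hs. c i *R (?hs ! i) p) =
   (- (SUM i<length es. c i * a p (es ! i))) *R e p + (SUM i<length es. c i *R (es ! i) p)" for c
  by (simp add: scaleR_diff_right sum_subtractf scaleR_sum_left)
 have ap: "(SUM i<length es. c i * a p (es ! i)) = l (SUM i<length es. c i *R (es ! i) p) / l (e p)" for c
  unfolding lsum[OF finite_lessThan subset_refl] sum_divide_distrib a by simp
 show ?thesis unfolding basis_at_iff
 proof (intro conjI allI impI)
  fix c i assume z: "(SUM i<length ?hs. c i *R (?hs ! i) p) = 0" and i: "i < length ?hs"
  define d where "d j = (case j of 0 => - (SUM i<length es. c i * a p (es ! i)) | Suc j => c j)" for j
  have "(SUM i<length (e # es). d i *R ((e # es) ! i) p) = (SUM i<length (e # es). 0 *R ((e # es) ! i) p)"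
   using z unfolding sum
   by (simp only: length_Cons sum.lessThan_Suc_shift nth_Cons_0 nth_Cons_Suc comp_def d_def nat.case) simp
  hence "d (Suc i) = 0" using basis_at_unique[OF b, of d "%_. 0" "Suc i"] i by simp
  thus "c i = 0" by (simp add: d_def)
 next
  show "{v : F. l v = 0} = {(SUM i<length ?hs. c i *R (?hs ! i) p) | c. True}"
  proof (intro set_eqI iffI)
   fix v assume v: "v : {v : F. l v = 0}"
   then obtain c where c: "v = c 0 *R e p + (SUM i<length es. c (Suc i) *R (es ! i) p)" unfolding F' by blast
   let ?s = "SUM i<length es. c (Suc i) *R (es ! i) p"
   have "0 = c 0 * l (e p) + 1 * l ?s" using l[OF eF hF, of "{..<length es}" "c 0" 1] v c by simp
   hence "c 0 = - (l ?s / l (e p))" using e by (simp add: field_simps)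
   hence "v = (SUM i<length ?hs. c (Suc i) *R (?hs ! i) p)" unfolding sum ap c by simp
   thus "v : {(SUM i<length ?hs. c i *R (?hs ! i) p) | c. True}"
    unfolding mem_Collect_eq by (intro exI[of _ "%i. c (Suc i)"] conjI TrueI)
  next
   fix v assume "v : {(SUM i<length ?hs. c i *R (?hs ! i) p) | c. True}"
   then obtain c where c: "v = (- (SUM i<length es. c i * a p (es ! i))) *R e p + (SUM i<length es. c i *R (es ! i) p)"
    unfolding sum by blast
   let ?s = "SUM i<length es. c i *R (es ! i) p"
   have sF: "?s : F" by (rule hF) simp
   have "v : F" unfolding c using subspace_add[OF sub subspace_scale[OF sub eF] sF] .
   moreover have "l v = - (l ?s / l (e p)) * l (e p) + 1 * l ?s"
    using l[OF eF sF, of "- (l ?s / l (e p))" 1] unfolding c ap by simp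
   ultimately show "v : {v : F. l v = 0}" using e by simp
  qed
 qed
qed

lemma sum_insert_if:
 "finite I ==> i ~: I ==> (SUM k:insert i I. (if k = i then x else d k) * a k) = x * a i + (SUM k:I. d k * (a k :: real))"
 by (simp, rule sum.cong) auto

context manifold
begin

text \<open>A linear system that is injective at \<open>p\<close> has smooth solutions: the unknowns
  are eliminated one at a time. The set \<open>J\<close> of equations may be infinite, as tangent
  vectors are tested on all smooth functions, but each unknown takes just one pivot
  equation.\<close>

lemma smooth_solution:
 assumes "finite I" "!!i j. i : I ==> j : J ==> smooth_at M (a i j) p" "!!j. j : J ==> smooth_at M (b j) p"
  and "open U" "p : U" "!!x j. x : U ==> j : J ==> b j x = (SUM i:I. c i x * a i j x)"
  and "!!d. (!!j. j : J ==> (SUM i:I. d i * a i j p) = 0) ==> ALL i:I. d i = 0"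
 shows "ALL i:I. smooth_at M (c i) p" using assms
proof (induction I arbitrary: a b U rule: finite_induct)
 case (insert i I)
 note a = insert.prems(1) and b = insert.prems(2) and U = insert.prems(3,4) and eq = insert.prems(5) and ind = insert.prems(6)
 have "EX j0:J. a i j0 p ~= 0"
 proof (rule ccontr)
  assume "~ ?thesis"
  hence z: "a i j p = 0" if "j : J" for j using that by blast
  have "ALL k:insert i I. (if k = i then 1 else 0 :: real) = 0"
  proof (rule ind)
   show "(SUM k:insert i I. (if k = i then 1 else 0) * a k j p) = 0" if "j : J" for j
    using sum_insert_if[OF insert.hyps, of 1 "%_. 0" "%k. a k j p"] z[OF that] by simp
  qed
  thus False by simp
 qed
 then obtain j0 where j0: "j0 : J" "a i j0 p ~= 0" by blast
 note ai = a[OF insertI1 j0(1)]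
 obtain W where W: "open W" "p : W" "!!x. x : W ==> smooth_at M (a i j0) x & a i j0 x ~= 0"
  using smooth_at_nonzero_open[OF ai j0(2)] by metis
 define r where "r j x = a i j x / a i j0 x" for j x
 have r: "smooth_at M (r j) p" if "j : J" for j unfolding r_def using smooth_at_divide[OF a[OF insertI1 that] ai j0(2)] .
 have ci: "c i x = (b j0 x - (SUM k:I. c k x * a k j0 x)) / a i j0 x" if "x : U Int W" for x
  using eq[of x j0] W(3)[of x] that insert.hyps j0(1) by (simp add: field_simps)
 have IH: "ALL k:I. smooth_at M (c k) p"
 proof (rule insert.IH)
  show "smooth_at M (%x. a k j x - a k j0 x * r j x) p" if "k : I" "j : J" for k j
   using that a j0(1) r by (intro smooth_at_diff smooth_at_mult) auto
  show "smooth_at M (%x. b j x - b j0 x * r j x) p" if "j : J" for j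
   using that b j0(1) r by (intro smooth_at_diff smooth_at_mult) auto
  show "open (U Int W)" "p : U Int W" using U W by auto
  show "b j x - b j0 x * r j x = (SUM k:I. c k x * (a k j x - a k j0 x * r j x))" if x: "x : U Int W" and j: "j : J" for x j
  proof -
   have nz: "a i j0 x ~= 0" using W(3) x by blast
   have 1: "b j x = c i x * a i j x + (SUM k:I. c k x * a k j x)"
    and 2: "b j0 x = c i x * a i j0 x + (SUM k:I. c k x * a k j0 x)" using eq x j j0(1) insert.hyps by auto
   have "c i x * a i j0 x * r j x = c i x * a i j x" using nz by (simp add: r_def)
   hence "c i x * a i j x = c i x * a i j0 x * r j x" ..
   thus ?thesis unfolding 1 2 by (simp add: algebra_simps sum_subtractf sum_distrib_left sum_distrib_right)
  qed
  show "ALL k:I. d k = 0" if d: "!!j. j : J ==> (SUM k:I. d k * (a k j p - a k j0 p * r j p)) = 0" for d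
  proof -
   \<comment> \<open>The value of the eliminated unknown, by which a solution of the reduced system
     at \<open>p\<close> becomes one of the full system.\<close>
   let ?t = "- (SUM k:I. d k * a k j0 p) / a i j0 p"
   have "ALL k:insert i I. (if k = i then ?t else d k) = 0"
   proof (rule ind)
    fix j assume j: "j : J"
    have "(SUM k:I. d k * a k j p) = (SUM k:I. d k * a k j0 p) * r j p"
     using d[OF j] by (simp add: algebra_simps sum_subtractf sum_distrib_left)
    thus "(SUM k:insert i I. (if k = i then ?t else d k) * a k j p) = 0"
     unfolding sum_insert_if[OF insert.hyps] using j0(2) by (simp add: r_def field_simps)
   qed
   thus ?thesis using insert.hyps(2) by (metis insertCI)
  qed
 qed
 have "smooth_at M (%x. (b j0 x - (SUM k:I. c k x * a k j0 x)) / a i j0 x) p"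
  using IH a b j0 ai by (intro smooth_at_divide smooth_at_diff smooth_at_sum smooth_at_mult) auto
 hence "smooth_at M (c i) p" by (rule smooth_at_cong[where U = "U Int W"]) (use U W ci in auto)
 thus ?case using IH by blast
qed simp

lemma tangent_basis:
 assumes V: "(V, u) : M" "p : V" and bs: "distinct bs" "set bs = basis"
 shows "basis_at (map (%b x. chart_deriv V u x b) bs) p (tangent_space M p)"
proof -
 let ?ds = "map (%b x. chart_deriv V u x b) bs"
 obtain y U where y: "!!b. b : basis ==> y b : smooth_funs M" "open U" "p : U" "U <= V"
   "!!b x. b : basis ==> x : U ==> y b x = u x \<bullet> b" using coord_exist[OF V] by metis
 have nth: "bs ! i : basis" if "i < length bs" for i using nth_mem[OF that] bs(2) by simp
 have sum: "(SUM i<length ?ds. c i *R (?ds ! i) p) g = (SUM i<length bs. c i * chart_deriv V u p (bs ! i) g)" for c g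
  by (simp add: sum_apply scaleR_fun_def)
 show ?thesis unfolding basis_at_iff
 proof (intro conjI allI impI)
  fix c j assume z: "(SUM i<length ?ds. c i *R (?ds ! i) p) = 0" and "j < length ?ds"
  hence j: "j < length bs" by simp
  have "chart_deriv V u p (bs ! i) (y (bs ! j)) = (if i = j then 1 else 0)" if "i < length bs" for i
   using chart_deriv_coord[OF V y(1)[OF nth[OF j]] y(2,3) y(5)[OF nth[OF j]] nth[OF that] nth[OF j]]
    nth_eq_iff_index_eq[OF bs(1) that j] by simp
  hence "(SUM i<length ?ds. c i *R (?ds ! i) p) (y (bs ! j)) = (SUM i<length bs. if i = j then c i else 0)"
   unfolding sum by (intro sum.cong) auto
  also have "... = c j" using j by simp
  finally show "c j = 0" unfolding z by simp
 next
  show "tangent_space M p = {(SUM i<length ?ds. c i *R (?ds ! i) p) | c. True}"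
  proof (intro set_eqI iffI)
   fix X assume X: "X : tangent_space M p"
   have "X = (SUM i<length ?ds. X (y (bs ! i)) *R (?ds ! i) p)"
   proof (rule HOL.ext)
    fix g
    show "X g = (SUM i<length ?ds. X (y (bs ! i)) *R (?ds ! i) p) g"
    proof (cases "g : smooth_funs M")
     case True
     have "X g = (SUM b:set bs. X (y b) * chart_deriv V u p b g)"
      unfolding bs(2) by (rule tangent_coord[OF V X True y(1,2,3,5)])
     also have "... = (SUM i<length bs. X (y (bs ! i)) * chart_deriv V u p (bs ! i) g)"
      unfolding sum.distinct_set_conv_list[OF bs(1)] by (simp add: sum_list_sum_nth atLeast0LessThan)
     finally show ?thesis unfolding sum .
    next
     case False
     thus ?thesis unfolding sum by (simp add: tangent_nonsmooth[OF X] chart_deriv_def)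
    qed
   qed
   thus "X : {(SUM i<length ?ds. c i *R (?ds ! i) p) | c. True}"
    unfolding mem_Collect_eq by (intro exI[of _ "%i. X (y (bs ! i))"] conjI TrueI)
  next
   fix X assume "X : {(SUM i<length ?ds. c i *R (?ds ! i) p) | c. True}"
   then obtain c where c: "X = (SUM i<length ?ds. c i *R (?ds ! i) p)" by blast
   show "X : tangent_space M p" unfolding c by (rule tangent_sum) (use chart_deriv_tangent[OF V] in auto)
  qed
 qed
qed

lemma vector_fieldsI:
 assumes "open U" "!!p. p : U ==> X p : tangent_space M p"
  "!!g p. g : smooth_funs M ==> p : U ==> smooth_at M (%p. X p g) p"
 shows "X : vector_fields M U" unfolding vector_fields_def using assms by (simp add: smooth_fun_on_iff)

lemma vector_fieldsD:
 assumes "X : vector_fields M U" "open U" "p : U"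
 shows "X p : tangent_space M p" "g : smooth_funs M ==> smooth_at M (%p. X p g) p"
 using assms by (simp_all add: vector_fields_def smooth_fun_on_iff)

lemma tangent_eqI:
 assumes "X : tangent_space M p" "Y : tangent_space M p" "!!g. g : smooth_funs M ==> X g = Y g"
 shows "X = Y" using assms tangent_nonsmooth by (metis HOL.ext)

end

lemma fcoef_lin:
 assumes "basis_at es p F" "!!i. i : I ==> v i : F" "k < length es"
 shows "fcoef es p (SUM i:I. c i *R v i) k = (SUM i:I. c i * fcoef es p (v i) k)"
proof -
 note sub = basis_at_subspace[OF assms(1)]
 have z: "fcoef es p 0 k = 0" using fcoef_scale[OF assms(1) subspace_0[OF sub] assms(3), of 0] by simp
 show ?thesis using assms(2)
 proof (induction I rule: infinite_finite_induct)
  case (insert i I)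
  have 1: "c i *R v i : F" using insert subspace_scale[OF sub] by blast
  have 2: "(SUM i:I. c i *R v i) : F" using insert by (intro subspace_sum[OF sub] subspace_scale[OF sub]) auto
  have 3: "v i : F" using insert by blast
  show ?case using insert fcoef_add[OF assms(1) 1 2 assms(3)] fcoef_scale[OF assms(1) 3 assms(3), of "c i"] by simp
 qed (simp_all add: z)
qed

locale pullback = algebroid M A + N: manifold N
 for M :: "('m::{t2_space,second_countable_topology}, 'd::real_inner) atlas"
  and A :: "('m, 'v::real_vector) lie_algebroid"
  and N :: "('n::{t2_space,second_countable_topology}, 'e::real_inner) atlas" +
 fixes f :: "'n => 'm"
 assumes f: "smooth_map N M f" and transverse: "transverse N M f A (fibre A)"
begin

lemma f_smooth: "smooth_at M g (f y) ==> smooth_at N (%x. g (f x)) y"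
 using smooth_at_compose[OF N.manifold_axioms manifold_axioms f] .

lemma f_open: "open U ==> open (f -` U)" using f unfolding smooth_map_def by (blast intro: open_vimage)

lemma f_funs: "g : smooth_funs M ==> (%x. g (f x)) : smooth_funs N" using f_smooth smooth_funsD N.smooth_funs_iff by blast

abbreviation PB where "PB \<equiv> pullback_bundle f A"
abbreviation P where "P \<equiv> pullback_algebroid N M f A"

lemma basis_at_comp: "basis_at (map (%e. e o f) es) y F \<longleftrightarrow> basis_at es (f y) F" by (simp add: basis_at_def comp_def)

lemma PB_fibre: "fibre PB y = fibre A (f y)" by (simp add: pullback_bundle_def)

lemma PB_frames: "frames PB = (%(U, es). (f -` U, map (%e. e o f) es)) ` frames A" by (simp add: pullback_bundle_def)

lemma pb_section:
 assumes "open U" "v : sections M A U" shows "v o f : sections N PB (f -` U)" unfolding sections_def mem_Collect_eq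
proof (intro conjI ballI)
 show "(v o f) y : fibre PB y" if "y : f -` U" for y
  using sections_fibre[OF assms(2), of "f y"] that by (simp add: PB_fibre)
 fix W assume "W : frames PB"
 then obtain V es where V: "(V, es) : frames A" and W: "W = (f -` V, map (%e. e o f) es)" unfolding PB_frames by auto
 obtain c where c: "!!i. i < length es ==> smooth_fun_on M (U Int V) (c i)"
  "!!p. p : U Int V ==> v p = (SUM i<length es. c i p *R (es ! i) p)"
  using bspec[OF conjunct2[OF assms(2)[unfolded sections_def mem_Collect_eq]] V] by auto
 have o: "open (U Int V)" using assms(1) frameD(1)[OF V] by blast
 have s: "smooth_fun_on N (f -` (U Int V)) (%y. c i (f y))" if "i < length es" for i
  unfolding N.smooth_fun_on_iff[OF f_open[OF o]]
  using c(1)[OF that] unfolding smooth_fun_on_iff[OF o] by (blast intro: f_smooth)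
 show "case W of (V, es) => EX c. (ALL i<length es. smooth_fun_on N (f -` U Int V) (c i)) &
    (ALL p:f -` U Int V. (v o f) p = (SUM i<length es. c i p *R (es ! i) p))" unfolding W prod.case vimage_Int[symmetric]
  by (rule exI[of _ "%i y. c i (f y)"]) (use s c(2) in auto)
qed

end

sublocale pullback \<subseteq> PB: vbundle N "pullback_bundle f A"
proof
 show "vector_bundle N PB" unfolding vector_bundle_def
 proof (intro conjI allI ballI)
  fix y
  obtain V es where "(V, es) : frames A" "f y : V" using frame_at by metis
  thus "EX (U, es):frames PB. y : U"
   unfolding PB_frames by (intro bexI[of _ "(f -` V, map (%e. e o f) es)"]) (auto intro!: rev_image_eqI)
 next
  fix W assume "W : frames PB"
  then obtain V es where V: "(V, es) : frames A" "W = (f -` V, map (%e. e o f) es)" unfolding PB_frames by auto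
  have "e o f : sections N PB (f -` V)" if "e : set es" for e
   using pb_section[OF frameD(1)[OF V(1)]] frameD(3)[OF V(1)] that by (metis in_set_conv_nth)
  thus "case W of (U, es) => open U & (ALL p:U. basis_at es p (fibre PB p)) & (ALL e:set es. e : sections N PB U)"
   unfolding V(2) using f_open[OF frameD(1)[OF V(1)]] frameD(2)[OF V(1)] by (auto simp: basis_at_comp PB_fibre)
 qed
qed

context pullback
begin

section \<open>Smooth frames in the sum of the pulled back bundle and the tangent bundle\<close>

lemma pb_global: "v : \<Gamma> M A ==> v o f : \<Gamma> N PB" using pb_section[OF open_UNIV] by simp

text \<open>Componentwise smoothness without the condition that ties the two components together,
  because the elimination below passes through larger fibres than those of the pullback
  algebroid.\<close>

definition psmooth :: "'n set => ('n => 'v \<times> 'n tangent) => bool" where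
 "psmooth U s \<longleftrightarrow> fst o s : sections N PB U & snd o s : vector_fields N U"

lemma psmooth_mono: "psmooth U s ==> open U ==> open W ==> W <= U ==> psmooth W s" unfolding psmooth_def
 by (auto intro!: N.vector_fieldsI dest: PB.sections_mono N.vector_fieldsD)

lemma psmooth_localI:
 assumes "open U" "!!y. y : U ==> EX W. open W & y : W & psmooth W s"
 shows "psmooth U s" unfolding psmooth_def
proof
 show "fst o s : sections N PB U" using assms unfolding psmooth_def by (intro PB.sections_localI) blast+
 show "snd o s : vector_fields N U"
 proof (rule N.vector_fieldsI[OF assms(1)])
  fix y assume y: "y : U"
  then obtain W where W: "open W" "y : W" "snd o s : vector_fields N W" using assms(2) unfolding psmooth_def by blast
  show "(snd o s) y : tangent_space N y" using N.vector_fieldsD(1)[OF W(3,1,2)] .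
  show "smooth_at N (%p. (snd o s) p g) y" if "g : smooth_funs N" for g using N.vector_fieldsD(2)[OF W(3,1,2) that] .
 qed
qed

lemma psmooth_cong:
 assumes "psmooth U s" "open U" "!!y. y : U ==> s y = t y" shows "psmooth U t" unfolding psmooth_def
proof
 show "fst o t : sections N PB U" by (rule PB.sections_cong[where s = "fst o s"]) (use assms in \<open>auto simp: psmooth_def\<close>)
 have s: "snd o s : vector_fields N U" using assms(1) unfolding psmooth_def by blast
 show "snd o t : vector_fields N U"
 proof (rule N.vector_fieldsI[OF assms(2)])
  show "(snd o t) p : tangent_space N p" if "p : U" for p
   using N.vector_fieldsD(1)[OF s assms(2) that] assms(3)[OF that] by simp
  show "smooth_at N (%p. (snd o t) p g) p" if "g : smooth_funs N" "p : U" for g p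
   using N.vector_fieldsD(2)[OF s assms(2) that(2,1)] by (rule N.smooth_at_cong) (use assms that in auto)
 qed
qed

lemma psmooth_sum:
 assumes U: "open U" and c: "!!i y. i : I ==> y : U ==> smooth_at N (c i) y" and s: "!!i. i : I ==> psmooth U (s i)"
 shows "psmooth U (%y. SUM i:I. c i y *R s i y)" unfolding psmooth_def
proof
 have "(%y. SUM i:I. c i y *R (fst o s i) y) : sections N PB U"
 proof (rule PB.sections_sum[OF U], rule PB.sections_smul[OF U])
  show "fst o s i : sections N PB U" if "i : I" for i using s[OF that] unfolding psmooth_def by blast
 qed (use c in blast)
 thus "fst o (%y. SUM i:I. c i y *R s i y) : sections N PB U" by (simp add: comp_def fst_sum)
 have v: "snd o s i : vector_fields N U" if "i : I" for i using s that unfolding psmooth_def by blast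
 show "snd o (%y. SUM i:I. c i y *R s i y) : vector_fields N U"
 proof (rule N.vector_fieldsI[OF U])
  show "(snd o (%y. SUM i:I. c i y *R s i y)) p : tangent_space N p" if "p : U" for p
   using N.vector_fieldsD(1)[OF v U that] by (auto simp: snd_sum intro!: N.tangent_sum)
  show "smooth_at N (%p. (snd o (%y. SUM i:I. c i y *R s i y)) p g) p" if "g : smooth_funs N" "p : U" for g p
   using N.vector_fieldsD(2)[OF v U that(2,1)] c that(2)
   by (auto simp: snd_sum sum_apply scaleR_fun_def intro!: N.smooth_at_sum N.smooth_at_mult)
 qed
qed

text \<open>The coefficients solve a linear system with one equation for each coordinate of the
  first component and one for each smooth function to which the second is applied. Independence of
  the frame at \<open>p\<close> makes the system injective there.\<close>

lemma psmooth_coefficients: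
 assumes U: "open U" "p : U" and es: "!!e. e : set es ==> psmooth U e" and b: "basis_at es p F"
  and s: "psmooth U s" "!!x. x : U ==> s x = (SUM i<length es. c i x *R (es ! i) x)" and i: "i < length es"
 shows "smooth_at N (c i) p"
proof -
 obtain V fs where V: "(V, fs) : frames PB" "p : V" using PB.frame_at by metis
 have Vo: "open V" using PB.frameD(1)[OF V(1)] .
 define r where "r j x z = (case j of Inl k => fcoef fs x (fst z) k | Inr g => snd z g)"
  for j :: "nat + ('n => real)" and x and z :: "'v \<times> 'n tangent"
 define J where "J = Inl ` {..<length fs} Un Inr ` smooth_funs N"
 have smooth: "smooth_at N (%x. r j x (t x)) p" if "psmooth U t" "j : J" for t j
 proof (cases j)
  case (Inl k)
  hence "k < length fs" using that(2) by (auto simp: J_def)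
  from PB.sections_coef[OF _ U(1) V(1) U(2) V(2) this, of "fst o t"]
  show ?thesis using that(1) by (simp add: psmooth_def r_def Inl)
 next
  case (Inr g)
  hence "g : smooth_funs N" using that(2) by (auto simp: J_def)
  with N.vector_fieldsD(2)[OF _ U, of "snd o t" g]
  show ?thesis using that(1) by (simp add: psmooth_def r_def Inr)
 qed
 have fib: "fst ((es ! i) x) : fibre PB x" if "i < length es" "x : U" for i x
  using es[of "es ! i"] that PB.sections_fibre[of "fst o es ! i" U x] by (simp add: psmooth_def)
 have lin: "r j x (SUM i<length es. d i *R (es ! i) x) = (SUM i<length es. d i * r j x ((es ! i) x))"
  if "j : J" "x : U Int V" for j x d
 proof (cases j)
  case (Inl k)
  hence "k < length fs" using that(1) by (auto simp: J_def)
  with fcoef_lin[OF PB.frameD(2)[OF V(1)], of x "{..<length es}" "%i. fst ((es ! i) x)" k d]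
  show ?thesis using that(2) fib by (simp add: r_def Inl fst_sum)
 qed (simp add: r_def snd_sum sum_apply scaleR_fun_def)
 have "ALL i:{..<length es}. smooth_at N (c i) p"
 proof (rule N.smooth_solution[where J = J and U = "U Int V" and a = "%i j x. r j x ((es ! i) x)" and b = "%j x. r j x (s x)"])
  show "smooth_at N (%x. r j x ((es ! i) x)) p" if "i : {..<length es}" "j : J" for i j
   using smooth[OF es that(2)] that(1) by simp
  show "smooth_at N (%x. r j x (s x)) p" if "j : J" for j using smooth[OF s(1) that] .
  show "r j x (s x) = (SUM i<length es. c i x * r j x ((es ! i) x))" if "x : U Int V" "j : J" for x j
   using lin[OF that(2,1)] s(2) that by simp
  show "ALL i:{..<length es}. d i = 0" if d: "!!j. j : J ==> (SUM i<length es. d i * r j p ((es ! i) p)) = 0" for d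
  proof -
   let ?z = "SUM i<length es. d i *R (es ! i) p"
   have z: "r j p ?z = 0" if "j : J" for j using lin[OF that] d[OF that] U V by simp
   have "psmooth U (%x. SUM i<length es. d i *R (es ! i) x)" by (rule psmooth_sum[OF U(1)]) (use es in auto)
   hence t: "fst ?z : fibre PB p" "snd ?z : tangent_space N p"
    using PB.sections_fibre[OF _ U(2)] N.vector_fieldsD(1)[OF _ U] unfolding psmooth_def by fastforce+
   have "fst ?z = 0" using fcoef_sum[OF PB.frameD(2)[OF V] t(1)] z[of "Inl _"] by (simp add: r_def J_def)
   moreover have "snd ?z = 0" using N.tangent_eqI[OF t(2) N.tangent_zero] z[of "Inr _"] by (simp add: r_def J_def)
   ultimately have "?z = 0" by (simp only: prod_eq_iff fst_zero snd_zero)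
   thus ?thesis using b unfolding basis_at_iff by blast
  qed
 qed (use U V Vo in auto)
 thus ?thesis using i by simp
qed

definition lframe :: "'n => ('n => ('v \<times> 'n tangent) set) => bool" where
 "lframe p K \<longleftrightarrow> (EX U es. open U & p : U & (ALL e:set es. psmooth U e) & (ALL x:U. basis_at es x (K x)))"

lemma lframe_all: "lframe p (%x. fibre A (f x) \<times> tangent_space N x)"
proof -
 obtain V es where V: "(V, es) : frames PB" "p : V" using PB.frame_at by metis
 obtain W c where W: "(W, c) : N" "p : W" using N.chart_at by metis
 have o: "open V" "open W" using PB.frameD(1)[OF V(1)] N.chartD(1)[OF W(1)] .
 obtain bs where bs: "distinct bs" "set bs = N.basis" using finite_distinct_list[OF N.finite_basis] by metis
 let ?es = "map (%e x. (e x, 0)) es @ map (%d x. (0, d x)) (map (%b x. N.chart_deriv W c x b) bs)"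
 have "psmooth (V Int W) h" if h: "h : set ?es" for h
 proof -
  consider e where "e : set es" "h = (%x. (e x, 0))" | b where "h = (%x. (0, N.chart_deriv W c x b))" using h by auto
  thus ?thesis
  proof cases
   case 1
   have "e : sections N PB V" using PB.frameD(3)[OF V(1)] 1(1) by (metis in_set_conv_nth)
   hence "e : sections N PB (V Int W)" by (rule PB.sections_mono) (use o in auto)
   moreover have "(%x. 0) : vector_fields N (V Int W)" by (rule N.vector_fieldsI) (use o N.tangent_zero in auto)
   ultimately show ?thesis by (simp add: psmooth_def 1(2) comp_def)
  next
   case 2
   have "(%x. N.chart_deriv W c x b) : vector_fields N (V Int W)"
    by (rule N.vector_fieldsI) (use o N.chart_deriv_tangent[OF W(1)] N.chart_deriv_smooth[OF W(1)] in auto)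
   thus ?thesis using PB.sections_zero[of "V Int W"] o by (auto simp add: psmooth_def 2 comp_def)
  qed
 qed
 moreover have "basis_at ?es x (fibre A (f x) \<times> tangent_space N x)" if "x : V Int W" for x
  using basis_at_prod[OF PB.frameD(2)[OF V(1)] N.tangent_basis[OF W(1) _ bs]] that by (simp add: PB_fibre)
 ultimately show ?thesis unfolding lframe_def using V W o by (intro exI[of _ "V Int W"] exI[of _ ?es]) auto
qed

text \<open>Some frame member has nonzero \<open>l\<close> at \<open>p\<close>, since otherwise
  \<open>l\<close> would vanish on all of \<open>K p\<close>. By continuity it stays a valid pivot
  on a neighbourhood, so that one frame of the kernel works there.\<close>

lemma lframe_pivot:
 assumes K: "lframe p K" and U: "open U" "p : U"
  and lin: "!!x v w a b. x : U ==> v : K x ==> w : K x ==> l x (a *R v + b *R w) = a * l x v + b * l x w"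
  and smooth: "!!s W x. open W ==> W <= U ==> x : W ==> psmooth W s ==> smooth_at N (%x. l x (s x)) x"
  and z: "z : K p" "l p z ~= 0"
 shows "lframe p (%x. {v : K x. l x v = 0})"
proof -
 obtain W es where W: "open W" "p : W" "!!e. e : set es ==> psmooth W e" "!!x. x : W ==> basis_at es x (K x)"
  using K unfolding lframe_def by blast
 have "EX e:set es. l p (e p) ~= 0"
 proof (rule ccontr)
  assume "~ ?thesis"
  hence 0: "l p (e p) = 0" if "e : set es" for e using that by blast
  have sub: "subspace (K p)" using basis_at_subspace[OF W(4)[OF W(2)]] .
  have "subspace {v : K p. l p v = 0}" unfolding subspace_def
   using subspace_0[OF sub] subspace_add[OF sub] subspace_scale[OF sub]
    lin[OF U(2) subspace_0[OF sub] subspace_0[OF sub], of 0 0] lin[OF U(2), of _ _ 1 1] lin[OF U(2), of _ _ _ 0] by auto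
  moreover have "set (map (%e. e p) es) <= {v : K p. l p v = 0}"
   using 0 W(4)[OF W(2)] span_base[of _ "set (map (%e. e p) es)"] unfolding basis_at_def by auto
  ultimately have "K p <= {v : K p. l p v = 0}" using W(4)[OF W(2)] span_minimal unfolding basis_at_def by blast
  thus False using z by blast
 qed
 then obtain e xs ys where e: "l p (e p) ~= 0" "es = xs @ e # ys" by (metis split_list)
 have se: "psmooth (W Int U) d" if "d : set es" for d by (rule psmooth_mono[OF W(3)[OF that]]) (use W U in auto)
 have e_in: "e : set es" using e(2) by simp
 have le: "smooth_at N (%x. l x (d x)) x" if "d : set es" "x : W Int U" for d x
  by (rule smooth[where W = "W Int U"]) (use W U se that in auto)
 obtain Y where Y: "open Y" "p : Y" "!!x. x : Y ==> l x (e x) ~= 0"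
  using N.smooth_at_nonzero_open[OF le[OF e_in] e(1)] W U by (metis IntI)
 define a where "a x d = l x (d x) / l x (e x)" for x and d :: "'n => 'v \<times> 'n tangent"
 let ?hs = "map (%d x. d x - a x d *R e x) (xs @ ys)"
 let ?T = "W Int U Int Y"
 have T: "open ?T" "p : ?T" using W U Y by auto
 have "psmooth ?T h" if h: "h : set ?hs" for h
 proof -
  obtain d where d: "d : set es" "h = (%x. d x - a x d *R e x)" using h e(2) by auto
  \<comment> \<open>The difference is written as a sum of two terms so that
    \<open>psmooth_sum\<close> covers scaling and addition at once.\<close>
  have "psmooth ?T (%x. SUM i:{..<2::nat}. (if i = 0 then (%_. 1) else (%x. - a x d)) x *R (if i = 0 then d else e) x)"
  proof (rule psmooth_sum[OF T(1)])
   show "psmooth ?T (if i = 0 then d else e)" for i :: nat by (rule psmooth_mono[OF W(3)]) (use d e_in W T in auto)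
   show "smooth_at N (if i = 0 then (%_. 1) else (%x. - a x d)) y" if "y : ?T" for i :: nat and y
    using le[OF d(1), of y] le[OF e_in, of y] Y(3)[of y] that
    by (auto simp: a_def intro!: N.smooth_at_minus N.smooth_at_divide)
  qed
  thus ?thesis unfolding d(2) by (simp add: numeral_2_eq_2)
 qed
 moreover have "basis_at ?hs x {v : K x. l x v = 0}" if "x : ?T" for x
 proof -
  have b: "basis_at (e # xs @ ys) x (K x)" by (rule basis_at_perm) (use W(4)[of x] that e(2) in simp)
  define a' where "a' y d = l x (d y) / l x (e y)" for y and d :: "'n => 'v \<times> 'n tangent"
  have "basis_at (map (%d y. d y - a' y d *R e y) (xs @ ys)) x {v : K x. l x v = 0}"
   by (rule basis_at_pivot[OF b]) (use Y(3) lin that in \<open>auto simp: a'_def\<close>)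
  thus ?thesis by (simp add: basis_at_def a_def a'_def comp_def)
 qed
 ultimately show ?thesis unfolding lframe_def using T by blast
qed

lemma anchor_sum:
 assumes "!!i. i : I ==> v i : fibre A p"
 shows "anchor A p (SUM i:I. c i *R v i) g = (SUM i:I. c i * anchor A p (v i) g)" using assms
proof (induction I rule: infinite_finite_induct)
 case (insert i I)
 have 1: "c i *R v i : fibre A p" using insert subspace_scale[OF fibre_subspace] by blast
 have 2: "(SUM i:I. c i *R v i) : fibre A p"
  using insert by (intro subspace_sum[OF fibre_subspace] subspace_scale[OF fibre_subspace]) auto
 show ?case using insert anchor_add[OF 1 2, of g] anchor_scale[of "v i" p "c i" g] by simp
qed (use anchor_scale[OF subspace_0[OF fibre_subspace], of p 0 g] in simp_all)

text \<open>The bundle atlas gives local coefficients with respect to a frame \<open>ds\<close> of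
  \<open>A\<close>. This frame is expressed through the global sections \<open>es\<close>, and the
  resulting coefficients are extended to global functions, as \<open>represents_near\<close>
  requires.\<close>

lemma pb_rep:
 assumes W: "framed W es" "f y : W" and U: "open U" "y : U" and s: "s : sections N PB U"
 obtains c Y where "!!i. i < length es ==> c i : smooth_funs N" "open Y" "y : Y" "Y <= U" "f ` Y <= W"
  "!!x. x : Y ==> s x = (SUM i<length es. c i x *R (es ! i) (f x))"
proof -
 obtain V ds where V: "(V, ds) : frames A" "f y : V" using frame_at by metis
 let ?ds = "map (%e. e o f) ds"
 have PV: "(f -` V, ?ds) : frames PB" unfolding PB_frames using V(1) by (auto intro!: rev_image_eqI)
 define b where "b j x = fcoef ?ds x (s x) j" for j x
 have b: "smooth_at N (b j) y" if "j < length ds" for j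
  unfolding b_def using PB.sections_coef[OF s U(1) PV U(2)] V(2) that by simp
 have sb: "s x = (SUM j<length ds. b j x *R (ds ! j) (f x))" if "x : U" "f x : V" for x
  using fcoef_sum[OF PB.frameD(2)[OF PV] PB.sections_fibre[OF s that(1)]] that(2) by (simp add: b_def)
 define Q where "Q j r \<longleftrightarrow> (ALL i<length es. fst r i : smooth_funs M) & open (snd r) & f y : snd r &
   (ALL p:snd r. (ds ! j) p = (SUM i<length es. fst r i p *R (es ! i) p))" for j and r :: "(nat => 'm => real) \<times> 'm set"
 have "EX r. Q j r" if j: "j < length ds" for j
 proof -
  obtain t T where T: "t : \<Gamma> M A" "open T" "f y : T" "T <= V" "!!x. x : T ==> t x = (ds ! j) x"
   using section_extend[OF frameD(1)[OF V(1)] V(2) frameD(3)[OF V(1) j]] by metis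
  obtain a where a: "ALL i<length es. a i : smooth_funs M" "ALL x:W. t x = (SUM i<length es. a i x *R (es ! i) x)"
   using framedD(4)[OF W(1) T(1)] by blast
  show ?thesis unfolding Q_def by (rule exI[of _ "(a, T Int W)"]) (use T a W framedD(1)[OF W(1)] in auto)
 qed
 hence "ALL j:{..<length ds}. EX r. Q j r" by blast
 from bchoice[OF this] obtain r where r: "!!j. j < length ds ==> Q j (r j)" by blast
 define a where "a j = fst (r j)" for j
 define T where "T j = snd (r j)" for j
 have a: "!!i j. j < length ds ==> i < length es ==> a j i : smooth_funs M"
  and T: "!!j. j < length ds ==> open (T j)" "!!j. j < length ds ==> f y : T j"
  and aT: "!!j p. j < length ds ==> p : T j ==> (ds ! j) p = (SUM i<length es. a j i p *R (es ! i) p)"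
  using r unfolding Q_def a_def T_def by blast+
 define c0 where "c0 i x = (SUM j<length ds. b j x * a j i (f x))" for i x
 have c0: "smooth_at N (c0 i) y" if "i < length es" for i
  unfolding c0_def by (intro N.smooth_at_sum N.smooth_at_mult f_smooth) (use b a that smooth_funsD in auto)
 have "ALL i:{..<length es}. EX r. fst r : smooth_funs N & open (snd r) & y : snd r & (ALL x:snd r. fst r x = c0 i x)"
 proof
  fix i assume "i : {..<length es}"
  then obtain c Z where "c : smooth_funs N" "open Z" "y : Z" "!!x. x : Z ==> c x = c0 i x"
   using N.smooth_extend[OF c0] by (metis lessThan_iff)
  thus "EX r. fst r : smooth_funs N & open (snd r) & y : snd r & (ALL x:snd r. fst r x = c0 i x)"
   by (intro exI[of _ "(c, Z)"]) simp
 qed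
 from bchoice[OF this] obtain h where h: "!!i. i < length es ==> fst (h i) : smooth_funs N & open (snd (h i)) &
   y : snd (h i) & (ALL x:snd (h i). fst (h i) x = c0 i x)" by blast define c where "c i = fst (h i)" for i
 define Z where "Z i = snd (h i)" for i
 have c: "!!i. i < length es ==> c i : smooth_funs N"
  and Z: "!!i. i < length es ==> open (Z i)" "!!i. i < length es ==> y : Z i"
  "!!i x. i < length es ==> x : Z i ==> c i x = c0 i x" using h unfolding c_def Z_def by blast+
 let ?Y = "U Int f -` (V Int W Int (INT j:{..<length ds}. T j)) Int (INT i:{..<length es}. Z i)"
 show ?thesis
 proof (rule that[of c ?Y])
  have "open (INT j:{..<length ds}. T j)" "open (INT i:{..<length es}. Z i)" using T Z by (auto intro!: open_INT)
  thus "open ?Y" using U(1) frameD(1)[OF V(1)] framedD(1)[OF W(1)] by (intro open_Int f_open)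
  show "s x = (SUM i<length es. c i x *R (es ! i) (f x))" if x: "x : ?Y" for x
  proof -
   have "s x = (SUM j<length ds. b j x *R (SUM i<length es. a j i (f x) *R (es ! i) (f x)))" using sb[of x] x aT by simp
   also have "... = (SUM i<length es. c0 i x *R (es ! i) (f x))"
    unfolding scaleR_sum_right c0_def scaleR_sum_left by (subst sum.swap) simp
   also have "... = (SUM i<length es. c i x *R (es ! i) (f x))" using Z(3) x by simp
   finally show ?thesis .
  qed
 qed (use c U V(2) W T Z in auto)
qed

lemma pb_anchor_smooth:
 assumes U: "open U" "y : U" and s: "s : sections N PB U" and g: "g : smooth_funs M"
 shows "smooth_at N (%x. anchor A (f x) (s x) g) y"
proof -
 obtain W es where W: "f y : W" "framed W es" using global_frame by metis
 obtain c Y where c: "!!i. i < length es ==> c i : smooth_funs N" "open Y" "y : Y" "Y <= U" "f ` Y <= W"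
  "!!x. x : Y ==> s x = (SUM i<length es. c i x *R (es ! i) (f x))" by (rule pb_rep[OF W(2,1) U s]) (rule that)
 have es: "es ! i : \<Gamma> M A" if "i < length es" for i using framedD(2)[OF W(2)] that by auto
 have "smooth_at N (%x. SUM i<length es. c i x * arho A (es ! i) g (f x)) y"
  using es g by (intro N.smooth_at_sum N.smooth_at_mult f_smooth smooth_funsD N.smooth_funsD c(1) arho_smooth) auto
 thus ?thesis
 proof (rule N.smooth_at_cong[OF _ c(2,3)])
  show "(SUM i<length es. c i x * arho A (es ! i) g (f x)) = anchor A (f x) (s x) g" if "x : Y" for x
   unfolding c(6)[OF that] arho_def by (rule anchor_sum[symmetric]) (use es sections_fibre[OF _ UNIV_I] in auto)
 qed
qed

section \<open>The pullback algebroid as a vector bundle\<close>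

lemma pushforward_tangent:
 assumes X: "X : tangent_space N y" shows "pushforward M f X : tangent_space M (f y)"
proof (rule tangentI)
 show "pushforward M f X g = 0" if "g ~: smooth_funs M" for g using that by (simp add: pushforward_def)
 fix g h a b assume g: "g : smooth_funs M" and h: "h : smooth_funs M"
 have s: "(%x. a * g x + b * h x) : smooth_funs M" "(%x. g x * h x) : smooth_funs M"
  using g h by (intro smooth_funs_closed; simp add: smooth_funs_closed)+
 show "pushforward M f X (%x. a * g x + b * h x) = a * pushforward M f X g + b * pushforward M f X h"
  using N.tangent_lin[OF X f_funs[OF g] f_funs[OF h], of a b] g h s by (simp add: pushforward_def comp_def)
 show "pushforward M f X (%x. g x * h x) = g (f y) * pushforward M f X h + h (f y) * pushforward M f X g"
  using N.tangent_mult[OF X f_funs[OF g] f_funs[OF h]] g h s by (simp add: pushforward_def comp_def)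
qed

lemma pushforward_apply: "g : smooth_funs M ==> pushforward M f X g = X (%x. g (f x))" by (simp add: pushforward_def comp_def)

lemma P_simps: "fibre P = pullback_fibre N M f A (fibre A)" "anchor P = (%y. snd)" "bracket P = pullback_bracket N M f A"
 "frames P = {(U, es). open U & (ALL e:set es. psmooth U e) & (ALL y:U. basis_at es y (fibre P y))}"
 by (simp_all add: pullback_algebroid_def psmooth_def)

lemma P_fibre: "z : fibre P y \<longleftrightarrow> fst z : fibre A (f y) & snd z : tangent_space N y &
  anchor A (f y) (fst z) = pushforward M f (snd z)" unfolding P_simps pullback_fibre_def by (cases z) simp 
lemma lframe_cong:
 assumes "lframe p K" "open U" "p : U" "!!x. x : U ==> K x = K' x" shows "lframe p K'"
proof -
 obtain W es where W: "open W" "p : W" "!!e. e : set es ==> psmooth W e" "!!x. x : W ==> basis_at es x (K x)"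
  using assms(1) unfolding lframe_def by blast
 have "psmooth (U Int W) e" if "e : set es" for e by (rule psmooth_mono[OF W(3)[OF that]]) (use W assms in auto)
 moreover have "basis_at es x (K' x)" if "x : U Int W" for x using W(4)[of x] assms(4)[of x] that by simp
 moreover have "open (U Int W)" "p : U Int W" using W assms by auto
 ultimately show ?thesis unfolding lframe_def by blast
qed

text \<open>Near \<open>y\<close> the fibre is cut out by the functionals \<open>l b\<close>, one
  for each coordinate of \<open>M\<close>. Transversality provides vectors dual to them at
  \<open>y\<close>, so the equations can be imposed one after another, each with a nonzero
  pivot.\<close>

lemma P_lframe: "lframe y (fibre P)"
proof -
 obtain V u where V: "(V, u) : M" "f y : V" using chart_at by metis
 obtain h U where h: "!!b. b : basis ==> h b : smooth_funs M" and U: "open U" "f y : U" "U <= V"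
  and hU: "!!b x. b : basis ==> x : U ==> h b x = u x \<bullet> b" using coord_exist[OF V] by metis
 define l where "l b x z = anchor A (f x) (fst z) (h b) - snd z (%x. h b (f x))" for b x and z :: "'v \<times> 'n tangent"
 have U': "open (f -` U)" "y : f -` U" using f_open U by auto
 have lin: "l b x (c *R v + d *R w) = c * l b x v + d * l b x w"
  if "v : fibre A (f x) \<times> tangent_space N x" "w : fibre A (f x) \<times> tangent_space N x" for b x v w c d
 proof -
  have v: "fst v : fibre A (f x)" and w: "fst w : fibre A (f x)" using that by auto
  show ?thesis unfolding l_def fst_add snd_add fst_scaleR snd_scaleR anchor_lin[OF v w]
   by (simp add: scaleR_fun_def algebra_simps)
 qed
 have smooth: "smooth_at N (%x. l b x (s x)) x" if "open W" "x : W" "psmooth W s" "b : basis" for b W x s unfolding l_def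
  using pb_anchor_smooth[OF that(1,2) _ h[OF that(4)], of "fst o s"]
   N.vector_fieldsD(2)[OF _ that(1,2) f_funs[OF h[OF that(4)]], of "snd o s"] that(3)
  by (auto simp: psmooth_def intro!: N.smooth_at_diff)
 have "lframe y (%x. {z : fibre A (f x) \<times> tangent_space N x. ALL b:S. l b x z = 0})" if "finite S" "S <= basis" for S using that
 proof (induction S rule: finite_induct)
  case empty
  thus ?case using lframe_all by simp
 next
  case (insert c S)
  let ?K = "%x. {z : fibre A (f x) \<times> tangent_space N x. ALL b:S. l b x z = 0}"
  have c: "c : basis" and IH: "lframe y ?K" using insert by auto
  have "chart_deriv V u (f y) c : tangent_space M (f y)" using chart_deriv_tangent[OF V] .
  then obtain X v where X: "X : tangent_space N y" "v : fibre A (f y)"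
   "chart_deriv V u (f y) c = pushforward M f X + anchor A (f y) v" using transverse unfolding transverse_def by blast
  \<comment> \<open>\<open>l b\<close> subtracts the tangent component, so \<open>X\<close> enters
    with a minus sign; the zero summand only gives the shape of
    \<open>tangent_lin_comb\<close>.\<close>
  let ?z = "(v, (-1) *R X + 0 *R X)"
  have z: "l b y ?z = (if c = b then 1 else 0)" if "b : basis" for b
  proof -
   have "l b y ?z = (pushforward M f X + anchor A (f y) v) (h b)"
    unfolding l_def plus_fun_apply pushforward_apply[OF h[OF that]] by (simp add: scaleR_fun_def)
   also have "... = (if c = b then 1 else 0)" unfolding X(3)[symmetric]
    using chart_deriv_coord[OF V h[OF that] U(1,2) hU[OF that] c that] .
   finally show ?thesis .
  qed
  have "lframe y (%x. {v : ?K x. l c x v = 0})"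
  proof (rule lframe_pivot[OF IH U'])
   show "l c x (a *R v + b *R w) = a * l c x v + b * l c x w" if "v : ?K x" "w : ?K x" for x v w a b
    by (rule lin) (use that in auto)
   show "smooth_at N (%x. l c x (s x)) x" if "open W" "x : W" "psmooth W s" for s W x using smooth[OF that c] .
   show "l c y ?z ~= 0" using z[OF c] by simp
   have "(-1) *R X + 0 *R X : tangent_space N y" using N.tangent_lin_comb[OF X(1,1)] .
   moreover have "l b y ?z = 0" if "b : S" for b using z[of b] that insert by auto
   ultimately show "?z : ?K y" using X(2) by blast
  qed
  moreover have "{v : ?K x. l c x v = 0} = {z : fibre A (f x) \<times> tangent_space N x. ALL b:insert c S. l b x z = 0}" for x
   by blast
  ultimately show ?case by simp
 qed
 hence "lframe y (%x. {z : fibre A (f x) \<times> tangent_space N x. ALL b:basis. l b x z = 0})" by simp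
 thus ?thesis
 proof (rule lframe_cong[OF _ U'])
  fix x assume "x : f -` U"
  hence x: "f x : U" "f x : V" using U(3) by auto
  show "{z : fibre A (f x) \<times> tangent_space N x. ALL b:basis. l b x z = 0} = fibre P x"
  proof (intro set_eqI iffI)
   fix z assume z: "z : {z : fibre A (f x) \<times> tangent_space N x. ALL b:basis. l b x z = 0}"
   hence zf: "fst z : fibre A (f x)" "snd z : tangent_space N x" by auto
   have t: "anchor A (f x) (fst z) : tangent_space M (f x)" "pushforward M f (snd z) : tangent_space M (f x)"
    using anchor_tangent[OF zf(1)] pushforward_tangent[OF zf(2)] .
   have "anchor A (f x) (fst z) = pushforward M f (snd z)"
   proof (rule tangent_eqI[OF t])
    fix g assume g: "g : smooth_funs M"
    have "anchor A (f x) (fst z) (h b) = pushforward M f (snd z) (h b)" if "b : basis" for b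
     using z that by (auto simp: l_def pushforward_apply[OF h])
    moreover have "anchor A (f x) (fst z) g = (SUM b:basis. anchor A (f x) (fst z) (h b) * chart_deriv V u (f x) b g)"
     by (rule tangent_coord[OF V(1) x(2) t(1) g h U(1) x(1) hU])
    moreover have "pushforward M f (snd z) g = (SUM b:basis. pushforward M f (snd z) (h b) * chart_deriv V u (f x) b g)"
     by (rule tangent_coord[OF V(1) x(2) t(2) g h U(1) x(1) hU])
    ultimately show "anchor A (f x) (fst z) g = pushforward M f (snd z) g" by (metis (mono_tags, lifting) sum.cong)
   qed
   thus "z : fibre P x" unfolding P_fibre using zf by blast
  next
   fix z assume "z : fibre P x"
   thus "z : {z : fibre A (f x) \<times> tangent_space N x. ALL b:basis. l b x z = 0}"
    unfolding P_fibre by (cases z) (auto simp: l_def pushforward_apply[OF h])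
  qed
 qed
qed

lemma P_frame_at: obtains U es where "(U, es) : frames P" "y : U"
 using P_lframe[of y] unfolding lframe_def P_simps(4) by blast

lemma P_framesD:
 assumes "(U, es) : frames P"
 shows "open U" "e : set es ==> psmooth U e" "y : U ==> basis_at es y (fibre P y)" using assms unfolding P_simps(4) by auto

lemma P_sectionsI:
 assumes U: "open U" and s: "psmooth U s" "!!y. y : U ==> s y : fibre P y"
 shows "s : sections N P U" unfolding sections_def mem_Collect_eq
proof (intro conjI ballI)
 show "s y : fibre P y" if "y : U" for y using s(2)[OF that] .
 fix W assume "W : frames P"
 then obtain V es where V: "(V, es) : frames P" and W: "W = (V, es)" by (cases W) auto
 note D = P_framesD[OF V]
 have o: "open (U Int V)" using U D(1) by blast
 let ?c = "%i x. fcoef es x (s x) i"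
 have eq: "s x = (SUM i<length es. ?c i x *R (es ! i) x)" if "x : U Int V" for x using fcoef_sum[OF D(3) s(2)] that by blast
 have "smooth_fun_on N (U Int V) (?c i)" if "i < length es" for i unfolding N.smooth_fun_on_iff[OF o]
 proof
  fix x assume x: "x : U Int V"
  show "smooth_at N (?c i) x"
  proof (rule psmooth_coefficients[OF o x _ D(3) _ eq that])
   show "psmooth (U Int V) e" if "e : set es" for e using psmooth_mono[OF D(2)[OF that] D(1) o] by blast
   show "psmooth (U Int V) s" using psmooth_mono[OF s(1) U o] by blast
  qed (use x in auto)
 qed
 thus "case W of (V, es) => EX c. (ALL i<length es. smooth_fun_on N (U Int V) (c i)) &
    (ALL p:U Int V. s p = (SUM i<length es. c i p *R (es ! i) p))" unfolding W prod.case using eq by (intro exI[of _ ?c]) blast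
qed

end

sublocale pullback \<subseteq> P: vbundle N "pullback_algebroid N M f A"
proof
 show "vector_bundle N P" unfolding vector_bundle_def
 proof (intro conjI allI ballI)
  show "EX (U, es):frames P. y : U" for y by (rule P_frame_at[of y]) blast
  fix W assume "W : frames P"
  then obtain V es where V: "(V, es) : frames P" and W: "W = (V, es)" by (cases W) auto
  note D = P_framesD[OF V]
  have "e : sections N P V" if "e : set es" for e
  proof (rule P_sectionsI[OF D(1) D(2)[OF that]])
   show "e y : fibre P y" if "y : V" for y
    using D(3)[OF that] `e : set es` span_superset[of "set (map (%e. e y) es)"] unfolding basis_at_def by auto
  qed
  thus "case W of (U, es) => open U & (ALL p:U. basis_at es p (fibre P p)) & (ALL e:set es. e : sections N P U)"
   unfolding W prod.case using D(1,3) by blast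
 qed
qed

context pullback
begin

lemma P_sections_iff:
 assumes U: "open U"
 shows "s : sections N P U \<longleftrightarrow> psmooth U s & (ALL y:U. s y : fibre P y)"
proof
 assume s: "s : sections N P U"
 have "EX W. open W & y : W & psmooth W s" if y: "y : U" for y
 proof -
  obtain V es where V: "(V, es) : frames P" "y : V" using P_frame_at by metis
  note D = P_framesD[OF V(1)]
  have o: "open (U Int V)" using U D(1) by blast
  have "psmooth (U Int V) (%x. SUM i<length es. fcoef es x (s x) i *R (es ! i) x)"
  proof (rule psmooth_sum[OF o])
   show "smooth_at N (%x. fcoef es x (s x) i) y" if "i : {..<length es}" "y : U Int V" for i y
    using P.sections_coef[OF s U V(1)] that by simp
   show "psmooth (U Int V) (es ! i)" if "i : {..<length es}" for i using psmooth_mono[OF D(2) D(1) o] that by simp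
  qed
  hence "psmooth (U Int V) s" by (rule psmooth_cong[OF _ o]) (use fcoef_sum[OF D(3) P.sections_fibre[OF s]] in auto)
  thus ?thesis using o y V(2) by blast
 qed
 thus "psmooth U s & (ALL y:U. s y : fibre P y)" using psmooth_localI[OF U] P.sections_fibre[OF s] by blast
qed (use P_sectionsI[OF U] in blast)

end

section \<open>The bracket of the pullback Lie algebroid\<close>

context manifold
begin

lemma field_funs: "X : vector_fields M UNIV ==> g : smooth_funs M ==> (%p. X p g) : smooth_funs M"
 by (simp add: vector_fields_def smooth_funs_def)

lemma field_tangent: "X : vector_fields M UNIV ==> X p : tangent_space M p" by (simp add: vector_fields_def)

lemma bracket_field_apply:
 "g : smooth_funs M ==> vector_field_bracket M X Y p g = X p (%x. Y x g) - Y p (%x. X x g)"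
 by (simp add: vector_field_bracket_def)

lemma bracket_field:
 assumes X: "X : vector_fields M UNIV" and Y: "Y : vector_fields M UNIV"
 shows "vector_field_bracket M X Y : vector_fields M UNIV"
proof (rule vector_fieldsI[OF open_UNIV])
 fix p :: 'm
 note Xp = field_tangent[OF X, of p] and Yp = field_tangent[OF Y, of p]
 show "vector_field_bracket M X Y p : tangent_space M p"
 proof (rule tangentI)
  show "vector_field_bracket M X Y p g = 0" if "g ~: smooth_funs M" for g using that by (simp add: vector_field_bracket_def)
  fix g h a b assume g: "g : smooth_funs M" and h: "h : smooth_funs M"
  have s: "(%x. a * g x + b * h x) : smooth_funs M" "(%x. g x * h x) : smooth_funs M"
   using g h by (intro smooth_funs_closed; simp add: smooth_funs_closed)+
  show "vector_field_bracket M X Y p (%x. a * g x + b * h x) =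
    a * vector_field_bracket M X Y p g + b * vector_field_bracket M X Y p h"
   unfolding bracket_field_apply[OF s(1)] bracket_field_apply[OF g] bracket_field_apply[OF h]
    tangent_lin[OF field_tangent[OF X] g h] tangent_lin[OF field_tangent[OF Y] g h]
    tangent_lin[OF Xp field_funs[OF Y g] field_funs[OF Y h]] tangent_lin[OF Yp field_funs[OF X g] field_funs[OF X h]]
   by (simp add: algebra_simps)
  have m: "Z p (%x. g x * W x h + h x * W x g) =
    g p * Z p (%x. W x h) + W p h * Z p g + (h p * Z p (%x. W x g) + W p g * Z p h)"
   if Z: "Z : vector_fields M UNIV" and W: "W : vector_fields M UNIV" for Z W
   using tangent_add[OF field_tangent[OF Z] smooth_funs_closed(3)[OF g field_funs[OF W h]] smooth_funs_closed(3)[OF h field_funs[OF W g]]]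
    tangent_mult[OF field_tangent[OF Z] g field_funs[OF W h]] tangent_mult[OF field_tangent[OF Z] h field_funs[OF W g]]
   by simp
  show "vector_field_bracket M X Y p (%x. g x * h x) =
    g p * vector_field_bracket M X Y p h + h p * vector_field_bracket M X Y p g"
   unfolding bracket_field_apply[OF s(2)] bracket_field_apply[OF g] bracket_field_apply[OF h]
    tangent_mult[OF field_tangent[OF X] g h] tangent_mult[OF field_tangent[OF Y] g h] m[OF X Y] m[OF Y X]
   by (simp add: algebra_simps)
 qed
 show "smooth_at M (%p. vector_field_bracket M X Y p g) p" if g: "g : smooth_funs M" for g
  unfolding bracket_field_apply[OF g]
  by (rule smooth_at_diff[OF smooth_funsD[OF field_funs[OF X field_funs[OF Y g]]] smooth_funsD[OF field_funs[OF Y field_funs[OF X g]]]])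
qed

end

context algebroid
begin

text \<open>\<open>v\<close> equals \<open>(1 - h) v\<close> for a bump function \<open>h\<close>
  supported in \<open>U\<close>; both Leibniz terms vanish at \<open>p\<close>, one by
  \<open>h p = 1\<close> and the other by \<open>v p = 0\<close>.\<close>

lemma bracket_vanish:
 assumes w: "w : \<Gamma> M A" and v: "v : \<Gamma> M A" and U: "open U" "p : U" "!!x. x : U ==> v x = 0"
 shows "bracket A w v p = 0"
proof -
 obtain h W C where h: "h : smooth_funs M" "open W" "p : W" "W <= C" "closed C" "C <= U"
  "!!x. x : W ==> h x = 1" "!!x. x ~: C ==> h x = 0" using bump[OF U(1,2)] by metis
 have s: "(%x. 1 - h x) : smooth_funs M" using h(1) by (intro smooth_funs_closed)
 have "(%x. (1 - h x) *R v x) = v"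
 proof
  show "(1 - h x) *R v x = v x" for x
  proof (cases "x : U")
   case False
   hence "x ~: C" using h(6) by blast
   thus ?thesis using h(8) by simp
  qed (simp add: U(3))
 qed
 hence "bracket A w v p = (1 - h p) *R bracket A w v p + anchor A p (w p) (%x. 1 - h x) *R v p"
  using bracket_leibniz[OF w v s] by metis
 thus ?thesis using U h(3,7) by simp
qed

lemma bracket_local:
 assumes w: "w : \<Gamma> M A" and v: "v : \<Gamma> M A" and v': "v' : \<Gamma> M A" and U: "open U" "p : U" "!!x. x : U ==> v x = v' x"
 shows "bracket A w v p = bracket A w v' p"
proof -
 have m: "- v' : \<Gamma> M A" using sec.L_minus[OF v'] .
 hence "v + - v' : \<Gamma> M A" using sec.L_add[OF v] by blast
 from bracket_vanish[OF w this U(1,2)] U(3)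
 have "bracket A w (v + - v') p = 0" by simp
 thus ?thesis unfolding bracket_add_right[OF w v m] bracket_minus_right[OF w v'] by simp
qed

lemma bracket_sum:
 assumes w: "w : \<Gamma> M A" and K: "finite K" "!!k. k : K ==> a k : smooth_funs M" "!!k. k : K ==> e k : \<Gamma> M A"
 shows "bracket A w (%p. SUM k:K. a k p *R e k p) =
  (%p. SUM k:K. a k p *R bracket A w (e k) p + anchor A p (w p) (a k) *R e k p)" using K
proof (induction K rule: finite_induct)
 case empty
 have z: "(%p. 0) : \<Gamma> M A" using sections_zero[OF open_UNIV] .
 show ?case using bracket_vanish[OF w z open_UNIV] by (simp add: fun_eq_iff)
next
 case (insert k K)
 have s: "(%p. a k p *R e k p) : \<Gamma> M A" "(%p. SUM k:K. a k p *R e k p) : \<Gamma> M A"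
  using insert smooth_funsD by (intro sections_sum sections_smul open_UNIV; blast)+
 have "bracket A w (%p. SUM k:insert k K. a k p *R e k p) = bracket A w ((%p. a k p *R e k p) + (%p. SUM k:K. a k p *R e k p))"
  using insert.hyps by (simp add: plus_fun_def)
 also have "... = bracket A w (%p. a k p *R e k p) + bracket A w (%p. SUM k:K. a k p *R e k p)"
  using bracket_add_right[OF w s] .
 finally show ?case using bracket_leibniz[OF w, of "e k" "a k"] insert by (simp add: plus_fun_def)
qed

end

section \<open>Well-definedness of the bracket on the pullback\<close>

context pullback
begin

text \<open>\<open>represents_near\<close> with an arbitrary finite index set in place of a list, so
  that representations can be combined through sums and products of index sets.\<close>

definition rep :: "'n => ('n => 'v) => 'i set => ('i => 'n => real) => ('i => 'm => 'v) => bool" where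
 "rep y s I g v \<longleftrightarrow> finite I & (ALL i:I. g i : smooth_funs N & v i : \<Gamma> M A) &
  (EX U. open U & y : U & (ALL x:U. s x = (SUM i:I. g i x *R v i (f x))))" 
definition bval :: "'n => 'i set => ('i => 'n => real) => ('i => 'm => 'v) => 'n tangent =>
  'j set => ('j => 'n => real) => ('j => 'm => 'v) => 'n tangent => 'v" where
 "bval y I g v X J h w Y = (SUM i:I. SUM j:J. (g i y * h j y) *R bracket A (v i) (w j) (f y))
   + (SUM j:J. X (h j) *R w j (f y)) - (SUM i:I. Y (g i) *R v i (f y))" lemma repD: assumes "rep y s I g v"
 shows "finite I" "i : I ==> g i : smooth_funs N" "i : I ==> v i : \<Gamma> M A"
  "s y = (SUM i:I. g i y *R v i (f y))" "s y : fibre A (f y)"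
proof -
 show "finite I" "i : I ==> g i : smooth_funs N" and v: "i : I ==> v i : \<Gamma> M A"
  and eq: "s y = (SUM i:I. g i y *R v i (f y))" for i using assms unfolding rep_def by blast+
 show "s y : fibre A (f y)" unfolding eq using v sections_fibre[OF _ UNIV_I]
  by (intro subspace_sum[OF fibre_subspace] subspace_scale[OF fibre_subspace]) auto
qed

lemma rep_open:
 assumes "rep y s I g v"
 obtains U where "open U" "y : U" "!!x. x : U ==> rep x s I g v"
proof -
 obtain U where "open U" "y : U" "ALL x:U. s x = (SUM i:I. g i x *R v i (f x))" using assms unfolding rep_def by blast
 thus ?thesis using assms that unfolding rep_def by blast
qed

lemma rep_anchor:
 assumes "rep y s I g v"
 shows "anchor A (f y) (s y) h = (SUM i:I. g i y * anchor A (f y) (v i (f y)) h)"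
 unfolding repD(4)[OF assms] using repD(3)[OF assms] sections_fibre[OF _ UNIV_I] by (intro anchor_sum) blast

text \<open>The core of well-definedness. In a frame of \<open>A\<close>, a representation of zero
  has coefficients \<open>u k\<close> that vanish near \<open>y\<close>. The bracket terms are
  multiples of \<open>u k y = 0\<close>, and \<open>Y (u k) = 0\<close> turns the derivatives of the
  structure coefficients into those of the \<open>g i\<close>. The hypothesis \<open>YJ\<close> says
  that the anchor of the other section is the image of \<open>Y\<close>.\<close>

lemma rep_zero:
 assumes I: "finite I" "!!i. i : I ==> g i : smooth_funs N" "!!i. i : I ==> v i : \<Gamma> M A"
  and U: "open U" "y : U" "!!x. x : U ==> (SUM i:I. g i x *R v i (f x)) = 0"
  and J: "!!j. j : J ==> w j : \<Gamma> M A" and Y: "Y : tangent_space N y"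
  and YJ: "!!g. g : smooth_funs M ==> Y (%x. g (f x)) = (SUM j:J. h j * anchor A (f y) (w j (f y)) g)"
 shows "(SUM i:I. SUM j:J. (g i y * h j) *R bracket A (v i) (w j) (f y)) = (SUM i:I. Y (g i) *R v i (f y))"
proof -
 obtain W es where W: "f y : W" "framed W es" using global_frame by metis
 note F = framedD[OF W(2)]
 define n where "n = length es"
 have es: "es ! k : \<Gamma> M A" if "k < n" for k using F(2) that by (auto simp: n_def)
 have "ALL i:I. EX a. (ALL k<n. a k : smooth_funs M) & (ALL x:W. v i x = (SUM k<n. a k x *R (es ! k) x))"
  using F(4)[OF I(3)] unfolding n_def by blast
 from bchoice[OF this] obtain a where a: "!!i k. i : I ==> k < n ==> a i k : smooth_funs M"
  "!!i x. i : I ==> x : W ==> v i x = (SUM k<n. a i k x *R (es ! k) x)" by blast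
 define u where "u k x = (SUM i:I. g i x * a i k (f x))" for k x
 have ga: "(%x. g i x * a i k (f x)) : smooth_funs N" if "i : I" "k < n" for i k
  using N.smooth_funs_closed(3)[OF I(2)[OF that(1)] f_funs[OF a(1)[OF that]]] .
 have u0: "u k x = 0" if x: "x : U Int f -` W" and k: "k < n" for k x
 proof -
  have "(SUM k<n. u k x *R (es ! k) (f x)) = (SUM i:I. g i x *R v i (f x))"
   using x unfolding u_def scaleR_sum_left by (subst sum.swap) (simp add: a(2) scaleR_sum_right)
  hence "(SUM k<length es. u k x *R (es ! k) (f x)) = (SUM k<length es. 0 *R (es ! k) (f x))"
   using U(3) x by (simp add: n_def)
  thus ?thesis using basis_at_unique[OF F(3), of "f x" "%k. u k x" "%_. 0" k] x k by (simp add: n_def)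
 qed
 have uy: "u k y = 0" if "k < n" for k using u0[OF _ that] U(2) W(1) by simp
 have Yu: "(SUM i:I. g i y * Y (%x. a i k (f x))) = - (SUM i:I. a i k (f y) * Y (g i))" if k: "k < n" for k
 proof -
  have s: "u k : smooth_funs N" unfolding u_def by (rule N.smooth_funs_closed(6)) (use ga k in blast)
  have o: "open (U Int f -` W)" "y : U Int f -` W" using U W(1) f_open[OF F(1)] by auto
  have "Y (u k) = Y (%x. 0)" by (rule N.tangent_local[OF Y s N.smooth_funs_closed(1) o]) (use u0 k in blast)
  hence "Y (u k) = 0" using N.tangent_const[OF Y] by simp
  moreover have "Y (u k) = (SUM i:I. g i y * Y (%x. a i k (f x)) + a i k (f y) * Y (g i))"
   unfolding u_def using N.tangent_sum_fun[OF Y, of I "%i x. g i x * a i k (f x)"] ga k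
    N.tangent_mult[OF Y I(2) f_funs[OF a(1)]] by simp
  ultimately show ?thesis by (simp add: sum.distrib)
 qed
 define S where "S k = (SUM j:J. h j *R bracket A (w j) (es ! k) (f y))" for k
 have br: "bracket A (v i) (w j) (f y) =
   - (SUM k<n. a i k (f y) *R bracket A (w j) (es ! k) (f y) + anchor A (f y) (w j (f y)) (a i k) *R (es ! k) (f y))"
  if i: "i : I" and j: "j : J" for i j
 proof -
  have s: "(%p. SUM k<n. a i k p *R (es ! k) p) : \<Gamma> M A"
   using a(1)[OF i] es by (intro sections_sum sections_smul open_UNIV) (auto intro: smooth_funsD)
  have "bracket A (v i) (w j) (f y) = - bracket A (w j) (v i) (f y)" using bracket_antisym[OF I(3)[OF i] J[OF j]] by simp
  also have "bracket A (w j) (v i) (f y) = bracket A (w j) (%p. SUM k<n. a i k p *R (es ! k) p) (f y)"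
   by (rule bracket_local[OF J[OF j] I(3)[OF i] s F(1) W(1)]) (use a(2)[OF i] in blast)
  finally show ?thesis using bracket_sum[OF J[OF j], of "{..<n}" "a i" "%k. es ! k"] a(1)[OF i] es by simp
 qed
 have 1: "(SUM j:J. (g i y * h j) *R bracket A (v i) (w j) (f y)) =
   - (SUM k<n. (g i y * a i k (f y)) *R S k + (g i y * Y (%x. a i k (f x))) *R (es ! k) (f y))" if i: "i : I" for i proof -
  have "(SUM j:J. (g i y * h j) *R bracket A (v i) (w j) (f y)) =
    - (SUM j:J. SUM k<n. (g i y * h j * a i k (f y)) *R bracket A (w j) (es ! k) (f y) +
     (g i y * h j * anchor A (f y) (w j (f y)) (a i k)) *R (es ! k) (f y))"
   using br[OF i] by (simp add: scaleR_sum_right scaleR_add_right sum_negf mult.assoc)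
  also have "... = - (SUM k<n. SUM j:J. (g i y * h j * a i k (f y)) *R bracket A (w j) (es ! k) (f y) +
     (g i y * h j * anchor A (f y) (w j (f y)) (a i k)) *R (es ! k) (f y))" by (subst sum.swap) (rule refl)
  also have "... = - (SUM k<n. (g i y * a i k (f y)) *R S k + (g i y * Y (%x. a i k (f x))) *R (es ! k) (f y))"
   using YJ[OF a(1)[OF i]] by (simp add: S_def sum.distrib scaleR_sum_right scaleR_sum_left sum_distrib_left mult_ac)
  finally show ?thesis .
 qed
 have "(SUM i:I. SUM j:J. (g i y * h j) *R bracket A (v i) (w j) (f y)) =
   - (SUM k<n. SUM i:I. (g i y * a i k (f y)) *R S k + (g i y * Y (%x. a i k (f x))) *R (es ! k) (f y))"
  using 1 by (simp add: sum_negf) (rule sum.swap)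
 also have "... = - (SUM k<n. u k y *R S k + (SUM i:I. g i y * Y (%x. a i k (f x))) *R (es ! k) (f y))"
  by (simp add: u_def sum.distrib scaleR_sum_left)
 also have "... = (SUM k<n. (SUM i:I. a i k (f y) * Y (g i)) *R (es ! k) (f y))" using uy Yu by (simp add: sum_negf)
 also have "... = (SUM i:I. Y (g i) *R v i (f y))"
  unfolding scaleR_sum_left by (subst sum.swap) (simp add: a(2) W(1) scaleR_sum_right mult.commute)
 finally show ?thesis .
qed

lemma bval_antisym:
 assumes "!!i. i : I ==> v i : \<Gamma> M A" "!!j. j : J ==> w j : \<Gamma> M A"
 shows "bval y I g v X J h w Y = - bval y J h w Y I g v X"
proof -
 have "(SUM i:I. SUM j:J. (g i y * h j y) *R bracket A (v i) (w j) (f y)) =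
   (SUM j:J. SUM i:I. - ((h j y * g i y) *R bracket A (w j) (v i) (f y)))"
  by (subst sum.swap) (intro sum.cong refl, use bracket_antisym[OF assms] in \<open>simp add: mult.commute\<close>)
 thus ?thesis unfolding bval_def by (simp add: sum_negf)
qed

text \<open>One representation together with the negative of the other represents zero.\<close>

lemma bval_left:
 assumes s: "rep y z I g v" "rep y z I' g' v'" and t: "rep y u J h w"
  and Y: "Y : tangent_space N y" "anchor A (f y) (u y) = pushforward M f Y"
 shows "bval y I g v X J h w Y = bval y I' g' v' X J h w Y"
proof -
 let ?I = "I <+> I'"
 let ?g = "case_sum g (%i x. - g' i x)" and ?v = "case_sum v v'"
 note fin = repD(1)[OF s(1)] repD(1)[OF s(2)]
 obtain U where U: "open U" "y : U" "!!x. x : U ==> rep x z I g v" using rep_open[OF s(1)] by metis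
 obtain U' where U': "open U'" "y : U'" "!!x. x : U' ==> rep x z I' g' v'" using rep_open[OF s(2)] by metis
 have "(SUM i:?I. SUM j:J. (?g i y * h j y) *R bracket A (?v i) (w j) (f y)) = (SUM i:?I. Y (?g i) *R ?v i (f y))"
 proof (rule rep_zero[OF _ _ _ _ _ _ repD(3)[OF t] Y(1)])
  show "open (U Int U')" "y : U Int U'" using U U' by auto
  show "(SUM i:?I. ?g i x *R ?v i (f x)) = 0" if "x : U Int U'" for x
   using that repD(4)[OF U(3), of x] repD(4)[OF U'(3), of x] unfolding sum.Plus[OF fin] by (simp add: sum_negf)
  show "Y (%x. k (f x)) = (SUM j:J. h j y * anchor A (f y) (w j (f y)) k)" if "k : smooth_funs M" for k
   using rep_anchor[OF t, of k] Y(2) pushforward_apply[OF that] by simp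
  show "?g i : smooth_funs N" if "i : ?I" for i
   using that repD(2)[OF s(1)] repD(2)[OF s(2)] N.smooth_funs_closed(4) by auto
  show "?v i : \<Gamma> M A" if "i : ?I" for i using that repD(3)[OF s(1)] repD(3)[OF s(2)] by auto
 qed (use fin in auto)
 moreover have "Y (%x. - g' i x) = - Y (g' i)" if "i : I'" for i
  using N.tangent_cmult[OF Y(1) repD(2)[OF s(2) that], of "-1"] by simp
 ultimately show ?thesis unfolding sum.Plus[OF fin] bval_def by (simp add: sum_negf algebra_simps)
qed

lemma sum_list_index: "(\<Sum>(g, v)\<leftarrow>gvs. F g v) = (SUM i<length gvs. F (fst (gvs ! i)) (snd (gvs ! i)))"
 by (simp add: sum_list_sum_nth atLeast0LessThan split_beta)

lemma represents_rep:
 assumes "represents_near N M f A y s gvs"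
 shows "rep y s {..<length gvs} (%i. fst (gvs ! i)) (%i. snd (gvs ! i))"
proof -
 have "fst (gvs ! i) : smooth_funs N & snd (gvs ! i) : \<Gamma> M A" if "i < length gvs" for i
  using assms nth_mem[OF that] unfolding represents_near_def by (cases "gvs ! i") auto
 thus ?thesis using assms unfolding represents_near_def rep_def sum_list_index by auto
qed

lemma rep_represents:
 assumes "rep y s I g v" obtains gvs where "represents_near N M f A y s gvs"
proof -
 obtain xs where xs: "set xs = I" "distinct xs" using finite_distinct_list[OF repD(1)[OF assms]] by metis
 have "represents_near N M f A y s (map (%i. (g i, v i)) xs)" using assms unfolding represents_near_def rep_def
  by (simp add: comp_def sum_list_distinct_conv_sum_set[OF xs(2)] xs(1))
 thus ?thesis using that by blast
qed

text \<open>Independence in the left argument and antisymmetry of \<open>bval\<close> give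
  independence in both, which makes the definite description in \<open>pullback_bracket\<close>
  meaningful.\<close>

lemma bracket_value:
 assumes s: "rep y (fst o s) I g v" "s y : fibre P y" and t: "rep y (fst o t) J h w" "t y : fibre P y"
 shows "fst (bracket P s t y) = bval y I g v (snd (s y)) J h w (snd (t y))"
proof -
 have a: "snd (s y) : tangent_space N y" "anchor A (f y) ((fst o s) y) = pushforward M f (snd (s y))"
  "snd (t y) : tangent_space N y" "anchor A (f y) ((fst o t) y) = pushforward M f (snd (t y))"
  using s(2) t(2) unfolding P_fibre by auto
 define Z where "Z gvs hws = (\<Sum>(g, v)\<leftarrow>gvs. \<Sum>(h, w)\<leftarrow>hws. (g y * h y) *R bracket A v w (f y))
      + (\<Sum>(h, w)\<leftarrow>hws. snd (s y) h *R w (f y)) - (\<Sum>(g, v)\<leftarrow>gvs. snd (t y) g *R v (f y))" for gvs hws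
 have Z: "Z gvs hws = bval y I g v (snd (s y)) J h w (snd (t y))"
  if 1: "represents_near N M f A y (fst o s) gvs" and 2: "represents_near N M f A y (fst o t) hws" for gvs hws
 proof -
  note 1 = represents_rep[OF 1] and 2 = represents_rep[OF 2]
  let ?I = "{..<length gvs}" and ?g = "%i. fst (gvs ! i)" and ?v = "%i. snd (gvs ! i)"
  let ?J = "{..<length hws}" and ?h = "%i. fst (hws ! i)" and ?w = "%i. snd (hws ! i)"
  have "Z gvs hws = bval y ?I ?g ?v (snd (s y)) ?J ?h ?w (snd (t y))" unfolding Z_def bval_def sum_list_index ..
  also have "... = bval y I g v (snd (s y)) ?J ?h ?w (snd (t y))" by (rule bval_left[OF 1 s(1) 2 a(3,4)])
  also have "... = - bval y ?J ?h ?w (snd (t y)) I g v (snd (s y))" by (rule bval_antisym[OF repD(3)[OF s(1)] repD(3)[OF 2]])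
  also have "... = - bval y J h w (snd (t y)) I g v (snd (s y))" using bval_left[OF 2 t(1) s(1) a(1,2)] by simp
  also have "... = bval y I g v (snd (s y)) J h w (snd (t y))"
   by (rule bval_antisym[OF repD(3)[OF s(1)] repD(3)[OF t(1)], symmetric])
  finally show ?thesis .
 qed
 obtain gvs where gvs: "represents_near N M f A y (fst o s) gvs" using rep_represents[OF s(1)] .
 obtain hws where hws: "represents_near N M f A y (fst o t) hws" using rep_represents[OF t(1)] .
 have "fst (bracket P s t y) = (THE z. EX gvs hws. represents_near N M f A y (fst o s) gvs &
    represents_near N M f A y (fst o t) hws & z = Z gvs hws)" unfolding P_simps pullback_bracket_def Z_def by simp
 also have "... = bval y I g v (snd (s y)) J h w (snd (t y))" by (rule the_equality) (use Z gvs hws in metis)+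
 finally show ?thesis .
qed

lemma snd_bracket: "snd (bracket P s t y) = vector_field_bracket N (snd o s) (snd o t) y"
 by (simp add: P_simps pullback_bracket_def)

lemma P_section_fibre: "s : \<Gamma> N P ==> s y : fibre P y" using P.sections_fibre by blast

lemma P_section_field: "s : \<Gamma> N P ==> snd o s : vector_fields N UNIV"
 unfolding P_sections_iff[OF open_UNIV] psmooth_def by blast

lemma P_section_pb: "s : \<Gamma> N P ==> fst o s : \<Gamma> N PB" unfolding P_sections_iff[OF open_UNIV] psmooth_def by blast

lemma P_tangent: "s : \<Gamma> N P ==> snd (s y) : tangent_space N y" using P_section_fibre unfolding P_fibre by blast

lemma P_field_funs: "s : \<Gamma> N P ==> g : smooth_funs N ==> (%x. snd (s x) g) : smooth_funs N"
 using N.field_funs[OF P_section_field] by (simp add: comp_def)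

lemma P_anchor:
 "s : \<Gamma> N P ==> g : smooth_funs M ==> snd (s y) (%x. g (f x)) = anchor A (f y) (fst (s y)) g"
 using P_section_fibre[of s y] pushforward_apply unfolding P_fibre by metis

lemma P_rep:
 assumes W: "framed W es" "f y : W" and s: "s : \<Gamma> N P"
 obtains c where "rep y (fst o s) {..<length es} c (%k. es ! k)"
proof -
 obtain c Y where c: "!!i. i < length es ==> c i : smooth_funs N" "open Y" "y : Y" "Y <= UNIV" "f ` Y <= W"
  "!!x. x : Y ==> (fst o s) x = (SUM i<length es. c i x *R (es ! i) (f x))"
  by (rule pb_rep[OF W open_UNIV UNIV_I P_section_pb[OF s]]) (rule that)
 have "rep y (fst o s) {..<length es} c (%k. es ! k)"
  unfolding rep_def using c(1,2,3,6) framedD(2)[OF W(1)] nth_mem by blast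
 thus ?thesis using that by blast
qed

text \<open>The iterated derivative of a function pulled back from \<open>M\<close>; its
  antisymmetric part is what \<open>bracket_anchor\<close> compares with the anchor of the
  bracket.\<close>

lemma vector_derivative_along:
 assumes s: "s : \<Gamma> N P" "rep y (fst o s) I g v" and t: "t : \<Gamma> N P" "rep y (fst o t) J h w" and k: "k : smooth_funs M"
 shows "snd (s y) (%x. snd (t x) (%z. k (f z))) =
  (SUM i:I. SUM j:J. g i y * h j y * arho A (v i) (arho A (w j) k) (f y)) + (SUM j:J. snd (s y) (h j) * arho A (w j) k (f y))"
proof -
 note X = P_tangent[OF s(1), of y]
 obtain U where U: "open U" "y : U" "!!x. x : U ==> rep x (fst o t) J h w" using rep_open[OF t(2)] by metis
 have G: "arho A (w j) k : smooth_funs M" if "j : J" for j using arho_smooth[OF repD(3)[OF t(2) that] k] .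
 have hG: "(%x. h j x * arho A (w j) k (f x)) : smooth_funs N" if "j : J" for j
  using N.smooth_funs_closed(3)[OF repD(2)[OF t(2) that] f_funs[OF G[OF that]]] .
 have "snd (s y) (%x. snd (t x) (%z. k (f z))) = snd (s y) (%x. SUM j:J. h j x * arho A (w j) k (f x))"
 proof (rule N.tangent_local[OF X P_field_funs[OF t(1) f_funs[OF k]] _ U(1,2)])
  show "(%x. SUM j:J. h j x * arho A (w j) k (f x)) : smooth_funs N" by (rule N.smooth_funs_closed(6)) (use hG in blast)
  show "snd (t x) (%z. k (f z)) = (SUM j:J. h j x * arho A (w j) k (f x))" if "x : U" for x
   using P_anchor[OF t(1) k, of x] rep_anchor[OF U(3)[OF that], of k] by (simp add: arho_def)
 qed
 also have "... = (SUM j:J. h j y * snd (s y) (%x. arho A (w j) k (f x)) + arho A (w j) k (f y) * snd (s y) (h j))"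
 proof -
  have "snd (s y) (%x. h j x * arho A (w j) k (f x)) =
    h j y * snd (s y) (%x. arho A (w j) k (f x)) + arho A (w j) k (f y) * snd (s y) (h j)" if "j : J" for j
   by (rule N.tangent_mult[OF X repD(2)[OF t(2) that] f_funs[OF G[OF that]]])
  thus ?thesis using N.tangent_sum_fun[OF X, of J "%j x. h j x * arho A (w j) k (f x)"] hG by simp
 qed
 also have "... = (SUM j:J. h j y * (SUM i:I. g i y * arho A (v i) (arho A (w j) k) (f y)) + snd (s y) (h j) * arho A (w j) k (f y))"
 proof (intro sum.cong refl)
  show "h j y * snd (s y) (%x. arho A (w j) k (f x)) + arho A (w j) k (f y) * snd (s y) (h j) =
    h j y * (SUM i:I. g i y * arho A (v i) (arho A (w j) k) (f y)) + snd (s y) (h j) * arho A (w j) k (f y)" if "j : J" for j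
   using P_anchor[OF s(1) G[OF that], of y] rep_anchor[OF s(2), of "arho A (w j) k"]
   by (simp add: arho_def[of A "v _"] mult.commute)
 qed
 also have "... = (SUM i:I. SUM j:J. g i y * h j y * arho A (v i) (arho A (w j) k) (f y)) + (SUM j:J. snd (s y) (h j) * arho A (w j) k (f y))"
  unfolding sum.distrib sum_distrib_left by (subst sum.swap) (simp add: mult_ac)
 finally show ?thesis .
qed

text \<open>Both tangent vectors are tested on functions \<open>k\<close> on \<open>M\<close>. On
  the side of \<open>A\<close>, \<open>arho_bracket\<close> yields a commutator of second
  derivatives; on the side of \<open>N\<close> it comes from \<open>vector_derivative_along\<close>
  in both orders.\<close>

lemma bracket_anchor:
 assumes s: "s : \<Gamma> N P" and t: "t : \<Gamma> N P"
 shows "bracket P s t y : fibre P y"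
proof -
 obtain W es where W: "f y : W" "framed W es" using global_frame by metis
 obtain c where c: "rep y (fst o s) {..<length es} c (%k. es ! k)" using P_rep[OF W(2,1) s] by metis
 obtain d where d: "rep y (fst o t) {..<length es} d (%k. es ! k)" using P_rep[OF W(2,1) t] by metis
 define n where "n = length es"
 note c = c[folded n_def] and d = d[folded n_def]
 have es: "es ! k : \<Gamma> M A" if "k < n" for k using repD(3)[OF c, of k] that by simp
 let ?X = "snd (s y)" and ?Y = "snd (t y)"
 have val: "fst (bracket P s t y) = (SUM i<n. SUM j<n. (c i y * d j y) *R bracket A (es ! i) (es ! j) (f y))
   + (SUM j<n. ?X (d j) *R (es ! j) (f y)) - (SUM i<n. ?Y (c i) *R (es ! i) (f y))"
  using bracket_value[OF c P_section_fibre[OF s] d P_section_fibre[OF t]] unfolding bval_def .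
 have f1: "(SUM j<n. (c i y * d j y) *R bracket A (es ! i) (es ! j) (f y)) : fibre A (f y)" if "i < n" for i
  using sections_fibre[OF bracket_closed UNIV_I] es that
  by (intro subspace_sum[OF fibre_subspace] subspace_scale[OF fibre_subspace]) auto
 have f1': "(SUM i<n. SUM j<n. (c i y * d j y) *R bracket A (es ! i) (es ! j) (f y)) : fibre A (f y)"
  by (rule subspace_sum[OF fibre_subspace]) (use f1 in auto)
 have f2: "(SUM j<n. r j *R (es ! j) (f y)) : fibre A (f y)" for r using sections_fibre[OF es UNIV_I]
  by (intro subspace_sum[OF fibre_subspace] subspace_scale[OF fibre_subspace]) auto
 have fib: "fst (bracket P s t y) : fibre A (f y)"
  unfolding val using f1' f2 by (intro subspace_diff[OF fibre_subspace] subspace_add[OF fibre_subspace])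
 have tan: "snd (bracket P s t y) : tangent_space N y"
  unfolding snd_bracket using N.field_tangent[OF N.bracket_field[OF P_section_field[OF s] P_section_field[OF t]]] .
 have "anchor A (f y) (fst (bracket P s t y)) = pushforward M f (snd (bracket P s t y))"
 proof (rule tangent_eqI[OF anchor_tangent[OF fib] pushforward_tangent[OF tan]])
  fix k assume k: "k : smooth_funs M"
  have a2: "anchor A (f y) (SUM j<n. r j *R (es ! j) (f y)) k = (SUM j<n. r j * arho A (es ! j) k (f y))" for r
   unfolding arho_def by (rule anchor_sum) (use sections_fibre[OF es UNIV_I] in auto)
  have "anchor A (f y) (SUM i<n. SUM j<n. (c i y * d j y) *R bracket A (es ! i) (es ! j) (f y)) k =
    anchor A (f y) (SUM i<n. 1 *R (SUM j<n. (c i y * d j y) *R bracket A (es ! i) (es ! j) (f y))) k" by simp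
  also have "... = (SUM i<n. 1 * anchor A (f y) (SUM j<n. (c i y * d j y) *R bracket A (es ! i) (es ! j) (f y)) k)"
   by (rule anchor_sum) (use f1 in auto)
  also have "... = (SUM i<n. SUM j<n. c i y * d j y * arho A (bracket A (es ! i) (es ! j)) k (f y))" unfolding mult_1 arho_def
   by (intro sum.cong refl anchor_sum) (use sections_fibre[OF bracket_closed UNIV_I] es in auto)
  also have "... = (SUM i<n. SUM j<n. c i y * d j y * arho A (es ! i) (arho A (es ! j) k) (f y)) -
    (SUM i<n. SUM j<n. c i y * d j y * arho A (es ! j) (arho A (es ! i) k) (f y))" proof -
   have "arho A (bracket A (es ! i) (es ! j)) k (f y) =
     arho A (es ! i) (arho A (es ! j) k) (f y) - arho A (es ! j) (arho A (es ! i) k) (f y)" if "i < n" "j < n" for i j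
    using arho_bracket[OF es[OF that(1)] es[OF that(2)] k] by simp
   thus ?thesis by (simp add: right_diff_distrib sum_subtractf)
  qed
  finally have a1: "anchor A (f y) (SUM i<n. SUM j<n. (c i y * d j y) *R bracket A (es ! i) (es ! j) (f y)) k =
    (SUM i<n. SUM j<n. c i y * d j y * arho A (es ! i) (arho A (es ! j) k) (f y)) -
    (SUM i<n. SUM j<n. c i y * d j y * arho A (es ! j) (arho A (es ! i) k) (f y))" .
  have sub: "anchor A (f y) (a - b) k = anchor A (f y) a k - anchor A (f y) b k"
   if "a : fibre A (f y)" "b : fibre A (f y)" for a b using anchor_lin[OF that, of 1 "-1"] by (simp add: scaleR_fun_def)
  have "anchor A (f y) (fst (bracket P s t y)) k =
    (SUM i<n. SUM j<n. c i y * d j y * arho A (es ! i) (arho A (es ! j) k) (f y)) -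
    (SUM i<n. SUM j<n. c i y * d j y * arho A (es ! j) (arho A (es ! i) k) (f y)) +
    (SUM j<n. ?X (d j) * arho A (es ! j) k (f y)) - (SUM i<n. ?Y (c i) * arho A (es ! i) k (f y))"
   unfolding val sub[OF subspace_add[OF fibre_subspace f1' f2] f2] anchor_add[OF f1' f2] a1 a2 by simp
  moreover have "(SUM i<n. SUM j<n. c i y * d j y * arho A (es ! j) (arho A (es ! i) k) (f y)) =
    (SUM j<n. SUM i<n. d j y * c i y * arho A (es ! j) (arho A (es ! i) k) (f y))" by (subst sum.swap) (simp only: mult_ac)
  ultimately show "anchor A (f y) (fst (bracket P s t y)) k = pushforward M f (snd (bracket P s t y)) k"
   unfolding pushforward_apply[OF k] snd_bracket N.bracket_field_apply[OF f_funs[OF k]]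
   using vector_derivative_along[OF s c t d k] vector_derivative_along[OF t d s c k] by (simp add: comp_def)
 qed
 thus ?thesis unfolding P_fibre using fib tan by blast
qed

lemma sum_Plus_prod:
 "finite I ==> finite J ==> finite K ==> (SUM x:I \<times> J <+> K. F x) = (SUM i:I. SUM j:J. F (Inl (i, j))) + (SUM k:K. F (Inr k))"
 by (simp add: sum.Plus sum.cartesian_product split_beta comp_def)

text \<open>With pairs and single indices as index set, the bracket of represented sections is
  represented again, which allows nested brackets to be evaluated.\<close>

lemma bracket_rep:
 fixes n :: nat
 assumes s: "s : \<Gamma> N P" "rep y (fst o s) {..<n} c e" and t: "t : \<Gamma> N P" "rep y (fst o t) {..<n} d e"
 shows "rep y (fst o bracket P s t) ({..<n} \<times> {..<n} <+> {..<n})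
  (case_sum (%(i, j) x. c i x * d j x) (%k x. snd (s x) (d k) - snd (t x) (c k)))
  (case_sum (%(i, j). bracket A (e i) (e j)) e)" proof -
 obtain U where U: "open U" "y : U" "!!x. x : U ==> rep x (fst o s) {..<n} c e" using rep_open[OF s(2)] by metis
 obtain U' where U': "open U'" "y : U'" "!!x. x : U' ==> rep x (fst o t) {..<n} d e" using rep_open[OF t(2)] by metis
 have e: "e i : \<Gamma> M A" "c i : smooth_funs N" "d i : smooth_funs N" if "i < n" for i
  using repD(2,3)[OF s(2)] repD(2)[OF t(2)] that by auto
 have o: "open (U Int U')" "y : U Int U'" using U U' by auto
 have eq: "(fst o bracket P s t) x = (SUM i:{..<n} \<times> {..<n} <+> {..<n}.
   case_sum (%(i, j) x. c i x * d j x) (%k x. snd (s x) (d k) - snd (t x) (c k)) i x *R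
   case_sum (%(i, j). bracket A (e i) (e j)) e i (f x))" if "x : U Int U'" for x
  using bracket_value[OF U(3) P_section_fibre[OF s(1)] U'(3) P_section_fibre[OF t(1)]] that
  by (subst sum_Plus_prod) (simp_all add: bval_def scaleR_diff_left sum_subtractf)
 have smooth: "case_sum (%(i, j) x. c i x * d j x) (%k x. snd (s x) (d k) - snd (t x) (c k)) i : smooth_funs N &
   case_sum (%(i, j). bracket A (e i) (e j)) e i : \<Gamma> M A" if "i : {..<n} \<times> {..<n} <+> {..<n}" for i
  using that e by (auto simp: bracket_closed intro!: N.smooth_funs_closed P_field_funs s t)
 show ?thesis unfolding rep_def
 proof (intro conjI ballI exI)
  show "finite ({..<n} \<times> {..<n} <+> {..<n})" by simp
 qed (use smooth eq o in blast)+
qed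

lemma rep_section:
 assumes "open U" "!!y. y : U ==> EX I g v. rep y s (I :: (nat \<times> nat + nat) set) g v" shows "s : sections N PB U"
proof (rule PB.sections_localI[OF assms(1)])
 fix y assume "y : U"
 then obtain I :: "(nat \<times> nat + nat) set" and g v where r: "rep y s I g v" using assms(2) by blast
 obtain W where W: "open W" "y : W" "!!x. x : W ==> rep x s I g v" using rep_open[OF r] by metis
 have "(%x. SUM i:I. g i x *R (v i o f) x) : sections N PB W"
 proof (rule PB.sections_sum[OF W(1)], rule PB.sections_smul[OF W(1)])
  show "smooth_at N (g i) x" if "i : I" for i x using N.smooth_funsD[OF repD(2)[OF r that]] .
  show "v i o f : sections N PB W" if "i : I" for i
   by (rule PB.sections_mono[OF pb_global[OF repD(3)[OF r that]] open_UNIV W(1)]) simp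
 qed
 hence "s : sections N PB W" by (rule PB.sections_cong) (use repD(4)[OF W(3)] in simp)
 thus "EX W. open W & y : W & s : sections N PB W" using W by blast
qed

lemma bracket_P_closed:
 assumes s: "s : \<Gamma> N P" and t: "t : \<Gamma> N P"
 shows "bracket P s t : \<Gamma> N P"
proof (rule P_sectionsI[OF open_UNIV])
 show "bracket P s t y : fibre P y" for y using bracket_anchor[OF s t] .
 have "fst o bracket P s t : \<Gamma> N PB"
 proof (rule rep_section[OF open_UNIV])
  fix y
  obtain W es where W: "f y : W" "framed W es" using global_frame by metis
  obtain c where c: "rep y (fst o s) {..<length es} c (%k. es ! k)" using P_rep[OF W(2,1) s] by metis
  obtain d where d: "rep y (fst o t) {..<length es} d (%k. es ! k)" using P_rep[OF W(2,1) t] by metis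
  show "EX I g v. rep y (fst o bracket P s t) (I :: (nat \<times> nat + nat) set) g v" using bracket_rep[OF s c t d] by blast
 qed
 moreover have "snd o bracket P s t = vector_field_bracket N (snd o s) (snd o t)" by (simp add: fun_eq_iff snd_bracket)
 ultimately show "psmooth UNIV (bracket P s t)"
  unfolding psmooth_def using N.bracket_field[OF P_section_field[OF s] P_section_field[OF t]] by simp
qed

text \<open>
 With respect to a frame \<open>e\<close> of \<open>A\<close> pulled back along \<open>f\<close>, the brackets of \<open>P\<close> are expressed by the following
 multilinear functions of the coefficients.
\<close>

definition C1 :: "'n => nat => (nat => 'm => 'v) => (nat => real) => 'v" where
 "C1 y n e a = (SUM i<n. a i *R e i (f y))"

definition C2 :: "'n => nat => (nat => 'm => 'v) => (nat => real) => (nat => real) => 'v" where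
 "C2 y n e a b = (SUM i<n. SUM j<n. (a i * b j) *R bracket A (e i) (e j) (f y))"

definition C3 :: "'n => nat => (nat => 'm => 'v) => (nat => real) => (nat => real) => (nat => real) => 'v" where
 "C3 y n e a b c = (SUM i<n. SUM j<n. SUM k<n. (a i * b j * c k) *R bracket A (e i) (bracket A (e j) (e k)) (f y))"

lemma C1_simps:
 "C1 y n e (%i. a i + b i) = C1 y n e a + C1 y n e b" "C1 y n e (%i. a i - b i) = C1 y n e a - C1 y n e b"
 "C1 y n e (%i. r * a i) = r *R C1 y n e a"
 by (simp_all add: C1_def scaleR_add_left scaleR_diff_left sum.distrib sum_subtractf scaleR_sum_right)

lemma C2_simps:
 "C2 y n e (%i. a i + b i) c = C2 y n e a c + C2 y n e b c" "C2 y n e (%i. r * a i) c = r *R C2 y n e a c"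
 "C2 y n e c (%i. a i - b i) = C2 y n e c a - C2 y n e c b" "C2 y n e c (%i. r * a i) = r *R C2 y n e c a"
 by (simp_all add: C2_def scaleR_add_left scaleR_diff_left sum.distrib sum_subtractf scaleR_sum_right algebra_simps)

lemma C_cong:
 "(!!i. i < n ==> a i = a' i) ==> C1 y n e a = C1 y n e a'"
 "(!!i. i < n ==> a i = a' i) ==> (!!i. i < n ==> b i = b' i) ==> C2 y n e a b = C2 y n e a' b'" by (simp_all add: C1_def C2_def)

lemma C2_antisym:
 assumes "!!i. i < n ==> e i : \<Gamma> M A"
 shows "C2 y n e a b = - C2 y n e b a"
proof -
 have "(a i * b j) *R bracket A (e i) (e j) (f y) = - ((a i * b j) *R bracket A (e j) (e i) (f y))"
  if "i < n" "j < n" for i j by (subst bracket_antisym[OF assms[OF that(1)] assms[OF that(2)]]) simp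
 hence "C2 y n e a b = (SUM i<n. SUM j<n. - ((a i * b j) *R bracket A (e j) (e i) (f y)))"
  unfolding C2_def by (intro sum.cong refl) simp
 also have "... = - C2 y n e b a" unfolding C2_def by (subst sum.swap) (simp add: sum_negf mult.commute)
 finally show ?thesis .
qed

lemma C3_jacobi:
 assumes "!!i. i < n ==> e i : \<Gamma> M A"
 shows "C3 y n e a b c + C3 y n e b c a + C3 y n e c a b = 0"
proof -
 let ?b = "%i j k. bracket A (e i) (bracket A (e j) (e k)) (f y)"
 have J: "?b i j k + ?b j k i + ?b k i j = 0" if "i < n" "j < n" "k < n" for i j k
  using fun_cong[OF bracket_jacobi[OF assms[OF that(1)] assms[OF that(2)] assms[OF that(3)]], of "f y"] by simp
 have 2: "C3 y n e b c a = (SUM i<n. SUM j<n. SUM k<n. (a i * b j * c k) *R ?b j k i)"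
 proof -
  have "C3 y n e b c a = (SUM j<n. SUM i<n. SUM k<n. (b j * c k * a i) *R ?b j k i)"
   unfolding C3_def by (intro sum.cong refl sum.swap)
  also have "... = (SUM i<n. SUM j<n. SUM k<n. (b j * c k * a i) *R ?b j k i)" by (rule sum.swap)
  finally show ?thesis by (simp add: mult_ac)
 qed
 have 3: "C3 y n e c a b = (SUM i<n. SUM j<n. SUM k<n. (a i * b j * c k) *R ?b k i j)"
 proof -
  have "C3 y n e c a b = (SUM i<n. SUM k<n. SUM j<n. (c k * a i * b j) *R ?b k i j)" unfolding C3_def by (rule sum.swap)
  also have "... = (SUM i<n. SUM j<n. SUM k<n. (c k * a i * b j) *R ?b k i j)" by (intro sum.cong refl sum.swap)
  finally show ?thesis by (simp add: mult_ac)
 qed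
 have "(SUM i<n. SUM j<n. SUM k<n. (a i * b j * c k) *R (?b i j k + ?b j k i + ?b k i j)) = 0"
  by (intro sum.neutral ballI) (use J in simp)
 thus ?thesis unfolding 2 3 unfolding C3_def by (simp only: scaleR_add_right sum.distrib)
qed

text \<open>One frame \<open>e\<close> near \<open>y\<close> represents all sections at once, so
  that identities between several sections reduce to their coefficient families.\<close>

definition frep :: "'n => nat => (nat => 'm => 'v) => ('n => 'v \<times> 'n tangent) => (nat => 'n => real) => bool" where
 "frep y n e s c \<longleftrightarrow> s : \<Gamma> N P & rep y (fst o s) {..<n} c e"

lemma frame_rep:
 obtains n e where "!!s. s : \<Gamma> N P ==> EX c. frep y n e s c" "!!i. i < n ==> e i : \<Gamma> M A"
proof -
 obtain W es where W: "f y : W" "framed W es" using global_frame by metis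
 have "EX c. frep y (length es) (%k. es ! k) s c" if "s : \<Gamma> N P" for s
  using P_rep[OF W(2,1) that] that unfolding frep_def by metis
 moreover have "es ! i : \<Gamma> M A" if "i < length es" for i using framedD(2)[OF W(2)] that by auto
 ultimately show ?thesis using that by blast
qed

lemma frep_value:
 assumes "frep y n e s c" "frep y n e t d"
 shows "fst (bracket P s t y) = C2 y n e (%i. c i y) (%i. d i y) + C1 y n e (%i. snd (s y) (d i)) - C1 y n e (%i. snd (t y) (c i))"
proof -
 have s: "s : \<Gamma> N P" "rep y (fst o s) {..<n} c e" and t: "t : \<Gamma> N P" "rep y (fst o t) {..<n} d e"
  using assms unfolding frep_def by auto
 show ?thesis using bracket_value[OF s(2) P_section_fibre[OF s(1)] t(2) P_section_fibre[OF t(1)]]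
  unfolding bval_def C1_def C2_def .
qed

lemma frepD: assumes "frep y n e s c" shows "s : \<Gamma> N P" "i < n ==> c i : smooth_funs N" "snd (s z) : tangent_space N z"
proof -
 show 1: "s : \<Gamma> N P" using assms unfolding frep_def by blast
 show "c i : smooth_funs N" if "i < n" using repD(2)[of y "fst o s" "{..<n}" c e i] assms that unfolding frep_def by simp
 show "snd (s z) : tangent_space N z" using P_tangent[OF 1] .
qed

text \<open>Sorted by the number of brackets of frame members that survive, two in
  \<open>C3\<close>, one in \<open>C2\<close> and none in \<open>C1\<close>, so that each kind can
  be cancelled separately in the Jacobi identity.\<close>

lemma frep_bracket_bracket:
 assumes s: "frep y n e s a" and t: "frep y n e t b" and r: "frep y n e r c"
 shows "fst (bracket P s (bracket P t r) y) = C3 y n e (%i. a i y) (%i. b i y) (%i. c i y) +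
  (C2 y n e (%i. a i y) (%i. snd (t y) (c i)) - C2 y n e (%i. a i y) (%i. snd (r y) (b i))) +
  (C2 y n e (%i. b i y) (%i. snd (s y) (c i)) + C2 y n e (%i. snd (s y) (b i)) (%i. c i y)) +
  (C1 y n e (%i. snd (s y) (%x. snd (t x) (c i))) - C1 y n e (%i. snd (s y) (%x. snd (r x) (b i)))) -
  (C1 y n e (%i. snd (t y) (%x. snd (r x) (a i))) - C1 y n e (%i. snd (r y) (%x. snd (t x) (a i))))" proof -
 note sD = frepD[OF s] and tD = frepD[OF t] and rD = frepD[OF r]
 note tr = bracket_P_closed[OF tD(1) rD(1)]
 have rs: "rep y (fst o s) {..<n} a e" "rep y (fst o t) {..<n} b e" "rep y (fst o r) {..<n} c e"
  using s t r unfolding frep_def by auto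
 let ?X = "snd (s y)" and ?Y = "snd (t y)" and ?Z = "snd (r y)"
 have d1: "?X (%x. b j x * c k x) = b j y * ?X (c k) + ?X (b j) * c k y" if "j < n" "k < n" for j k
  using N.tangent_mult[OF sD(3) tD(2)[OF that(1)] rD(2)[OF that(2)]] by simp
 have d2: "?X (%x. snd (t x) (c k) - snd (r x) (b k)) = ?X (%x. snd (t x) (c k)) - ?X (%x. snd (r x) (b k))" if "k < n" for k
  by (rule N.tangent_diff[OF sD(3) P_field_funs[OF tD(1) rD(2)[OF that]] P_field_funs[OF rD(1) tD(2)[OF that]]])
 have d3: "snd (bracket P t r y) (a i) = ?Y (%x. snd (r x) (a i)) - ?Z (%x. snd (t x) (a i))" if "i < n" for i
  using N.bracket_field_apply[OF sD(2)[OF that]] by (simp add: snd_bracket comp_def)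
 have "fst (bracket P s (bracket P t r) y) =
   (SUM i<n. (SUM j<n. SUM k<n. (a i y * (b j y * c k y)) *R bracket A (e i) (bracket A (e j) (e k)) (f y)) +
    (SUM k<n. (a i y * (?Y (c k) - ?Z (b k))) *R bracket A (e i) (e k) (f y))) +
   ((SUM j<n. SUM k<n. ?X (%x. b j x * c k x) *R bracket A (e j) (e k) (f y)) +
    (SUM k<n. ?X (%x. snd (t x) (c k) - snd (r x) (b k)) *R e k (f y))) -
   (SUM i<n. snd (bracket P t r y) (a i) *R e i (f y))"
  unfolding bracket_value[OF rs(1) P_section_fibre[OF sD(1)] bracket_rep[OF tD(1) rs(2) rD(1) rs(3)] P_section_fibre[OF tr]] bval_def
  by (simp add: sum_Plus_prod)
 also have "... = (SUM i<n. (SUM j<n. SUM k<n. (a i y * (b j y * c k y)) *R bracket A (e i) (bracket A (e j) (e k)) (f y)) +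
    (SUM k<n. (a i y * (?Y (c k) - ?Z (b k))) *R bracket A (e i) (e k) (f y))) +
   (SUM j<n. SUM k<n. (b j y * ?X (c k) + ?X (b j) * c k y) *R bracket A (e j) (e k) (f y)) +
    (SUM k<n. (?X (%x. snd (t x) (c k)) - ?X (%x. snd (r x) (b k))) *R e k (f y)) -
   (SUM i<n. (?Y (%x. snd (r x) (a i)) - ?Z (%x. snd (t x) (a i))) *R e i (f y))" using d1 d2 d3 by (simp add: add.assoc)
 finally show ?thesis unfolding C1_def C2_def C3_def
  by (simp only: scaleR_add_left scaleR_diff_left sum.distrib sum_subtractf right_diff_distrib mult.assoc)
qed

section \<open>The algebroid axioms for the pullback\<close>

lemma P_section_lin:
 assumes "s : \<Gamma> N P" "t : \<Gamma> N P" shows "a *R s + b *R t : \<Gamma> N P"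
proof -
 have "(%y. a *R s y + b *R t y) : \<Gamma> N P" by (intro P.sections_add P.sections_smul open_UNIV assms N.smooth_at_const)
 thus ?thesis by (simp add: plus_fun_def scaleR_fun_def)
qed

lemma frep_lin:
 assumes s: "frep y n e s c" and t: "frep y n e t d"
 shows "frep y n e (a *R s + b *R t) (%i x. a * c i x + b * d i x)"
proof -
 note sD = frepD[OF s] and tD = frepD[OF t]
 have rs: "rep y (fst o s) {..<n} c e" "rep y (fst o t) {..<n} d e" using s t unfolding frep_def by auto
 obtain U where U: "open U" "y : U" "!!x. x : U ==> rep x (fst o s) {..<n} c e" using rep_open[OF rs(1)] by metis
 obtain U' where U': "open U'" "y : U'" "!!x. x : U' ==> rep x (fst o t) {..<n} d e" using rep_open[OF rs(2)] by metis
 have "(fst o (a *R s + b *R t)) x = (SUM i<n. (a * c i x + b * d i x) *R e i (f x))" if "x : U Int U'" for x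
  using repD(4)[OF U(3), of x] repD(4)[OF U'(3), of x] that
  by (simp add: scaleR_fun_def scaleR_add_left sum.distrib scaleR_sum_right)
 moreover have "(%x. a * c i x + b * d i x) : smooth_funs N" if "i < n" for i
  using sD(2)[OF that] tD(2)[OF that] by (intro N.smooth_funs_closed)
 moreover have "open (U Int U')" "y : U Int U'" using U U' by auto
 ultimately show ?thesis unfolding frep_def rep_def using P_section_lin[OF sD(1) tD(1)] repD(3)[OF rs(1)] by blast
qed

lemma P_section_smul:
 assumes "s : \<Gamma> N P" "g : smooth_funs N" shows "(%y. g y *R s y) : \<Gamma> N P"
 by (intro P.sections_smul open_UNIV assms N.smooth_funsD)

lemma frep_smul:
 assumes s: "frep y n e s c" and g: "g : smooth_funs N"
 shows "frep y n e (%x. g x *R s x) (%i x. g x * c i x)"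
proof -
 note sD = frepD[OF s]
 have rs: "rep y (fst o s) {..<n} c e" using s unfolding frep_def by auto
 obtain U where U: "open U" "y : U" "!!x. x : U ==> rep x (fst o s) {..<n} c e" using rep_open[OF rs(1)] by metis
 have "(fst o (%x. g x *R s x)) x = (SUM i<n. (g x * c i x) *R e i (f x))" if "x : U" for x
  using repD(4)[OF U(3), of x] that by (simp add: scaleR_sum_right)
 moreover have "(%x. g x * c i x) : smooth_funs N" if "i < n" for i using N.smooth_funs_closed(3)[OF g sD(2)[OF that]] .
 ultimately show ?thesis unfolding frep_def rep_def using P_section_smul[OF sD(1) g] repD(3)[OF rs(1)] U(1,2) by blast
qed

lemma bracket_P_lin:
 assumes s: "s : \<Gamma> N P" and t: "t : \<Gamma> N P" and r: "r : \<Gamma> N P"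
 shows "bracket P (a *R s + b *R t) r = a *R bracket P s r + b *R bracket P t r"
proof
 fix y
 obtain n e where ne: "!!s. s : \<Gamma> N P ==> EX c. frep y n e s c" "!!i. i < n ==> e i : \<Gamma> M A" using frame_rep by metis
 obtain c d h where c: "frep y n e s c" "frep y n e t d" "frep y n e r h" using ne(1) s t r by metis
 have X: "snd ((a *R s + b *R t) x) g = a * snd (s x) g + b * snd (t x) g" for g x by (simp add: scaleR_fun_def)
 have Y: "snd (r y) (%x. a * c i x + b * d i x) = a * snd (r y) (c i) + b * snd (r y) (d i)" if "i < n" for i
  by (rule N.tangent_lin[OF P_tangent[OF r] frepD(2)[OF c(1) that] frepD(2)[OF c(2) that]])
 have Y': "C1 y n e (%i. snd (r y) (%x. a * c i x + b * d i x)) =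
   C1 y n e (%i. a * snd (r y) (c i) + b * snd (r y) (d i))" by (rule C_cong(1)) (rule Y)
 have "fst (bracket P (a *R s + b *R t) r y) = fst ((a *R bracket P s r + b *R bracket P t r) y)"
  unfolding frep_value[OF frep_lin[OF c(1,2)] c(3)] X Y' C1_simps C2_simps
  by (simp add: frep_value[OF c(1,3)] frep_value[OF c(2,3)] scaleR_fun_def algebra_simps)
 moreover have "vector_field_bracket N (snd o (a *R s + b *R t)) (snd o r) y =
   (a *R vector_field_bracket N (snd o s) (snd o r) y + b *R vector_field_bracket N (snd o t) (snd o r) y)" proof fix g
  show "vector_field_bracket N (snd o (a *R s + b *R t)) (snd o r) y g =
   (a *R vector_field_bracket N (snd o s) (snd o r) y + b *R vector_field_bracket N (snd o t) (snd o r) y) g"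
  proof (cases "g : smooth_funs N")
   case True
   show ?thesis using N.tangent_lin[OF P_tangent[OF r, of y] P_field_funs[OF s True] P_field_funs[OF t True], of a b]
    by (simp add: N.bracket_field_apply[OF True] comp_def X scaleR_fun_def algebra_simps)
  qed (simp add: vector_field_bracket_def scaleR_fun_def)
 qed
 ultimately show "bracket P (a *R s + b *R t) r y = (a *R bracket P s r + b *R bracket P t r) y"
  by (intro prod_eqI) (simp_all add: snd_bracket scaleR_fun_def)
qed

lemma bracket_P_antisym:
 assumes s: "s : \<Gamma> N P" and t: "t : \<Gamma> N P"
 shows "bracket P s t = - bracket P t s"
proof
 fix y
 obtain n e where ne: "!!s. s : \<Gamma> N P ==> EX c. frep y n e s c" "!!i. i < n ==> e i : \<Gamma> M A" using frame_rep by metis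
 obtain c d where c: "frep y n e s c" "frep y n e t d" using ne(1) s t by metis
 have "fst (bracket P s t y) = fst ((- bracket P t s) y)"
  using frep_value[OF c] frep_value[OF c(2,1)] C2_antisym[OF ne(2), where y = y and a = "%i. c i y" and b = "%i. d i y"] by simp
 moreover have "vector_field_bracket N (snd o s) (snd o t) y = - vector_field_bracket N (snd o t) (snd o s) y"
  by (simp add: vector_field_bracket_def fun_eq_iff)
 ultimately show "bracket P s t y = (- bracket P t s) y" by (intro prod_eqI) (simp_all add: snd_bracket)
qed

lemma bracket_P_leibniz:
 assumes s: "s : \<Gamma> N P" and t: "t : \<Gamma> N P" and g: "g : smooth_funs N"
 shows "bracket P s (%y. g y *R t y) = (%y. g y *R bracket P s t y + snd (s y) g *R t y)"
proof
 fix y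
 obtain n e where ne: "!!s. s : \<Gamma> N P ==> EX c. frep y n e s c" "!!i. i < n ==> e i : \<Gamma> M A" using frame_rep by metis
 obtain c d where c: "frep y n e s c" "frep y n e t d" using ne(1) s t by metis
 have t1: "fst (t y) = C1 y n e (%i. d i y)"
  using c(2) repD(4)[of y "fst o t" "{..<n}" d e] unfolding frep_def C1_def by simp
 have X: "snd (s y) (%x. g x * d i x) = g y * snd (s y) (d i) + snd (s y) g * d i y" if "i < n" for i
  using N.tangent_mult[OF P_tangent[OF s] g frepD(2)[OF c(2) that], of y] by simp
 have X': "C1 y n e (%i. snd (s y) (%x. g x * d i x)) =
   C1 y n e (%i. g y * snd (s y) (d i) + snd (s y) g * d i y)" by (rule C_cong(1)) (rule X)
 have Y: "snd (g y *R t y) h = g y * snd (t y) h" for h y by (simp add: scaleR_fun_def)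
 have "fst (bracket P s (%y. g y *R t y) y) = fst (g y *R bracket P s t y + snd (s y) g *R t y)"
  unfolding frep_value[OF c(1) frep_smul[OF c(2) g]] Y X' C1_simps C2_simps
  by (simp add: frep_value[OF c] t1 C1_simps algebra_simps)
 moreover have "vector_field_bracket N (snd o s) (snd o (%y. g y *R t y)) y =
   g y *R vector_field_bracket N (snd o s) (snd o t) y + snd (s y) g *R snd (t y)" proof fix h
  show "vector_field_bracket N (snd o s) (snd o (%y. g y *R t y)) y h =
   (g y *R vector_field_bracket N (snd o s) (snd o t) y + snd (s y) g *R snd (t y)) h" proof (cases "h : smooth_funs N")
   case True
   show ?thesis using N.tangent_mult[OF P_tangent[OF s, of y] g P_field_funs[OF t True]]
    by (simp add: N.bracket_field_apply[OF True] comp_def scaleR_fun_def algebra_simps)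
  next
   case False
   thus ?thesis using N.tangent_nonsmooth[OF P_tangent[OF t]] by (simp add: vector_field_bracket_def scaleR_fun_def)
  qed
 qed
 ultimately show "bracket P s (%y. g y *R t y) y = g y *R bracket P s t y + snd (s y) g *R t y"
  by (intro prod_eqI) (simp_all add: snd_bracket)
qed

text \<open>In the first component the cubic terms cancel by the Jacobi identity of
  \<open>A\<close>, the quadratic ones by antisymmetry, and the second derivatives of the
  coefficients pairwise in the cyclic sum. The second component is the Jacobi identity for vector
  fields.\<close>

lemma bracket_P_jacobi:
 assumes s: "s : \<Gamma> N P" and t: "t : \<Gamma> N P" and r: "r : \<Gamma> N P"
 shows "bracket P s (bracket P t r) + bracket P t (bracket P r s) + bracket P r (bracket P s t) = 0"
proof
 fix y
 obtain n e where ne: "!!s. s : \<Gamma> N P ==> EX c. frep y n e s c" "!!i. i < n ==> e i : \<Gamma> M A" using frame_rep by metis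
 obtain a b c where abc: "frep y n e s a" "frep y n e t b" "frep y n e r c" using ne(1) s t r by metis
 note anti = C2_antisym[OF ne(2)]
 have "fst (bracket P s (bracket P t r) y) + fst (bracket P t (bracket P r s) y) + fst (bracket P r (bracket P s t) y) = 0"
  unfolding frep_bracket_bracket[OF abc] frep_bracket_bracket[OF abc(2,3,1)] frep_bracket_bracket[OF abc(3,1,2)]
  using C3_jacobi[OF ne(2), where y = y and a = "%i. a i y" and b = "%i. b i y" and c = "%i. c i y"]
   anti[where y = y and a = "%i. a i y" and b = "%i. snd (t y) (c i)"] anti[where y = y and a = "%i. a i y" and b = "%i. snd (r y) (b i)"]
   anti[where y = y and a = "%i. b i y" and b = "%i. snd (s y) (c i)"] anti[where y = y and a = "%i. b i y" and b = "%i. snd (r y) (a i)"]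
   anti[where y = y and a = "%i. c i y" and b = "%i. snd (s y) (b i)"] anti[where y = y and a = "%i. c i y" and b = "%i. snd (t y) (a i)"]
  by (simp add: algebra_simps)
 moreover have "snd (bracket P s (bracket P t r) y) + snd (bracket P t (bracket P r s) y) + snd (bracket P r (bracket P s t) y) = 0"
 proof
  fix g
  show "(snd (bracket P s (bracket P t r) y) + snd (bracket P t (bracket P r s) y) + snd (bracket P r (bracket P s t) y)) g = 0 g"
  proof (cases "g : smooth_funs N")
   case True
   have d: "snd (u y) (%x. snd (v x) (%z. snd (w z) g) - snd (w x) (%z. snd (v z) g)) =
     snd (u y) (%x. snd (v x) (%z. snd (w z) g)) - snd (u y) (%x. snd (w x) (%z. snd (v z) g))"
    if "u : \<Gamma> N P" "v : \<Gamma> N P" "w : \<Gamma> N P" for u v w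
    by (rule N.tangent_diff[OF P_tangent[OF that(1)]]) (intro P_field_funs that True)+
   have b: "snd (bracket P u (bracket P v w) y) g =
     snd (u y) (%x. snd (v x) (%z. snd (w z) g)) - snd (u y) (%x. snd (w x) (%z. snd (v z) g)) -
     (snd (v y) (%x. snd (w x) (%z. snd (u z) g)) - snd (w y) (%x. snd (v x) (%z. snd (u z) g)))"
    if "u : \<Gamma> N P" "v : \<Gamma> N P" "w : \<Gamma> N P" for u v w
    using d[OF that] N.bracket_field_apply[OF P_field_funs[OF that(1) True]]
    by (simp add: snd_bracket N.bracket_field_apply[OF True] comp_def)
   show ?thesis by (simp add: b[OF s t r] b[OF t r s] b[OF r s t])
  qed (simp add: snd_bracket vector_field_bracket_def)
 qed
 ultimately show "(bracket P s (bracket P t r) + bracket P t (bracket P r s) + bracket P r (bracket P s t)) y = 0 y"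
  by (intro prod_eqI) (simp_all only: plus_fun_apply fst_add snd_add zero_fun_apply fst_zero snd_zero)
qed

lemma lie_algebroid_P: "lie_algebroid N P" unfolding lie_algebroid_def
proof (intro conjI ballI allI)
 show "vector_bundle N P" by (rule P.vbundle)
 show "anchor P y (a *R v + b *R w) = a *R anchor P y v + b *R anchor P y w" for y v w a b by (simp add: P_simps)
 show "(%y. anchor P y (s y)) : vector_fields N UNIV" if "s : \<Gamma> N P" for s
  using P_section_field[OF that] by (simp add: P_simps comp_def)
 show "bracket P v (%p. g p *R w p) = (%p. g p *R bracket P v w p + anchor P p (v p) g *R w p)"
  if "v : \<Gamma> N P" "w : \<Gamma> N P" "g : smooth_funs N" for v w g using bracket_P_leibniz[OF that] by (simp add: P_simps(2))
qed (fact bracket_P_closed bracket_P_lin bracket_P_antisym bracket_P_jacobi)+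

end

sublocale pullback \<subseteq> PA: algebroid N "pullback_algebroid N M f A" by standard (rule lie_algebroid_P)

section \<open>Pullback of forms\<close>

text \<open>The wedge product is computed pointwise, so an expansion of the second factor at the
  single point \<open>y\<close> is enough.\<close>

lemma lwedge_at_sum:
 fixes c :: "'j => real"
 shows "vs : lists L ==> (!!us. us : lists L ==> G us y = (SUM j:J. c j * H j us y)) ==>
  lwedge D G vs y = (SUM j:J. c j * lwedge D (H j) vs y)" proof (induction vs arbitrary: D G H) case Nil
 thus ?case by (simp add: sum_distrib_left mult_ac)
next
 case (Cons v vs)
 hence vs: "vs : lists L" "v : L" by auto
 have 1: "lwedge (contract v D) G vs y = (SUM j:J. c j * lwedge (contract v D) (H j) vs y)"
  by (rule Cons.IH[OF vs(1)]) (rule Cons.prems(2))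
 have 2: "lwedge (invol D) (contract v G) vs y = (SUM j:J. c j * lwedge (invol D) (contract v (H j)) vs y)"
  by (rule Cons.IH[OF vs(1)]) (use Cons.prems(2) vs in \<open>simp add: contract_apply\<close>)
 show ?case by (simp only: lwedge.simps plus_fun_apply 1 2 distrib_left sum.distrib)
qed

lemma lwedge_map:
 fixes F G :: "'k list => 'r::comm_ring_1"
 shows "lwedge F G (map h vs) = lwedge (%us. F (map h us)) (%us. G (map h us)) vs"
proof (induction vs arbitrary: F G)
 case (Cons v vs)
 have c: "(%us. contract (h v) F (map h us)) = contract v (%us. F (map h us))" for F :: "'k list => 'r"
  by (simp add: fun_eq_iff contract_apply)
 have i: "(%us. invol F (map h us)) = invol (%us. F (map h us))" by (simp add: fun_eq_iff invol_def)
 show ?case by (simp only: list.map lwedge.simps Cons.IH c i)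
qed simp

context lie_rinehart
begin

lemma valued_scale: "valued F ==> g : R ==> valued (%us. g * F us)" by (simp add: valued_def R_mult)

lemma valued_sum: "finite J ==> (!!j. j : J ==> valued (G j)) ==> (!!j. j : J ==> h j : R) ==> valued (%us. SUM j:J. h j * G j us)"
 by (induction J rule: finite_induct) (simp_all add: valued_def R_add R_mult R_const)

lemma llie_sum:
 assumes "finite J" "vs : lists L" "v : L" "!!j. j : J ==> valued (G j)" "!!j. j : J ==> h j : R"
 shows "llie v (%us. SUM j:J. h j * G j us) vs = (SUM j:J. rho v (h j) * G j vs + h j * llie v (G j) vs)" using assms(1,4,5)
proof (induction J rule: finite_induct)
 case empty
 have "(%us. SUM j:{}. h j * G j us) = (0 :: 'l list => 'r)" by (simp only: sum.empty zero_fun_def)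
 thus ?case using llie_zero[OF assms(2,3)] by (simp only: sum.empty)
next
 case (insert j J)
 have "(%us. SUM j:insert j J. h j * G j us) = (%us. h j * G j us) + (%us. SUM j:J. h j * G j us)"
  by (simp only: sum.insert[OF insert.hyps] plus_fun_def)
 moreover have "valued (%us. h j * G j us)" "valued (%us. SUM j:J. h j * G j us)"
  using insert by (intro valued_scale valued_sum; simp)+
 ultimately show ?case using llie_add[OF assms(2,3), of "%us. h j * G j us" "%us. SUM j:J. h j * G j us"]
   llie_scale[OF assms(2,3), of "G j" "h j"] insert by simp
qed

lemma ld_sum:
 assumes "finite J" "vs : lists L" "!!j. j : J ==> valued (G j)" "!!j. j : J ==> h j : R"
 shows "ld (%us. SUM j:J. h j * G j us) vs = (SUM j:J. h j * ld (G j) vs + lwedge (dfun (h j)) (G j) vs)" using assms(1,3,4)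
proof (induction J rule: finite_induct)
 case empty
 have z: "valued 0" by (simp add: valued_def zero_fun_def R_const)
 have "(%us. SUM j:{}. h j * G j us) = (0 :: 'l list => 'r) - 0" by (simp only: sum.empty zero_fun_def diff_self)
 thus ?case using ld_diff[OF assms(2) z z] by (simp only: sum.empty diff_self)
next
 case (insert j J)
 have "(%us. SUM j:insert j J. h j * G j us) = (%us. h j * G j us) + (%us. SUM j:J. h j * G j us)"
  by (simp only: sum.insert[OF insert.hyps] plus_fun_def)
 moreover have "valued (%us. h j * G j us)" "valued (%us. SUM j:J. h j * G j us)"
  using insert by (intro valued_scale valued_sum; simp)+
 ultimately show ?case using ld_add[OF assms(2), of "%us. h j * G j us" "%us. SUM j:J. h j * G j us"]
   ld_scale[OF assms(2), of "G j" "h j"] insert by simp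
qed

end

section \<open>Locality of the Lie derivative and the differential\<close>

context algebroid
begin

text \<open>Representations hold only near a point; a tangent vector sees just the germ of a
  function, and the bracket terms are evaluated at the point itself.\<close>

lemma llie_local:
 "vs : lists (\<Gamma> M A) ==> v : \<Gamma> M A ==> sec.valued F ==> sec.valued G ==> open U ==> p : U ==>
  (!!us x. us : lists (\<Gamma> M A) ==> x : U ==> F us x = G us x) ==> lr.llie v F vs p = lr.llie v G vs p"
proof (induction vs arbitrary: F G)
 case Nil
 have "F [] : smooth_funs M" "G [] : smooth_funs M" using Nil unfolding sec.valued_def by auto
 hence "anchor A p (v p) (F []) = anchor A p (v p) (G [])"
  by (rule tangent_local[OF section_tangent[OF Nil.prems(2)] _ _ Nil.prems(5,6)]) (rule Nil.prems(7)[OF lists.Nil])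
 hence "arho A v (F []) p = arho A v (G []) p" by (simp only: arho_def)
 thus ?case by (simp only: lr.llie.simps)
next
 case (Cons w ws)
 hence ws: "ws : lists (\<Gamma> M A)" "w : \<Gamma> M A" by auto
 have "lr.llie v (contract w F) ws p = lr.llie v (contract w G) ws p"
 proof (rule Cons.IH[OF ws(1) Cons.prems(2) _ _ Cons.prems(5,6)])
  show "sec.valued (contract w F)" "sec.valued (contract w G)" using sec.valued_contract Cons.prems(3,4) ws(2) by blast+
  show "contract w F us x = contract w G us x" if "us : lists (\<Gamma> M A)" "x : U" for us x
   using Cons.prems(7)[of "w # us" x] that ws(2) by (simp add: contract_apply)
 qed
 moreover have "F (bracket A v w # ws) p = G (bracket A v w # ws) p"
  using Cons.prems(7)[of "bracket A v w # ws" p] bracket_closed[OF Cons.prems(2) ws(2)] ws(1) Cons.prems(6) by simp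
 ultimately show ?case by simp
qed

lemma ld_local:
 "vs : lists (\<Gamma> M A) ==> sec.valued F ==> sec.valued G ==> open U ==> p : U ==>
  (!!us x. us : lists (\<Gamma> M A) ==> x : U ==> F us x = G us x) ==> lr.ld F vs p = lr.ld G vs p" proof (induction vs arbitrary: F G)
 case (Cons w ws)
 hence ws: "ws : lists (\<Gamma> M A)" "w : \<Gamma> M A" by auto
 have "lr.ld (contract w F) ws p = lr.ld (contract w G) ws p"
 proof (rule Cons.IH[OF ws(1) _ _ Cons.prems(4,5)])
  show "sec.valued (contract w F)" "sec.valued (contract w G)" using sec.valued_contract Cons.prems(2,3) ws(2) by blast+
  show "contract w F us x = contract w G us x" if "us : lists (\<Gamma> M A)" "x : U" for us x
   using Cons.prems(6)[of "w # us" x] that ws(2) by (simp add: contract_apply)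
 qed
 moreover have "lr.llie w F ws p = lr.llie w G ws p" by (rule llie_local[OF ws Cons.prems(2-6)])
 ultimately show ?case by simp
qed simp

lemma llie_local_sum:
 assumes "vs : lists (\<Gamma> M A)" "v : \<Gamma> M A" "sec.valued F" "open U" "p : U" "finite J"
  "!!j. j : J ==> sec.valued (G j)" "!!j. j : J ==> h j : smooth_funs M"
  and eq: "!!us x. us : lists (\<Gamma> M A) ==> x : U ==> F us x = (SUM j:J. h j x * G j us x)"
 shows "lr.llie v F vs p = (SUM j:J. arho A v (h j) p * G j vs p + h j p * lr.llie v (G j) vs p)"
proof -
 have "lr.llie v F vs p = lr.llie v (%us. SUM j:J. h j * G j us) vs p"
  by (rule llie_local[OF assms(1,2,3) lr.valued_sum[OF assms(6,7,8)] assms(4,5)]) (use eq in \<open>simp_all add: sum_apply\<close>)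
 also have "... = (SUM j:J. arho A v (h j) * G j vs + h j * lr.llie v (G j) vs) p"
  by (rule fun_cong[OF lr.llie_sum[OF assms(6,1,2,7,8)]])
 finally show ?thesis by (simp only: sum_apply plus_fun_apply times_fun_apply)
qed

lemma ld_local_sum:
 assumes "vs : lists (\<Gamma> M A)" "sec.valued F" "open U" "p : U" "finite J"
  "!!j. j : J ==> sec.valued (G j)" "!!j. j : J ==> h j : smooth_funs M"
  and eq: "!!us x. us : lists (\<Gamma> M A) ==> x : U ==> F us x = (SUM j:J. h j x * G j us x)"
 shows "lr.ld F vs p = (SUM j:J. h j p * lr.ld (G j) vs p + lwedge (lr.dfun (h j)) (G j) vs p)"
proof -
 have "lr.ld F vs p = lr.ld (%us. SUM j:J. h j * G j us) vs p"
  by (rule ld_local[OF assms(1,2) lr.valued_sum[OF assms(5,6,7)] assms(3,4)]) (use eq in \<open>simp_all add: sum_apply\<close>)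
 also have "... = (SUM j:J. h j * lr.ld (G j) vs + lwedge (lr.dfun (h j)) (G j) vs) p"
  by (rule fun_cong[OF lr.ld_sum[OF assms(5,1,6,7)]])
 finally show ?thesis by (simp only: sum_apply plus_fun_apply times_fun_apply)
qed

lemma on_fibre_Cons:
 assumes F: "sec.altf F" and v: "v : \<Gamma> M A" and us: "set us <= fibre A p"
 shows "on_fibre F p (v p # us) = on_fibre (contract v F) p us"
proof -
 have vp: "v p : fibre A p" using sections_fibre[OF v UNIV_I] .
 have "F (extend_vec p (v p) # map (extend_vec p) us) p = F (v # map (extend_vec p) us) p" by (rule altf_pointwise[OF F])
   (use extend_vec[OF vp] extend_list(1)[OF us] v in \<open>simp_all add: eval_sections_def\<close>)
 thus ?thesis using vp us by (simp add: on_fibre_def contract_apply)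
qed

lemma alt_on_sum:
 assumes G: "alt_on (fibre A p) G" and us: "us : lists (fibre A p)" and v: "!!i. i : I ==> v i : fibre A p"
 shows "G ((SUM i:I. c i *R v i) # us) = (SUM i:I. c i * G (v i # us))" using v
proof (induction I rule: infinite_finite_induct)
 interpret l: lmodule "UNIV :: real set" "fibre A p" scaleR using lmodule_subspace[OF fibre_subspace] .
 have sm: "G (a *R w # us) = a * G (w # us)" if "w : fibre A p" for a w
  using l.altf_sm[OF G lists.Nil us that, of a] by simp
 have z: "G (0 # us) = 0" using sm[OF subspace_0[OF fibre_subspace], of 0] by simp
 {
  case (infinite I)
  thus ?case using z by simp
 next
  case empty
  thus ?case using z by simp
 next
  case (insert i I)
  have 1: "c i *R v i : fibre A p" using insert subspace_scale[OF fibre_subspace] by blast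
  have 2: "(SUM i:I. c i *R v i) : fibre A p"
   using insert by (intro subspace_sum[OF fibre_subspace] subspace_scale[OF fibre_subspace]) auto
  have "G ((c i *R v i + (SUM i:I. c i *R v i)) # us) = G (c i *R v i # us) + G ((SUM i:I. c i *R v i) # us)"
   using l.alt0_add[OF l.altf_alt0[OF G] lists.Nil us 1 2] by simp
  thus ?case using insert sm by simp
 }
qed

end

context pullback
begin

text \<open>The pullback of forms on the level of sections, where the recursive calculus lives. The
  first component of a section of the pullback need not come from a section of \<open>A\<close>, so
  the evaluation goes through the fibre.\<close>

definition fp :: "(('m => 'v) list => 'm => real) => ('n => 'v \<times> 'n tangent) list => 'n => real" where
 "fp F ss y = on_fibre F (f y) (map (%s. fst (s y)) ss)"

lemma fst_fibre: "ss : lists (\<Gamma> N P) ==> set (map (%s. fst (s y)) ss) <= fibre A (f y)"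
 using P_section_fibre unfolding P_fibre by auto

lemma fp_Nil: "fp F [] y = F [] (f y)" by (simp add: fp_def on_fibre_def)

lemma fp_diff: "fp (F - G) ss y = fp F ss y - fp G ss y" by (simp add: fp_def on_fibre_def)

lemma fp_Cons_value:
 assumes F: "sec.altf F" and ss: "ss : lists (\<Gamma> N P)" and w: "!!j. j : J ==> w j : \<Gamma> M A"
 shows "on_fibre F (f x) ((SUM j:J. h j *R w j (f x)) # map (%s. fst (s x)) ss) = (SUM j:J. h j * fp (contract (w j) F) ss x)"
proof -
 have "on_fibre F (f x) ((SUM j:J. h j *R w j (f x)) # map (%s. fst (s x)) ss) =
   (SUM j:J. h j * on_fibre F (f x) (w j (f x) # map (%s. fst (s x)) ss))"
  by (rule alt_on_sum[OF on_fibre_alt[OF F]]) (use fst_fibre[OF ss, of x] sections_fibre[OF w UNIV_I] in auto)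
 also have "... = (SUM j:J. h j * fp (contract (w j) F) ss x)"
  unfolding fp_def by (intro sum.cong refl) (simp only: on_fibre_Cons[OF F w fst_fibre[OF ss]])
 finally show ?thesis .
qed

lemma fp_Cons:
 assumes F: "sec.altf F" and ss: "ss : lists (\<Gamma> N P)" and t: "rep x (fst o t) J h w"
 shows "fp F (t # ss) x = (SUM j:J. h j x * fp (contract (w j) F) ss x)"
 using fp_Cons_value[OF F ss repD(3)[OF t], where h = "%j. h j x"] repD(4)[OF t] by (simp add: fp_def)

lemma fp_smooth:
 "ss : lists (\<Gamma> N P) ==> sec.altf F ==> fp F ss : smooth_funs N"
proof (induction ss arbitrary: F)
 case Nil
 have "F [] : smooth_funs M" using sec.altf_valued[OF Nil(2)] unfolding sec.valued_def by auto
 moreover have "fp F [] = (%x. F [] (f x))" by (rule HOL.ext) (rule fp_Nil)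
 ultimately show ?case using f_funs by metis
next
 case (Cons t ss)
 hence ss: "ss : lists (\<Gamma> N P)" "t : \<Gamma> N P" by auto
 show ?case unfolding N.smooth_funs_iff
 proof
  fix y
  obtain n e where ne: "!!s. s : \<Gamma> N P ==> EX c. frep y n e s c" "!!i. i < n ==> e i : \<Gamma> M A" using frame_rep by metis
  obtain c where c: "rep y (fst o t) {..<n} c e" using ne(1)[OF ss(2)] unfolding frep_def by blast
  obtain U where U: "open U" "y : U" "!!x. x : U ==> rep x (fst o t) {..<n} c e" using rep_open[OF c] by metis
  have "smooth_at N (%x. SUM i<n. c i x * fp (contract (e i) F) ss x) y"
   using Cons.IH[OF ss(1) sec.altf_contract[OF Cons.prems(2) ne(2)]] repD(2)[OF c]
   by (intro N.smooth_at_sum N.smooth_at_mult N.smooth_funsD) auto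
  thus "smooth_at N (fp F (t # ss)) y"
   by (rule N.smooth_at_cong[OF _ U(1,2)]) (use fp_Cons[OF Cons.prems(2) ss(1) U(3)] in simp)
 qed
qed

lemma altf_fp:
 assumes F: "sec.altf F" shows "P.sec.altf (fp F)"
proof (rule P.sec.altfI)
 show "fp F ss : smooth_funs N" if "ss : lists (\<Gamma> N P)" for ss using fp_smooth[OF that F] .
 fix xs ys v w assume l: "xs : lists (\<Gamma> N P)" "ys : lists (\<Gamma> N P)" "v : \<Gamma> N P"
 have l': "map (%s. fst (s y)) xs : lists (fibre A (f y))" "map (%s. fst (s y)) ys : lists (fibre A (f y))"
  "fst (v y) : fibre A (f y)" for y using fst_fibre[of xs y] fst_fibre[of ys y] fst_fibre[of "[v]" y] l by auto
 have lm: "lmodule (UNIV :: real set) (fibre A (f y)) scaleR" for y using lmodule_subspace[OF fibre_subspace] .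
 note alt = on_fibre_alt[OF F]
 show "fp F (xs @ (v + w) # ys) = fp F (xs @ v # ys) + fp F (xs @ w # ys)" if "w : \<Gamma> N P"
 proof
  fix y
  have "fst (w y) : fibre A (f y)" using fst_fibre[of "[w]" y] that by simp
  from lmodule.alt0_add[OF lm lmodule.altf_alt0[OF lm alt] l' this]
  show "fp F (xs @ (v + w) # ys) y = (fp F (xs @ v # ys) + fp F (xs @ w # ys)) y" by (simp add: fp_def)
 qed
 show "fp F (xs @ v # v # ys) = 0"
 proof
  fix y show "fp F (xs @ v # v # ys) y = 0 y"
   using lmodule.alt0_same[OF lm lmodule.altf_alt0[OF lm alt] l'] by (simp add: fp_def)
 qed
 show "fp F (xs @ smul g v # ys) = g * fp F (xs @ v # ys)" if "g : smooth_funs N" for g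
 proof
  fix y show "fp F (xs @ smul g v # ys) y = (g * fp F (xs @ v # ys)) y"
   using lmodule.altf_sm[OF lm alt l' UNIV_I] by (simp add: fp_def smul_def)
 qed
qed

lemma fp_valued: "sec.altf F ==> P.sec.valued (fp F)" using P.sec.altf_valued[OF altf_fp] .

lemma fp_contract:
 assumes F: "sec.altf F" and t: "t : \<Gamma> N P" "rep x (fst o t) J h w" and ss: "ss : lists (\<Gamma> N P)"
 shows "contract t (fp F) ss x = (SUM j:J. h j x * fp (contract (w j) F) ss x)"
 using fp_Cons[OF F ss t(2)] by (simp add: contract_apply)

text \<open>The rule \<open>L_s = \<Sum> (g_i L_{v_i} + dg_i \<and> i_{v_i})\<close> for
  \<open>s = \<Sum> g_i v_i\<close>, the counterpart of \<open>llie_sm\<close> with functions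
  \<open>g_i\<close> on \<open>N\<close>. In the inductive step the derivatives of the coefficients
  \<open>h j\<close> of the next argument cancel against the same terms of the pullback
  bracket.\<close>

lemma llie_fp:
 assumes s: "s : \<Gamma> N P" "rep y (fst o s) I g v"
 shows "ss : lists (\<Gamma> N P) ==> sec.altf F ==> PA.lr.llie s (fp F) ss y =
  (SUM i:I. g i y * fp (lr.llie (v i) F) ss y + lwedge (PA.lr.dfun (g i)) (fp (contract (v i) F)) ss y)"
proof (induction ss arbitrary: F)
 case Nil
 have k: "F [] : smooth_funs M" using sec.altf_valued[OF Nil(2)] unfolding sec.valued_def by auto
 have "PA.lr.llie s (fp F) [] y = snd (s y) (%x. F [] (f x))" by (simp add: arho_def P_simps(2) fp_Nil[abs_def])
 also have "... = (SUM i:I. g i y * fp (lr.llie (v i) F) [] y)"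
  using P_anchor[OF s(1) k, of y] rep_anchor[OF s(2), of "F []"] by (simp add: fp_Nil arho_def)
 finally show ?case by (simp add: PA.lr.dfun_def)
next
 case (Cons t ss)
 note F = Cons.prems(2)
 have ss: "ss : lists (\<Gamma> N P)" "t : \<Gamma> N P" using Cons.prems(1) by auto
 obtain n e where ne: "!!s. s : \<Gamma> N P ==> EX c. frep y n e s c" "!!i. i < n ==> e i : \<Gamma> M A" using frame_rep by metis
 obtain h where h: "rep y (fst o t) {..<n} h e" using ne(1)[OF ss(2)] unfolding frep_def by blast
 obtain U where U: "open U" "y : U" "!!x. x : U ==> rep x (fst o t) {..<n} h e" using rep_open[OF h] by metis
 let ?X = "snd (s y)" and ?Y = "snd (t y)"
 define D where "D i = PA.lr.dfun (g i)" for i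
 have eF: "sec.altf (contract (e j) F)" if "j < n" for j using sec.altf_contract[OF F ne(2)[OF that]] .
 have vF: "sec.altf (contract (v i) F)" if "i : I" for i using sec.altf_contract[OF F repD(3)[OF s(2) that]] .
 have a: "PA.lr.llie s (contract t (fp F)) ss y =
   (SUM j<n. ?X (h j) * fp (contract (e j) F) ss y + h j y * PA.lr.llie s (fp (contract (e j) F)) ss y)" proof -
  have "PA.lr.llie s (contract t (fp F)) ss y =
    (SUM j<n. arho P s (h j) y * fp (contract (e j) F) ss y + h j y * PA.lr.llie s (fp (contract (e j) F)) ss y)"
  proof (rule PA.llie_local_sum[OF ss(1) s(1) P.sec.valued_contract[OF fp_valued[OF F] ss(2)] U(1,2) finite_lessThan])
   show "P.sec.valued (fp (contract (e j) F))" if "j : {..<n}" for j using fp_valued[OF eF] that by simp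
   show "h j : smooth_funs N" if "j : {..<n}" for j using repD(2)[OF h that] .
   show "contract t (fp F) us x = (SUM j<n. h j x * fp (contract (e j) F) us x)"
    if "us : lists (\<Gamma> N P)" "x : U" for us x by (rule fp_contract[OF F ss(2) U(3)[OF that(2)] that(1)])
  qed
  thus ?thesis by (simp only: arho_def P_simps(2))
 qed
 have IH: "PA.lr.llie s (fp (contract (e j) F)) ss y =
   (SUM i:I. g i y * fp (lr.llie (v i) (contract (e j) F)) ss y + lwedge (D i) (fp (contract (v i) (contract (e j) F))) ss y)"
  if "j < n" for j unfolding D_def by (rule Cons.IH[OF ss(1) eF[OF that]])
 \<comment> \<open>The bracket is written as one linear combination of sections of \<open>A\<close>,
   so that linearity in the first slot applies: the pairs carry the brackets, the two other index
   sets the derivative terms.\<close>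
 have b: "fp F (bracket P s t # ss) y = (SUM i:I. SUM j<n. (g i y * h j y) * fp (contract (bracket A (v i) (e j)) F) ss y) +
   (SUM j<n. ?X (h j) * fp (contract (e j) F) ss y) - (SUM i:I. ?Y (g i) * fp (contract (v i) F) ss y)" proof -
  have val: "fst (bracket P s t y) = bval y I g v ?X {..<n} h e ?Y"
   by (rule bracket_value[OF s(2) P_section_fibre[OF s(1)] h P_section_fibre[OF ss(2)]])
  let ?K = "I \<times> {..<n} <+> ({..<n} <+> I)"
  let ?c = "case_sum (%(i, j). g i y * h j y) (case_sum (%j. ?X (h j)) (%i. - ?Y (g i)))"
  let ?u = "case_sum (%(i, j). bracket A (v i) (e j)) (case_sum e v)"
  have fin: "finite I" using repD(1)[OF s(2)] .
  have u: "?u k : \<Gamma> M A" if "k : ?K" for k using that by (auto intro!: bracket_closed repD(3)[OF s(2)] ne(2))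
  have "fst (bracket P s t y) = (SUM k:?K. ?c k *R ?u k (f y))"
   unfolding val bval_def by (subst sum_Plus_prod) (simp_all add: sum.Plus sum_negf fin)
  hence "fp F (bracket P s t # ss) y = (SUM k:?K. ?c k * fp (contract (?u k) F) ss y)"
   using fp_Cons_value[OF F ss(1) u, where x = y and h = ?c] by (simp add: fp_def)
  also have "... = (SUM i:I. SUM j<n. (g i y * h j y) * fp (contract (bracket A (v i) (e j)) F) ss y) +
   ((SUM j<n. ?X (h j) * fp (contract (e j) F) ss y) + (SUM i:I. - ?Y (g i) * fp (contract (v i) F) ss y))"
   by (subst sum_Plus_prod) (simp_all add: sum.Plus fin)
  finally show ?thesis by (simp add: sum_negf)
 qed
 have c: "fp (lr.llie (v i) F) (t # ss) y =
   (SUM j<n. h j y * (fp (lr.llie (v i) (contract (e j) F)) ss y - fp (contract (bracket A (v i) (e j)) F) ss y))"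
  if "i : I" for i unfolding fp_Cons[OF lr.altf_llie[OF repD(3)[OF s(2) that] F] ss(1) h] lr.contract_llie fp_diff ..
 \<comment> \<open>The two contractions are exchanged to match the order in the induction
   hypothesis; the sign this costs cancels the one in \<open>lwedge_dfun\<close>.\<close>
 have d: "lwedge (D i) (fp (contract (v i) F)) (t # ss) y =
   ?Y (g i) * fp (contract (v i) F) ss y + (SUM j<n. h j y * lwedge (D i) (fp (contract (v i) (contract (e j) F))) ss y)"
  if i: "i : I" for i
 proof -
  have "contract t (fp (contract (v i) F)) us y = (SUM j<n. - h j y * fp (contract (v i) (contract (e j) F)) us y)"
   if us: "us : lists (\<Gamma> N P)" for us
  proof -
   have "fp (contract (e j) (contract (v i) F)) us y = - fp (contract (v i) (contract (e j) F)) us y" if j: "j < n" for j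
   proof -
    let ?us = "map (extend_vec (f y)) (map (%s. fst (s y)) us)"
    have "?us : lists (\<Gamma> M A)" using extend_list(1)[OF fst_fibre[OF us]] .
    from sec.alt0_swap[OF sec.altf_alt0[OF F] lists.Nil this repD(3)[OF s(2) i] ne(2)[OF j]]
    show ?thesis using fst_fibre[OF us, of y] by (simp add: fp_def on_fibre_def contract_apply)
   qed
   thus ?thesis unfolding fp_contract[OF vF[OF i] ss(2) h us] by simp
  qed
  from lwedge_at_sum[OF ss(1), where D = "D i" and G = "contract t (fp (contract (v i) F))" and y = y and J = "{..<n}" and c = "%j. - h j y"
    and H = "%j. fp (contract (v i) (contract (e j) F))", OF this]
  have "lwedge (D i) (contract t (fp (contract (v i) F))) ss y =
    - (SUM j<n. h j y * lwedge (D i) (fp (contract (v i) (contract (e j) F))) ss y)" by (simp add: sum_negf)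
  thus ?thesis unfolding D_def PA.lr.lwedge_dfun by (simp add: arho_def P_simps(2))
 qed
 have "PA.lr.llie s (fp F) (t # ss) y = PA.lr.llie s (contract t (fp F)) ss y - fp F (bracket P s t # ss) y" by simp
 also have "... = (SUM j<n. h j y * (SUM i:I. g i y * fp (lr.llie (v i) (contract (e j) F)) ss y +
    lwedge (D i) (fp (contract (v i) (contract (e j) F))) ss y)) -
   (SUM i:I. SUM j<n. (g i y * h j y) * fp (contract (bracket A (v i) (e j)) F) ss y) +
   (SUM i:I. ?Y (g i) * fp (contract (v i) F) ss y)" unfolding a b using IH by (simp add: sum.distrib)
 also have "(SUM j<n. h j y * (SUM i:I. g i y * fp (lr.llie (v i) (contract (e j) F)) ss y +
    lwedge (D i) (fp (contract (v i) (contract (e j) F))) ss y)) =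
   (SUM i:I. SUM j<n. h j y * (g i y * fp (lr.llie (v i) (contract (e j) F)) ss y +
    lwedge (D i) (fp (contract (v i) (contract (e j) F))) ss y))" unfolding sum_distrib_left by (rule sum.swap)
 also have "... - (SUM i:I. SUM j<n. (g i y * h j y) * fp (contract (bracket A (v i) (e j)) F) ss y) +
   (SUM i:I. ?Y (g i) * fp (contract (v i) F) ss y) =
   (SUM i:I. g i y * fp (lr.llie (v i) F) (t # ss) y + lwedge (D i) (fp (contract (v i) F)) (t # ss) y)"
  unfolding sum_subtractf[symmetric] sum.distrib[symmetric]
 proof (intro sum.cong refl)
  fix i assume i: "i : I"
  show "(SUM j<n. h j y * (g i y * fp (lr.llie (v i) (contract (e j) F)) ss y +
    lwedge (D i) (fp (contract (v i) (contract (e j) F))) ss y) - (g i y * h j y) * fp (contract (bracket A (v i) (e j)) F) ss y) +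
   ?Y (g i) * fp (contract (v i) F) ss y =
   g i y * fp (lr.llie (v i) F) (t # ss) y + lwedge (D i) (fp (contract (v i) F)) (t # ss) y"
   unfolding c[OF i] d[OF i] sum_distrib_left by (simp add: algebra_simps sum.distrib sum_subtractf)
 qed
 finally show ?case unfolding D_def .
qed

text \<open>Cartan's formula on both sides: the \<open>dg\<close> terms of \<open>llie_fp\<close>
  cancel those of \<open>ld_local_sum\<close>, and the contracted forms are covered by the induction
  hypothesis.\<close>

lemma ld_fp: "ss : lists (\<Gamma> N P) ==> sec.altf F ==> PA.lr.ld (fp F) ss y = fp (lr.ld F) ss y"
proof (induction ss arbitrary: F)
 case Nil
 show ?case by (simp add: fp_Nil)
next
 case (Cons s ss)
 note F = Cons.prems(2)
 have ss: "ss : lists (\<Gamma> N P)" "s : \<Gamma> N P" using Cons.prems(1) by auto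
 obtain n e where ne: "!!s. s : \<Gamma> N P ==> EX c. frep y n e s c" "!!i. i < n ==> e i : \<Gamma> M A" using frame_rep by metis
 obtain g where g: "rep y (fst o s) {..<n} g e" using ne(1)[OF ss(2)] unfolding frep_def by blast
 obtain U where U: "open U" "y : U" "!!x. x : U ==> rep x (fst o s) {..<n} g e" using rep_open[OF g] by metis
 have eF: "sec.altf (contract (e j) F)" if "j < n" for j using sec.altf_contract[OF F ne(2)[OF that]] .
 have "PA.lr.ld (contract s (fp F)) ss y =
   (SUM i<n. g i y * PA.lr.ld (fp (contract (e i) F)) ss y + lwedge (PA.lr.dfun (g i)) (fp (contract (e i) F)) ss y)"
 proof (rule PA.ld_local_sum[OF ss(1) P.sec.valued_contract[OF fp_valued[OF F] ss(2)] U(1,2) finite_lessThan])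
  show "P.sec.valued (fp (contract (e j) F))" if "j : {..<n}" for j using fp_valued[OF eF] that by simp
  show "g j : smooth_funs N" if "j : {..<n}" for j using repD(2)[OF g that] .
  show "contract s (fp F) us x = (SUM j<n. g j x * fp (contract (e j) F) us x)"
   if "us : lists (\<Gamma> N P)" "x : U" for us x by (rule fp_contract[OF F ss(2) U(3)[OF that(2)] that(1)])
 qed
 also have "... = (SUM i<n. g i y * fp (lr.ld (contract (e i) F)) ss y + lwedge (PA.lr.dfun (g i)) (fp (contract (e i) F)) ss y)"
  using Cons.IH[OF ss(1) eF] by simp
 finally have "PA.lr.ld (fp F) (s # ss) y =
   (SUM i<n. g i y * fp (lr.llie (e i) F) ss y) - (SUM i<n. g i y * fp (lr.ld (contract (e i) F)) ss y)"
  using llie_fp[OF ss(2) g ss(1) F] by (simp add: sum.distrib)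
 also have "... = fp (lr.ld F) (s # ss) y" unfolding fp_Cons[OF lr.altf_ld[OF F] ss(1) g] lr.contract_ld fp_diff
  by (simp add: right_diff_distrib sum_subtractf)
 finally show ?case .
qed

section \<open>The pullback map on forms\<close>

abbreviation pf where "pf \<equiv> pullback_form N M f A"

lemma pf_apply: "pf w y ws = (if set ws <= fibre P y then w (f y) (map fst ws) else 0)" by (simp add: pullback_form_def)

lemma pf_sections: "w : \<Omega> M A k ==> ss : lists (\<Gamma> N P) ==> P.on_sections (pf w) ss = fp (on_sections w) ss"
proof
 fix y assume w: "w : \<Omega> M A k" and ss: "ss : lists (\<Gamma> N P)"
 have 1: "set (eval_sections ss y) <= fibre P y" using P.eval_fibre[OF ss] .
 have 2: "map fst (eval_sections ss y) = map (%s. fst (s y)) ss" by (simp add: eval_sections_def)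
 show "P.on_sections (pf w) ss y = fp (on_sections w) ss y" using 1 fst_fibre[OF ss] extend_list(2)[OF fst_fibre[OF ss]]
  unfolding P.on_sections_def on_sections_def fp_def on_fibre_def pf_apply 2 by simp
qed

lemma pf_form:
 assumes w: "w : \<Omega> M A k" shows "pf w : \<Omega> N P k"
proof -
 have h: "fp (on_sections w) ss = 0" if "length ss ~= k" for ss
  using forms_homog[OF w] that by (simp add: fun_eq_iff fp_def on_fibre_def on_sections_def homog_def eval_sections_def)
 have "pf w = P.on_fibre (fp (on_sections w))"
 proof (intro HOL.ext)
  fix y ws
  show "pf w y ws = P.on_fibre (fp (on_sections w)) y ws"
  proof (cases "set ws <= fibre P y")
   case True
   have m: "map (%s. fst (s y)) (map (P.extend_vec y) ws) = map fst ws"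
    using arg_cong[OF P.extend_list(2)[OF True], of "map fst"] by (simp add: eval_sections_def)
   have fib: "set (map fst ws) <= fibre A (f y)" using True P_fibre by auto
   show ?thesis using True fib extend_list(2)[OF fib]
    unfolding P.on_fibre_def fp_def m on_fibre_def on_sections_def pf_apply by simp
  qed (simp add: P.on_fibre_def pf_apply)
 qed
 thus ?thesis using P.on_fibre_form[OF altf_fp[OF form_altf[OF w]] h] by simp
qed

lemma pf_lie_d:
 assumes w: "w : \<Omega> M A k" shows "lie_d N P k (pf w) = pf (lie_d M A k w)"
proof (rule PA.lie_d_eqI[OF pf_form[OF w] pf_form[OF lie_d_form[OF w]]])
 fix ss assume ss: "ss : lists (\<Gamma> N P)"
 have "PA.lr.ld (P.on_sections (pf w)) ss = PA.lr.ld (fp (on_sections w)) ss"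
  by (rule PA.lr.ld_cong[OF ss]) (rule pf_sections[OF w])
 also have "... = fp (lr.ld (on_sections w)) ss" using ld_fp[OF ss form_altf[OF w]] by (rule HOL.ext)
 also have "... = fp (on_sections (lie_d M A k w)) ss"
 proof
  fix y
  show "fp (lr.ld (on_sections w)) ss y = fp (on_sections (lie_d M A k w)) ss y"
   using lie_d_eval[OF w extend_list(1)[OF fst_fibre[OF ss]], of y] by (simp add: fp_def on_fibre_def)
 qed
 finally show "PA.lr.ld (P.on_sections (pf w)) ss = P.on_sections (pf (lie_d M A k w)) ss"
  unfolding pf_sections[OF lie_d_form[OF w] ss] .
qed

lemma pf_fwedge: "w : \<Omega> M A k ==> h : \<Omega> M A l ==> pf (fwedge w h) = fwedge (pf w) (pf h)"
proof (intro HOL.ext)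
 fix y ws
 show "pf (fwedge w h) y ws = fwedge (pf w) (pf h) y ws"
 proof (cases "set ws <= fibre P y")
  case True
  thus ?thesis unfolding fwedge_def pf_apply lwedge_map by (simp, intro lwedge_cong) auto
 next
  case False
  have "lwedge (pf w y) (pf h y) ws = 0"
   using lwedge_support[where V = "fibre P y" and F = "pf w y" and G = "pf h y" and vs = ws] False by (metis pf_apply)
  thus ?thesis using False by (simp add: fwedge_def pf_apply)
 qed
qed

lemma pf_wedge: "w : \<Omega> M A k ==> h : \<Omega> M A l ==> pf (wedge k l w h) = wedge k l (pf w) (pf h)"
 using wedge_eq_fwedge P.wedge_eq_fwedge pf_form pf_fwedge by metis

lemma pf_unit: "pf unit_form = unit_form" by (auto simp: fun_eq_iff pf_apply unit_form_def)

lemma pf_wedge_list: "set rs <= \<Omega> M A 1 ==> pf (wedge_list rs) = wedge_list (map pf rs)"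
proof (induction rs)
 case (Cons a as)
 thus ?case using pf_wedge[of a 1 "wedge_list as" "length as"] wedge_list_form[of as] by simp
qed (simp add: pf_unit)

lemma pf_wedge_power2: "x : \<Omega> M A 2 ==> pf (wedge_power2 x n) = wedge_power2 (pf x) n"
proof (induction n)
 case (Suc n)
 thus ?case using pf_wedge[OF Suc.prems wedge_power2_form[OF Suc.prems]] by simp
qed (simp add: pf_unit)

lemma pf_add: "pf (w + h) = pf w + pf h" by (simp add: fun_eq_iff pf_apply)

end

theorem theorem1p1:
  fixes M :: "('m::{t2_space,second_countable_topology}, 'd::real_inner) atlas"
    and N :: "('n::{t2_space,second_countable_topology}, 'e::real_inner) atlas"
    and A :: "('m, 'v::real_vector) lie_algebroid"
    and B :: "'m \<Rightarrow> 'v set"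
    and f :: "'n \<Rightarrow> 'm"
    and q :: nat
  assumes "smooth_manifold M" and "smooth_manifold N"
    and "lie_algebroid M A"
    and "smooth_map N M f"
    and "transverse N M f A (fibre A)"
    and "lie_subalgebroid M A B"
    and "trivial_quotient M A B q"
    and "transverse N M f A B"
  shows "godbillon_vey N (pullback_algebroid N M f A) (pullback_fibre N M f A B) q
           \<in> cohomology N (pullback_algebroid N M f A) (2 * q + 1) \<and>
         godbillon_vey N (pullback_algebroid N M f A) (pullback_fibre N M f A B) q
           = pullback_class N M f A (2 * q + 1) (godbillon_vey M A B q)"
proof -
 interpret pullback M A N f using assms(1-5) by unfold_locales
 have sub: "subspace (B p)" "B p <= fibre A p" for p using assms(6) unfolding lie_subalgebroid_def subbundle_def by blast+
 obtain rs where rs: "set rs <= \<Omega> M A 1" "length rs = q" "defining_form M A B q (wedge_list rs)"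
  using trivial_quotient_forms[OF sub assms(7)] by metis
 let ?r = "wedge_list rs"
 obtain u where u: "gv_pair B q ?r u" using gv_pair_exists[OF assms(6) rs(3)] by metis
 note uf = gv_pairD(2)[OF u] and rf = defining_form_form[OF rs(3)]
 let ?B = "pullback_fibre N M f A B"
 have ker: "B p = {v : fibre A p. ALL a:set rs. a p [v] = 0}" for p
 proof -
  have "decomposes_on M A UNIV q ?r rs" unfolding decomposes_on_def using rs by blast
  thus ?thesis using rs(3) unfolding defining_form_def by blast
 qed
 \<comment> \<open>The pulled back factors decompose the pulled back form globally, with the right
   kernel; transversality to \<open>B\<close> enters in the proof that it vanishes nowhere.\<close>
 have dN: "defining_form N P ?B (length (map pf rs)) (wedge_list (map pf rs))"
 proof (rule PA.defining_formI)
  show "set (map pf rs) <= \<Omega> N P 1" using rs(1) pf_form by auto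
  fix y
  show "?B y = {z : fibre P y. ALL a:set (map pf rs). a y [z] = 0}"
  proof (intro set_eqI)
   fix z
   show "z : ?B y \<longleftrightarrow> z : {z : fibre P y. ALL a:set (map pf rs). a y [z] = 0}"
    using sub(2)[of "f y"] ker[of "f y"] P_fibre[of z y] by (cases z) (auto simp: pullback_fibre_def pf_apply)
  qed
  show "EX zs. zs : lists (fibre P y) & wedge_list (map pf rs) y zs ~= 0"
  proof (rule ccontr)
   assume "~ ?thesis"
   hence zero: "?r (f y) (map fst zs) = 0" if "zs : lists (fibre P y)" for zs
    using that pf_wedge_list[OF rs(1)] pf_apply[of ?r y zs] by (metis in_lists_conv_set subsetI)
   let ?S = "fst ` fibre P y Un B (f y)"
   have S: "?S <= fibre A (f y)" using sub(2) P_fibre by blast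
   \<comment> \<open>Transversality to \<open>B\<close> splits the anchor of \<open>w\<close> into
     the image of some \<open>X\<close> and the anchor of some \<open>b\<close> in \<open>B\<close>;
     then \<open>w - b\<close>, paired with \<open>X\<close>, lies in the pullback fibre.\<close>
   have span: "fibre A (f y) <= span ?S"
   proof
    fix w assume w: "w : fibre A (f y)"
    hence "anchor A (f y) w : tangent_space M (f y)" by (rule anchor_tangent)
    then obtain X b where X: "X : tangent_space N y" "b : B (f y)"
     "anchor A (f y) w = pushforward M f X + anchor A (f y) b" using assms(8) unfolding transverse_def by blast
    have b: "b : fibre A (f y)" using X(2) sub(2) by blast
    have "anchor A (f y) (1 *R w + (-1) *R b) = pushforward M f X" unfolding anchor_lin[OF w b] X(3) by simp
    hence "(w - b, X) : fibre P y" unfolding P_fibre using X(1) subspace_diff[OF fibre_subspace w b] by simp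
    hence "w - b : span ?S" by (intro span_base UnI1) force
    moreover have "b : span ?S" using X(2) by (intro span_base UnI2)
    ultimately have "(w - b) + b : span ?S" by (rule span_add)
    thus "w : span ?S" by simp
   qed
   \<comment> \<open>A list from the spanning set with an entry in \<open>B\<close> is killed by the
     filtration; without such an entry it lifts to the pullback fibre, where \<open>zero\<close>
     applies.\<close>
   have z: "?r (f y) vs = 0" if vs: "vs : lists ?S" for vs
   proof (cases "length vs = q & set vs Int B (f y) = {}")
    case True
    hence "vs : map fst ` lists (fibre P y)" using vs unfolding lists_image[symmetric] by auto
    then obtain zs where "zs : lists (fibre P y)" "vs = map fst zs" by blast
    thus ?thesis using zero by blast
   next
    case False
    show ?thesis
    proof (cases "length vs = q")
     case True
     then obtain b where "b : set vs" "b : B (f y)" using False by blast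
     hence "length (filter (%v. v ~: B (f y)) vs) < q"
      using length_filter_less[of b vs "%v. v ~: B (f y)"] True by simp
     moreover have "vs : lists (fibre A (f y))" using vs S by auto
     ultimately show ?thesis using defining_form_filt[OF rs(3), of "f y"] unfolding filt_def by blast
    next
     case False
     thus ?thesis using forms_homog[OF rf, of "f y"] unfolding homog_def by blast
    qed
   qed
   obtain ws where ws: "ws : lists (fibre A (f y))" "?r (f y) ws ~= 0" using defining_form_nonzero[OF rs(3)] by blast
   thus False using alt_on_span_zero[OF fibre_subspace forms_alt[OF rf UNIV_I] S span z ws(1)] by blast
  qed
 qed
 have gv: "PA.gv_pair ?B q (pf ?r) (pf u)" unfolding PA.gv_pair_def
 proof (intro conjI)
  show "defining_form N P ?B q (pf ?r)" using dN rs(2) pf_wedge_list[OF rs(1)] by simp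
  show "pf u : \<Omega> N P 1" using pf_form[OF uf] .
  show "lie_d N P q (pf ?r) = wedge 1 q (pf u) (pf ?r)"
   unfolding pf_lie_d[OF rf] pf_wedge[OF uf rf, symmetric] using u unfolding gv_pair_def by simp
 qed
 define t where "t = gv_form q u"
 have "PA.gv_form q (pf u) = pf t" unfolding PA.gv_form_def gv_form_def t_def
  using pf_lie_d[OF uf] pf_wedge_power2[OF lie_d_1_form[OF uf]]
   pf_wedge[OF uf wedge_power2_form[OF lie_d_1_form[OF uf]]] by simp
 hence GVN: "godbillon_vey N P ?B q = cohomology_class N P (2 * q + 1) (pf t)"
  "godbillon_vey N P ?B q : cohomology N P (2 * q + 1)" using PA.godbillon_vey_eq[OF gv] by simp_all
 have GVM: "godbillon_vey M A B q = cohomology_class M A (2 * q + 1) t" using godbillon_vey_eq(1)[OF u] unfolding t_def .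
 \<comment> \<open>The definite description in \<open>pullback_class\<close> requires independence
   of the representative, which holds because \<open>pf\<close> commutes with the
   differential.\<close>
 have cls: "cohomology_class N P (2 * q + 1) (pf t') = cohomology_class N P (2 * q + 1) (pf t)"
  if t': "t' : cohomology_class M A (2 * q + 1) t" for t'
 proof -
  obtain h where h: "h : \<Omega> M A (2 * q)" "t' = t + lie_d M A (2 * q) h"
   using t' unfolding cohomology_class_def coboundaries_def by auto
  have "pf t' - pf t = lie_d N P (2 * q) (pf h)"
   unfolding h(2) pf_add pf_lie_d[OF h(1)] by (simp only: add_diff_cancel_left')
  hence "pf t' - pf t : lie_d N P (2 * q) ` \<Omega> N P (2 * q)" using pf_form[OF h(1)] by blast
  thus ?thesis using PA.cohomology_class_eqI by simp
 qed
 have "0 : coboundaries M A (2 * q + 1)" using lie_d_zero[of "2 * q"] forms_zero[of "2 * q"] by (simp add: coboundaries_def)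
 hence t: "t : cohomology_class M A (2 * q + 1) t" unfolding cohomology_class_def by (rule rev_image_eqI) simp
 have "pullback_class N M f A (2 * q + 1) (cohomology_class M A (2 * q + 1) t) = cohomology_class N P (2 * q + 1) (pf t)"
  unfolding pullback_class_def by (rule the_equality) (use t cls in blast)+
 thus ?thesis using GVN GVM by simp
qed

end
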